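(* Let $p$ be a prime and $G=\mathrm{GL}_2(\mathbb{Q}_p)$. Breuil's semi-simple mod $p$ Local Langlands Correspondence (whose definition is recalled in the context) is given in terms of Iwahori induction as follows. For every $r\in\{0,\ldots,p-1\}$, every $\lambda\in\overline{\mathbb{F}}_p$ and every smooth character $\eta:\mathbb{Q}_p^*\to\overline{\mathbb{F}}_p^*$: (1) If $\lambda=0$: $$(\mathrm{ind}\,\omega_2^{r+1})\otimes\eta \;\longleftrightarrow\; \frac{\mathrm{ind}_{IZ}^G\, d^r}{(T_{-1,0}+\delta_{r,p-1}T_{1,0})+(T_{1,2}+\delta_{r,0}T_{1,0})}\otimes\eta .$$ (2) If $\lambda\neq 0$: $$(\mu_\lambda\omega^{r+1}\oplus\mu_{\lambda^{-1}})\otimes\eta \;\longleftrightarrow\; \left(\frac{\mathrm{ind}_{IZ}^G\, d^r}{(T_{-1,0}+\delta_{r,p-1}T_{1,0})+(T_{1,2}+\delta_{r,0}T_{1,0}-\lambda)}\otimes\eta\right)^{\mathrm{ss}}\oplus\left(\frac{\mathrm{ind}_{IZ}^G\, d^{s}}{(T_{-1,0}+\delta_{s,p-1}T_{1,0})+(T_{1,2}+\delta_{s,0}T_{1,0}-\lambda^{-1})}\otimes\eta\omega^{r+1}\right)^{\mathrm{ss}},$$ where $s=[p-3-r]$. That is, in each case the smooth $G$-representation displayed on the right is isomorphic to the $G$-representation that Breuil's correspondence attaches to the Galois representation displayed on the left.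
   Context: Groups. $G=\mathrm{GL}_2(\mathbb{Q}_p)$, $Z$ is its center, $K=\mathrm{GL}_2(\mathbb{Z}_p)$, and $I\subset K$ is the Iwahori subgroup of matrices that are upper triangular mod $p$. Put $\alpha=\begin{pmatrix} 1 & 0 \\ 0 & p \end{pmatrix}$, $\beta=\begin{pmatrix} 0 & 1 \\ p & 0 \end{pmatrix}$. $I_1\subset\mathbb{Z}_p$ is the set of the $p$ Teichmüller representatives $\{[x]:x\in\mathbb{F}_p\}$ of $\mathbb{Z}_p/p$. Weights and characters. $V_r$ ($r\ge0$) is the space of homogeneous polynomials of degree $r$ in $X,Y$ over $\mathbb{F}_p$ with $K$ acting through reduction mod $p$ by $\begin{pmatrix} a & b \\ c & d \end{pmatrix}P(X,Y)=P(aX+cY,bX+dY)$, extended to $KZ$ by letting the scalar matrix $p$ act trivially. $d^r$ is the character of $IZ$ sending $\begin{pmatrix} a & b \\ c & d \end{pmatrix}\in I$ to $d^r\bmod p$ and the scalar $p$ to $1$; it is trivial for $r=0$ and $r=p-1$. $[a]\in\{0,\ldots,p-2\}$ is the class of the integer $a$ mod $p-1$; $\delta_{a,b}$ is $1$ if $a=b$ and $0$ otherwise. Compact induction. For $H=KZ$ or $IZ$ and a representation $\sigma$ of $H$, $\mathrm{ind}_H^G\sigma$ is the space of functions $f:G\to\sigma$ with $f(hx)=\sigma(h)f(x)$ for $h\in H$, compactly supported modulo $Z$, with $G$ acting by right translation. For $g\in G$, $v\in\sigma$, the function supported on $Hg^{-1}$ and sending $x\in Hg^{-1}$ to $\sigma(xg)v$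 is denoted $[g,v]$ when $H=KZ$ and $[[g,v]]$ when $H=IZ$; thus $g'[[g,v]]=[[g'g,v]]$. Whenever $\lambda$ or $\eta$ with values in $\overline{\mathbb{F}}_p$ occur, scalars are extended from $\mathbb{F}_p$ to $\overline{\mathbb{F}}_p$. Hecke operators. $T$ is the $G$-endomorphism of $\mathrm{ind}_{KZ}^G V_r$ ($0\le r\le p-1$) determined by $$T[\mathrm{id},P(X,Y)]=\sum_{\lambda\in I_1}\left[\begin{pmatrix} p & \lambda \\ 0 & 1 \end{pmatrix},P(X,-\lambda X+pY)\right]+\left[\alpha,P(pX,Y)\right].$$ $T_{-1,0}$ and $T_{1,2}$ are the $G$-endomorphisms of $\mathrm{ind}_{IZ}^G d^r$ ($0\le r\le p-1$) determined by $$T_{-1,0}[[\mathrm{id},1]]=\sum_{\lambda\in I_1}\left[\left[\begin{pmatrix} p & \lambda \\ 0 & 1 \end{pmatrix},1\right]\right],\qquad T_{1,2}[[\mathrm{id},1]]=\sum_{\lambda\in I_1}\left[\left[\begin{pmatrix} 1 & 0 \\ p\lambda & p \end{pmatrix},1\right]\right].$$ When $r=0$ or $p-1$ (so $d^r=1$), $T_{1,0}$ is the $G$-endomorphism of $\mathrm{ind}_{IZ}^G 1$ determined by $T_{1,0}[[\mathrm{id},1]]=[[\beta,1]]$; for other $r$ the operator $T_{1,0}$ does not occur (its coefficient is $0$). For an endomorphism $S$, $(S)$ denotes its image, and $(S)+(S')$ the sum of the two images. Twists. For a $G$-representation $\pi$ and a smooth character $\chi:\mathbb{Q}_p^*\to\overline{\mathbb{F}}_p^*$,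 $\pi\otimes\chi$ means $\pi\otimes(\chi\circ\det)$. Smooth characters of $\mathbb{Q}_p^*$ are identified with characters of $\mathrm{Gal}(\overline{\mathbb{Q}}_p/\mathbb{Q}_p)$ by local class field theory, with $p$ corresponding to a geometric Frobenius; the mod $p$ cyclotomic character $\omega$ corresponds to $x\mapsto x|x|\bmod p$. "ss" denotes semi-simplification. Galois side. $\omega,\omega_2$ are the fundamental characters of the inertia group $I_{\mathbb{Q}_p}$ of levels $1$ and $2$, $\omega$ being extended canonically to $\mathrm{Gal}(\overline{\mathbb{Q}}_p/\mathbb{Q}_p)$ (as the mod $p$ cyclotomic character). For $p+1\nmid c$, $\mathrm{ind}(\omega_2^c)$ is the irreducible two-dimensional representation of $\mathrm{Gal}(\overline{\mathbb{Q}}_p/\mathbb{Q}_p)$ induced from an extension of $\omega_2^c$ to $\mathrm{Gal}(\overline{\mathbb{Q}}_p/\mathbb{Q}_{p^2})$ chosen so that the determinant is $\omega^c$. $\mu_\lambda$ is the unramified character of $\mathrm{Gal}(\overline{\mathbb{Q}}_p/\mathbb{Q}_p)$ sending a geometric Frobenius to $\lambda\in\overline{\mathbb{F}}_p^*$. Breuil's correspondence. For $r\in\{0,\ldots,p-1\}$, $\lambda\in\overline{\mathbb{F}}_p$ and smooth $\eta:\mathbb{Q}_p^*\to\overline{\mathbb{F}}_p^*$ put $\pi(r,\lambda,\eta)=\dfrac{\mathrm{ind}_{KZ}^G V_r}{(T-\lambda)}\otimes\eta$. Breuil's semi-simple mod $p$ Local Langlands Correspondence is the injection from isomorphism classes of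 two-dimensional semi-simple mod $p$ representations of $\mathrm{Gal}(\overline{\mathbb{Q}}_p/\mathbb{Q}_p)$ to isomorphism classes of smooth representations of $G$ given by: if $\lambda=0$, $(\mathrm{ind}\,\omega_2^{r+1})\otimes\eta\leftrightarrow\pi(r,0,\eta)$; if $\lambda\ne0$, $(\mu_\lambda\omega^{r+1}\oplus\mu_{\lambda^{-1}})\otimes\eta\leftrightarrow\pi(r,\lambda,\eta)^{\mathrm{ss}}\oplus\pi([p-3-r],\lambda^{-1},\eta\omega^{r+1})^{\mathrm{ss}}$. *)

theory Defs
  imports
    "HOL-Analysis.Analysis"
    "HOL-Algebra.Embedded_Algebras"
    "HOL-Algebra.Algebraic_Closure_Type"
    "Berlekamp_Zassenhaus.Finite_Field"
begin

text \<open>Throughout, the prime \<open>p\<close> is the cardinality of a type \<open>'p\<close> of class \<open>prime_card\<close>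
  (every prime is the cardinality of such a type), so that the fields below are types.\<close>

section \<open>The \<open>p\<close>-adic numbers\<close>

text \<open>\<open>Z_p\<close> is the inverse limit of the rings \<open>Z/p^n\<close>, the residue classes being represented
  by \<open>0, ..., p^n - 1\<close>.\<close>

typedef 'p zp =
  "{f :: nat \<Rightarrow> int. \<forall>n. 0 \<le> f n \<and> f n < int (CARD('p::prime_card)) ^ n \<and>
      f (Suc n) mod int (CARD('p)) ^ n = f n}"
  by (rule exI[of _ "\<lambda>_. 0"]) (simp add: prime_gt_0_nat[OF prime_card])

setup_lifting type_definition_zp

lemma prime_card_pos: "(0::int) < int (CARD('p::prime_card)) ^ n"
  by (simp add: prime_gt_0_nat[OF prime_card])

lemma mod_mult_cancel: "a mod (m * c) mod m = a mod (m::int)" "a mod (c * m) mod m = a mod (m::int)"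
  by (simp_all add: mod_mod_cancel)

lemma zp_mod_eq:
  fixes f :: "nat \<Rightarrow> int"
  assumes "\<forall>n. 0 \<le> f n \<and> f n < int c ^ n \<and> f (Suc n) mod int c ^ n = f n"
  shows "f (n + k) mod int c ^ n = f n"
proof (induction k)
  case 0
  then show ?case using assms by simp
next
  case (Suc k)
  have "f (n + Suc k) mod int c ^ n = (f (Suc (n + k)) mod int c ^ (n + k)) mod int c ^ n"
    by (simp add: mod_mod_cancel le_imp_power_dvd)
  also have "\<dots> = f (n + k) mod int c ^ n" using assms by simp
  finally show ?case using Suc by simp
qed

lemma mod_lift2:
  fixes f g :: "nat \<Rightarrow> int"
  assumes "f (Suc n) mod m = f n" "g (Suc n) mod m = g n"
  shows "(f (Suc n) + g (Suc n)) mod m = (f n + g n) mod m"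
    "(f (Suc n) - g (Suc n)) mod m = (f n - g n) mod m"
    "(f (Suc n) * g (Suc n)) mod m = (f n * g n) mod m"
  using assms by (metis mod_add_eq, metis mod_diff_eq, metis mod_mult_eq)

instantiation zp :: (prime_card) comm_ring_1
begin
lift_definition zero_zp :: "'a zp" is "\<lambda>_. 0"
  by (simp add: prime_gt_0_nat[OF prime_card])
lift_definition one_zp :: "'a zp" is "\<lambda>n. 1 mod int (CARD('a)) ^ n"
  by (simp add: mod_mult_cancel prime_card_pos)
lift_definition plus_zp :: "'a zp \<Rightarrow> 'a zp \<Rightarrow> 'a zp"
  is "\<lambda>f g n. (f n + g n) mod int (CARD('a)) ^ n"
  by (simp add: mod_mult_cancel prime_card_pos mod_lift2)
lift_definition minus_zp :: "'a zp \<Rightarrow> 'a zp \<Rightarrow> 'a zp"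
  is "\<lambda>f g n. (f n - g n) mod int (CARD('a)) ^ n"
  by (simp add: mod_mult_cancel prime_card_pos mod_lift2)
lift_definition uminus_zp :: "'a zp \<Rightarrow> 'a zp"
  is "\<lambda>f n. (- f n) mod int (CARD('a)) ^ n"
  by (simp add: mod_mult_cancel prime_card_pos) (metis mod_minus_eq)
lift_definition times_zp :: "'a zp \<Rightarrow> 'a zp \<Rightarrow> 'a zp"
  is "\<lambda>f g n. (f n * g n) mod int (CARD('a)) ^ n"
  by (simp add: mod_mult_cancel prime_card_pos mod_lift2)
instance
proof
  fix a b c :: "'a zp"
  show "a + b + c = a + (b + c)" by transfer (simp add: fun_eq_iff mod_simps add.assoc)
  show "a + b = b + a" by transfer (simp add: add.commute)
  show "0 + a = a" by transfer (simp add: fun_eq_iff)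
  show "- a + a = 0" by transfer (simp add: fun_eq_iff mod_simps)
  show "a - b = a + - b" by transfer (simp add: fun_eq_iff mod_simps)
  show "a * b * c = a * (b * c)" by transfer (simp add: fun_eq_iff mod_simps mult.assoc)
  show "a * b = b * a" by transfer (simp add: mult.commute)
  show "1 * a = a" by transfer (simp add: fun_eq_iff mod_simps)
  show "(a + b) * c = a * c + b * c" by transfer (simp add: fun_eq_iff mod_simps algebra_simps)
  show "(0::'a zp) \<noteq> 1"
  proof transfer
    have "1 < int (CARD('a))" using prime_gt_1_nat[OF prime_card] by simp
    then have "1 mod int (CARD('a)) ^ 1 = 1" by simp
    then show "(\<lambda>_. 0) \<noteq> (\<lambda>n. 1 mod int (CARD('a)) ^ n)" by (metis zero_neq_one)
  qed
qed
end

instance zp :: (prime_card) idom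
proof
  fix a b :: "'a zp"
  assume "a \<noteq> 0" "b \<noteq> 0"
  then show "a * b \<noteq> 0"
  proof transfer
    fix f g :: "nat \<Rightarrow> int"
    let ?p = "int (CARD('a))"
    assume f: "\<forall>n. 0 \<le> f n \<and> f n < ?p ^ n \<and> f (Suc n) mod ?p ^ n = f n"
      and g: "\<forall>n. 0 \<le> g n \<and> g n < ?p ^ n \<and> g (Suc n) mod ?p ^ n = g n"
      and "f \<noteq> (\<lambda>_. 0)" "g \<noteq> (\<lambda>_. 0)"
    then obtain m n where mn: "f m \<noteq> 0" "g n \<noteq> 0" by blast
    have p: "Factorial_Ring.prime ?p" using prime_card[where ?'a = 'a] by simp
    have "f (m + n) mod ?p ^ m \<noteq> 0" "g (n + m) mod ?p ^ n \<noteq> 0"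
      using zp_mod_eq[OF f, of m n] zp_mod_eq[OF g, of n m] mn by simp_all
    then have nd: "\<not> ?p ^ m dvd f (m + n)" "\<not> ?p ^ n dvd g (m + n)"
      by (simp_all add: dvd_eq_mod_eq_0 add.commute)
    then have nz: "f (m + n) \<noteq> 0" "g (m + n) \<noteq> 0" by auto
    have "multiplicity ?p (f (m + n)) < m" "multiplicity ?p (g (m + n)) < n"
      using nd by (meson multiplicity_dvd' not_le)+
    moreover have "multiplicity ?p (f (m + n) * g (m + n)) =
        multiplicity ?p (f (m + n)) + multiplicity ?p (g (m + n))"
      using p nz by (simp add: prime_elem_multiplicity_mult_distrib)
    ultimately have "multiplicity ?p (f (m + n) * g (m + n)) < m + n" by simp
    moreover have "\<not> is_unit ?p" using p not_prime_unit by blast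
    ultimately have "\<not> ?p ^ (m + n) dvd f (m + n) * g (m + n)"
      using nz by (metis mult_eq_0_iff multiplicity_geI not_le)
    then have "(f (m + n) * g (m + n)) mod ?p ^ (m + n) \<noteq> 0"
      by (simp add: dvd_eq_mod_eq_0)
    then show "(\<lambda>n. f n * g n mod ?p ^ n) \<noteq> (\<lambda>_. 0)" by metis
  qed
qed

text \<open>\<open>Q_p\<close> is the fraction field of \<open>Z_p\<close>; it is made a separate type in order to carry its
  topology as a type class instance.\<close>

typedef (overloaded) 'p qp = "UNIV :: 'p::prime_card zp fract set" ..

setup_lifting type_definition_qp

instantiation qp :: (prime_card) field
begin
lift_definition zero_qp :: "'a qp" is 0 .
lift_definition one_qp :: "'a qp" is 1 .
lift_definition plus_qp :: "'a qp \<Rightarrow> 'a qp \<Rightarrow> 'a qp" is "(+)" .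
lift_definition minus_qp :: "'a qp \<Rightarrow> 'a qp \<Rightarrow> 'a qp" is "(-)" .
lift_definition uminus_qp :: "'a qp \<Rightarrow> 'a qp" is uminus .
lift_definition times_qp :: "'a qp \<Rightarrow> 'a qp \<Rightarrow> 'a qp" is "(*)" .
lift_definition inverse_qp :: "'a qp \<Rightarrow> 'a qp" is inverse .
lift_definition divide_qp :: "'a qp \<Rightarrow> 'a qp \<Rightarrow> 'a qp" is "(/)" .
instance
  by standard (transfer; simp add: algebra_simps divide_inverse)+
end

definition of_zp :: "'p::prime_card zp \<Rightarrow> 'p qp" where
  "of_zp x = Abs_qp (Fract x 1)"

lemma of_zp_add: "of_zp (x + y) = of_zp x + of_zp y"
  by (simp add: of_zp_def plus_qp_def Abs_qp_inverse)

lemma of_zp_mult: "of_zp (x * y) = of_zp x * of_zp y"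
  by (simp add: of_zp_def times_qp_def Abs_qp_inverse)

lemma of_zp_0: "of_zp 0 = 0"
  by (simp add: of_zp_def zero_qp_def Zero_fract_def)

lemma of_zp_1: "of_zp 1 = 1"
  by (simp add: of_zp_def one_qp_def One_fract_def)

lemma of_zp_of_nat: "of_zp (of_nat n) = of_nat n"
  by (induction n) (simp_all add: of_zp_0 of_zp_1 of_zp_add)

lemma of_zp_inject: "of_zp x = of_zp y \<longleftrightarrow> x = y"
  by (simp add: of_zp_def Abs_qp_inject eq_fract)

text \<open>The \<open>p\<close>-adic topology: the cosets \<open>x + p^n Z_p\<close> form a base of neighbourhoods of \<open>x\<close>.\<close>

instantiation qp :: (prime_card) topological_space
begin
definition open_qp :: "'a qp set \<Rightarrow> bool" where
  "open_qp U \<longleftrightarrow> (\<forall>x\<in>U. \<exists>n. \<forall>z. x + of_nat (CARD('a)) ^ n * of_zp z \<in> U)"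
instance
proof
  show "open (UNIV :: 'a qp set)" by (simp add: open_qp_def)
next
  fix S T :: "'a qp set"
  assume S: "open S" and T: "open T"
  show "open (S \<inter> T)"
    unfolding open_qp_def
  proof
    fix x assume x: "x \<in> S \<inter> T"
    obtain m where m: "\<forall>z. x + of_nat (CARD('a)) ^ m * of_zp z \<in> S"
      using S x unfolding open_qp_def by blast
    obtain n where n: "\<forall>z. x + of_nat (CARD('a)) ^ n * of_zp z \<in> T"
      using T x unfolding open_qp_def by blast
    have eq: "of_nat (CARD('a)) ^ (j + k) * of_zp z =
        of_nat (CARD('a)) ^ j * of_zp (of_nat (CARD('a) ^ k) * z)" for j k and z :: "'a zp"
      by (simp only: of_zp_mult of_zp_of_nat) (simp add: power_add)
    have "x + of_nat (CARD('a)) ^ (m + n) * of_zp z \<in> S \<inter> T" for z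
      unfolding Int_iff using m n eq[of m n z] eq[of n m z] by (metis add.commute)
    then show "\<exists>k. \<forall>z. x + of_nat (CARD('a)) ^ k * of_zp z \<in> S \<inter> T" by blast
  qed
next
  fix K :: "'a qp set set"
  assume "\<forall>S\<in>K. open S"
  then show "open (\<Union>K)" unfolding open_qp_def by (meson UnionE UnionI)
qed
end

text \<open>\<open>padic_val x\<close> and \<open>unit_part x\<close> are the \<open>n\<close> and \<open>u\<close> in \<open>x = p^n u\<close>, \<open>u \<in> Z_p^*\<close>
  (for \<open>x \<noteq> 0\<close>); thus \<open>of_zp (unit_part x) = x |x|\<close>.\<close>

definition padic_val :: "'p::prime_card qp \<Rightarrow> int" where
  "padic_val x = (THE n. \<exists>u. u dvd 1 \<and> x = of_nat (CARD('p)) powi n * of_zp u)"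

definition unit_part :: "'p::prime_card qp \<Rightarrow> 'p zp" where
  "unit_part x = (THE u. u dvd 1 \<and> (\<exists>n::int. x = of_nat (CARD('p)) powi n * of_zp u))"

type_synonym 'p fpbar = "'p mod_ring alg_closure"

definition red :: "'p::prime_card zp \<Rightarrow> 'p fpbar" where
  "red x = to_ac (of_int (Rep_zp x 1))"

text \<open>Only meaningful on the image of \<open>Z_p\<close> in \<open>Q_p\<close>.\<close>

definition red_qp :: "'p::prime_card qp \<Rightarrow> 'p fpbar" where
  "red_qp x = red (THE z. of_zp z = x)"

definition teich :: "'p::prime_card mod_ring \<Rightarrow> 'p zp" where
  "teich x = (THE t. t ^ CARD('p) = t \<and> red t = to_ac x)"

definition teich_reps :: "'p::prime_card zp set" where
  "teich_reps = range teich"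

section \<open>\<open>GL_2(Q_p)\<close> and its representations over \<open>\<^bold>F_p\<close>-bar\<close>

text \<open>Note that \<open>*\<close> on \<open>vec\<close> is componentwise; the matrix product is \<open>**\<close>, and \<open>mat c\<close> is the
  scalar matrix \<open>c\<close>.\<close>

type_synonym 'p mat2 = "'p qp^2^2"

definition mat2 :: "'a \<Rightarrow> 'a \<Rightarrow> 'a \<Rightarrow> 'a \<Rightarrow> 'a::zero^2^2" where
  "mat2 a b c d = vector [vector [a, b], vector [c, d]]"

definition GL2 :: "'p::prime_card mat2 set" where
  "GL2 = {g. invertible g}"

definition center :: "'p::prime_card mat2 set" where
  "center = {mat z | z. z \<noteq> 0}"

definition GL2_Zp :: "'p::prime_card mat2 set" where
  "GL2_Zp = map_matrix of_zp ` {A. invertible A}"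

definition Iwahori :: "'p::prime_card mat2 set" where
  "Iwahori = {k \<in> GL2_Zp. red_qp (k $ 2 $ 1) = 0}"

definition times_center :: "'p::prime_card mat2 set \<Rightarrow> 'p mat2 set" where
  "times_center H = {h ** z | h z. h \<in> H \<and> z \<in> center}"

text \<open>Every element of \<open>KZ\<close> is uniquely \<open>p^n k\<close> with \<open>n\<close> an integer and \<open>k \<in> K\<close>. Representations
  of \<open>K\<close> and \<open>I\<close> are extended to \<open>KZ\<close> and \<open>IZ\<close> with \<open>p\<close> acting trivially by means of
  this \<open>k\<close> (which lies in \<open>I\<close> for elements of \<open>IZ\<close>).\<close>

definition K_part :: "'p::prime_card mat2 \<Rightarrow> 'p mat2" where
  "K_part g = (THE k. k \<in> GL2_Zp \<and> (\<exists>n::int. g = mat (of_nat (CARD('p)) powi n) ** k))"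

text \<open>A representation is a module over \<open>ring_of_type_algebra :: 'p fpbar ring\<close>, in the sense of
  HOL-Algebra, with an action; the ring fields \<open>mult\<close> and \<open>one\<close> of the record are not used.\<close>

record ('p, 'v) rep = "('p fpbar, 'v) module" +
  act :: "'p mat2 \<Rightarrow> 'v \<Rightarrow> 'v"

abbreviation Fpbar :: "'p::prime_card fpbar ring" where
  "Fpbar \<equiv> ring_of_type_algebra"

definition G_rep :: "('p::prime_card, 'v) rep \<Rightarrow> bool" where
  "G_rep M \<longleftrightarrow> Module.module Fpbar M \<and>
    (\<forall>g\<in>GL2. \<forall>v\<in>carrier M. act M g v \<in> carrier M) \<and>
    (\<forall>g\<in>GL2. \<forall>v\<in>carrier M. \<forall>w\<in>carrier M. act M g (v \<oplus>\<^bsub>M\<^esub> w) = act M g v \<oplus>\<^bsub>M\<^esub> act M g w) \<and>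
    (\<forall>g\<in>GL2. \<forall>c. \<forall>v\<in>carrier M. act M g (c \<odot>\<^bsub>M\<^esub> v) = c \<odot>\<^bsub>M\<^esub> act M g v) \<and>
    (\<forall>v\<in>carrier M. act M (mat 1) v = v) \<and>
    (\<forall>g\<in>GL2. \<forall>h\<in>GL2. \<forall>v\<in>carrier M. act M (g ** h) v = act M g (act M h v))"

definition G_equivariant ::
    "('p::prime_card, 'v) rep \<Rightarrow> ('p, 'w) rep \<Rightarrow> ('v \<Rightarrow> 'w) \<Rightarrow> bool" where
  "G_equivariant M N f \<longleftrightarrow> f \<in> carrier M \<rightarrow> carrier N \<and>
    (\<forall>v\<in>carrier M. \<forall>w\<in>carrier M. f (v \<oplus>\<^bsub>M\<^esub> w) = f v \<oplus>\<^bsub>N\<^esub> f w) \<and>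
    (\<forall>c. \<forall>v\<in>carrier M. f (c \<odot>\<^bsub>M\<^esub> v) = c \<odot>\<^bsub>N\<^esub> f v) \<and>
    (\<forall>g\<in>GL2. \<forall>v\<in>carrier M. f (act M g v) = act N g (f v))"

definition rep_iso :: "('p::prime_card, 'v) rep \<Rightarrow> ('p, 'w) rep \<Rightarrow> bool"  (infix "\<cong>\<^sub>G" 50) where
  "M \<cong>\<^sub>G N \<longleftrightarrow> G_rep M \<and> G_rep N \<and>
    (\<exists>f. G_equivariant M N f \<and> bij_betw f (carrier M) (carrier N))"

text \<open>Endomorphisms are extensional functions on the carrier, so that an endomorphism determined by
  its values on generators is unique as a function.\<close>

definition G_endo :: "('p::prime_card, 'v) rep \<Rightarrow> ('v \<Rightarrow> 'v) \<Rightarrow> bool" where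
  "G_endo M T \<longleftrightarrow> T \<in> extensional (carrier M) \<and> G_equivariant M M T"

definition endo_add :: "('p, 'v) rep \<Rightarrow> ('v \<Rightarrow> 'v) \<Rightarrow> ('v \<Rightarrow> 'v) \<Rightarrow> 'v \<Rightarrow> 'v" where
  "endo_add M S T = (\<lambda>v\<in>carrier M. S v \<oplus>\<^bsub>M\<^esub> T v)"

definition endo_minus :: "('p, 'v) rep \<Rightarrow> ('v \<Rightarrow> 'v) \<Rightarrow> ('v \<Rightarrow> 'v) \<Rightarrow> 'v \<Rightarrow> 'v" where
  "endo_minus M S T = (\<lambda>v\<in>carrier M. S v \<ominus>\<^bsub>M\<^esub> T v)"

definition endo_scalar :: "('p, 'v) rep \<Rightarrow> 'p fpbar \<Rightarrow> 'v \<Rightarrow> 'v" where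
  "endo_scalar M c = (\<lambda>v\<in>carrier M. c \<odot>\<^bsub>M\<^esub> v)"

definition endo_image :: "('p, 'v) rep \<Rightarrow> ('v \<Rightarrow> 'v) \<Rightarrow> 'v set" where
  "endo_image M S = S ` carrier M"

definition subrep :: "'v set \<Rightarrow> ('p::prime_card, 'v) rep \<Rightarrow> bool" where
  "subrep W M \<longleftrightarrow> submodule W Fpbar M \<and> (\<forall>g\<in>GL2. \<forall>w\<in>W. act M g w \<in> W)"

definition rep_quot :: "('p, 'v) rep \<Rightarrow> 'v set \<Rightarrow> ('p, 'v set) rep" where
  "rep_quot M W = \<lparr>
    carrier = a_rcosets\<^bsub>M\<^esub> W,
    monoid.mult = undefined,
    one = undefined,
    ring.zero = W,
    add = set_add M,
    smult = (\<lambda>c A. \<Union>v\<in>A. W +>\<^bsub>M\<^esub> (c \<odot>\<^bsub>M\<^esub> v)),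
    act = (\<lambda>g A. \<Union>v\<in>A. W +>\<^bsub>M\<^esub> (act M g v))\<rparr>"

definition rep_prod :: "('p, 'v) rep \<Rightarrow> ('p, 'w) rep \<Rightarrow> ('p, 'v \<times> 'w) rep"  (infixr "\<oplus>\<^sub>G" 65) where
  "M \<oplus>\<^sub>G N = \<lparr>
    carrier = carrier M \<times> carrier N,
    monoid.mult = undefined,
    one = undefined,
    ring.zero = (\<zero>\<^bsub>M\<^esub>, \<zero>\<^bsub>N\<^esub>),
    add = (\<lambda>x y. (fst x \<oplus>\<^bsub>M\<^esub> fst y, snd x \<oplus>\<^bsub>N\<^esub> snd y)),
    smult = (\<lambda>c x. (c \<odot>\<^bsub>M\<^esub> fst x, c \<odot>\<^bsub>N\<^esub> snd x)),
    act = (\<lambda>g x. (act M g (fst x), act N g (snd x)))\<rparr>"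

text \<open>The direct sum of a family of representations, for finite \<open>J\<close>.\<close>

definition rep_dsum :: "'i set \<Rightarrow> ('i \<Rightarrow> ('p, 'v) rep) \<Rightarrow> ('p, 'i \<Rightarrow> 'v) rep" where
  "rep_dsum J M = \<lparr>
    carrier = (\<Pi>\<^sub>E i\<in>J. carrier (M i)),
    monoid.mult = undefined,
    one = undefined,
    ring.zero = (\<lambda>i\<in>J. \<zero>\<^bsub>M i\<^esub>),
    add = (\<lambda>x y. \<lambda>i\<in>J. x i \<oplus>\<^bsub>M i\<^esub> y i),
    smult = (\<lambda>c x. \<lambda>i\<in>J. c \<odot>\<^bsub>M i\<^esub> x i),
    act = (\<lambda>g x. \<lambda>i\<in>J. act (M i) g (x i))\<rparr>"

definition rep_twist :: "('p::prime_card, 'v) rep \<Rightarrow> ('p qp \<Rightarrow> 'p fpbar) \<Rightarrow> ('p, 'v) rep"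
    (infixl "\<otimes>\<^sub>G" 70) where
  "M \<otimes>\<^sub>G \<kappa> = M\<lparr>act := \<lambda>g v. \<kappa> (det g) \<odot>\<^bsub>M\<^esub> act M g v\<rparr>"

definition irreducible_rep :: "('p::prime_card, 'v) rep \<Rightarrow> bool" where
  "irreducible_rep M \<longleftrightarrow> carrier M \<noteq> {\<zero>\<^bsub>M\<^esub>} \<and>
    (\<forall>W. subrep W M \<longrightarrow> W = {\<zero>\<^bsub>M\<^esub>} \<or> W = carrier M)"

definition subquot :: "('p, 'v) rep \<Rightarrow> 'v set \<Rightarrow> 'v set \<Rightarrow> ('p, 'v set) rep" where
  "subquot M W' W = rep_quot (M\<lparr>carrier := W'\<rparr>) W"

definition composition_series :: "('p::prime_card, 'v) rep \<Rightarrow> nat \<Rightarrow> (nat \<Rightarrow> 'v set) \<Rightarrow> bool" where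
  "composition_series M n F \<longleftrightarrow> F 0 = {\<zero>\<^bsub>M\<^esub>} \<and> F n = carrier M \<and>
    (\<forall>i\<le>n. subrep (F i) M) \<and>
    (\<forall>i<n. F i \<subseteq> F (Suc i) \<and> irreducible_rep (subquot M (F (Suc i)) (F i)))"

text \<open>\<open>N\<close> is the semi-simplification of \<open>M\<close>: it is isomorphic to the direct sum of the factors of
  a composition series of \<open>M\<close>. By the theorem of Jordan and Hoelder this determines \<open>N\<close> up to
  isomorphism.\<close>

definition semisimplification :: "('p::prime_card, 'v) rep \<Rightarrow> ('p, 'w) rep \<Rightarrow> bool" where
  "semisimplification M N \<longleftrightarrow> (\<exists>n F. composition_series M n F \<and>
    N \<cong>\<^sub>G rep_dsum {..<n} (\<lambda>i. subquot M (F (Suc i)) (F i)))"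

section \<open>Compact induction\<close>

text \<open>For a representation \<open>\<sigma>\<close> of an open subgroup \<open>H\<close> of \<open>GL_2(Q_p)\<close>; only the values
  \<open>act \<sigma> h\<close>, \<open>h \<in> H\<close>, matter. Functions on \<open>GL_2(Q_p)\<close> are extensional functions on all
  matrices. The topology on \<open>GL_2(Q_p)\<close> is the one induced by \<open>Q_p^4\<close>.\<close>

definition compact_mod_center :: "'p::prime_card mat2 set \<Rightarrow> bool" where
  "compact_mod_center S \<longleftrightarrow> (\<exists>C\<subseteq>GL2. compact C \<and> S \<subseteq> times_center C)"

definition cind :: "'p::prime_card mat2 set \<Rightarrow> ('p, 'v) rep \<Rightarrow> ('p, 'p mat2 \<Rightarrow> 'v) rep" where
  "cind H \<sigma> = \<lparr>
    carrier = {f \<in> GL2 \<rightarrow>\<^sub>E carrier \<sigma>.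
      (\<forall>h\<in>H. \<forall>x\<in>GL2. f (h ** x) = act \<sigma> h (f x)) \<and>
      compact_mod_center {x \<in> GL2. f x \<noteq> \<zero>\<^bsub>\<sigma>\<^esub>}},
    monoid.mult = undefined,
    one = undefined,
    ring.zero = (\<lambda>x\<in>GL2. \<zero>\<^bsub>\<sigma>\<^esub>),
    add = (\<lambda>f f'. \<lambda>x\<in>GL2. f x \<oplus>\<^bsub>\<sigma>\<^esub> f' x),
    smult = (\<lambda>c f. \<lambda>x\<in>GL2. c \<odot>\<^bsub>\<sigma>\<^esub> f x),
    act = (\<lambda>g f. \<lambda>x\<in>GL2. f (x ** g))\<rparr>"

text \<open>The function \<open>[g, v]\<close>; note that \<open>x \<in> H g\<^sup>-\<^sup>1\<close> iff \<open>x g \<in> H\<close>.\<close>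

definition elem_fun ::
    "'p::prime_card mat2 set \<Rightarrow> ('p, 'v) rep \<Rightarrow> 'p mat2 \<Rightarrow> 'v \<Rightarrow> 'p mat2 \<Rightarrow> 'v" where
  "elem_fun H \<sigma> g v = (\<lambda>x\<in>GL2. if x ** g \<in> H then act \<sigma> (x ** g) v else \<zero>\<^bsub>\<sigma>\<^esub>)"

section \<open>Weights, characters and Hecke operators\<close>

text \<open>Polynomials in \<open>X, Y\<close> are elements of \<open>'p fpbar poly poly\<close>, the inner variable being \<open>X\<close>
  and the outer one \<open>Y\<close>.\<close>

definition varX :: "'a::comm_ring_1 poly poly" where "varX = [:[:0, 1:]:]"

definition varY :: "'a::comm_ring_1 poly poly" where "varY = [:0, 1:]"

definition const2 :: "'a::comm_ring_1 \<Rightarrow> 'a poly poly" where "const2 c = [:[:c:]:]"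

definition subst2 :: "'a::comm_ring_1 poly poly \<Rightarrow> 'a poly poly \<Rightarrow> 'a poly poly \<Rightarrow> 'a poly poly" where
  "subst2 P u v = (\<Sum>j\<le>Polynomial.degree P. \<Sum>i\<le>Polynomial.degree (Polynomial.coeff P j).
    const2 (Polynomial.coeff (Polynomial.coeff P j) i) * u ^ i * v ^ j)"

definition homogeneous2 :: "nat \<Rightarrow> 'a::comm_ring_1 poly poly set" where
  "homogeneous2 r = {P. \<forall>i j. Polynomial.coeff (Polynomial.coeff P j) i \<noteq> 0 \<longrightarrow> i + j = r}"

definition KZ :: "'p::prime_card mat2 set" where "KZ = times_center GL2_Zp"

definition IZ :: "'p::prime_card mat2 set" where "IZ = times_center Iwahori"

definition V_rep :: "nat \<Rightarrow> ('p::prime_card, 'p fpbar poly poly) rep" where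
  "V_rep r = \<lparr>
    carrier = homogeneous2 r,
    monoid.mult = undefined,
    one = undefined,
    ring.zero = 0,
    add = (+),
    smult = (\<lambda>c P. const2 c * P),
    act = (\<lambda>g P. let k = K_part g in
      subst2 P (const2 (red_qp (k $ 1 $ 1)) * varX + const2 (red_qp (k $ 2 $ 1)) * varY)
               (const2 (red_qp (k $ 1 $ 2)) * varX + const2 (red_qp (k $ 2 $ 2)) * varY))\<rparr>"

definition d_rep :: "nat \<Rightarrow> ('p::prime_card, 'p fpbar) rep" where
  "d_rep r = \<lparr>
    carrier = UNIV,
    monoid.mult = undefined,
    one = undefined,
    ring.zero = 0,
    add = (+),
    smult = (*),
    act = (\<lambda>g v. red_qp (K_part g $ 2 $ 2) ^ r * v)\<rparr>"

definition ind_KZ :: "nat \<Rightarrow> ('p::prime_card, 'p mat2 \<Rightarrow> 'p fpbar poly poly) rep" where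
  "ind_KZ r = cind KZ (V_rep r)"

definition ind_IZ :: "nat \<Rightarrow> ('p::prime_card, 'p mat2 \<Rightarrow> 'p fpbar) rep" where
  "ind_IZ r = cind IZ (d_rep r)"

definition alpha :: "'p::prime_card mat2" where
  "alpha = mat2 1 0 0 (of_nat (CARD('p)))"

definition beta :: "'p::prime_card mat2" where
  "beta = mat2 0 1 (of_nat (CARD('p))) 0"

text \<open>Coefficients \<open>\<lambda>\<close> and \<open>p\<close> of a substitution into a polynomial are read modulo \<open>p\<close>.\<close>

definition T_op :: "nat \<Rightarrow> ('p::prime_card mat2 \<Rightarrow> 'p fpbar poly poly) \<Rightarrow> 'p mat2 \<Rightarrow> 'p fpbar poly poly" where
  "T_op r = (THE T. G_endo (ind_KZ r) T \<and>
    (\<forall>P\<in>homogeneous2 r. T (elem_fun KZ (V_rep r) (mat 1) P) =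
      (\<Oplus>\<^bsub>ind_KZ r\<^esub> t\<in>teich_reps.
        elem_fun KZ (V_rep r) (mat2 (of_nat (CARD('p))) (of_zp t) 0 1)
          (subst2 P varX (const2 (red (- t)) * varX + const2 (red (of_nat (CARD('p)))) * varY)))
      \<oplus>\<^bsub>ind_KZ r\<^esub>
        elem_fun KZ (V_rep r) alpha (subst2 P (const2 (red (of_nat (CARD('p)))) * varX) varY)))"

definition Tm10 :: "nat \<Rightarrow> ('p::prime_card mat2 \<Rightarrow> 'p fpbar) \<Rightarrow> 'p mat2 \<Rightarrow> 'p fpbar" where
  "Tm10 r = (THE T. G_endo (ind_IZ r) T \<and>
    T (elem_fun IZ (d_rep r) (mat 1) 1) =
      (\<Oplus>\<^bsub>ind_IZ r\<^esub> t\<in>teich_reps.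
        elem_fun IZ (d_rep r) (mat2 (of_nat (CARD('p))) (of_zp t) 0 1) 1))"

definition T12 :: "nat \<Rightarrow> ('p::prime_card mat2 \<Rightarrow> 'p fpbar) \<Rightarrow> 'p mat2 \<Rightarrow> 'p fpbar" where
  "T12 r = (THE T. G_endo (ind_IZ r) T \<and>
    T (elem_fun IZ (d_rep r) (mat 1) 1) =
      (\<Oplus>\<^bsub>ind_IZ r\<^esub> t\<in>teich_reps.
        elem_fun IZ (d_rep r)
          (mat2 1 0 (of_nat (CARD('p)) * of_zp t) (of_nat (CARD('p)))) 1))"

text \<open>Only used for \<open>r = 0\<close> and \<open>r = p - 1\<close>.\<close>

definition T10 :: "nat \<Rightarrow> ('p::prime_card mat2 \<Rightarrow> 'p fpbar) \<Rightarrow> 'p mat2 \<Rightarrow> 'p fpbar" where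
  "T10 r = (THE T. G_endo (ind_IZ r) T \<and>
    T (elem_fun IZ (d_rep r) (mat 1) 1) = elem_fun IZ (d_rep r) beta 1)"

text \<open>The operator \<open>\<delta>_{r,a} T_{1,0}\<close> on \<open>ind_IZ d^r\<close>.\<close>

definition delta_T10 :: "nat \<Rightarrow> nat \<Rightarrow> ('p::prime_card mat2 \<Rightarrow> 'p fpbar) \<Rightarrow> 'p mat2 \<Rightarrow> 'p fpbar" where
  "delta_T10 r a = (if r = a then T10 r else endo_scalar (ind_IZ r) 0)"

text \<open>The quotient of \<open>ind_IZ d^r\<close> by \<open>(T_{-1,0} + \<delta>_{r,p-1} T_{1,0}) + (S)\<close>.\<close>

definition Iwahori_quot ::
    "nat \<Rightarrow> (('p::prime_card mat2 \<Rightarrow> 'p fpbar) \<Rightarrow> 'p mat2 \<Rightarrow> 'p fpbar) \<Rightarrow>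
      ('p, ('p mat2 \<Rightarrow> 'p fpbar) set) rep" where
  "Iwahori_quot r S = rep_quot (ind_IZ r)
    (endo_image (ind_IZ r) (endo_add (ind_IZ r) (Tm10 r) (delta_T10 r (CARD('p) - 1)))
      <+>\<^bsub>ind_IZ r\<^esub> endo_image (ind_IZ r) S)"

definition smooth_char :: "('p::prime_card qp \<Rightarrow> 'p fpbar) \<Rightarrow> bool" where
  "smooth_char \<eta> \<longleftrightarrow> (\<forall>x. x \<noteq> 0 \<longrightarrow> \<eta> x \<noteq> 0) \<and>
    (\<forall>x y. x \<noteq> 0 \<longrightarrow> y \<noteq> 0 \<longrightarrow> \<eta> (x * y) = \<eta> x * \<eta> y) \<and>
    (\<forall>x. x \<noteq> 0 \<longrightarrow> (\<exists>U. open U \<and> x \<in> U \<and> (\<forall>y\<in>U. y \<noteq> 0 \<longrightarrow> \<eta> y = \<eta> x)))"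

text \<open>The character \<open>x \<mapsto> x |x| mod p\<close>.\<close>

definition omega_Qp :: "'p::prime_card qp \<Rightarrow> 'p fpbar" where
  "omega_Qp x = red (unit_part x)"

definition pi_rep ::
    "nat \<Rightarrow> 'p::prime_card fpbar \<Rightarrow> ('p qp \<Rightarrow> 'p fpbar) \<Rightarrow>
      ('p, ('p mat2 \<Rightarrow> 'p fpbar poly poly) set) rep" where
  "pi_rep r l \<eta> = rep_quot (ind_KZ r)
    (endo_image (ind_KZ r) (endo_minus (ind_KZ r) (T_op r) (endo_scalar (ind_KZ r) l))) \<otimes>\<^sub>G \<eta>"

section \<open>The Galois side\<close>

type_synonym 'p qpbar = "'p qp alg_closure"

definition Gal :: "('p::prime_card qpbar \<Rightarrow> 'p qpbar) set" where
  "Gal = {\<sigma>. bij \<sigma> \<and> (\<forall>x y. \<sigma> (x + y) = \<sigma> x + \<sigma> y) \<and> (\<forall>x y. \<sigma> (x * y) = \<sigma> x * \<sigma> y) \<and>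
    (\<forall>a. \<sigma> (to_ac a) = to_ac a)}"

text \<open>The ring of integers of the algebraic closure of \<open>Q_p\<close>, its maximal ideal (the non-units),
  and an identification of the residue field with the chosen algebraic closure of \<open>\<^bold>F_p\<close>. The
  latter only enters through \<open>omega2\<close>; a different choice replaces \<open>omega2\<close> by its conjugate
  \<open>omega2^p\<close>, which does not change the induced representations below up to isomorphism.\<close>

definition int_ring :: "'p::prime_card qpbar set" where
  "int_ring = {x. \<exists>q :: 'p zp poly. Polynomial.lead_coeff q = 1 \<and> poly (map_poly (\<lambda>z. to_ac (of_zp z)) q) x = 0}"

definition max_ideal :: "'p::prime_card qpbar set" where
  "max_ideal = {x \<in> int_ring. x = 0 \<or> inverse x \<notin> int_ring}"

definition red_bar :: "'p::prime_card qpbar \<Rightarrow> 'p fpbar" where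
  "red_bar = (SOME \<phi>. \<phi> 1 = 1 \<and>
    (\<forall>x\<in>int_ring. \<forall>y\<in>int_ring. \<phi> (x + y) = \<phi> x + \<phi> y \<and> \<phi> (x * y) = \<phi> x * \<phi> y) \<and>
    (\<forall>x\<in>int_ring. \<phi> x = 0 \<longleftrightarrow> x \<in> max_ideal))"

definition inertia :: "('p::prime_card qpbar \<Rightarrow> 'p qpbar) set" where
  "inertia = {\<sigma> \<in> Gal. \<forall>x\<in>int_ring. \<sigma> x - x \<in> max_ideal}"

text \<open>\<open>\<sigma>\<close> induces the inverse of \<open>x \<mapsto> x^p\<close> on the residue field.\<close>

definition geometric_Frobenius :: "('p::prime_card qpbar \<Rightarrow> 'p qpbar) \<Rightarrow> bool" where
  "geometric_Frobenius \<sigma> \<longleftrightarrow> \<sigma> \<in> Gal \<and> (\<forall>x\<in>int_ring. \<sigma> x ^ CARD('p) - x \<in> max_ideal)"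

text \<open>The Galois group of \<open>Q_{p^2} = Q_p(\<mu>_{p^2-1})\<close>.\<close>

definition Gal2 :: "('p::prime_card qpbar \<Rightarrow> 'p qpbar) set" where
  "Gal2 = {\<sigma> \<in> Gal. \<forall>z. z ^ (CARD('p)\<^sup>2 - 1) = 1 \<longrightarrow> \<sigma> z = z}"

text \<open>Continuous characters, for the Krull topology, of a subgroup \<open>H\<close> of \<open>Gal\<close>. Only the values on
  \<open>H\<close> are relevant.\<close>

definition cont_char ::
    "('p::prime_card qpbar \<Rightarrow> 'p qpbar) set \<Rightarrow> (('p qpbar \<Rightarrow> 'p qpbar) \<Rightarrow> 'p fpbar) \<Rightarrow> bool" where
  "cont_char H \<kappa> \<longleftrightarrow> (\<forall>\<sigma>\<in>H. \<kappa> \<sigma> \<noteq> 0) \<and>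
    (\<forall>\<sigma>\<in>H. \<forall>\<tau>\<in>H. \<kappa> (\<sigma> \<circ> \<tau>) = \<kappa> \<sigma> * \<kappa> \<tau>) \<and>
    (\<exists>S. finite S \<and> (\<forall>\<sigma>\<in>H. (\<forall>x\<in>S. \<sigma> x = x) \<longrightarrow> \<kappa> \<sigma> = 1))"

definition cyclotomic :: "('p::prime_card qpbar \<Rightarrow> 'p qpbar) \<Rightarrow> 'p fpbar" where
  "cyclotomic \<sigma> = of_nat (SOME k. \<forall>z. z ^ CARD('p) = 1 \<longrightarrow> \<sigma> z = z ^ k)"

text \<open>The fundamental character of level 2, on inertia: \<open>\<sigma> \<mapsto> \<sigma>(w)/w\<close> with \<open>w^(p^2-1) = p\<close>.\<close>

definition omega2 :: "('p::prime_card qpbar \<Rightarrow> 'p qpbar) \<Rightarrow> 'p fpbar" where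
  "omega2 \<sigma> = (let w = (SOME w. w ^ (CARD('p)\<^sup>2 - 1) = of_nat (CARD('p))) in red_bar (\<sigma> w / w))"

definition unram :: "'p::prime_card fpbar \<Rightarrow> ('p qpbar \<Rightarrow> 'p qpbar) \<Rightarrow> 'p fpbar" where
  "unram l = (SOME \<kappa>. cont_char Gal \<kappa> \<and> (\<forall>\<sigma>\<in>inertia. \<kappa> \<sigma> = 1) \<and>
    (\<forall>\<sigma>. geometric_Frobenius \<sigma> \<longrightarrow> \<kappa> \<sigma> = l))"

text \<open>Two-dimensional representations of \<open>Gal\<close> are given by matrices; only the values on \<open>Gal\<close>
  are relevant.\<close>

type_synonym 'p galrep = "('p qpbar \<Rightarrow> 'p qpbar) \<Rightarrow> 'p fpbar^2^2"

definition gal_iso :: "'p::prime_card galrep \<Rightarrow> 'p galrep \<Rightarrow> bool"  (infix "\<cong>\<^sub>G\<^sub>a\<^sub>l" 50) where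
  "\<rho> \<cong>\<^sub>G\<^sub>a\<^sub>l \<rho>' \<longleftrightarrow> (\<exists>Q. invertible Q \<and> (\<forall>\<sigma>\<in>Gal. \<rho>' \<sigma> = Q ** \<rho> \<sigma> ** matrix_inv Q))"

definition gal_sum ::
    "(('p::prime_card qpbar \<Rightarrow> 'p qpbar) \<Rightarrow> 'p fpbar) \<Rightarrow> (('p qpbar \<Rightarrow> 'p qpbar) \<Rightarrow> 'p fpbar) \<Rightarrow> 'p galrep" where
  "gal_sum \<kappa> \<kappa>' = (\<lambda>\<sigma>. mat2 (\<kappa> \<sigma>) 0 0 (\<kappa>' \<sigma>))"

definition gal_twist ::
    "'p::prime_card galrep \<Rightarrow> (('p qpbar \<Rightarrow> 'p qpbar) \<Rightarrow> 'p fpbar) \<Rightarrow> 'p galrep" where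
  "gal_twist \<rho> \<kappa> = (\<lambda>\<sigma>. mat (\<kappa> \<sigma>) ** \<rho> \<sigma>)"

text \<open>The representation induced from a character of \<open>Gal2\<close>, in the basis given by the coset
  representatives \<open>t 1 = id\<close> and \<open>t 2\<close> of the subgroup \<open>Gal2\<close> of index 2.\<close>

definition gal_ind :: "(('p::prime_card qpbar \<Rightarrow> 'p qpbar) \<Rightarrow> 'p fpbar) \<Rightarrow> 'p galrep" where
  "gal_ind \<psi> = (let \<tau> = (SOME \<tau>. \<tau> \<in> Gal - Gal2); t = (\<lambda>i::2. if i = 1 then id else \<tau>) in
    (\<lambda>\<sigma>. \<chi> i j. let s = inv_into UNIV (t i) \<circ> \<sigma> \<circ> t j in if s \<in> Gal2 then \<psi> s else 0))"

definition ind_omega2 :: "nat \<Rightarrow> 'p::prime_card galrep" where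
  "ind_omega2 c = gal_ind (SOME \<psi>. cont_char Gal2 \<psi> \<and> (\<forall>\<sigma>\<in>inertia. \<psi> \<sigma> = omega2 \<sigma> ^ c) \<and>
    (\<forall>\<sigma>\<in>Gal. det (gal_ind \<psi> \<sigma>) = cyclotomic \<sigma> ^ c))"

text \<open>Local class field theory: the reciprocity map from \<open>Q_p^*\<close> to \<open>Gal(Q_p^ab/Q_p)\<close> is the
  unique homomorphism sending uniformizers to geometric Frobenius elements and such that the
  norms from every finite abelian extension \<open>L\<close> act trivially on \<open>L\<close>. Elements of
  \<open>Gal(Q_p^ab/Q_p)\<close> are represented by elements of \<open>Gal\<close>; \<open>Q_p^ab\<close> is the fixed field of all
  commutators.\<close>

definition max_abelian_ext :: "'p::prime_card qpbar set" where
  "max_abelian_ext = {x. \<forall>\<sigma>\<in>Gal. \<forall>\<tau>\<in>Gal. \<sigma> (\<tau> x) = \<tau> (\<sigma> x)}"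

definition finite_abelian_ext :: "'p::prime_card qpbar set \<Rightarrow> bool" where
  "finite_abelian_ext L \<longleftrightarrow> subfield L ring_of_type_algebra \<and> range to_ac \<subseteq> L \<and>
    L \<subseteq> max_abelian_ext \<and> ring.finite_dimension ring_of_type_algebra (range to_ac) L"

definition field_norm :: "'p::prime_card qpbar set \<Rightarrow> 'p qpbar \<Rightarrow> 'p qpbar" where
  "field_norm L y = (\<Prod>\<tau>\<in>(\<lambda>\<sigma>. restrict \<sigma> L) ` Gal. \<tau> y)"

definition reciprocity_map :: "('p::prime_card qp \<Rightarrow> 'p qpbar \<Rightarrow> 'p qpbar) \<Rightarrow> bool" where
  "reciprocity_map A \<longleftrightarrow> (\<forall>a. a \<noteq> 0 \<longrightarrow> A a \<in> Gal) \<and>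
    (\<forall>a b. a \<noteq> 0 \<longrightarrow> b \<noteq> 0 \<longrightarrow> (\<forall>x\<in>max_abelian_ext. A (a * b) x = A a (A b x))) \<and>
    (\<forall>a. a \<noteq> 0 \<longrightarrow> padic_val a = 1 \<longrightarrow> geometric_Frobenius (A a)) \<and>
    (\<forall>L y a. finite_abelian_ext L \<longrightarrow> y \<in> L \<longrightarrow> y \<noteq> 0 \<longrightarrow> to_ac a = field_norm L y \<longrightarrow>
      (\<forall>x\<in>L. A a x = x))"

text \<open>The continuous character of \<open>Gal\<close> corresponding to a smooth character of \<open>Q_p^*\<close>; its
  restriction to \<open>Gal\<close> is unique.\<close>

definition gal_char :: "('p::prime_card qp \<Rightarrow> 'p fpbar) \<Rightarrow> ('p qpbar \<Rightarrow> 'p qpbar) \<Rightarrow> 'p fpbar" where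
  "gal_char \<eta> = (SOME \<kappa>. cont_char Gal \<kappa> \<and>
    (\<forall>A. reciprocity_map A \<longrightarrow> (\<forall>a. a \<noteq> 0 \<longrightarrow> \<kappa> (A a) = \<eta> a)))"

section \<open>Breuil's correspondence\<close>

text \<open>The class \<open>[a]\<close> in \<open>{0, ..., p-2}\<close> of \<open>a\<close> modulo \<open>p - 1\<close>.\<close>

definition residue_class :: "'p::prime_card itself \<Rightarrow> int \<Rightarrow> nat" where
  "residue_class _ a = nat (a mod (int (CARD('p)) - 1))"

text \<open>\<open>breuil_LL \<rho> \<pi>\<close> says that the correspondence attaches \<open>\<pi>\<close> to \<open>\<rho>\<close>. It is a relation
  between isomorphism classes, i.e. invariant under isomorphism in both arguments. The
  semi-simplifications \<open>N1\<close>, \<open>N2\<close> are determined up to isomorphism, and have representatives on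
  the types given here, see \<open>semisimplification\<close>.\<close>

definition breuil_LL :: "'p::prime_card galrep \<Rightarrow> ('p, 'v) rep \<Rightarrow> bool" where
  "breuil_LL \<rho> \<pi> \<longleftrightarrow>
    (\<exists>r \<eta>. r \<le> CARD('p) - 1 \<and> smooth_char \<eta> \<and>
       \<rho> \<cong>\<^sub>G\<^sub>a\<^sub>l gal_twist (ind_omega2 (r + 1)) (gal_char \<eta>) \<and> \<pi> \<cong>\<^sub>G pi_rep r 0 \<eta>) \<or>
    (\<exists>r l \<eta>.
       \<exists>(N1 :: ('p, nat \<Rightarrow> ('p mat2 \<Rightarrow> 'p fpbar poly poly) set set) rep)
         (N2 :: ('p, nat \<Rightarrow> ('p mat2 \<Rightarrow> 'p fpbar poly poly) set set) rep).
       r \<le> CARD('p) - 1 \<and> l \<noteq> 0 \<and> smooth_char \<eta> \<and>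
       \<rho> \<cong>\<^sub>G\<^sub>a\<^sub>l gal_twist
         (gal_sum (\<lambda>\<sigma>. unram l \<sigma> * cyclotomic \<sigma> ^ (r + 1)) (unram (inverse l))) (gal_char \<eta>) \<and>
       semisimplification (pi_rep r l \<eta>) N1 \<and>
       semisimplification
         (pi_rep (residue_class TYPE('p) (int (CARD('p)) - 3 - int r)) (inverse l)
           (\<lambda>x. \<eta> x * omega_Qp x ^ (r + 1))) N2 \<and>
       \<pi> \<cong>\<^sub>G N1 \<oplus>\<^sub>G N2)"

end

theory Submission
  imports Defs
begin

text \<open>By Frobenius reciprocity there is a \<open>G\<close>-map \<open>Phi\<close> from \<open>ind_IZ d^r\<close> to \<open>ind_KZ V_r\<close> sending
  \<open>[[id, 1]]\<close> to \<open>[beta, X^r]\<close>. It is onto, because the powers \<open>(t X + Y)^r\<close> and \<open>X^r\<close> span \<open>V_r\<close>, and it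
  intertwines \<open>T_{1,2} + delta_{r,0} T_{1,0}\<close> with \<open>T\<close>, which only has to be checked on \<open>[[id, 1]]\<close>. Its
  kernel is the image of \<open>T_{-1,0} + delta_{r,p-1} T_{1,0}\<close>: the linear relations between the \<open>(t X + Y)^r\<close> are
  the functions on \<open>F_p\<close> orthogonal to the polynomials of low degree, and these are spanned by the functions
  \<open>t \<mapsto> (t - u)^(p-1-r)\<close>, which are translates of the image of \<open>[[id, 1]]\<close>. Hence the Iwahori quotient for
  \<open>\<lambda>\<close> is isomorphic to \<open>ind_KZ V_r / (T - \<lambda>)\<close>, and the correspondence is invariant under isomorphisms.\<close>

section \<open>The ring of $p$-adic integers\<close>

text \<open>In \<open>V_r\<close> the vector \<open>X^r\<close> is an eigenvector of
  \<open>I\<close> for the character \<open>a^r\<close>, not \<open>d^r\<close>. Conjugation by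
  \<open>beta\<close> exchanges the diagonal entries, which is why \<open>[[id, 1]]\<close> has to
  be sent to \<open>[beta, X^r]\<close>. The correction terms are boundary effects. For
  \<open>r = p - 1\<close> the sum of all \<open>(t X + Y)^r\<close> is \<open>- X^r\<close> instead
  of 0, so \<open>T_{-1,0}\<close> alone does not land in the kernel. For \<open>r = 0\<close> the
  last of the \<open>p + 1\<close> terms of \<open>T\<close>, which substitutes \<open>p X\<close>
  for \<open>X\<close>, does not kill \<open>X^r\<close>, so \<open>T_{1,2}\<close> with its
  \<open>p\<close> terms falls short of \<open>T\<close>. Relations between powers of linear forms
  describe the kernel only on functions supported on the one coset \<open>beta KZ\<close>, whereas
  an element of the kernel of \<open>Phi\<close> may have any finite support. Instead of decomposing
  it, an inverse is built: Frobenius reciprocity for \<open>KZ\<close>, applied to the quotient by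
  the image of the first operator, extends the local inverse to all of \<open>ind_KZ V_r\<close>.
  Support conditions are made combinatorial beforehand: compactness modulo the center becomes
  finiteness of a set of cosets.\<close>

lemma zp_eqI: "(\<And>n. Rep_zp x n = Rep_zp y n) \<Longrightarrow> x = y"
  by (metis Rep_zp_inject ext)

lemma Rep_zp_props:
  fixes x :: "'p::prime_card zp"
  shows "0 \<le> Rep_zp x n" "Rep_zp x n < int (CARD('p)) ^ n"
    "Rep_zp x (n + k) mod int (CARD('p)) ^ n = Rep_zp x n"
proof -
  have *: "\<forall>n. 0 \<le> Rep_zp x n \<and> Rep_zp x n < int (CARD('p)) ^ n \<and>
      Rep_zp x (Suc n) mod int (CARD('p)) ^ n = Rep_zp x n"
    using Rep_zp[of x] by blast
  then show "0 \<le> Rep_zp x n" "Rep_zp x n < int (CARD('p)) ^ n" by auto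
  show "Rep_zp x (n + k) mod int (CARD('p)) ^ n = Rep_zp x n"
    by (rule zp_mod_eq[OF *])
qed

lemma Rep_zp_mod_self [simp]:
  fixes x :: "'p::prime_card zp"
  shows "Rep_zp x n mod int (CARD('p)) ^ n = Rep_zp x n"
  using Rep_zp_props(3)[of x n 0] by simp

lemma Rep_zp_0 [simp]: "Rep_zp x 0 = 0"
  using Rep_zp_props(1,2)[of x 0] by simp

lemma Rep_zp_of_nat:
  "Rep_zp (of_nat k :: 'p::prime_card zp) n = int k mod int (CARD('p)) ^ n"
  by (induction k) (simp_all add: zero_zp.rep_eq one_zp.rep_eq plus_zp.rep_eq mod_simps)

lemma Rep_zp_power:
  "Rep_zp (x ^ k :: 'p::prime_card zp) n = Rep_zp x n ^ k mod int (CARD('p)) ^ n"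
  by (induction k) (simp_all add: one_zp.rep_eq times_zp.rep_eq mod_simps)

lemma zp_exists:
  assumes "\<And>n. 0 \<le> f n" "\<And>n. f n < int (CARD('p::prime_card)) ^ n"
    "\<And>n. f (Suc n) mod int (CARD('p::prime_card)) ^ n = f n"
  shows "\<exists>x :: 'p::prime_card zp. \<forall>n. Rep_zp x n = f n"
proof (intro exI allI)
  show "Rep_zp (Abs_zp f :: 'p zp) n = f n" for n
    using assms by (subst Abs_zp_inverse) simp_all
qed

lemma zp_dvd_pow_iff:
  fixes x :: "'p::prime_card zp"
  shows "of_nat (CARD('p)) ^ n dvd x \<longleftrightarrow> Rep_zp x n = 0"
proof
  let ?p = "int (CARD('p))"
  have p: "0 < ?p" by (simp add: prime_gt_0_nat[OF prime_card])
  assume "of_nat (CARD('p)) ^ n dvd x"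
  then obtain y where "x = of_nat (CARD('p)) ^ n * y" by (auto elim: dvdE)
  then show "Rep_zp x n = 0"
    by (simp add: times_zp.rep_eq Rep_zp_of_nat Rep_zp_power mod_simps)
next
  let ?p = "int (CARD('p))"
  have p: "0 < ?p" by (simp add: prime_gt_0_nat[OF prime_card])
  assume 0: "Rep_zp x n = 0"
  have dv: "?p ^ n dvd Rep_zp x (n + m)" for m
    using Rep_zp_props(3)[of x n m] 0 by (simp add: dvd_eq_mod_eq_0)
  \<comment> \<open>Dividing by \<open>p^n\<close> lowers the precision: the residue of the quotient
    modulo \<open>p^m\<close> is determined by that of \<open>x\<close> modulo
    \<open>p^(n+m)\<close>.\<close>
  define f where "f m = Rep_zp x (n + m) div ?p ^ n" for m
  have f0: "0 \<le> f m" for m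
    unfolding f_def using Rep_zp_props(1)[of x "n + m"] p by (simp add: pos_imp_zdiv_nonneg_iff)
  have f1: "f m < ?p ^ m" for m
    unfolding f_def using Rep_zp_props(2)[of x "n + m"] p
    by (metis dv dvd_mult_div_cancel mult_less_cancel_left_pos power_add zero_less_power)
  have f2: "f (Suc m) mod ?p ^ m = f m" for m
  proof -
    have "(?p ^ n * f (Suc m)) mod (?p ^ n * ?p ^ m) = ?p ^ n * f m"
      using Rep_zp_props(3)[of x "n + m" 1] dv[of m] dv[of "Suc m"]
      by (simp add: f_def power_add dvd_mult_div_cancel)
    then have eq: "?p ^ n * (f (Suc m) mod ?p ^ m) = ?p ^ n * f m"
      by (simp only: mult_mod_right)
    have "?p ^ n \<noteq> 0" using p by simp
    from iffD1[OF mult_left_cancel[OF this] eq] show ?thesis .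
  qed
  obtain y :: "'p zp" where y: "\<And>m. Rep_zp y m = f m"
    using zp_exists[OF f0 f1 f2] by blast
  have "x = of_nat (CARD('p)) ^ n * y"
  proof (rule zp_eqI)
    fix m
    have "Rep_zp (of_nat (CARD('p)) ^ n * y) m = (?p ^ n * f m) mod ?p ^ m"
      by (simp add: times_zp.rep_eq Rep_zp_of_nat Rep_zp_power mod_simps y)
    also have "\<dots> = Rep_zp x (n + m) mod ?p ^ m"
      using dv by (simp add: f_def)
    also have "\<dots> = Rep_zp x m"
      using Rep_zp_props(3)[of x m n] by (simp add: add.commute)
    finally show "Rep_zp x m = Rep_zp (of_nat (CARD('p)) ^ n * y) m" by simp
  qed
  then show "of_nat (CARD('p)) ^ n dvd x" by simp
qed

lemma zp_p_dvd_iff: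
  fixes x :: "'p::prime_card zp"
  shows "of_nat (CARD('p)) dvd x \<longleftrightarrow> Rep_zp x 1 = 0"
  using zp_dvd_pow_iff[of 1 x] by simp

lemma zp_p_nonzero: "of_nat (CARD('p::prime_card)) \<noteq> (0 :: 'p zp)"
proof
  assume 0: "of_nat (CARD('p)) = (0 :: 'p zp)"
  \<comment> \<open>Modulo \<open>p\<close> the element vanishes, so level 2 is the first at which
    it can be told from 0.\<close>
  have "Rep_zp (of_nat (CARD('p)) :: 'p zp) 2 = Rep_zp (0 :: 'p zp) 2" using 0 by simp
  moreover have "int (CARD('p)) < int (CARD('p)) ^ 2"
    using prime_gt_1_nat[OF prime_card[where ?'a = 'p]] by (simp add: power2_eq_square)
  ultimately show False by (simp add: Rep_zp_of_nat zero_zp.rep_eq)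
qed

lemma zp_unit_iff:
  fixes x :: "'p::prime_card zp"
  shows "x dvd 1 \<longleftrightarrow> Rep_zp x 1 \<noteq> 0"
proof
  let ?p = "int (CARD('p))"
  have p1: "1 < ?p" using prime_gt_1_nat[OF prime_card[where ?'a = 'p]] by simp
  assume "x dvd 1"
  then obtain y where y: "1 = x * y" by (auto elim: dvdE)
  have "Rep_zp (1 :: 'p zp) 1 = 1" using p1 by (simp add: one_zp.rep_eq)
  then have "(Rep_zp x 1 * Rep_zp y 1) mod ?p = 1" by (subst (asm) y) (simp add: times_zp.rep_eq)
  then show "Rep_zp x 1 \<noteq> 0" by auto
next
  let ?p = "int (CARD('p))"
  have p1: "1 < ?p" using prime_gt_1_nat[OF prime_card[where ?'a = 'p]] by simp
  assume nz: "Rep_zp x 1 \<noteq> 0"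
  have cop: "coprime (Rep_zp x n) (?p ^ n)" for n
  proof (cases n)
    case (Suc k)
    have "Rep_zp x n mod ?p = Rep_zp x 1"
      using Rep_zp_props(3)[of x 1 k] Suc by simp
    then have "\<not> ?p dvd Rep_zp x n" using nz by auto
    then show ?thesis
      using prime_imp_coprime[of ?p "Rep_zp x n"] prime_card[where ?'a = 'p]
      by (simp add: coprime_commute)
  qed simp
  have ex: "\<exists>y. 0 \<le> y \<and> y < ?p ^ n \<and> (Rep_zp x n * y) mod ?p ^ n = 1 mod ?p ^ n" for n
  proof -
    obtain y where "[Rep_zp x n * y = 1] (mod ?p ^ n)"
      using cong_solve_coprime_int[OF cop[of n]] by blast
    then have "(Rep_zp x n * (y mod ?p ^ n)) mod ?p ^ n = 1 mod ?p ^ n"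
      by (simp add: cong_def mod_simps)
    then show ?thesis using p1 by (intro exI[of _ "y mod ?p ^ n"]) simp
  qed
  define g where "g n = (SOME y. 0 \<le> y \<and> y < ?p ^ n \<and> (Rep_zp x n * y) mod ?p ^ n = 1 mod ?p ^ n)" for n
  have g: "0 \<le> g n \<and> g n < ?p ^ n \<and> (Rep_zp x n * g n) mod ?p ^ n = 1 mod ?p ^ n" for n
    unfolding g_def by (rule someI_ex[OF ex])
  \<comment> \<open>The inverses are chosen independently at each level. They are compatible because
    an inverse modulo \<open>p^n\<close> is unique in the range below \<open>p^n\<close>.\<close>
  have "g (Suc n) mod ?p ^ n = g n" for n
  proof -
    have "(Rep_zp x (Suc n) * g (Suc n)) mod ?p ^ n = 1 mod ?p ^ n"
      using g[of "Suc n"] by (metis mod_mult_cancel(2) power_Suc)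
    then have "(Rep_zp x n * g (Suc n)) mod ?p ^ n = 1 mod ?p ^ n"
      using Rep_zp_props(3)[of x n 1] by (metis add.commute mod_mult_left_eq plus_1_eq_Suc)
    then have "[Rep_zp x n * g (Suc n) = Rep_zp x n * g n] (mod ?p ^ n)"
      using g[of n] by (simp add: cong_def)
    then have "[g (Suc n) = g n] (mod ?p ^ n)"
      using cong_mult_lcancel cop by blast
    then show ?thesis using g[of n] by (simp add: cong_def)
  qed
  then obtain y :: "'p zp" where y: "\<And>n. Rep_zp y n = g n"
    using zp_exists[where ?'p = 'p, of g] g by blast
  have "x * y = 1"
    by (rule zp_eqI) (simp add: times_zp.rep_eq one_zp.rep_eq y g)
  then show "x dvd 1" by (metis dvd_triv_left)
qed

lemma zp_decomp:
  fixes x :: "'p::prime_card zp"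
  assumes "x \<noteq> 0"
  obtains n u where "u dvd 1" "x = of_nat (CARD('p)) ^ n * u"
proof -
  obtain m where m: "Rep_zp x m \<noteq> 0"
    using assms by (metis zero_zp.rep_eq zp_eqI)
  \<comment> \<open>The exact power of \<open>p\<close> dividing \<open>x\<close> is one less than
    the first level at which \<open>x\<close> is nonzero; that level is positive since every residue
    at level 0 is 0.\<close>
  define k where "k = (LEAST m. Rep_zp x m \<noteq> 0)"
  have k: "Rep_zp x k \<noteq> 0" unfolding k_def using m by (rule LeastI)
  then obtain n where n: "k = Suc n" by (metis Rep_zp_0 not0_implies_Suc)
  have "Rep_zp x n = 0" using not_less_Least[of n "\<lambda>m. Rep_zp x m \<noteq> 0"] n k_def by auto
  then obtain u where u: "x = of_nat (CARD('p)) ^ n * u"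
    using zp_dvd_pow_iff[of n x] by (auto elim: dvdE)
  have "\<not> of_nat (CARD('p)) dvd u"
  proof
    assume "of_nat (CARD('p)) dvd u"
    then have "of_nat (CARD('p)) ^ Suc n dvd x" using u by (auto elim!: dvdE)
    then show False using k n zp_dvd_pow_iff[of "Suc n" x] by simp
  qed
  then have "u dvd 1" using zp_unit_iff zp_p_dvd_iff by blast
  then show ?thesis using that u by blast
qed

section \<open>Reduction modulo \<open>p\<close>\<close>

lemma of_int_mod_ring_eq_0: "(of_int k :: 'p::prime_card mod_ring) = 0 \<longleftrightarrow> int (CARD('p)) dvd k"
proof -
  have "(of_int k :: 'p mod_ring) = 0 \<longleftrightarrow> [k = 0] (mod int (CARD('p)))"
    by (simp add: of_int_eq_iff_cong_CHAR[of k 0, simplified])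
  then show ?thesis by (simp add: cong_0_iff)
qed

lemma of_int_mod_ring_mod: "(of_int (k mod int (CARD('p))) :: 'p::prime_card mod_ring) = of_int k"
  using of_int_mod_ring_eq_0[where ?'p = 'p, of "k mod int (CARD('p)) - k"]
  by (simp add: mod_eq_dvd_iff[symmetric])

lemma red_add [simp]: "red (x + y) = red x + red y"
  by (simp add: red_def plus_zp.rep_eq of_int_mod_ring_mod flip: to_ac_add of_int_add del: to_ac_of_int)

lemma red_mult [simp]: "red (x * y) = red x * red y"
  by (simp add: red_def times_zp.rep_eq of_int_mod_ring_mod flip: to_ac_mult of_int_mult del: to_ac_of_int)

lemma red_0 [simp]: "red 0 = 0"
  by (simp add: red_def zero_zp.rep_eq)

lemma red_1 [simp]: "red 1 = 1"
  using of_int_mod_ring_mod[where ?'p = 'a, of 1] by (simp add: red_def one_zp.rep_eq del: to_ac_of_int)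

lemma red_minus [simp]: "red (- x) = - red x"
  using red_add[of x "- x"] by (simp add: eq_neg_iff_add_eq_0 add.commute del: red_add)

lemma red_diff [simp]: "red (x - y) = red x - red y"
  using red_add[of x "- y"] by simp

lemma red_power [simp]: "red (x ^ n) = red x ^ n"
  by (induction n) simp_all

lemma red_eq_0_iff: "red x = 0 \<longleftrightarrow> Rep_zp x 1 = 0"
proof -
  have "red x = 0 \<longleftrightarrow> int (CARD('a)) dvd Rep_zp x 1"
    by (simp add: red_def of_int_mod_ring_eq_0 del: to_ac_of_int)
  then show ?thesis using Rep_zp_props(1,2)[of x 1]
    by (auto simp: zdvd_not_zless dest: zdvd_imp_le)
qed

lemma red_eq_0_iff_dvd: "red x = 0 \<longleftrightarrow> of_nat (CARD('p)) dvd (x :: 'p::prime_card zp)"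
  by (simp add: red_eq_0_iff zp_p_dvd_iff)

lemma zp_unit_iff_red: "x dvd 1 \<longleftrightarrow> red x \<noteq> 0"
  by (simp add: red_eq_0_iff zp_unit_iff)

lemma red_p [simp]: "red (of_nat (CARD('p)) :: 'p::prime_card zp) = 0"
  by (simp add: red_eq_0_iff_dvd)

section \<open>Fermat's little theorem and Teichmueller representatives\<close>

lemma red_in_range: "red x \<in> range to_ac"
  by (simp add: red_def del: to_ac_of_int)

lemma to_ac_fermat: "(to_ac (x :: 'p::prime_card mod_ring)) ^ CARD('p) = to_ac x"
  using finite_field_power_card_eq_same[of x] by (simp flip: to_ac_power)

lemma red_fermat: "red (x :: 'p::prime_card zp) ^ CARD('p) = red x"
  using red_in_range[of x] to_ac_fermat by auto

text \<open>The cofactor of \<open>a - b\<close> in \<open>a^n - b^n\<close> is a sum of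
  \<open>n\<close> terms, each congruent to \<open>b^(n-1)\<close> modulo \<open>q\<close>, so it is
  congruent to \<open>n b^(n-1) = q b^(n-1)\<close> and contributes one further factor
  \<open>q\<close>. Existence and uniqueness of Teichmueller representatives both rest on this
  gain.\<close>

lemma power_prime_dvd_diff:
  fixes a b q :: "'a::comm_ring_1"
  assumes "q ^ Suc k dvd a - b" "q = of_nat n"
  shows "q ^ Suc (Suc k) dvd a ^ n - b ^ n"
proof -
  let ?S = "\<Sum>i<n. b ^ (n - Suc i) * a ^ i"
  have q: "q dvd a - b" using assms(1) by (metis dvd_mult_left power_Suc)
  have "q dvd b ^ (n - Suc i) * a ^ i - b ^ (n - 1)" if "i < n" for i
  proof -
    have "b ^ (n - 1) = b ^ (n - Suc i) * b ^ i" using that by (simp flip: power_add)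
    then have "b ^ (n - Suc i) * a ^ i - b ^ (n - 1) = b ^ (n - Suc i) * (a ^ i - b ^ i)"
      by (simp add: algebra_simps)
    also have "(a - b) dvd \<dots>"
      by (simp add: power_diff_sumr2[of a i b])
    finally show ?thesis using q by (metis dvd_trans)
  qed
  then have "q dvd (\<Sum>i<n. b ^ (n - Suc i) * a ^ i - b ^ (n - 1))"
    by (intro dvd_sum) auto
  then have "q dvd ?S - q * b ^ (n - 1)"
    by (simp add: sum_subtractf assms(2))
  then have "q dvd ?S" by (metis dvd_diff_left_iff dvd_triv_left)
  then have "q ^ Suc k * q dvd (a - b) * ?S" using assms(1) by (intro mult_dvd_mono)
  then show ?thesis by (simp add: power_diff_sumr2[of a n b] mult.commute)
qed

lemma Rep_zp_eq_iff_dvd: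
  fixes x y :: "'p::prime_card zp"
  shows "Rep_zp x n = Rep_zp y n \<longleftrightarrow> of_nat (CARD('p)) ^ n dvd x - y"
proof -
  have "Rep_zp (x - y) n = 0 \<longleftrightarrow> Rep_zp x n mod int (CARD('p)) ^ n = Rep_zp y n mod int (CARD('p)) ^ n"
    by (simp only: minus_zp.rep_eq mod_eq_dvd_iff) (simp add: dvd_eq_mod_eq_0)
  then show ?thesis by (simp add: zp_dvd_pow_iff)
qed

text \<open>The representative is the limit of \<open>x^(p^n)\<close> for a lift \<open>x\<close> of
  \<open>c\<close>: consecutive terms agree modulo \<open>p^(n+1)\<close>, so the residue modulo
  \<open>p^n\<close> can be taken from the \<open>n\<close>-th term.\<close>

lemma teich_exists:
  fixes c :: "'p::prime_card mod_ring"
  obtains t :: "'p zp" where "t ^ CARD('p) = t" "red t = to_ac c"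
proof -
  let ?p = "CARD('p)"
  obtain i where i: "c = of_nat i" using surj_of_nat_mod_ring by blast
  define x :: "'p zp" where "x = of_nat i"
  have rx: "red x = to_ac c"
    by (simp add: red_def x_def Rep_zp_of_nat of_int_mod_ring_mod i del: to_ac_of_int to_ac_of_nat)
  have "of_nat ?p ^ Suc n dvd x ^ (?p ^ Suc n) - x ^ (?p ^ n)" for n
  proof (induction n)
    case 0
    then show ?case by (simp add: red_fermat flip: red_eq_0_iff_dvd)
  next
    case (Suc n)
    have "of_nat ?p ^ Suc (Suc n) dvd (x ^ (?p ^ Suc n)) ^ ?p - (x ^ (?p ^ n)) ^ ?p"
      by (rule power_prime_dvd_diff[OF Suc refl])
    then show ?case by (simp flip: power_mult add: mult.commute)
  qed
  then have eqn: "Rep_zp (x ^ (?p ^ Suc n)) m = Rep_zp (x ^ (?p ^ n)) m" if "m \<le> Suc n" for m n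
    unfolding Rep_zp_eq_iff_dvd using that by (meson dvd_trans le_imp_power_dvd)
  have "Rep_zp (x ^ ?p ^ Suc n) (Suc n) mod int ?p ^ n = Rep_zp (x ^ ?p ^ n) n" for n
    using Rep_zp_props(3)[of "x ^ ?p ^ Suc n" n 1] eqn[of n n] by simp
  then obtain t :: "'p zp" where t: "\<And>n. Rep_zp t n = Rep_zp (x ^ (?p ^ n)) n"
    using zp_exists[where ?'p = 'p, of "\<lambda>n. Rep_zp (x ^ (?p ^ n)) n"] Rep_zp_props(1,2) by metis
  have "t ^ ?p = t"
  proof (rule zp_eqI)
    fix n
    have "Rep_zp (t ^ ?p) n = Rep_zp ((x ^ (?p ^ n)) ^ ?p) n"
      by (simp add: Rep_zp_power t)
    also have "\<dots> = Rep_zp t n"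
      using eqn[of n n] by (simp add: t mult.commute flip: power_mult)
    finally show "Rep_zp (t ^ ?p) n = Rep_zp t n" .
  qed
  moreover have "red t = red (x ^ ?p)"
    by (simp add: red_def t)
  then have "red t = to_ac c"
    using rx red_fermat[of x] by simp
  ultimately show ?thesis using that by blast
qed

text \<open>Taking \<open>p\<close>-th powers improves a congruence modulo \<open>p^(n+1)\<close>
  between fixed points of the \<open>p\<close>-th power map to one modulo \<open>p^(n+2)\<close>.
  This legitimates the \<open>THE\<close> in \<open>teich\<close>.\<close>

lemma teich_unique:
  fixes s t :: "'p::prime_card zp"
  assumes "s ^ CARD('p) = s" "t ^ CARD('p) = t" "red s = red t"
  shows "s = t"
proof -
  have dv: "of_nat (CARD('p)) ^ Suc n dvd s - t" for n
  proof (induction n)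
    case 0
    then show ?case using assms(3) by (simp flip: red_eq_0_iff_dvd)
  next
    case (Suc n)
    then show ?case using power_prime_dvd_diff[OF Suc refl] assms by simp
  qed
  show ?thesis
  proof (rule zp_eqI)
    fix n show "Rep_zp s n = Rep_zp t n"
      using dv[of n] by (meson Rep_zp_eq_iff_dvd dvd_trans le_imp_power_dvd le_SucI order_refl)
  qed
qed

lemma red_teich [simp]: "red (teich c) = to_ac c"
proof -
  obtain t where t: "t ^ CARD('a) = t" "red t = to_ac c" by (rule teich_exists)
  have "teich c = t"
    unfolding teich_def using t by (intro the_equality) (auto intro: teich_unique)
  then show ?thesis using t(2) by simp
qed

lemma inj_teich: "inj teich"
  by (rule injI) (metis red_teich to_ac_eq_iff)

lemma finite_teich_reps: "finite (teich_reps :: 'p::prime_card zp set)"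
  by (simp add: teich_reps_def)

section \<open>The embedding of \<open>Z_p\<close> in \<open>Q_p\<close> and the factorization
  \<open>p^n u\<close>\<close>

lemma of_zp_minus: "of_zp (- x) = - of_zp x"
  using of_zp_add[of x "- x"] by (simp add: of_zp_0 eq_neg_iff_add_eq_0 add.commute)

lemma of_zp_diff: "of_zp (x - y) = of_zp x - of_zp y"
  using of_zp_add[of x "- y"] by (simp add: of_zp_minus)

lemma of_zp_power: "of_zp (x ^ n) = of_zp x ^ n"
  by (induction n) (simp_all add: of_zp_1 of_zp_mult)

lemma of_zp_eq_0_iff: "of_zp x = 0 \<longleftrightarrow> x = 0"
  using of_zp_inject[of x 0] by (simp add: of_zp_0)

lemma qp_p_nonzero [simp]: "of_nat (CARD('p::prime_card)) \<noteq> (0 :: 'p qp)"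
  using zp_p_nonzero[where ?'p = 'p] of_zp_eq_0_iff by (metis of_zp_of_nat)

lemma red_qp_of_zp [simp]: "red_qp (of_zp z) = red z"
proof -
  have "(THE y. of_zp y = of_zp z) = z" by (rule the_equality) (auto simp: of_zp_inject)
  then show ?thesis by (simp add: red_qp_def)
qed

lemma zp_unit_inverse:
  assumes "u dvd 1"
  obtains v where "v dvd 1" "u * v = 1" "inverse (of_zp u) = of_zp v"
proof -
  obtain v where v: "u * v = 1" using assms by (metis dvdE)
  then have "of_zp u * of_zp v = 1" by (metis of_zp_1 of_zp_mult)
  then have "inverse (of_zp u) = of_zp v" by (rule inverse_unique)
  moreover have "v dvd 1" using v by (metis dvd_triv_right)
  ultimately show ?thesis using that v by blast
qed

lemma qp_decomp:
  fixes x :: "'p::prime_card qp"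
  assumes "x \<noteq> 0"
  obtains n u where "u dvd 1" "x = of_nat (CARD('p)) powi n * of_zp u"
proof -
  let ?P = "of_nat (CARD('p)) :: 'p qp"
  obtain a b where ab: "Rep_qp x = Fract a b" "b \<noteq> 0" by (cases "Rep_qp x")
  have x: "x = of_zp a / of_zp b"
    using ab by (simp add: of_zp_def divide_qp_def Abs_qp_inverse) (metis Rep_qp_inverse)
  then have "a \<noteq> 0" using assms by (auto simp: of_zp_0)
  then obtain m u where u: "u dvd 1" "a = of_nat (CARD('p)) ^ m * u" by (rule zp_decomp)
  obtain k w where w: "w dvd 1" "b = of_nat (CARD('p)) ^ k * w" using ab(2) by (rule zp_decomp)
  obtain v where v: "v dvd 1" "w * v = 1" "inverse (of_zp w) = of_zp v" using zp_unit_inverse[OF w(1)] .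
  have "of_zp a = ?P powi int m * of_zp u" "of_zp b = ?P powi int k * of_zp w"
    using u w by (simp_all add: of_zp_mult of_zp_power of_zp_of_nat)
  then have "x = ?P powi (int m - int k) * of_zp (u * v)"
    using v(3) by (simp add: x of_zp_mult power_int_diff divide_inverse)
  moreover have "u * v dvd 1" using u(1) v(1) by (metis mult_1 mult_dvd_mono)
  ultimately show ?thesis using that by blast
qed

text \<open>A difference of exponents would make \<open>p\<close> divide a unit. This gives meaning
  to \<open>unit_part\<close> and, through determinants, to \<open>K_part\<close>.\<close>

lemma qp_decomp_unique:
  assumes "u dvd 1" "v dvd 1"
    "of_nat (CARD('p::prime_card)) powi m * of_zp u = (of_nat (CARD('p)) powi n * of_zp v :: 'p qp)"
  shows "m = n \<and> u = v"
proof -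
  let ?P = "of_nat (CARD('p)) :: 'p qp"
  have *: "m = n \<and> u = v" if "m \<le> n" "u dvd 1" "v dvd 1" "?P powi m * of_zp u = ?P powi n * of_zp v"
    for m n and u v :: "'p zp"
  proof -
    define k where "k = nat (n - m)"
    have n: "n = m + int k" using that(1) by (simp add: k_def)
    have "?P powi m * of_zp u = ?P powi m * (?P ^ k * of_zp v)"
      using that(4) by (simp add: n power_int_add)
    then have "of_zp u = of_zp (of_nat (CARD('p)) ^ k * v)"
      by (simp add: of_zp_mult of_zp_power of_zp_of_nat)
    then have u: "u = of_nat (CARD('p)) ^ k * v" by (simp only: of_zp_inject)
    have "k = 0"
    proof (rule ccontr)
      assume "k \<noteq> 0"
      then have "red u = 0" by (simp add: u)
      then show False using that(2) zp_unit_iff_red by blast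
    qed
    then show ?thesis using u n by simp
  qed
  show ?thesis
  proof (cases "m \<le> n")
    case True then show ?thesis using * assms by blast
  next
    case False then show ?thesis using *[of n m v u] assms by simp
  qed
qed

lemma unit_part_eq:
  assumes "u dvd 1"
  shows "unit_part (of_nat (CARD('p::prime_card)) powi n * of_zp u :: 'p qp) = u"
  unfolding unit_part_def using assms qp_decomp_unique by (intro the_equality) blast+

lemma unit_part_mult:
  fixes x y :: "'p::prime_card qp"
  assumes "x \<noteq> 0" "y \<noteq> 0"
  shows "unit_part (x * y) = unit_part x * unit_part y"
proof -
  obtain m u where u: "u dvd 1" "x = of_nat (CARD('p)) powi m * of_zp u" using qp_decomp[OF assms(1)] .
  obtain n v where v: "v dvd 1" "y = of_nat (CARD('p)) powi n * of_zp v" using qp_decomp[OF assms(2)] .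
  have "x * y = of_nat (CARD('p)) powi (m + n) * of_zp (u * v)"
    by (simp add: u v power_int_add of_zp_mult mult_ac)
  moreover have "u * v dvd 1" using u(1) v(1) by (metis mult_1 mult_dvd_mono)
  ultimately show ?thesis using unit_part_eq u v by metis
qed

section \<open>Power sums over \<open>F_p\<close>\<close>

lemma sum_to_ac_power_less:
  assumes "i < CARD('p) - 1"
  shows "(\<Sum>t\<in>(UNIV :: 'p::prime_card mod_ring set). to_ac t ^ i) = 0"
proof (cases "i = 0")
  case True
  \<comment> \<open>Since \<open>0^0\<close> counts as 1, the sum is \<open>p\<close>.\<close>
  have "(of_nat (CARD('p)) :: 'p mod_ring) = 0" by simp
  then have "(of_nat (CARD('p)) :: 'p fpbar) = 0" by (metis to_ac_0 to_ac_of_nat)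
  then show ?thesis using True by simp
next
  case False
  \<comment> \<open>The polynomial \<open>t^i - 1\<close> has at most \<open>i < p - 1\<close>
    roots, so some nonzero \<open>g\<close> has \<open>g^i \<noteq> 1\<close>. Multiplication by
    \<open>g\<close> permutes \<open>F_p\<close> and multiplies the sum by
    \<open>g^i\<close>.\<close>
  define f :: "'p mod_ring poly" where "f = Polynomial.monom 1 i + [:-1:]"
  have df: "Polynomial.degree f = i"
    unfolding f_def using False by (subst degree_add_eq_left) (simp_all add: degree_monom_eq)
  then have f0: "f \<noteq> 0" using False by auto
  have "card {x. poly f x = 0} \<le> i" using card_poly_roots_bound[OF f0] df by simp
  moreover have "card (UNIV - {0 :: 'p mod_ring}) = CARD('p) - 1" by simp
  moreover have "card (UNIV - {0 :: 'p mod_ring}) \<le> card {x. poly f x = 0}"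
    if "UNIV - {0} \<subseteq> {x. poly f x = 0}"
    by (rule card_mono[OF poly_roots_finite[OF f0] that])
  ultimately have "\<not> UNIV - {0} \<subseteq> {x. poly f x = 0}"
    using assms by linarith
  then obtain g where g: "g \<noteq> 0" "poly f g \<noteq> 0" by blast
  have gi: "g ^ i \<noteq> 1" using g(2) by (simp add: f_def poly_monom)
  let ?S = "\<Sum>t\<in>(UNIV :: 'p mod_ring set). t ^ i"
  have "bij_betw ((*) g) UNIV (UNIV :: 'p mod_ring set)"
    using g(1) by (intro bij_betwI[where g = "\<lambda>x. x / g"]) auto
  then have "?S = (\<Sum>t\<in>UNIV. (g * t) ^ i)"
    by (rule sum.reindex_bij_betw[symmetric])
  also have "\<dots> = g ^ i * ?S" by (simp add: power_mult_distrib sum_distrib_left)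
  finally have "(g ^ i - 1) * ?S = 0" by (simp add: algebra_simps)
  then have "?S = 0" using gi by simp
  then have "to_ac ?S = 0" by simp
  then show ?thesis by (simp add: to_ac_sum)
qed

lemma sum_to_ac_power_last:
  "(\<Sum>t\<in>(UNIV :: 'p::prime_card mod_ring set). to_ac t ^ (CARD('p) - 1)) = -1"
proof -
  have one: "t ^ (CARD('p) - 1) = 1" if "t \<noteq> 0" for t :: "'p mod_ring"
  proof -
    have "t * t ^ (CARD('p) - 1) = t * 1"
      using finite_field_power_card_eq_same[of t] prime_gt_0_nat[OF prime_card[where ?'a = 'p]]
      by (simp flip: power_Suc)
    then show ?thesis using that by simp
  qed
  have p1: "CARD('p) > 1" using prime_gt_1_nat[OF prime_card] .
  have "(\<Sum>t\<in>(UNIV :: 'p mod_ring set). t ^ (CARD('p) - 1)) = (\<Sum>t\<in>UNIV - {0}. t ^ (CARD('p) - 1))"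
    using p1 by (intro sum.mono_neutral_right) auto
  also have "\<dots> = of_nat (CARD('p) - 1)"
    using one by simp
  also have "\<dots> = -1" using p1 by (simp add: of_nat_diff)
  finally have "to_ac (\<Sum>t\<in>(UNIV :: 'p mod_ring set). t ^ (CARD('p) - 1)) = to_ac (-1)" by simp
  then show ?thesis by (simp add: to_ac_sum)
qed

text \<open>Since \<open>t^p = t\<close>, the exponent can be lowered by \<open>p - 1\<close> and
  lands strictly between 0 and \<open>p - 1\<close>. The upper bound is sharp: for
  \<open>2 (p - 1)\<close> the sum is \<open>-1\<close> again.\<close>

lemma sum_to_ac_power_between:
  assumes "CARD('p) - 1 < i" "i < 2 * (CARD('p) - 1)"
  shows "(\<Sum>t\<in>(UNIV :: 'p::prime_card mod_ring set). to_ac t ^ i) = 0"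
proof -
  define j where "j = i - CARD('p)"
  have i: "i = CARD('p) + j" using assms(1) by (simp add: j_def)
  have "(\<Sum>t\<in>(UNIV :: 'p mod_ring set). to_ac t ^ i) = (\<Sum>t\<in>UNIV. to_ac t ^ Suc j)"
    by (simp only: i power_add to_ac_fermat power_Suc)
  also have "\<dots> = 0" using assms i by (intro sum_to_ac_power_less) simp
  finally show ?thesis .
qed

no_notation fps_nth (infixl \<open>$\<close> 75)

section \<open>Matrices over $Q_p$ and compactness modulo the center\<close>

lemma mat2_nth [simp]:
  "mat2 a b c d $ 1 $ 1 = a" "mat2 a b c d $ 1 $ 2 = b"
  "mat2 a b c d $ 2 $ 1 = c" "mat2 a b c d $ 2 $ 2 = d"
  by (simp_all add: mat2_def vector_2)

lemma mat2_eqI: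
  fixes A B :: "'a::zero^2^2"
  assumes "A $ 1 $ 1 = B $ 1 $ 1" "A $ 1 $ 2 = B $ 1 $ 2" "A $ 2 $ 1 = B $ 2 $ 1" "A $ 2 $ 2 = B $ 2 $ 2"
  shows "A = B"
  using assms by (simp add: vec_eq_iff forall_2)

lemma mat2_expand: "A = mat2 (A $ 1 $ 1) (A $ 1 $ 2) (A $ 2 $ 1) (A $ 2 $ 2)"
  by (rule mat2_eqI) simp_all

lemma mat2_eq_iff [simp]: "mat2 a b c d = mat2 a' b' c' d' \<longleftrightarrow> a = a' \<and> b = b' \<and> c = c' \<and> d = d'"
  by (metis mat2_nth)

lemma mat2_mult:
  fixes a :: "'a::comm_semiring_1"
  shows "mat2 a b c d ** mat2 a' b' c' d' = mat2 (a*a'+b*c') (a*b'+b*d') (c*a'+d*c') (c*b'+d*d')"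
  by (rule mat2_eqI) (simp_all add: matrix_matrix_mult_def sum_2)

lemma mat_mat2: "mat z = mat2 z 0 0 z"
  by (rule mat2_eqI) (simp_all add: mat_def)

lemma matrix_add_right2:
  fixes A B C :: "'a::comm_semiring_1^2^2"
  shows "(A + B) ** C = A ** C + B ** C"
  by (rule mat2_eqI) (simp_all add: matrix_matrix_mult_def sum_2 algebra_simps)

lemma det_mat2: "det (mat2 a b c d) = a * d - b * (c :: 'a::comm_ring_1)"
  by (simp add: det_2)

lemma map_matrix_mat2: "map_matrix f (mat2 a b c d) = mat2 (f a) (f b) (f c) (f d)"
  by (rule mat2_eqI) (simp_all add: map_matrix_def)

lemma mat_commute:
  fixes A :: "'a::comm_semiring_1^2^2"
  shows "mat z ** A = A ** mat z"
  by (subst (1 2) mat2_expand[of A]) (simp add: mat_mat2 mat2_mult mult.commute)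

lemma mat_mult_mat: "mat y ** mat z = (mat (y * z) :: 'a::comm_semiring_1^2^2)"
  by (simp add: mat_mat2 mat2_mult)

lemma mat2_GL2_iff: "mat2 a b c d \<in> GL2 \<longleftrightarrow> a * d - b * c \<noteq> 0"
  by (simp add: GL2_def invertible_det_nz det_mat2)

lemma GL2_iff_det: "g \<in> GL2 \<longleftrightarrow> det g \<noteq> 0"
  by (simp add: GL2_def invertible_det_nz)

lemma GL2_one [simp]: "mat 1 \<in> GL2"
  by (simp add: mat_mat2 mat2_GL2_iff)

lemma GL2_mult [simp]: "g \<in> GL2 \<Longrightarrow> h \<in> GL2 \<Longrightarrow> g ** h \<in> GL2"
  by (simp add: GL2_iff_det det_mul)

lemma GL2_inv:
  assumes "g \<in> GL2"
  shows "matrix_inv g \<in> GL2" "g ** matrix_inv g = mat 1" "matrix_inv g ** g = mat 1"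
proof -
  have "\<exists>A'. g ** A' = mat 1 \<and> A' ** g = mat 1" using assms by (simp add: GL2_def invertible_def)
  then have *: "g ** matrix_inv g = mat 1 \<and> matrix_inv g ** g = mat 1"
    unfolding matrix_inv_def by (rule someI_ex)
  then show "g ** matrix_inv g = mat 1" "matrix_inv g ** g = mat 1" by auto
  then show "matrix_inv g \<in> GL2" unfolding GL2_def invertible_def by blast
qed

lemma GL2_inv_cancel [simp]:
  assumes "g \<in> GL2"
  shows "x ** g ** matrix_inv g = x" "x ** matrix_inv g ** g = x"
    "g ** (matrix_inv g ** y) = y" "matrix_inv g ** (g ** y) = y"
  using GL2_inv[OF assms] by (simp_all add: matrix_mul_assoc) (simp_all flip: matrix_mul_assoc)

lemma GL2_inv_unique: "g ** h = mat 1 \<Longrightarrow> matrix_inv g = h" if "g \<in> GL2"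
  using GL2_inv_cancel(4)[OF that, of h] by simp

lemma GL2_inv_mult:
  assumes "g \<in> GL2" "h \<in> GL2"
  shows "matrix_inv (g ** h) = matrix_inv h ** matrix_inv g"
proof -
  have "g ** h ** (matrix_inv h ** matrix_inv g) = g ** (h ** (matrix_inv h ** matrix_inv g))"
    by (simp only: matrix_mul_assoc)
  also have "\<dots> = mat 1" using assms by (simp add: GL2_inv)
  finally show ?thesis using assms by (intro GL2_inv_unique) simp_all
qed

lemma mat_GL2 [simp]: "mat z \<in> GL2 \<longleftrightarrow> z \<noteq> 0"
  by (simp add: mat_mat2 mat2_GL2_iff)

section \<open>Integral matrices, \<open>GL2_Zp\<close> and \<open>Iwahori\<close>\<close>

definition zmat :: "'p::prime_card zp \<Rightarrow> 'p zp \<Rightarrow> 'p zp \<Rightarrow> 'p zp \<Rightarrow> 'p mat2" where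
  "zmat a b c d = mat2 (of_zp a) (of_zp b) (of_zp c) (of_zp d)"

lemma zmat_nth [simp]:
  "zmat a b c d $ 1 $ 1 = of_zp a" "zmat a b c d $ 1 $ 2 = of_zp b"
  "zmat a b c d $ 2 $ 1 = of_zp c" "zmat a b c d $ 2 $ 2 = of_zp d"
  by (simp_all add: zmat_def)

lemma zmat_mult:
  "zmat a b c d ** zmat a' b' c' d' = zmat (a*a'+b*c') (a*b'+b*d') (c*a'+d*c') (c*b'+d*d')"
  by (simp add: zmat_def mat2_mult of_zp_add of_zp_mult)

lemma zmat_one: "zmat 1 0 0 1 = mat 1"
  by (simp add: zmat_def mat_mat2 of_zp_0 of_zp_1)

lemma zmat_eq_iff [simp]: "zmat a b c d = zmat a' b' c' d' \<longleftrightarrow> a = a' \<and> b = b' \<and> c = c' \<and> d = d'"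
  by (simp add: zmat_def of_zp_inject)

lemma det_zmat: "det (zmat a b c d) = of_zp (a * d - b * c)"
  by (simp add: zmat_def det_mat2 of_zp_diff of_zp_mult)

lemma mat2_unit_inverse:
  assumes "(a * d - b * c) * v = (1 :: 'a::comm_ring_1)"
  shows "mat2 a b c d ** mat2 (d * v) (-b * v) (-c * v) (a * v) = mat 1"
    "mat2 (d * v) (-b * v) (-c * v) (a * v) ** mat2 a b c d = mat 1"
  using assms by (simp_all add: mat_mat2 mat2_mult algebra_simps)

lemma invertible_mat2_iff: "invertible (mat2 a b c d) \<longleftrightarrow> (a * d - b * c) dvd (1 :: 'a::comm_ring_1)"
proof
  assume "invertible (mat2 a b c d)"
  then obtain B where "mat2 a b c d ** B = mat 1" by (auto simp: invertible_def)
  then have "det (mat2 a b c d) * det B = 1" by (metis det_I det_mul)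
  then show "(a * d - b * c) dvd 1" by (metis det_mat2 dvd_triv_left)
next
  assume "(a * d - b * c) dvd 1"
  then obtain v where "(a * d - b * c) * v = 1" by (metis dvdE)
  from mat2_unit_inverse[OF this] show "invertible (mat2 a b c d)"
    unfolding invertible_def by blast
qed

lemma zmat_map_matrix: "zmat a b c d = map_matrix of_zp (mat2 a b c d)"
  by (simp add: zmat_def map_matrix_mat2)

lemma map_matrix_zmat: "map_matrix of_zp A = zmat (A $ 1 $ 1) (A $ 1 $ 2) (A $ 2 $ 1) (A $ 2 $ 2)"
  by (subst (1) mat2_expand[of A]) (simp add: map_matrix_mat2 zmat_def)

lemma zmat_K_iff: "zmat a b c d \<in> GL2_Zp \<longleftrightarrow> (a * d - b * c) dvd 1"
proof
  assume "zmat a b c d \<in> GL2_Zp"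
  then obtain A where A: "invertible A" "zmat a b c d = map_matrix of_zp A"
    by (auto simp: GL2_Zp_def)
  then have "A = mat2 a b c d"
    unfolding map_matrix_zmat using mat2_expand[of A] by simp
  then show "(a * d - b * c) dvd 1" using A(1) invertible_mat2_iff by blast
next
  assume "(a * d - b * c) dvd 1"
  then show "zmat a b c d \<in> GL2_Zp"
    unfolding GL2_Zp_def zmat_map_matrix using invertible_mat2_iff by blast
qed

lemma K_cases:
  assumes "k \<in> GL2_Zp"
  obtains a b c d where "k = zmat a b c d" "(a * d - b * c) dvd 1"
proof -
  obtain A where A: "invertible A" "k = map_matrix of_zp A" using assms by (auto simp: GL2_Zp_def)
  show ?thesis
    using that[OF A(2)[unfolded map_matrix_zmat]] A(1) mat2_expand[of A] invertible_mat2_iff by metis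
qed

lemma zmat_I_iff: "zmat a b c d \<in> Iwahori \<longleftrightarrow> a dvd 1 \<and> d dvd 1 \<and> red c = 0"
  by (auto simp: Iwahori_def zmat_K_iff zp_unit_iff_red)

lemma I_cases:
  assumes "k \<in> Iwahori"
  obtains a b c d where "k = zmat a b c d" "a dvd 1" "d dvd 1" "red c = 0"
proof -
  have "k \<in> GL2_Zp" using assms by (simp add: Iwahori_def)
  then obtain a b c d where "k = zmat a b c d" by (rule K_cases)
  then show ?thesis using assms that zmat_I_iff by blast
qed

lemma K_GL2: "k \<in> GL2_Zp \<Longrightarrow> k \<in> GL2"
proof (erule K_cases)
  fix a b c d :: "'a zp" assume "k = zmat a b c d" "(a * d - b * c) dvd 1"
  then have "a * d - b * c \<noteq> 0" using zp_unit_iff_red by (metis red_0)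
  then show "k \<in> GL2" using \<open>k = zmat a b c d\<close> by (simp only: GL2_iff_det det_zmat of_zp_eq_0_iff) simp
qed

lemma I_sub_K: "k \<in> Iwahori \<Longrightarrow> k \<in> GL2_Zp"
  by (simp add: Iwahori_def)

lemma zp_unit_mult_iff: "(x * y :: 'p::prime_card zp) dvd 1 \<longleftrightarrow> x dvd 1 \<and> y dvd 1"
  by (simp add: zp_unit_iff_red)

lemma K_mult: "k \<in> GL2_Zp \<Longrightarrow> k' \<in> GL2_Zp \<Longrightarrow> k ** k' \<in> GL2_Zp"
proof (elim K_cases)
  fix a b c d a' b' c' d' :: "'a zp"
  assume "k = zmat a b c d" "k' = zmat a' b' c' d'" "(a * d - b * c) dvd 1" "(a' * d' - b' * c') dvd 1"
  moreover have "(a*a'+b*c') * (c*b'+d*d') - (a*b'+b*d') * (c*a'+d*c') = (a * d - b * c) * (a' * d' - b' * c')"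
    by (simp add: algebra_simps)
  ultimately show "k ** k' \<in> GL2_Zp" by (simp add: zmat_mult zmat_K_iff zp_unit_mult_iff)
qed

lemma I_mult: "k \<in> Iwahori \<Longrightarrow> k' \<in> Iwahori \<Longrightarrow> k ** k' \<in> Iwahori"
  by (elim I_cases) (auto simp: zmat_mult zmat_I_iff zp_unit_iff_red)

lemma zmat_inv:
  assumes "(a * d - b * c) * v = 1"
  shows "matrix_inv (zmat a b c d) = zmat (d * v) (-b * v) (-c * v) (a * v)"
proof (rule GL2_inv_unique)
  have "(a * d - b * c) dvd 1" using assms by (metis dvd_triv_left)
  then show "zmat a b c d \<in> GL2" by (intro K_GL2) (simp add: zmat_K_iff)
  show "zmat a b c d ** zmat (d * v) (-b * v) (-c * v) (a * v) = mat 1"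
    using assms by (simp add: zmat_mult algebra_simps flip: zmat_one)
qed

lemma K_inv: "k \<in> GL2_Zp \<Longrightarrow> matrix_inv k \<in> GL2_Zp"
proof (erule K_cases)
  fix a b c d :: "'a zp"
  assume k: "k = zmat a b c d" "(a * d - b * c) dvd 1"
  then obtain v where v: "(a * d - b * c) * v = 1" by (metis dvdE)
  have "(d * v) * (a * v) - (-b * v) * (-c * v) = (a * d - b * c) * v * v" by (simp add: algebra_simps)
  also have "\<dots> dvd 1" using v by (metis dvd_triv_right mult_1)
  finally show "matrix_inv k \<in> GL2_Zp" by (simp only: k zmat_inv[OF v] zmat_K_iff)
qed

lemma I_inv: "k \<in> Iwahori \<Longrightarrow> matrix_inv k \<in> Iwahori"
proof -
  assume kI: "k \<in> Iwahori"
  then obtain a b c d where k: "k = zmat a b c d" "a dvd 1" "d dvd 1" "red c = 0" by (rule I_cases)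
  have "(a * d - b * c) dvd 1" using kI k(1) I_sub_K zmat_K_iff by blast
  then obtain v where v: "(a * d - b * c) * v = 1" by (metis dvdE)
  then have "v dvd 1" by (metis dvd_triv_right)
  then show "matrix_inv k \<in> Iwahori"
    using k by (simp add: zmat_inv[OF v] zmat_I_iff zp_unit_mult_iff)
qed

lemma K_one [simp]: "mat 1 \<in> GL2_Zp" and I_one [simp]: "mat 1 \<in> Iwahori"
  by (simp_all add: zmat_K_iff zmat_I_iff flip: zmat_one)

section \<open>The groups \<open>KZ\<close> and \<open>IZ\<close>\<close>

abbreviation (input) ppow :: "int \<Rightarrow> 'p::prime_card mat2" where
  "ppow n \<equiv> mat (of_nat (CARD('p)) powi n)"

lemma unit_scalar: "u dvd 1 \<Longrightarrow> mat (of_zp u) \<in> Iwahori"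
  by (simp add: mat_mat2 zmat_I_iff flip: zmat_def of_zp_0)

text \<open>A nonzero scalar is \<open>p^n u\<close> with \<open>u\<close> a unit, and the scalar
  \<open>u\<close> is absorbed by \<open>K\<close> or \<open>I\<close>; of the center only the
  powers of \<open>p\<close> remain.\<close>

lemma KZ_iff: "g \<in> KZ \<longleftrightarrow> (\<exists>n k. k \<in> GL2_Zp \<and> g = ppow n ** k)"
  and IZ_iff: "g \<in> IZ \<longleftrightarrow> (\<exists>n k. k \<in> Iwahori \<and> g = ppow n ** k)" for g :: "'p::prime_card mat2"
proof -
  have *: "g \<in> times_center H \<longleftrightarrow> (\<exists>n k. k \<in> H \<and> g = ppow n ** k)"
    if H: "\<And>k u. k \<in> H \<Longrightarrow> u dvd 1 \<Longrightarrow> mat (of_zp u) ** k \<in> H" for H :: "'p mat2 set"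
  proof
    assume "g \<in> times_center H"
    then obtain h z where hz: "h \<in> H" "z \<noteq> 0" "g = h ** mat z"
      by (auto simp: times_center_def center_def)
    obtain n u where u: "u dvd 1" "z = of_nat (CARD('p)) powi n * of_zp u" using qp_decomp[OF hz(2)] .
    have "g = mat z ** h" by (simp only: hz(3) mat_commute)
    then have "g = ppow n ** (mat (of_zp u) ** h)"
      by (simp only: u(2) matrix_mul_assoc mat_mult_mat)
    then show "\<exists>n k. k \<in> H \<and> g = ppow n ** k" using H[OF hz(1) u(1)] by blast
  next
    assume "\<exists>n k. k \<in> H \<and> g = ppow n ** k"
    then obtain n k where "k \<in> H" "g = k ** ppow n" by (auto simp: mat_commute)
    moreover have "(ppow n :: 'p mat2) \<in> center" by (auto simp: center_def)
    ultimately show "g \<in> times_center H" unfolding times_center_def by blast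
  qed
  show "g \<in> KZ \<longleftrightarrow> (\<exists>n k. k \<in> GL2_Zp \<and> g = ppow n ** k)"
    unfolding KZ_def using I_sub_K unit_scalar K_mult by (intro *) blast
  show "g \<in> IZ \<longleftrightarrow> (\<exists>n k. k \<in> Iwahori \<and> g = ppow n ** k)"
    unfolding IZ_def using unit_scalar I_mult by (intro *) blast
qed

lemma KZ_cases:
  assumes "g \<in> KZ"
  obtains n k where "k \<in> GL2_Zp" "g = ppow n ** k"
  using assms KZ_iff by blast

lemma IZ_cases:
  assumes "g \<in> IZ"
  obtains n k where "k \<in> Iwahori" "g = ppow n ** k"
  using assms IZ_iff by blast

lemma ppow_mult: "(ppow m ** A) ** (ppow n ** B) = ppow (m + n) ** (A ** B)"
  for A B :: "'p::prime_card mat2"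
proof -
  have "(ppow m ** A) ** (ppow n ** B) = ppow m ** (A ** ppow n) ** B"
    by (simp only: matrix_mul_assoc)
  also have "A ** ppow n = ppow n ** A" by (simp only: mat_commute)
  finally show ?thesis by (simp add: matrix_mul_assoc mat_mult_mat power_int_add)
qed

lemma KZ_mult: "g \<in> KZ \<Longrightarrow> h \<in> KZ \<Longrightarrow> g ** h \<in> KZ"
  by (elim KZ_cases) (metis KZ_iff K_mult ppow_mult)

lemma IZ_mult: "g \<in> IZ \<Longrightarrow> h \<in> IZ \<Longrightarrow> g ** h \<in> IZ"
  by (elim IZ_cases) (metis IZ_iff I_mult ppow_mult)

lemma I_sub_IZ: "k \<in> Iwahori \<Longrightarrow> k \<in> IZ"
  unfolding IZ_iff by (rule exI[of _ 0]) simp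

lemma ppow_inv: "matrix_inv (ppow n ** k) = ppow (- n) ** matrix_inv k" if "k \<in> GL2"
  for k :: "'p::prime_card mat2"
proof (rule GL2_inv_unique)
  show "ppow n ** k \<in> GL2" using that by simp
  show "(ppow n ** k) ** (ppow (- n) ** matrix_inv k) = mat 1"
    using that by (simp add: ppow_mult GL2_inv)
qed

lemma KZ_inv: "g \<in> KZ \<Longrightarrow> matrix_inv g \<in> KZ"
  by (elim KZ_cases) (metis KZ_iff K_inv K_GL2 ppow_inv)

lemma IZ_inv: "g \<in> IZ \<Longrightarrow> matrix_inv g \<in> IZ"
  by (elim IZ_cases) (metis IZ_iff I_inv I_sub_K K_GL2 ppow_inv)

lemma IZ_sub_KZ: "g \<in> IZ \<Longrightarrow> g \<in> KZ"
  by (elim IZ_cases) (metis KZ_iff I_sub_K)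

lemma KZ_GL2: "g \<in> KZ \<Longrightarrow> g \<in> GL2"
  by (elim KZ_cases) (simp add: K_GL2)

text \<open>The determinant of \<open>p^n k\<close> has valuation \<open>2 n\<close>, which
  determines \<open>n\<close>. Hence the \<open>THE\<close> in \<open>K_part\<close>
  denotes.\<close>

lemma ppow_K_unique:
  fixes k k' :: "'p::prime_card mat2"
  assumes "k \<in> GL2_Zp" "k' \<in> GL2_Zp" "ppow m ** k = ppow n ** k'"
  shows "m = n \<and> k = k'"
proof -
  let ?P = "of_nat (CARD('p)) :: 'p qp"
  obtain a b c d where k: "k = zmat a b c d" "(a * d - b * c) dvd 1" using assms(1) by (rule K_cases)
  obtain a' b' c' d' where k': "k' = zmat a' b' c' d'" "(a' * d' - b' * c') dvd 1" using assms(2) by (rule K_cases)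
  have dm: "det (ppow n :: 'p mat2) = ?P powi (n + n)" for n
    by (simp only: mat_mat2 det_mat2 power_int_add[OF disjI1[OF qp_p_nonzero]]) simp
  have "det (ppow m ** k) = det (ppow n ** k')" using assms(3) by simp
  then have "?P powi (m + m) * of_zp (a * d - b * c) = ?P powi (n + n) * of_zp (a' * d' - b' * c')"
    by (simp only: det_mul dm k(1) k'(1) det_zmat)
  then have mn: "m = n" using qp_decomp_unique[OF k(2) k'(2)] by (metis add_diff_cancel_right' mult_2 mult_cancel_left zero_neq_numeral)
  have "ppow (-m) ** (ppow m ** k) = ppow (-m) ** (ppow m ** k')" using assms(3) mn by simp
  then have "k = k'" by (simp add: matrix_mul_assoc mat_mult_mat flip: power_int_add)
  with mn show ?thesis by simp
qed

lemma K_part_eq: "k \<in> GL2_Zp \<Longrightarrow> K_part (ppow n ** k) = k" for k :: "'p::prime_card mat2"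
  unfolding K_part_def using ppow_K_unique by (intro the_equality) blast+

lemma K_part_K: "k \<in> GL2_Zp \<Longrightarrow> K_part k = k"
  using K_part_eq[of k 0] by simp

lemma K_part_mult: "g \<in> KZ \<Longrightarrow> h \<in> KZ \<Longrightarrow> K_part (g ** h) = K_part g ** K_part h"
  by (elim KZ_cases) (simp add: ppow_mult K_part_eq K_mult)

lemma K_part_in_K: "g \<in> KZ \<Longrightarrow> K_part g \<in> GL2_Zp"
  by (elim KZ_cases) (simp add: K_part_eq)

lemma K_part_in_I: "g \<in> IZ \<Longrightarrow> K_part g \<in> Iwahori"
  by (elim IZ_cases) (simp add: K_part_eq I_sub_K)

lemma center_sub_IZ: "z \<noteq> 0 \<Longrightarrow> mat z \<in> IZ"
proof -
  assume "z \<noteq> 0"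
  then have "mat z \<in> center" by (auto simp: center_def)
  moreover have "mat z = mat 1 ** mat z" by simp
  ultimately show "mat z \<in> IZ" unfolding IZ_def times_center_def using I_one by blast
qed

section \<open>Open and compact cosets\<close>

definition zint_mat :: "'p::prime_card mat2 set" where
  "zint_mat = {A. \<forall>i j. A $ i $ j \<in> range of_zp}"

lemma zint_mat_iff: "A \<in> zint_mat \<longleftrightarrow> (\<exists>a b c d. A = zmat a b c d)"
proof
  assume "A \<in> zint_mat"
  then have "\<exists>z. A $ i $ j = of_zp z" for i j unfolding zint_mat_def by blast
  then obtain a b c d where "A $ 1 $ 1 = of_zp a" "A $ 1 $ 2 = of_zp b" "A $ 2 $ 1 = of_zp c" "A $ 2 $ 2 = of_zp d"
    by metis
  then have "A = zmat a b c d" by (intro mat2_eqI) simp_all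
  then show "\<exists>a b c d. A = zmat a b c d" by blast
next
  assume "\<exists>a b c d. A = zmat a b c d"
  then show "A \<in> zint_mat" by (auto simp: zint_mat_def forall_2)
qed

lemma zint_mat_mult: "A \<in> zint_mat \<Longrightarrow> B \<in> zint_mat \<Longrightarrow> A ** B \<in> zint_mat"
  unfolding zint_mat_iff using zmat_mult by blast

text \<open>The claim is made for all large exponents so that the four entries of a matrix have a
  common one.\<close>

lemma qp_clear_denom:
  fixes x :: "'p::prime_card qp"
  shows "\<exists>m. \<forall>n\<ge>m. of_nat (CARD('p)) ^ n * x \<in> range of_zp"
proof (cases "x = 0")
  case True
  then show ?thesis by (metis mult_zero_right of_zp_0 rangeI)
next
  case False
  then obtain k u where u: "u dvd 1" "x = of_nat (CARD('p)) powi k * of_zp u" by (rule qp_decomp)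
  have "of_nat (CARD('p)) ^ n * x \<in> range of_zp" if "n \<ge> nat (- k)" for n
  proof -
    have "of_nat (CARD('p)) ^ n * x = of_nat (CARD('p)) powi (int n + k) * of_zp u"
      by (simp add: u(2) power_int_add)
    also have "int n + k = int (nat (int n + k))" using that by simp
    also have "of_nat (CARD('p)) powi \<dots> * of_zp u = of_zp (of_nat (CARD('p)) ^ nat (int n + k) * u)"
      by (simp only: power_int_of_nat of_zp_mult of_zp_power of_zp_of_nat)
    finally show ?thesis by simp
  qed
  then show ?thesis by blast
qed

lemma mat_clear_denom:
  fixes g :: "'p::prime_card mat2"
  shows "\<exists>m. mat (of_nat (CARD('p)) ^ m) ** g \<in> zint_mat"
proof -
  have "\<forall>i j. \<exists>m. \<forall>n\<ge>m. of_nat (CARD('p)) ^ n * g $ i $ j \<in> range of_zp"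
    using qp_clear_denom by blast
  then obtain f where f: "\<And>i j n. n \<ge> f i j \<Longrightarrow> of_nat (CARD('p)) ^ n * g $ i $ j \<in> range of_zp"
    by metis
  define m where "m = f 1 1 + f 1 2 + f 2 1 + f 2 2"
  have "of_nat (CARD('p)) ^ m * g $ i $ j \<in> range of_zp" for i j
    using exhaust_2[of i] exhaust_2[of j] by (intro f) (auto simp: m_def)
  then have "mat (of_nat (CARD('p)) ^ m) ** g \<in> zint_mat"
    by (subst mat2_expand[of g]) (simp add: zint_mat_def forall_2 mat_mat2 mat2_mult)
  then show ?thesis by blast
qed

text \<open>The product topology in usable form: as there are only four entries, one exponent serves
  them all, and the sets \<open>A + p^n M_2(Z_p)\<close> form a base of neighbourhoods of
  \<open>A\<close>.\<close>

lemma open_mat2_iff: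
  fixes S :: "'p::prime_card mat2 set"
  shows "open S \<longleftrightarrow> (\<forall>A\<in>S. \<exists>n. \<forall>B\<in>zint_mat. A + mat (of_nat (CARD('p)) ^ n) ** B \<in> S)"
proof
  assume S: "open S"
  show "\<forall>A\<in>S. \<exists>n. \<forall>B\<in>zint_mat. A + mat (of_nat (CARD('p)) ^ n) ** B \<in> S"
  proof
    fix A assume "A \<in> S"
    then obtain U where U: "\<And>i. open (U i)" "\<And>i. A $ i \<in> U i" "\<And>y. (\<forall>i. y $ i \<in> U i) \<Longrightarrow> y \<in> S"
      using S unfolding open_vec_def by metis
    have "\<exists>V. \<forall>j. open (V j) \<and> A $ i $ j \<in> V j \<and> (\<forall>y. (\<forall>j. y $ j \<in> V j) \<longrightarrow> y \<in> U i)" for i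
      using U(1)[of i] U(2)[of i] unfolding open_vec_def by metis
    then obtain V where V: "\<And>i j. open (V i j)" "\<And>i j. A $ i $ j \<in> V i j"
        "\<And>i y. (\<forall>j. y $ j \<in> V i j) \<Longrightarrow> y \<in> U i"
      by metis
    have "\<exists>n. \<forall>z. A $ i $ j + of_nat (CARD('p)) ^ n * of_zp z \<in> V i j" for i j
      using V(1,2)[of i j] unfolding open_qp_def by blast
    then obtain f where f: "\<And>i j z. A $ i $ j + of_nat (CARD('p)) ^ f i j * of_zp z \<in> V i j"
      by metis
    define n where "n = f 1 1 + f 1 2 + f 2 1 + f 2 2"
    have n: "f i j \<le> n" for i j
      using exhaust_2[of i] exhaust_2[of j] by (auto simp: n_def)
    have "A + mat (of_nat (CARD('p)) ^ n) ** B \<in> S" if B: "B \<in> zint_mat" for B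
    proof (intro U(3) V(3) allI)
      fix i j
      obtain z where z: "B $ i $ j = of_zp z" using B by (auto simp: zint_mat_def)
      have "(mat (of_nat (CARD('p)) ^ n) ** B) $ i $ j = of_nat (CARD('p)) ^ n * B $ i $ j"
        using exhaust_2[of i] exhaust_2[of j]
        by (subst mat2_expand[of B]) (auto simp: mat_mat2 mat2_mult)
      also have "\<dots> = of_nat (CARD('p)) ^ f i j * of_zp (of_nat (CARD('p)) ^ (n - f i j) * z)"
        using n[of i j] by (simp add: z of_zp_mult of_zp_power of_zp_of_nat flip: power_add)
      finally show "(A + mat (of_nat (CARD('p)) ^ n) ** B) $ i $ j \<in> V i j" using f by simp
    qed
    then show "\<exists>n. \<forall>B\<in>zint_mat. A + mat (of_nat (CARD('p)) ^ n) ** B \<in> S" by blast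
  qed
next
  assume S: "\<forall>A\<in>S. \<exists>n. \<forall>B\<in>zint_mat. A + mat (of_nat (CARD('p)) ^ n) ** B \<in> S"
  let ?b = "\<lambda>n x. {x + of_nat (CARD('p)) ^ n * of_zp z | z. True} :: 'p qp set"
  have ob: "open (?b n x)" for n x
    unfolding open_qp_def
  proof (intro ballI exI allI)
    fix y z assume "y \<in> ?b n x"
    then obtain w where "y = x + of_nat (CARD('p)) ^ n * of_zp w" by blast
    then have "y + of_nat (CARD('p)) ^ n * of_zp z = x + of_nat (CARD('p)) ^ n * of_zp (w + z)"
      by (simp add: of_zp_add algebra_simps)
    then show "y + of_nat (CARD('p)) ^ n * of_zp z \<in> ?b n x" by blast
  qed
  have xb: "x \<in> ?b n x" for n x by (auto intro!: exI[of _ 0] simp: of_zp_0)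
  show "open S"
  proof (subst open_vec_def, rule ballI)
    fix A assume "A \<in> S"
    then obtain n where n: "\<And>B. B \<in> zint_mat \<Longrightarrow> A + mat (of_nat (CARD('p)) ^ n) ** B \<in> S" using S by blast
    define U where "U i = {v. \<forall>j. v $ j \<in> ?b n (A $ i $ j)}" for i
    have "open (U i)" for i
      unfolding open_vec_def U_def using ob by (intro ballI exI[of _ "\<lambda>j. ?b n (A $ i $ j)"]) auto
    moreover have "A $ i \<in> U i" for i unfolding U_def using xb by blast
    moreover have "y \<in> S" if y: "\<forall>i. y $ i \<in> U i" for y
    proof -
      have "\<forall>i j. \<exists>z. y $ i $ j = A $ i $ j + of_nat (CARD('p)) ^ n * of_zp z"
        using y unfolding U_def by blast
      then obtain z where z: "\<And>i j. y $ i $ j = A $ i $ j + of_nat (CARD('p)) ^ n * of_zp (z i j)"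
        by metis
      define B where "B = zmat (z 1 1) (z 1 2) (z 2 1) (z 2 2)"
      have "y = A + mat (of_nat (CARD('p)) ^ n) ** B"
        by (rule mat2_eqI) (simp_all add: z B_def zmat_def mat_mat2 mat2_mult)
      then show ?thesis using n[of B] by (auto simp: B_def zint_mat_iff)
    qed
    ultimately show "\<exists>U. (\<forall>i. open (U i) \<and> A $ i \<in> U i) \<and> (\<forall>y. (\<forall>i. y $ i \<in> U i) \<longrightarrow> y \<in> S)"
      by blast
  qed
qed

lemma zint_near_I:
  assumes "h \<in> Iwahori" "B \<in> zint_mat"
  shows "h + mat (of_nat (CARD('p::prime_card))) ** B \<in> (Iwahori :: 'p mat2 set)"
proof -
  obtain a b c d where h: "h = zmat a b c d" "a dvd 1" "d dvd 1" "red c = 0" using assms(1) by (rule I_cases)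
  obtain a' b' c' d' where B: "B = zmat a' b' c' d'" using assms(2) by (auto simp: zint_mat_iff)
  let ?p = "of_nat (CARD('p)) :: 'p zp"
  have "h + mat (of_nat (CARD('p))) ** B = zmat (a + ?p * a') (b + ?p * b') (c + ?p * c') (d + ?p * d')"
    by (rule mat2_eqI) (simp_all add: h B zmat_def mat_mat2 mat2_mult of_zp_add of_zp_mult of_zp_of_nat)
  then show ?thesis using h by (simp add: zmat_I_iff zp_unit_iff_red)
qed

lemma open_I_coset:
  fixes y :: "'p::prime_card mat2"
  assumes "y \<in> GL2"
  shows "open ((\<lambda>h. h ** y) ` Iwahori)"
  unfolding open_mat2_iff
proof
  fix A assume "A \<in> (\<lambda>h. h ** y) ` Iwahori"
  then obtain h where h: "h \<in> Iwahori" "A = h ** y" by blast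
  \<comment> \<open>\<open>p^m\<close> clears the denominators of the inverse of \<open>y\<close>,
    so changing \<open>A = h ** y\<close> by an integral multiple of \<open>p^(m+1)\<close> changes
    \<open>h\<close> by an integral multiple of \<open>p\<close>, which does not leave
    \<open>I\<close>.\<close>
  obtain m where m: "mat (of_nat (CARD('p)) ^ m) ** matrix_inv y \<in> zint_mat"
    using mat_clear_denom by blast
  have "A + mat (of_nat (CARD('p)) ^ Suc m) ** B \<in> (\<lambda>h. h ** y) ` Iwahori" if B: "B \<in> zint_mat" for B
  proof -
    let ?C = "B ** (mat (of_nat (CARD('p)) ^ m) ** matrix_inv y)"
    have "(h + mat (of_nat (CARD('p))) ** ?C) ** y =
        A + mat (of_nat (CARD('p))) ** (B ** mat (of_nat (CARD('p)) ^ m)) ** (matrix_inv y ** y)"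
      by (simp only: h(2) matrix_add_right2 matrix_mul_assoc)
    also have "B ** mat (of_nat (CARD('p)) ^ m) = mat (of_nat (CARD('p)) ^ m) ** B"
      by (rule mat_commute[symmetric])
    also have "A + mat (of_nat (CARD('p))) ** (mat (of_nat (CARD('p)) ^ m) ** B) ** (matrix_inv y ** y) =
        A + mat (of_nat (CARD('p)) ^ Suc m) ** B"
      by (simp only: GL2_inv[OF assms] matrix_mul_assoc mat_mult_mat matrix_mul_rid power_Suc)
    finally show ?thesis
      using zint_near_I[OF h(1) zint_mat_mult[OF B m]] by (intro image_eqI) (rule sym)
  qed
  then show "\<exists>n. \<forall>B\<in>zint_mat. A + mat (of_nat (CARD('p)) ^ n) ** B \<in> (\<lambda>h. h ** y) ` Iwahori" by blast
qed

text \<open>A Heine--Borel argument: if an open cover of \<open>K g\<close> had no finite subcover, then neither had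
  one of the finitely many residue classes modulo \<open>p^n\<close>, for every \<open>n\<close>, and a nested sequence of
  such classes would shrink to a point of \<open>K g\<close>.\<close>

lemma compact_K_coset:
  fixes g :: "'p::prime_card mat2"
  shows "compact ((\<lambda>k. k ** g) ` GL2_Zp)"
  unfolding compact_eq_Heine_Borel
proof (intro allI impI, elim conjE, rule ccontr)
  fix \<C> :: "'p mat2 set set"
  assume op: "\<forall>U\<in>\<C>. open U" and cov: "(\<lambda>k. k ** g) ` GL2_Zp \<subseteq> \<Union>\<C>"
    and no: "\<not> (\<exists>\<D>\<subseteq>\<C>. finite \<D> \<and> (\<lambda>k. k ** g) ` GL2_Zp \<subseteq> \<Union>\<D>)"
  let ?p = "int (CARD('p))"
  have p: "0 < ?p" by (simp add: prime_gt_0_nat[OF prime_card])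
  define Bl where "Bl n M = {map_matrix of_zp B ** g | B. invertible B \<and>
    (\<forall>i j. Rep_zp (B $ i $ j) n = M $ i $ j)}" for n and M :: "int^2^2"
  define bad where "bad S \<longleftrightarrow> \<not> (\<exists>\<D>\<subseteq>\<C>. finite \<D> \<and> S \<subseteq> \<Union>\<D>)" for S
  define ok where "ok n M \<longleftrightarrow> (\<forall>i j. 0 \<le> M $ i $ j \<and> M $ i $ j < ?p ^ n)" for n and M :: "int^2^2"
  have "Bl 0 0 = (\<lambda>k. k ** g) ` GL2_Zp" by (auto simp: Bl_def GL2_Zp_def)
  then have bad0: "bad (Bl 0 0)" using no by (simp add: bad_def)
  have step: "\<exists>M'. (ok (Suc n) M' \<and> bad (Bl (Suc n) M')) \<and> (\<forall>i j. M' $ i $ j mod ?p ^ n = M $ i $ j)"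
    if "ok n M \<and> bad (Bl n M)" for n M
  proof (rule ccontr)
    assume neg: "\<not> ?thesis"
    define Q where "Q = {M'. ok (Suc n) M' \<and> (\<forall>i j. M' $ i $ j mod ?p ^ n = M $ i $ j)}"
    have "Q \<subseteq> (\<lambda>f. \<chi> i j. f (i, j)) ` (UNIV \<rightarrow>\<^sub>E {0..<?p ^ Suc n})"
    proof
      fix M' assume M': "M' \<in> Q"
      show "M' \<in> (\<lambda>f. \<chi> i j. f (i, j)) ` (UNIV \<rightarrow>\<^sub>E {0..<?p ^ Suc n})"
        using M'[unfolded Q_def] by (intro image_eqI[of _ _ "\<lambda>(i, j). M' $ i $ j"]) (auto simp: ok_def vec_eq_iff)
    qed
    moreover have "finite ((\<lambda>f. \<chi> i j. f (i, j)) ` ((UNIV :: (2 \<times> 2) set) \<rightarrow>\<^sub>E {0..<?p ^ Suc n}) :: (int^2^2) set)"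
      by (intro finite_imageI finite_PiE) auto
    ultimately have fin: "finite Q" by (rule finite_subset)
    have "\<forall>M'\<in>Q. \<exists>\<D>\<subseteq>\<C>. finite \<D> \<and> Bl (Suc n) M' \<subseteq> \<Union>\<D>"
      using neg unfolding bad_def Q_def by blast
    from bchoice[OF this] obtain D where
      D: "\<forall>M'\<in>Q. D M' \<subseteq> \<C> \<and> finite (D M') \<and> Bl (Suc n) M' \<subseteq> \<Union>(D M')"
      by blast
    have "Bl n M \<subseteq> (\<Union>M'\<in>Q. Bl (Suc n) M')"
    proof
      fix x assume "x \<in> Bl n M"
      then obtain B where B: "x = map_matrix of_zp B ** g" "invertible B"
          "\<And>i j. Rep_zp (B $ i $ j) n = M $ i $ j"
        unfolding Bl_def by blast
      define M' where "M' = (\<chi> i j. Rep_zp (B $ i $ j) (Suc n))"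
      have "M' \<in> Q"
        using Rep_zp_props(1)[where ?'p = 'p] Rep_zp_props(2)[where ?'p = 'p, of _ "Suc n"]
          Rep_zp_props(3)[where ?'p = 'p, of _ n 1] B(3)
        by (simp add: M'_def ok_def Q_def)
      moreover have "x \<in> Bl (Suc n) M'" using B unfolding Bl_def M'_def by auto
      ultimately show "x \<in> (\<Union>M'\<in>Q. Bl (Suc n) M')" by blast
    qed
    also have "\<dots> \<subseteq> \<Union>(\<Union>M'\<in>Q. D M')"
    proof (rule UN_least)
      fix M' assume M': "M' \<in> Q"
      have "Bl (Suc n) M' \<subseteq> \<Union>(D M')" using D M' by simp
      also have "\<dots> \<subseteq> \<Union>(\<Union>M'\<in>Q. D M')" using M' by (intro Union_mono UN_upper)
      finally show "Bl (Suc n) M' \<subseteq> \<Union>(\<Union>M'\<in>Q. D M')" .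
    qed
    finally have "Bl n M \<subseteq> \<Union>(\<Union>M'\<in>Q. D M')" .
    moreover have "finite (\<Union>M'\<in>Q. D M')" using fin D by blast
    moreover have "(\<Union>M'\<in>Q. D M') \<subseteq> \<C>" using D by blast
    ultimately show False using that unfolding bad_def by blast
  qed
  have "\<exists>f. \<forall>n. (ok n (f n) \<and> bad (Bl n (f n))) \<and> (\<forall>i j. f (Suc n) $ i $ j mod ?p ^ n = f n $ i $ j)"
  proof (rule dependent_nat_choice)
    have "ok 0 0" by (simp add: ok_def)
    then show "\<exists>M. ok 0 M \<and> bad (Bl 0 M)" using bad0 by blast
  qed (rule step)
  then obtain f where f: "\<And>n. ok n (f n)" "\<And>n. bad (Bl n (f n))"
      "\<And>n i j. f (Suc n) $ i $ j mod ?p ^ n = f n $ i $ j"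
    by blast
  have "\<exists>x :: 'p zp. \<forall>n. Rep_zp x n = f n $ i $ j" for i j
    using f(1,3) unfolding ok_def by (intro zp_exists) auto
  then obtain z :: "2 \<Rightarrow> 2 \<Rightarrow> 'p zp" where z: "\<And>i j n. Rep_zp (z i j) n = f n $ i $ j" by metis
  define Xm where "Xm = (\<chi> i j. z i j)"
  \<comment> \<open>Bad classes are nonempty, as the empty set is covered by the empty family. At
    level 1 this yields an invertible matrix with the same reduction as the limit \<open>Xm\<close>,
    so \<open>Xm\<close> is invertible too.\<close>
  have nonempty: "\<exists>B :: 'p zp^2^2. invertible B \<and> (\<forall>i j. Rep_zp (B $ i $ j) n = f n $ i $ j)" for n
  proof (rule ccontr)
    assume "\<not> ?thesis"
    then have "Bl n (f n) = {}" unfolding Bl_def by blast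
    then show False using f(2)[of n] unfolding bad_def by (metis Union_empty empty_subsetI finite.emptyI)
  qed
  from nonempty[of 1] obtain B1 :: "'p zp^2^2" where B1: "invertible B1" "\<And>i j. Rep_zp (B1 $ i $ j) 1 = f 1 $ i $ j" by blast
  have rX: "red (Xm $ i $ j) = red (B1 $ i $ j)" for i j
    unfolding red_def Xm_def using z[of i j 1] B1(2)[of i j] by simp
  have "invertible Xm"
    using B1(1) by (subst (asm) mat2_expand[of B1], subst mat2_expand[of Xm])
      (simp add: invertible_mat2_iff zp_unit_iff_red rX)
  then have "map_matrix of_zp Xm ** g \<in> \<Union>\<C>" using cov unfolding GL2_Zp_def by blast
  then obtain U where U: "U \<in> \<C>" "map_matrix of_zp Xm ** g \<in> U" by blast
  then obtain n where n: "\<And>B. B \<in> zint_mat \<Longrightarrow>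
      map_matrix of_zp Xm ** g + mat (of_nat (CARD('p)) ^ n) ** B \<in> U"
    using op open_mat2_iff by metis
  \<comment> \<open>Right multiplication by \<open>g\<close> may introduce denominators;
    \<open>m\<close> further digits of agreement compensate for them.\<close>
  obtain m where m: "mat (of_nat (CARD('p)) ^ m) ** g \<in> zint_mat" using mat_clear_denom by blast
  have "Bl (n + m) (f (n + m)) \<subseteq> U"
  proof
    fix x assume "x \<in> Bl (n + m) (f (n + m))"
    then obtain B where B: "x = map_matrix of_zp B ** g" "\<And>i j. Rep_zp (B $ i $ j) (n + m) = f (n + m) $ i $ j"
      unfolding Bl_def by blast
    have "\<exists>w. B $ i $ j - Xm $ i $ j = of_nat (CARD('p)) ^ (n + m) * w" for i j
      using B(2)[of i j] z[of i j "n + m"] unfolding Xm_def by (metis Rep_zp_eq_iff_dvd dvdE vec_lambda_beta)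
    then obtain w where w: "\<And>i j. B $ i $ j - Xm $ i $ j = of_nat (CARD('p)) ^ (n + m) * w i j" by metis
    define W where "W = zmat (w 1 1) (w 1 2) (w 2 1) (w 2 2)"
    have Wz: "W \<in> zint_mat" by (auto simp: W_def zint_mat_iff)
    have eB: "B $ i $ j = Xm $ i $ j + of_nat (CARD('p)) ^ (n + m) * w i j" for i j
      using w[of i j] by (simp add: algebra_simps)
    have "map_matrix of_zp B = map_matrix of_zp Xm + mat (of_nat (CARD('p)) ^ (n + m)) ** W"
      by (rule mat2_eqI) (simp_all add: map_matrix_zmat eB W_def zmat_def mat_mat2 mat2_mult of_zp_add of_zp_mult of_zp_power of_zp_of_nat)
    then have "x = map_matrix of_zp Xm ** g + mat (of_nat (CARD('p)) ^ n) ** (mat (of_nat (CARD('p)) ^ m) ** W) ** g"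
      by (simp add: B(1) matrix_add_right2 matrix_mul_assoc mat_mult_mat power_add)
    also have "mat (of_nat (CARD('p)) ^ m) ** W = W ** mat (of_nat (CARD('p)) ^ m)" by (rule mat_commute)
    finally have "x = map_matrix of_zp Xm ** g + mat (of_nat (CARD('p)) ^ n) ** (W ** (mat (of_nat (CARD('p)) ^ m) ** g))"
      by (simp add: matrix_mul_assoc)
    then show "x \<in> U" using n[OF zint_mat_mult[OF Wz m]] by simp
  qed
  then show False using f(2)[of "n + m"] U(1) unfolding bad_def
    by (metis Union_insert Union_empty Un_empty_right empty_subsetI finite.emptyI finite_insert insert_subset)
qed

text \<open>In one direction cosets of \<open>I\<close> are open, so finitely many of them cover a
  compact set, and each lies in a single coset of \<open>H\<close>. In the other, cosets of
  \<open>K\<close> are compact and \<open>H\<close> is contained in \<open>K\<close> times the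
  center. Sandwiching \<open>H\<close> between \<open>IZ\<close> and \<open>KZ\<close> fits both
  inductions.\<close>

lemma compact_mod_center_iff:
  fixes S :: "'p::prime_card mat2 set"
  assumes S: "S \<subseteq> GL2" and H: "IZ \<subseteq> H" "H \<subseteq> KZ" "\<And>g h. g \<in> H \<Longrightarrow> h \<in> H \<Longrightarrow> g ** h \<in> H"
    "\<And>g. g \<in> H \<Longrightarrow> matrix_inv g \<in> H"
  shows "compact_mod_center S \<longleftrightarrow> finite ((\<lambda>x. (\<lambda>h. h ** x) ` H) ` S)"
proof
  assume "compact_mod_center S"
  then obtain C where C: "C \<subseteq> GL2" "compact C" "S \<subseteq> times_center C" by (auto simp: compact_mod_center_def)
  let ?U = "\<lambda>y. (\<lambda>h. h ** y) ` Iwahori"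
  have "\<forall>y\<in>C. open (?U y)" using C(1) open_I_coset by blast
  moreover have "y \<in> ?U y" for y by (rule image_eqI[of _ _ "mat 1"]) simp_all
  then have "C \<subseteq> (\<Union>y\<in>C. ?U y)" by blast
  ultimately obtain F where F: "F \<subseteq> C" "finite F" "C \<subseteq> (\<Union>y\<in>F. ?U y)"
    using compactE_image[OF C(2), of C ?U] by metis
  have coset: "(\<lambda>h. h ** (g ** y)) ` H = (\<lambda>h. h ** y) ` H" if g: "g \<in> H" for g y
  proof -
    have gG: "g \<in> GL2" using g H(2) KZ_GL2 by blast
    show ?thesis
    proof (intro equalityI subsetI)
      fix z assume "z \<in> (\<lambda>h. h ** (g ** y)) ` H"
      then show "z \<in> (\<lambda>h. h ** y) ` H" using H(3) g by (force simp: matrix_mul_assoc)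
    next
      fix z assume "z \<in> (\<lambda>h. h ** y) ` H"
      then obtain h where h: "h \<in> H" "z = h ** y" by blast
      have "z = (h ** matrix_inv g) ** (g ** y)" using gG by (simp add: h matrix_mul_assoc)
      then show "z \<in> (\<lambda>h. h ** (g ** y)) ` H" using H(3,4) g h(1) by blast
    qed
  qed
  have "(\<lambda>x. (\<lambda>h. h ** x) ` H) ` S \<subseteq> (\<lambda>x. (\<lambda>h. h ** x) ` H) ` F"
  proof
    fix Q assume "Q \<in> (\<lambda>x. (\<lambda>h. h ** x) ` H) ` S"
    then obtain x where x: "x \<in> S" "Q = (\<lambda>h. h ** x) ` H" by blast
    obtain c z where cz: "c \<in> C" "z \<noteq> 0" "x = c ** mat z" using C(3) x(1) by (auto simp: times_center_def center_def)
    obtain h y where hy: "y \<in> F" "h \<in> Iwahori" "c = h ** y" using F(3) cz(1) by blast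
    have "x = (mat z ** h) ** y" by (simp add: cz(3) hy(3) matrix_mul_assoc flip: mat_commute)
    moreover have "mat z ** h \<in> H" using IZ_mult[OF center_sub_IZ[OF cz(2)] I_sub_IZ[OF hy(2)]] H(1) by blast
    ultimately have "Q = (\<lambda>h. h ** y) ` H" using coset x(2) by simp
    then show "Q \<in> (\<lambda>x. (\<lambda>h. h ** x) ` H) ` F" using hy(1) by blast
  qed
  then show "finite ((\<lambda>x. (\<lambda>h. h ** x) ` H) ` S)" using F(2) by (meson finite_imageI finite_subset)
next
  assume fin: "finite ((\<lambda>x. (\<lambda>h. h ** x) ` H) ` S)"
  define q where "q x = (\<lambda>h. h ** x) ` H" for x :: "'p mat2"
  have "finite (q ` S)" using fin unfolding q_def .
  then obtain F where F: "F \<subseteq> S" "finite F" "q ` S = q ` F"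
    using finite_subset_image[OF _ subset_refl, of q S] by blast
  define C where "C = (\<Union>y\<in>F. (\<lambda>k. k ** y) ` GL2_Zp)"
  have "compact C" unfolding C_def using F(2) compact_K_coset by (intro compact_UN) auto
  moreover have "C \<subseteq> GL2" using F(1) S K_GL2 unfolding C_def by (auto intro!: GL2_mult)
  moreover have "S \<subseteq> times_center C"
  proof
    fix x assume x: "x \<in> S"
    have 1: "mat 1 \<in> H" using H(1) I_sub_IZ[OF I_one] by blast
    have xx: "x \<in> q x" unfolding q_def using 1 by (intro image_eqI[of _ _ "mat 1"]) simp_all
    obtain y where y: "y \<in> F" "q x = q y" using F(3) x by blast
    have "x \<in> q y" using xx unfolding y(2) .
    then obtain h where h: "h \<in> H" "x = h ** y" unfolding q_def by blast
    obtain n k where k: "k \<in> GL2_Zp" "h = ppow n ** k" using h(1) H(2) KZ_cases by blast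
    have "x = (k ** y) ** ppow n" by (simp only: h(2) k(2) matrix_mul_assoc[symmetric] mat_commute)
    moreover have "(ppow n :: 'p mat2) \<in> center" by (auto simp: center_def)
    ultimately show "x \<in> times_center C" using k(1) y(1) unfolding times_center_def C_def by blast
  qed
  ultimately show "compact_mod_center S" unfolding compact_mod_center_def by blast
qed

section \<open>Smooth representations and their quotients\<close>

lemma Fpbar_simps [simp]:
  "carrier (Fpbar :: 'p::prime_card fpbar ring) = UNIV" "x \<otimes>\<^bsub>Fpbar\<^esub> y = x * y" "x \<oplus>\<^bsub>Fpbar\<^esub> y = x + y"
  "\<one>\<^bsub>Fpbar\<^esub> = 1" "\<zero>\<^bsub>Fpbar\<^esub> = 0"
  by (simp_all add: ring_of_type_algebra_def)

lemma Fpbar_minus [simp]: "\<ominus>\<^bsub>Fpbar\<^esub> x = - (x :: 'p::prime_card fpbar)"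
proof -
  interpret cring "Fpbar :: 'p fpbar ring" by (rule cring_from_type_algebra)
  show ?thesis using minus_equality[of "- x" x] by simp
qed

lemma G_repI:
  fixes M :: "('p::prime_card, 'v) rep" (structure)
  assumes "\<zero> \<in> carrier M" "\<And>v w. v \<in> carrier M \<Longrightarrow> w \<in> carrier M \<Longrightarrow> v \<oplus> w \<in> carrier M"
    and "\<And>u v w. u \<in> carrier M \<Longrightarrow> v \<in> carrier M \<Longrightarrow> w \<in> carrier M \<Longrightarrow> u \<oplus> v \<oplus> w = u \<oplus> (v \<oplus> w)"
    and "\<And>v w. v \<in> carrier M \<Longrightarrow> w \<in> carrier M \<Longrightarrow> v \<oplus> w = w \<oplus> v"
    and "\<And>v. v \<in> carrier M \<Longrightarrow> \<zero> \<oplus> v = v"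
    and "\<And>c v. v \<in> carrier M \<Longrightarrow> c \<odot> v \<in> carrier M"
    and "\<And>a b v. v \<in> carrier M \<Longrightarrow> (a + b) \<odot> v = a \<odot> v \<oplus> b \<odot> v"
    and "\<And>a v w. v \<in> carrier M \<Longrightarrow> w \<in> carrier M \<Longrightarrow> a \<odot> (v \<oplus> w) = a \<odot> v \<oplus> a \<odot> w"
    and "\<And>a b v. v \<in> carrier M \<Longrightarrow> (a * b) \<odot> v = a \<odot> (b \<odot> v)"
    and "\<And>v. v \<in> carrier M \<Longrightarrow> 1 \<odot> v = v" "\<And>v. v \<in> carrier M \<Longrightarrow> 0 \<odot> v = \<zero>"
    and "\<And>g v. g \<in> GL2 \<Longrightarrow> v \<in> carrier M \<Longrightarrow> act M g v \<in> carrier M"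
    and "\<And>g v w. g \<in> GL2 \<Longrightarrow> v \<in> carrier M \<Longrightarrow> w \<in> carrier M \<Longrightarrow> act M g (v \<oplus> w) = act M g v \<oplus> act M g w"
    and "\<And>g c v. g \<in> GL2 \<Longrightarrow> v \<in> carrier M \<Longrightarrow> act M g (c \<odot> v) = c \<odot> act M g v"
    and "\<And>v. v \<in> carrier M \<Longrightarrow> act M (mat 1) v = v"
    and "\<And>g h v. g \<in> GL2 \<Longrightarrow> h \<in> GL2 \<Longrightarrow> v \<in> carrier M \<Longrightarrow> act M (g ** h) v = act M g (act M h v)"
  shows "G_rep M"
proof -
  have ag: "abelian_group M"
  proof (rule abelian_groupI)
    fix v assume v: "v \<in> carrier M"
    \<comment> \<open>Additive inverses come from the scalars: \<open>(-1) v\<close> is inverse to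
      \<open>v\<close> because \<open>0 v\<close> is zero.\<close>
    have "(-1 + 1) \<odot> v = (-1) \<odot> v \<oplus> v" using assms(7)[OF v, of "-1" 1] assms(10)[OF v] by simp
    then have "(-1) \<odot> v \<oplus> v = \<zero>" using assms(11)[OF v] by simp
    then show "\<exists>y\<in>carrier M. y \<oplus> v = \<zero>" using assms(6)[OF v] by blast
  qed (use assms in auto)
  have "Module.module Fpbar M"
    using assms by (intro moduleI ag cring_from_type_algebra) simp_all
  then show ?thesis unfolding G_rep_def using assms(12-16) by blast
qed

text \<open>The ring record \<open>Fpbar\<close> and the type \<open>'p fpbar\<close> have the same
  operations under different names; here the module laws are restated in those of the type.\<close>

locale Fpbar_module = Module.module Fpbar M
  for M :: "('p::prime_card fpbar, 'v, 'm) module_scheme" (structure)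
begin

lemma smult_add: "v \<in> carrier M \<Longrightarrow> (a + b) \<odot> v = a \<odot> v \<oplus> b \<odot> v"
  using smult_l_distr[of a b v] by simp

lemma smult_mult: "v \<in> carrier M \<Longrightarrow> (a * b) \<odot> v = a \<odot> (b \<odot> v)"
  using smult_assoc1[of a b v] by simp

lemma smult_1 [simp]: "v \<in> carrier M \<Longrightarrow> 1 \<odot> v = v"
  using smult_one[of v] by simp

lemma smult_0 [simp]: "v \<in> carrier M \<Longrightarrow> 0 \<odot> v = \<zero>"
  using smult_l_null[of v] by simp

lemma smult_neg1: "v \<in> carrier M \<Longrightarrow> (- 1) \<odot> v = \<ominus> v"
  using smult_l_minus[of 1 v] by simp

lemma smult_clo [simp, intro]: "v \<in> carrier M \<Longrightarrow> a \<odot> v \<in> carrier M"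
  using smult_closed[of a v] by simp

lemma smult_add_r: "v \<in> carrier M \<Longrightarrow> w \<in> carrier M \<Longrightarrow> a \<odot> (v \<oplus> w) = a \<odot> v \<oplus> a \<odot> w"
  using smult_r_distr[of a v w] by simp

lemma smult_zero_r [simp]: "a \<odot> \<zero> = \<zero>"
  using smult_r_null[of a] by simp

end

locale G_representation =
  fixes M :: "('p::prime_card, 'v) rep" (structure)
  assumes G_rep: "G_rep M"
begin

sublocale Fpbar_module M
  using G_rep by (simp add: G_rep_def Fpbar_module_def)

lemma act_closed [simp, intro]: "g \<in> GL2 \<Longrightarrow> v \<in> carrier M \<Longrightarrow> act M g v \<in> carrier M"
  using G_rep by (simp add: G_rep_def)

lemma act_add: "g \<in> GL2 \<Longrightarrow> v \<in> carrier M \<Longrightarrow> w \<in> carrier M \<Longrightarrow> act M g (v \<oplus> w) = act M g v \<oplus> act M g w"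
  using G_rep by (simp add: G_rep_def)

lemma act_smult: "g \<in> GL2 \<Longrightarrow> v \<in> carrier M \<Longrightarrow> act M g (c \<odot> v) = c \<odot> act M g v"
  using G_rep by (simp add: G_rep_def)

lemma act_one [simp]: "v \<in> carrier M \<Longrightarrow> act M (mat 1) v = v"
  using G_rep by (simp add: G_rep_def)

lemma act_mult: "g \<in> GL2 \<Longrightarrow> h \<in> GL2 \<Longrightarrow> v \<in> carrier M \<Longrightarrow> act M (g ** h) v = act M g (act M h v)"
  using G_rep by (simp add: G_rep_def)

lemma act_zero [simp]: "g \<in> GL2 \<Longrightarrow> act M g \<zero> = \<zero>"
  using act_smult[of g \<zero> 0] by simp

lemma subrepI:
  assumes "W \<subseteq> carrier M" "\<zero> \<in> W" "\<And>v w. v \<in> W \<Longrightarrow> w \<in> W \<Longrightarrow> v \<oplus> w \<in> W"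
    "\<And>c v. v \<in> W \<Longrightarrow> c \<odot> v \<in> W" "\<And>g v. g \<in> GL2 \<Longrightarrow> v \<in> W \<Longrightarrow> act M g v \<in> W"
  shows "subrep W M"
proof -
  have "\<ominus> v \<in> W" if "v \<in> W" for v
    using assms(1) assms(4)[OF that, of "-1"] that smult_neg1[of v] by auto
  then have "submodule W Fpbar M" using assms by (intro submoduleI) auto
  then show ?thesis using assms(5) by (auto simp: subrep_def)
qed

lemma subrepD:
  assumes "subrep W M"
  shows "W \<subseteq> carrier M" "\<zero> \<in> W" "\<And>v w. v \<in> W \<Longrightarrow> w \<in> W \<Longrightarrow> v \<oplus> w \<in> W"
    "\<And>c v. v \<in> W \<Longrightarrow> c \<odot> v \<in> W" "\<And>g v. g \<in> GL2 \<Longrightarrow> v \<in> W \<Longrightarrow> act M g v \<in> W"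
    "\<And>v. v \<in> W \<Longrightarrow> \<ominus> v \<in> W"
proof -
  have *: "submodule W Fpbar M" using assms by (simp add: subrep_def)
  interpret S: submodule W Fpbar M by (rule *)
  show "W \<subseteq> carrier M" "\<zero> \<in> W" using S.subset S.one_closed by simp_all
  show "v \<oplus> w \<in> W" if "v \<in> W" "w \<in> W" for v w using S.m_closed[OF that] by simp
  show "c \<odot> v \<in> W" if "v \<in> W" for c v using S.smult_closed[of c v] that by simp
  show "act M g v \<in> W" if "g \<in> GL2" "v \<in> W" for g v using assms that by (simp add: subrep_def)
  show "\<ominus> v \<in> W" if "v \<in> W" for v using submoduleE(3)[OF * that] .
qed

lemma subrep_carrier: "subrep (carrier M) M"
  by (rule subrepI) auto

lemma G_rep_restrict:
  assumes "subrep W M"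
  shows "G_rep (M\<lparr>carrier := W\<rparr>)"
  using subrepD[OF assms] by (intro G_repI)
    (auto simp: subset_iff a_ac smult_add smult_add_r smult_mult act_add act_smult act_mult)

lemma subrep_restrict:
  assumes "subrep W M" "subrep W' M" "W \<subseteq> W'"
  shows "subrep W (M\<lparr>carrier := W'\<rparr>)"
proof -
  interpret N: G_representation "M\<lparr>carrier := W'\<rparr>" by unfold_locales (rule G_rep_restrict[OF assms(2)])
  show ?thesis using subrepD[OF assms(1)] assms(3) by (intro N.subrepI) auto
qed

section \<open>Quotients by subrepresentations\<close>

lemma coset_eq_iff:
  assumes "subrep W M" "v \<in> carrier M" "w \<in> carrier M"
  shows "W +> v = W +> w \<longleftrightarrow> v \<ominus> w \<in> W"
proof -
  note W = subrepD[OF assms(1)]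
  show ?thesis
  proof
    assume eq: "W +> v = W +> w"
    have "v \<in> W +> v" using W(2) assms(2) by (auto simp: a_r_coset_def' intro!: bexI[of _ \<zero>])
    then obtain h where h: "h \<in> W" "v = h \<oplus> w" unfolding eq by (auto simp: a_r_coset_def')
    then show "v \<ominus> w \<in> W" using W(1) assms(3) by (simp add: minus_eq a_assoc r_neg subset_iff)
  next
    assume d: "v \<ominus> w \<in> W"
    have vw: "v = (v \<ominus> w) \<oplus> w" using assms by (simp add: minus_eq a_assoc l_neg)
    have "\<ominus> (v \<ominus> w) \<oplus> v = w \<oplus> (\<ominus> v \<oplus> v)" using assms by (simp add: minus_eq minus_add a_ac)
    then have wv: "\<ominus> (v \<ominus> w) \<oplus> v = w" using assms by (simp add: l_neg)
    have dc: "v \<ominus> w \<in> carrier M" using d W(1) by blast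
    have "h \<oplus> v = (h \<oplus> (v \<ominus> w)) \<oplus> w" if "h \<in> W" for h
      using a_assoc[of h "v \<ominus> w" w] that W(1) dc assms(3) vw by auto
    moreover have "h \<oplus> w = (h \<oplus> \<ominus> (v \<ominus> w)) \<oplus> v" if "h \<in> W" for h
      using a_assoc[of h "\<ominus> (v \<ominus> w)" v] that W(1) dc assms(2) wv by auto
    ultimately show "W +> v = W +> w"
      unfolding a_r_coset_def' using W(3)[OF _ d] W(3)[OF _ W(6)[OF d]] by (intro equalityI subsetI; blast)
  qed
qed

lemma coset_memI: "subrep W M \<Longrightarrow> v \<in> carrier M \<Longrightarrow> v \<in> W +> v"
  using subrepD(2) by (force simp: a_r_coset_def' intro!: bexI[of _ \<zero>])

lemma coset_memD:
  assumes "subrep W M" "v \<in> carrier M" "w \<in> W +> v"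
  shows "w \<in> carrier M" "W +> w = W +> v"
proof -
  note W = subrepD[OF assms(1)]
  obtain h where h: "h \<in> W" "w = h \<oplus> v" using assms(3) by (auto simp: a_r_coset_def')
  then show w: "w \<in> carrier M" using W(1) assms(2) by auto
  have "w \<ominus> v = h" using h W(1) assms(2) by (simp add: minus_eq a_assoc r_neg subset_iff)
  then show "W +> w = W +> v" using coset_eq_iff[OF assms(1) w assms(2)] h(1) by simp
qed

lemma quot_carrier: "carrier (rep_quot M W) = (\<lambda>v. W +> v) ` carrier M"
  by (auto simp: rep_quot_def A_RCOSETS_def' )

lemma quot_zero: "subrep W M \<Longrightarrow> \<zero>\<^bsub>rep_quot M W\<^esub> = W +> \<zero>"
  using subrepD(1)[of W] by (force simp: rep_quot_def a_r_coset_def')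

lemma quot_add:
  assumes "subrep W M" "v \<in> carrier M" "w \<in> carrier M"
  shows "(W +> v) \<oplus>\<^bsub>rep_quot M W\<^esub> (W +> w) = W +> (v \<oplus> w)"
proof -
  have "additive_subgroup W M" using assms(1) unfolding subrep_def submodule_def by (intro additive_subgroupI) blast
  moreover have "abelian_group M" using G_rep Module.module.axioms(2) unfolding G_rep_def by blast
  ultimately interpret abelian_subgroup W M by (rule abelian_subgroupI3)
  show ?thesis using a_rcos_sum[OF assms(2,3)] by (simp add: rep_quot_def)
qed

lemma quot_smult:
  assumes "subrep W M" "v \<in> carrier M"
  shows "c \<odot>\<^bsub>rep_quot M W\<^esub> (W +> v) = W +> (c \<odot> v)"
proof -
  have *: "W +> (c \<odot> w) = W +> (c \<odot> v)" if w: "w \<in> W +> v" for w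
  proof -
    note d = coset_memD[OF assms w]
    have "c \<odot> w \<ominus> c \<odot> v = c \<odot> (w \<ominus> v)"
      using d(1) assms(2) by (simp add: minus_eq smult_add_r flip: smult_neg1 smult_mult)
    moreover have "w \<ominus> v \<in> W" using coset_eq_iff[OF assms(1) d(1) assms(2)] d(2) by simp
    ultimately show ?thesis using d(1) assms subrepD(4)[OF assms(1)] by (simp add: coset_eq_iff)
  qed
  show ?thesis unfolding rep_quot_def by simp (rule UN_constant_eq[OF coset_memI[OF assms] ballI[OF *]])
qed

lemma quot_act:
  assumes "subrep W M" "v \<in> carrier M" "g \<in> GL2"
  shows "act (rep_quot M W) g (W +> v) = W +> (act M g v)"
proof -
  have *: "W +> (act M g w) = W +> (act M g v)" if w: "w \<in> W +> v" for w
  proof -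
    note d = coset_memD[OF assms(1,2) w]
    have "act M g w \<ominus> act M g v = act M g (w \<ominus> v)"
      using d(1) assms by (simp add: minus_eq act_add act_smult flip: smult_neg1)
    moreover have "w \<ominus> v \<in> W" using coset_eq_iff[OF assms(1) d(1) assms(2)] d(2) by simp
    ultimately show ?thesis using d(1) assms subrepD(5)[OF assms(1)] by (simp add: coset_eq_iff)
  qed
  show ?thesis unfolding rep_quot_def by simp (rule UN_constant_eq[OF coset_memI[OF assms(1,2)] ballI[OF *]])
qed

lemma G_rep_quot:
  assumes "subrep W M"
  shows "G_rep (rep_quot M W)"
  by (rule G_repI; (unfold quot_carrier)?; (elim imageE)?)
    (simp_all add: quot_zero quot_add quot_smult quot_act assms a_assoc smult_add smult_add_r smult_mult
      act_add act_smult act_mult, (simp add: a_comm)?)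

end

section \<open>Equivariant maps\<close>

locale G_map = M: G_representation M + N: G_representation N
  for M :: "('p::prime_card, 'v) rep" and N :: "('p, 'w) rep" +
  fixes f :: "'v \<Rightarrow> 'w"
  assumes equi: "G_equivariant M N f"
begin

lemma closed [simp, intro]: "v \<in> carrier M \<Longrightarrow> f v \<in> carrier N"
  using equi by (auto simp: G_equivariant_def)

lemma add: "v \<in> carrier M \<Longrightarrow> w \<in> carrier M \<Longrightarrow> f (v \<oplus>\<^bsub>M\<^esub> w) = f v \<oplus>\<^bsub>N\<^esub> f w"
  using equi by (auto simp: G_equivariant_def)

lemma smult: "v \<in> carrier M \<Longrightarrow> f (c \<odot>\<^bsub>M\<^esub> v) = c \<odot>\<^bsub>N\<^esub> f v"
  using equi by (auto simp: G_equivariant_def)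

lemma act: "g \<in> GL2 \<Longrightarrow> v \<in> carrier M \<Longrightarrow> f (act M g v) = act N g (f v)"
  using equi by (auto simp: G_equivariant_def)

lemma zero [simp]: "f \<zero>\<^bsub>M\<^esub> = \<zero>\<^bsub>N\<^esub>"
  using smult[of "\<zero>\<^bsub>M\<^esub>" 0] by simp

lemma minus: "v \<in> carrier M \<Longrightarrow> w \<in> carrier M \<Longrightarrow> f (v \<ominus>\<^bsub>M\<^esub> w) = f v \<ominus>\<^bsub>N\<^esub> f w"
  by (simp add: M.minus_eq N.minus_eq add smult flip: M.smult_neg1 N.smult_neg1)

lemma subrep_image: "subrep W M \<Longrightarrow> subrep (f ` W) N"
proof (rule N.subrepI)
  assume W: "subrep W M"
  note W' = M.subrepD[OF W]
  show "f ` W \<subseteq> carrier N" using W'(1) by auto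
  show "\<zero>\<^bsub>N\<^esub> \<in> f ` W" using W'(2) zero by (metis imageI)
  show "v \<oplus>\<^bsub>N\<^esub> w \<in> f ` W" if "v \<in> f ` W" "w \<in> f ` W" for v w
    using that W'(1,3) by (auto simp: subset_iff simp flip: add)
  show "c \<odot>\<^bsub>N\<^esub> v \<in> f ` W" if "v \<in> f ` W" for c v
    using that W'(1,4) by (auto simp: subset_iff simp flip: smult)
  show "rep.act N g v \<in> f ` W" if "g \<in> GL2" "v \<in> f ` W" for g v
    using that W'(1,5) by (auto simp: subset_iff simp flip: act)
qed

lemma subrep_vimage: "subrep W N \<Longrightarrow> subrep {v \<in> carrier M. f v \<in> W} M"
  using N.subrepD[of W] by (intro M.subrepI) (auto simp: add smult act)

end

lemma rep_isoI:
  "G_rep M \<Longrightarrow> G_rep N \<Longrightarrow> G_equivariant M N f \<Longrightarrow> bij_betw f (carrier M) (carrier N) \<Longrightarrow> M \<cong>\<^sub>G N"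
  by (auto simp: rep_iso_def)

lemma G_equivariant_id: "G_equivariant M M (\<lambda>v. v)"
  by (auto simp: G_equivariant_def)

lemma G_equivariant_comp:
  "G_equivariant M N f \<Longrightarrow> G_equivariant N L g \<Longrightarrow> G_equivariant M L (\<lambda>v. g (f v))"
  by (auto simp: G_equivariant_def Pi_iff)

lemma rep_iso_refl: "G_rep M \<Longrightarrow> M \<cong>\<^sub>G M"
  by (rule rep_isoI[OF _ _ G_equivariant_id]) (auto simp: bij_betw_def)

lemma rep_iso_trans: "M \<cong>\<^sub>G N \<Longrightarrow> N \<cong>\<^sub>G L \<Longrightarrow> M \<cong>\<^sub>G L"
proof -
  assume "M \<cong>\<^sub>G N" "N \<cong>\<^sub>G L"
  then obtain f g where "G_rep M" "G_rep L" and f: "G_equivariant M N f" "bij_betw f (carrier M) (carrier N)"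
    and g: "G_equivariant N L g" "bij_betw g (carrier N) (carrier L)"
    by (auto simp: rep_iso_def)
  then show ?thesis
    using G_equivariant_comp[OF f(1) g(1)] bij_betw_trans[OF f(2) g(2)]
    by (intro rep_isoI) (auto simp: comp_def)
qed

text \<open>A surjection identifies the quotient by a full preimage with the quotient by the
  subrepresentation itself. The preimage enters through an equation for \<open>W\<close> because in
  the applications \<open>W\<close> is given independently: as a sum of two images, or as a step of
  a composition series.\<close>

lemma rep_quot_iso:
  assumes M: "G_rep M" and N: "G_rep N" and f: "G_equivariant M N f" "f ` carrier M = carrier N"
    and W': "subrep W' N" and W: "W = {v \<in> carrier M. f v \<in> W'}"
  shows "rep_quot M W \<cong>\<^sub>G rep_quot N W'"
proof -
  interpret G_map M N f by (intro G_map.intro G_map_axioms.intro G_representation.intro M N f(1))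
  have sW: "subrep W M" unfolding W by (rule subrep_vimage[OF W'])
  note N' = N.subrepD[OF W']
  \<comment> \<open>Any representative of the coset may be taken, since \<open>f\<close> maps
    differences in \<open>W\<close> into \<open>W'\<close>.\<close>
  define F where "F A = W' +>\<^bsub>N\<^esub> f (SOME v. v \<in> A)" for A
  have F: "F (W +>\<^bsub>M\<^esub> v) = W' +>\<^bsub>N\<^esub> f v" if v: "v \<in> carrier M" for v
  proof -
    have "(SOME w. w \<in> W +>\<^bsub>M\<^esub> v) \<in> W +>\<^bsub>M\<^esub> v" using M.coset_memI[OF sW v] by (rule someI)
    then obtain w where w: "w \<in> W +>\<^bsub>M\<^esub> v" "F (W +>\<^bsub>M\<^esub> v) = W' +>\<^bsub>N\<^esub> f w" unfolding F_def by blast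
    note d = M.coset_memD[OF sW v w(1)]
    have "w \<ominus>\<^bsub>M\<^esub> v \<in> W" using M.coset_eq_iff[OF sW d(1) v] d(2) by simp
    then have "f w \<ominus>\<^bsub>N\<^esub> f v \<in> W'" using d(1) v by (simp add: W minus)
    then show ?thesis using w(2) N.coset_eq_iff[OF W' closed[OF d(1)] closed[OF v]] by simp
  qed
  have inj: "inj_on F (carrier (rep_quot M W))"
  proof (rule inj_onI)
    fix A B assume "A \<in> carrier (rep_quot M W)" "B \<in> carrier (rep_quot M W)" and eq: "F A = F B"
    then obtain v w where v: "v \<in> carrier M" "A = W +>\<^bsub>M\<^esub> v" and w: "w \<in> carrier M" "B = W +>\<^bsub>M\<^esub> w"
      unfolding M.quot_carrier by blast
    have "f v \<ominus>\<^bsub>N\<^esub> f w \<in> W'" using eq v w F N.coset_eq_iff[OF W'] by simp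
    then have "v \<ominus>\<^bsub>M\<^esub> w \<in> W" using v w by (simp add: W minus M.minus_closed)
    then show "A = B" using v w M.coset_eq_iff[OF sW] by simp
  qed
  have "F ` carrier (rep_quot M W) = (\<lambda>v. W' +>\<^bsub>N\<^esub> f v) ` carrier M"
    unfolding M.quot_carrier image_image by (rule image_cong) (simp_all add: F)
  also have "\<dots> = carrier (rep_quot N W')"
    unfolding N.quot_carrier f(2)[symmetric] image_image ..
  finally have bij: "bij_betw F (carrier (rep_quot M W)) (carrier (rep_quot N W'))"
    using inj by (simp add: bij_betw_def)
  have "G_equivariant (rep_quot M W) (rep_quot N W') F"
    unfolding G_equivariant_def M.quot_carrier N.quot_carrier
    by (auto simp: F M.quot_add[OF sW] M.quot_smult[OF sW] M.quot_act[OF sW]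
        N.quot_add[OF W'] N.quot_smult[OF W'] N.quot_act[OF W'] add smult act)
  then show ?thesis
    using rep_isoI[OF M.G_rep_quot[OF sW] N.G_rep_quot[OF W'] _ bij] by blast
qed

section \<open>Twists and direct sums\<close>

lemma rep_twist_simps [simp]:
  "carrier (M \<otimes>\<^sub>G \<kappa>) = carrier M" "add (M \<otimes>\<^sub>G \<kappa>) = add M" "zero (M \<otimes>\<^sub>G \<kappa>) = zero M"
  "Module.smult (M \<otimes>\<^sub>G \<kappa>) = Module.smult M" "act (M \<otimes>\<^sub>G \<kappa>) g v = \<kappa> (det g) \<odot>\<^bsub>M\<^esub> act M g v"
  by (simp_all add: rep_twist_def)

lemma G_rep_twist:
  assumes M: "G_rep M" and mult: "\<And>x y. x \<noteq> 0 \<Longrightarrow> y \<noteq> 0 \<Longrightarrow> \<kappa> (x * y) = \<kappa> x * \<kappa> y" and "\<kappa> 1 = 1"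
  shows "G_rep (M \<otimes>\<^sub>G \<kappa>)"
proof -
  interpret G_representation M by unfold_locales (rule M)
  show ?thesis
    by (rule G_repI)
      (use assms(3) in \<open>auto simp: a_ac smult_add smult_add_r act_add act_smult act_mult GL2_iff_det
        det_mul mult simp flip: smult_mult\<close>, simp_all add: mult_ac)
qed

lemma rep_iso_twist:
  assumes iso: "M \<cong>\<^sub>G N" and mult: "\<And>x y. x \<noteq> 0 \<Longrightarrow> y \<noteq> 0 \<Longrightarrow> \<kappa> (x * y) = \<kappa> x * \<kappa> y" and "\<kappa> 1 = 1"
  shows "M \<otimes>\<^sub>G \<kappa> \<cong>\<^sub>G N \<otimes>\<^sub>G \<kappa>"
proof -
  obtain f where MN: "G_rep M" "G_rep N" and f: "G_equivariant M N f" "bij_betw f (carrier M) (carrier N)"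
    using iso by (auto simp: rep_iso_def)
  interpret G_map M N f by (intro G_map.intro G_map_axioms.intro G_representation.intro MN f(1))
  have "G_equivariant (M \<otimes>\<^sub>G \<kappa>) (N \<otimes>\<^sub>G \<kappa>) f"
    unfolding G_equivariant_def by (auto simp: add smult act)
  then show ?thesis
    using rep_isoI[OF G_rep_twist[OF MN(1) mult assms(3)] G_rep_twist[OF MN(2) mult assms(3)]] f(2) by simp
qed

lemma rep_prod_simps [simp]:
  "carrier (M \<oplus>\<^sub>G N) = carrier M \<times> carrier N" "\<zero>\<^bsub>M \<oplus>\<^sub>G N\<^esub> = (\<zero>\<^bsub>M\<^esub>, \<zero>\<^bsub>N\<^esub>)"
  "x \<oplus>\<^bsub>M \<oplus>\<^sub>G N\<^esub> y = (fst x \<oplus>\<^bsub>M\<^esub> fst y, snd x \<oplus>\<^bsub>N\<^esub> snd y)"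
  "c \<odot>\<^bsub>M \<oplus>\<^sub>G N\<^esub> x = (c \<odot>\<^bsub>M\<^esub> fst x, c \<odot>\<^bsub>N\<^esub> snd x)" "act (M \<oplus>\<^sub>G N) g x = (act M g (fst x), act N g (snd x))"
  by (simp_all add: rep_prod_def)

lemma G_rep_prod:
  assumes "G_rep M" "G_rep N"
  shows "G_rep (M \<oplus>\<^sub>G N)"
proof -
  interpret M: G_representation M by unfold_locales (rule assms)
  interpret N: G_representation N by unfold_locales (rule assms)
  show ?thesis
    by (rule G_repI) (auto simp: M.a_ac N.a_ac M.smult_add N.smult_add M.smult_add_r
      N.smult_add_r M.smult_mult N.smult_mult M.act_add N.act_add M.act_smult N.act_smult M.act_mult N.act_mult)
qed

lemma rep_iso_prod:
  assumes "M \<cong>\<^sub>G M'" "N \<cong>\<^sub>G N'"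
  shows "M \<oplus>\<^sub>G N \<cong>\<^sub>G M' \<oplus>\<^sub>G N'"
proof -
  obtain f where f: "G_rep M" "G_rep M'" "G_equivariant M M' f" "bij_betw f (carrier M) (carrier M')"
    using assms(1) by (auto simp: rep_iso_def)
  obtain g where g: "G_rep N" "G_rep N'" "G_equivariant N N' g" "bij_betw g (carrier N) (carrier N')"
    using assms(2) by (auto simp: rep_iso_def)
  have "G_equivariant (M \<oplus>\<^sub>G N) (M' \<oplus>\<^sub>G N') (map_prod f g)"
    using f(3) g(3) unfolding G_equivariant_def by (auto simp: Pi_iff)
  moreover have "bij_betw (map_prod f g) (carrier (M \<oplus>\<^sub>G N)) (carrier (M' \<oplus>\<^sub>G N'))"
    using f(4) g(4) unfolding bij_betw_def by (auto intro: map_prod_inj_on simp: map_prod_surj_on)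
  ultimately show ?thesis using rep_isoI[OF G_rep_prod[OF f(1) g(1)] G_rep_prod[OF f(2) g(2)]] by blast
qed

lemma rep_dsum_simps [simp]:
  "carrier (rep_dsum J M) = (\<Pi>\<^sub>E i\<in>J. carrier (M i))" "\<zero>\<^bsub>rep_dsum J M\<^esub> = (\<lambda>i\<in>J. \<zero>\<^bsub>M i\<^esub>)"
  "x \<oplus>\<^bsub>rep_dsum J M\<^esub> y = (\<lambda>i\<in>J. x i \<oplus>\<^bsub>M i\<^esub> y i)" "c \<odot>\<^bsub>rep_dsum J M\<^esub> x = (\<lambda>i\<in>J. c \<odot>\<^bsub>M i\<^esub> x i)"
  "act (rep_dsum J M) g x = (\<lambda>i\<in>J. act (M i) g (x i))"
  by (simp_all add: rep_dsum_def)

lemma G_rep_dsum: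
  assumes "\<And>i. i \<in> J \<Longrightarrow> G_rep (M i)"
  shows "G_rep (rep_dsum J M)"
proof -
  have *: "G_representation (M i)" if "i \<in> J" for i by unfold_locales (rule assms[OF that])
  have F: "Fpbar_module (M i)" if "i \<in> J" for i
    using assms[OF that] unfolding G_rep_def Fpbar_module_def by blast
  have ag: "abelian_group (M i)" if "i \<in> J" for i
    using assms[OF that] Module.module.axioms(2) unfolding G_rep_def by blast
  note ops = Fpbar_module.smult_add[OF F] Fpbar_module.smult_add_r[OF F] Fpbar_module.smult_mult[OF F]
    G_representation.act_add[OF *] G_representation.act_smult[OF *] G_representation.act_mult[OF *]
    Fpbar_module.smult_1[OF F] Fpbar_module.smult_0[OF F] G_representation.act_one[OF *]
    Fpbar_module.smult_clo[OF F] G_representation.act_closed[OF *]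
    abelian_monoid.a_closed[OF abelian_group.axioms(1)[OF ag]] abelian_monoid.zero_closed[OF abelian_group.axioms(1)[OF ag]]
    abelian_monoid.l_zero[OF abelian_group.axioms(1)[OF ag]]
  show ?thesis
  proof (rule G_repI)
    show "u \<oplus>\<^bsub>rep_dsum J M\<^esub> v \<oplus>\<^bsub>rep_dsum J M\<^esub> w = u \<oplus>\<^bsub>rep_dsum J M\<^esub> (v \<oplus>\<^bsub>rep_dsum J M\<^esub> w)"
      if "u \<in> carrier (rep_dsum J M)" "v \<in> carrier (rep_dsum J M)" "w \<in> carrier (rep_dsum J M)" for u v w
      using that by (auto simp: fun_eq_iff PiE_iff restrict_def abelian_monoid.a_assoc[OF abelian_group.axioms(1)[OF ag]])
    show "v \<oplus>\<^bsub>rep_dsum J M\<^esub> w = w \<oplus>\<^bsub>rep_dsum J M\<^esub> v"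
      if "v \<in> carrier (rep_dsum J M)" "w \<in> carrier (rep_dsum J M)" for v w
      using that by (auto simp: fun_eq_iff PiE_iff restrict_def abelian_monoid.a_comm[OF abelian_group.axioms(1)[OF ag]])
  qed (auto simp: fun_eq_iff PiE_iff restrict_def extensional_def ops)
qed

lemma rep_iso_dsum:
  assumes "\<And>i. i \<in> J \<Longrightarrow> M i \<cong>\<^sub>G N i"
  shows "rep_dsum J M \<cong>\<^sub>G rep_dsum J N"
proof -
  have "\<forall>i\<in>J. \<exists>f. G_equivariant (M i) (N i) f \<and> bij_betw f (carrier (M i)) (carrier (N i))"
    using assms by (auto simp: rep_iso_def)
  then obtain f where f: "\<And>i. i \<in> J \<Longrightarrow> G_equivariant (M i) (N i) (f i)"
      "\<And>i. i \<in> J \<Longrightarrow> bij_betw (f i) (carrier (M i)) (carrier (N i))"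
    by metis
  define F where "F x = (\<lambda>i\<in>J. f i (x i))" for x
  have "G_equivariant (rep_dsum J M) (rep_dsum J N) F"
    using f(1) unfolding G_equivariant_def F_def by (auto simp: PiE_iff fun_eq_iff restrict_def Pi_iff extensional_def)
  moreover have "bij_betw F (carrier (rep_dsum J M)) (carrier (rep_dsum J N))"
  proof (rule bij_betwI[where g = "\<lambda>y. \<lambda>i\<in>J. inv_into (carrier (M i)) (f i) (y i)"])
    show "F \<in> carrier (rep_dsum J M) \<rightarrow> carrier (rep_dsum J N)"
      using f(2) unfolding F_def by (fastforce simp: PiE_iff bij_betw_def)
    show "(\<lambda>y. \<lambda>i\<in>J. inv_into (carrier (M i)) (f i) (y i)) \<in> carrier (rep_dsum J N) \<rightarrow> carrier (rep_dsum J M)"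
      using f(2) by (auto simp: PiE_iff bij_betw_def intro!: inv_into_into)
    show "(\<lambda>i\<in>J. inv_into (carrier (M i)) (f i) (F x i)) = x" if "x \<in> carrier (rep_dsum J M)" for x
      using that f(2) unfolding F_def
      by (auto simp: PiE_iff bij_betw_def fun_eq_iff restrict_def extensional_def inv_into_f_f)
    show "F (\<lambda>i\<in>J. inv_into (carrier (M i)) (f i) (y i)) = y" if "y \<in> carrier (rep_dsum J N)" for y
      using that f(2) unfolding F_def
      by (auto simp: PiE_iff bij_betw_def fun_eq_iff restrict_def extensional_def intro!: f_inv_into_f)
  qed
  ultimately show ?thesis
    using assms by (intro rep_isoI[OF G_rep_dsum G_rep_dsum]) (auto simp: rep_iso_def)
qed

section \<open>Transport of semi-simplifications along isomorphisms\<close>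

lemma irreducible_rep_iso:
  assumes iso: "M \<cong>\<^sub>G N" and irr: "irreducible_rep M"
  shows "irreducible_rep N"
proof -
  obtain f where MN: "G_rep M" "G_rep N" and f: "G_equivariant M N f" "bij_betw f (carrier M) (carrier N)"
    using iso by (auto simp: rep_iso_def)
  interpret G_map M N f by (intro G_map.intro G_map_axioms.intro G_representation.intro MN f(1))
  have im: "f ` carrier M = carrier N" and inj: "inj_on f (carrier M)" using f(2) by (auto simp: bij_betw_def)
  show ?thesis
    unfolding irreducible_rep_def
  proof (intro conjI allI impI)
    show "carrier N \<noteq> {\<zero>\<^bsub>N\<^esub>}"
    proof
      assume N0: "carrier N = {\<zero>\<^bsub>N\<^esub>}"
      have "v = \<zero>\<^bsub>M\<^esub>" if "v \<in> carrier M" for v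
        using closed[OF that] N0 inj that by (simp add: inj_on_def)
      then have "carrier M = {\<zero>\<^bsub>M\<^esub>}" using M.zero_closed by blast
      then show False using irr by (simp add: irreducible_rep_def)
    qed
    fix W assume W: "subrep W N"
    let ?V = "{v \<in> carrier M. f v \<in> W}"
    have fV: "f ` ?V = W" using im N.subrepD(1)[OF W] by auto
    have "?V = {\<zero>\<^bsub>M\<^esub>} \<or> ?V = carrier M"
      using subrep_vimage[OF W] irr unfolding irreducible_rep_def by blast
    then show "W = {\<zero>\<^bsub>N\<^esub>} \<or> W = carrier N"
      using fV im zero by (metis (no_types, lifting) image_empty image_insert)
  qed
qed

text \<open>Pushing a composition series of \<open>M\<close> forward gives one of \<open>M'\<close>
  with isomorphic factors. Their sum \<open>N'\<close> is produced because \<open>breuil_LL\<close>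
  asks for semi-simplifications on one specific type, while \<open>N\<close> may live on
  any.\<close>

lemma semisimplification_iso:
  fixes M :: "('p::prime_card, 'v) rep" and M' :: "('p, 'w) rep" and N :: "('p, 'u) rep"
  assumes iso: "M \<cong>\<^sub>G M'" and ss: "semisimplification M N"
  shows "\<exists>N' :: ('p, nat \<Rightarrow> 'w set) rep. semisimplification M' N' \<and> N \<cong>\<^sub>G N'"
proof -
  obtain f where MN: "G_rep M" "G_rep M'" and f: "G_equivariant M M' f" "bij_betw f (carrier M) (carrier M')"
    using iso by (auto simp: rep_iso_def)
  interpret G_map M M' f by (intro G_map.intro G_map_axioms.intro G_representation.intro MN f(1))
  have im: "f ` carrier M = carrier M'" and inj: "inj_on f (carrier M)" using f(2) by (auto simp: bij_betw_def)
  obtain n F where cs: "composition_series M n F" and N: "N \<cong>\<^sub>G rep_dsum {..<n} (\<lambda>i. subquot M (F (Suc i)) (F i))"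
    using ss by (auto simp: semisimplification_def)
  have sub: "subrep (F i) M" if "i \<le> n" for i using cs that by (simp add: composition_series_def)
  define F' where "F' i = f ` F i" for i
  have sub': "subrep (F' i) M'" if "i \<le> n" for i unfolding F'_def by (rule subrep_image[OF sub[OF that]])
  have sq: "subquot M (F (Suc i)) (F i) \<cong>\<^sub>G subquot M' (F' (Suc i)) (F' i)" if i: "i < n" for i
    unfolding subquot_def
  proof (rule rep_quot_iso[where f = f])
    have le: "i \<le> n" "Suc i \<le> n" and FF: "F i \<subseteq> F (Suc i)" using i cs by (auto simp: composition_series_def)
    note S = M.subrepD(1)[OF sub[OF le(1)]] M.subrepD(1)[OF sub[OF le(2)]]
    show "G_rep (M\<lparr>carrier := F (Suc i)\<rparr>)" by (rule M.G_rep_restrict[OF sub[OF le(2)]])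
    show "G_rep (M'\<lparr>carrier := F' (Suc i)\<rparr>)" by (rule N.G_rep_restrict[OF sub'[OF le(2)]])
    show "G_equivariant (M\<lparr>carrier := F (Suc i)\<rparr>) (M'\<lparr>carrier := F' (Suc i)\<rparr>) f"
      using S(2) unfolding G_equivariant_def F'_def by (auto simp: add smult act subset_iff)
    show "f ` carrier (M\<lparr>carrier := F (Suc i)\<rparr>) = carrier (M'\<lparr>carrier := F' (Suc i)\<rparr>)" by (simp add: F'_def)
    show "subrep (F' i) (M'\<lparr>carrier := F' (Suc i)\<rparr>)"
      by (rule N.subrep_restrict[OF sub'[OF le(1)] sub'[OF le(2)]]) (use FF in \<open>auto simp: F'_def\<close>)
    \<comment> \<open>Injectivity of \<open>f\<close> makes \<open>F i\<close> the full preimage of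
      its image, as \<open>rep_quot_iso\<close> requires.\<close>
    show "F i = {v \<in> carrier (M\<lparr>carrier := F (Suc i)\<rparr>). f v \<in> F' i}"
    proof -
      have "f v \<in> F' i \<longleftrightarrow> v \<in> F i" if "v \<in> F (Suc i)" for v
        unfolding F'_def using inj_on_image_mem_iff[OF inj _ S(1), of v] S(2) that by blast
      then show ?thesis using FF by auto
    qed
  qed
  have cs': "composition_series M' n F'"
    unfolding composition_series_def
  proof (intro conjI allI impI)
    show "F' 0 = {\<zero>\<^bsub>M'\<^esub>}" "F' n = carrier M'" using cs im by (auto simp: composition_series_def F'_def)
    show "subrep (F' i) M'" if "i \<le> n" for i by (rule sub'[OF that])
    show "F' i \<subseteq> F' (Suc i)" if "i < n" for i
      unfolding F'_def by (rule image_mono) (use cs that in \<open>simp add: composition_series_def\<close>)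
    show "irreducible_rep (subquot M' (F' (Suc i)) (F' i))" if "i < n" for i
      using irreducible_rep_iso[OF sq[OF that]] cs that by (simp add: composition_series_def)
  qed
  let ?N' = "rep_dsum {..<n} (\<lambda>i. subquot M' (F' (Suc i)) (F' i))"
  have NN: "N \<cong>\<^sub>G ?N'" by (rule rep_iso_trans[OF N rep_iso_dsum]) (use sq in auto)
  moreover have "semisimplification M' ?N'"
  proof -
    have "G_rep ?N'" using NN by (simp add: rep_iso_def)
    from rep_iso_refl[OF this] show ?thesis unfolding semisimplification_def using cs' by blast
  qed
  ultimately show ?thesis by blast
qed

section \<open>Sums, scalars and images of endomorphisms\<close>

context G_representation
begin

lemma endo_add_equivariant:
  assumes "G_equivariant M M S" "G_equivariant M M T"
  shows "G_equivariant M M (endo_add M S T)"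
proof -
  interpret S: G_map M M S by (intro G_map.intro G_map_axioms.intro G_representation_axioms assms)
  interpret T: G_map M M T by (intro G_map.intro G_map_axioms.intro G_representation_axioms assms)
  show ?thesis
    unfolding G_equivariant_def endo_add_def
    by (auto simp: S.add T.add S.smult T.smult S.act T.act smult_add_r act_add a_ac)
qed

lemma endo_scalar_equivariant: "G_equivariant M M (endo_scalar M c)"
  unfolding G_equivariant_def endo_scalar_def
  by (auto simp: smult_add_r act_smult mult.commute simp flip: smult_mult)

lemma endo_minus_equivariant:
  assumes "G_equivariant M M S" "G_equivariant M M T"
  shows "G_equivariant M M (endo_minus M S T)"
proof -
  interpret T: G_map M M T by (intro G_map.intro G_map_axioms.intro G_representation_axioms assms)
  have "endo_minus M S T = endo_add M S (endo_scalar M (- 1) \<circ> T)"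
    by (rule ext) (simp add: endo_minus_def endo_add_def endo_scalar_def minus_eq smult_neg1 T.closed)
  then show ?thesis
    using endo_add_equivariant[OF assms(1)] G_equivariant_comp[OF assms(2) endo_scalar_equivariant]
    by (simp add: comp_def)
qed

lemma subrep_endo_image: "G_equivariant M M S \<Longrightarrow> subrep (endo_image M S) M"
proof -
  assume "G_equivariant M M S"
  then interpret S: G_map M M S by (intro G_map.intro G_map_axioms.intro G_representation_axioms)
  show ?thesis unfolding endo_image_def by (rule S.subrep_image[OF subrep_carrier])
qed

lemma set_add_mem: "x \<in> W <+> W' \<longleftrightarrow> (\<exists>v\<in>W. \<exists>w\<in>W'. x = v \<oplus> w)"
  by (auto simp: set_add_def')

end

text \<open>Stated for a bare additive map, since besides equivariant maps it is applied to the
  action of one group element, to evaluation at a point and to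
  \<open>P \<mapsto> [id, P]\<close>.\<close>

lemma finsum_additive_image:
  assumes M: "abelian_monoid M" and N: "abelian_monoid N"
    and F: "\<And>v. v \<in> carrier M \<Longrightarrow> F v \<in> carrier N" "F \<zero>\<^bsub>M\<^esub> = \<zero>\<^bsub>N\<^esub>"
      "\<And>v w. v \<in> carrier M \<Longrightarrow> w \<in> carrier M \<Longrightarrow> F (v \<oplus>\<^bsub>M\<^esub> w) = F v \<oplus>\<^bsub>N\<^esub> F w"
    and "finite A" "u \<in> A \<rightarrow> carrier M"
  shows "F (\<Oplus>\<^bsub>M\<^esub>i\<in>A. u i) = (\<Oplus>\<^bsub>N\<^esub>i\<in>A. F (u i))"
proof -
  interpret M: abelian_monoid M by (rule M)
  interpret N: abelian_monoid N by (rule N)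
  show ?thesis
    using assms(6,7)
  proof (induction A rule: finite_induct)
    case empty
    then show ?case by (simp add: F)
  next
    case (insert a A)
    then have u: "u \<in> A \<rightarrow> carrier M" "u a \<in> carrier M" by auto
    have "F (u a \<oplus>\<^bsub>M\<^esub> (\<Oplus>\<^bsub>M\<^esub>i\<in>A. u i)) = F (u a) \<oplus>\<^bsub>N\<^esub> F (\<Oplus>\<^bsub>M\<^esub>i\<in>A. u i)"
      using u by (intro F(3) M.finsum_closed)
    moreover have "(\<lambda>i. F (u i)) \<in> A \<rightarrow> carrier N" using u F(1) by auto
    ultimately show ?case using insert u F(1) by simp
  qed
qed

lemma (in G_map) finsum:
  assumes "finite A" "u \<in> A \<rightarrow> carrier M"
  shows "f (\<Oplus>\<^bsub>M\<^esub>i\<in>A. u i) = (\<Oplus>\<^bsub>N\<^esub>i\<in>A. f (u i))"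
  by (rule finsum_additive_image[OF M.abelian_monoid_axioms N.abelian_monoid_axioms closed zero add assms])

lemma (in G_representation) act_finsum:
  assumes "g \<in> GL2" "finite A" "u \<in> A \<rightarrow> carrier M"
  shows "act M g (\<Oplus>i\<in>A. u i) = (\<Oplus>i\<in>A. act M g (u i))"
  by (rule finsum_additive_image[OF abelian_monoid_axioms abelian_monoid_axioms])
    (use assms in \<open>auto simp: act_add\<close>)

section \<open>Frobenius reciprocity for compact induction\<close>

text \<open>Abstracts \<open>KZ\<close> and \<open>IZ\<close>, so that induction is treated once;
  the two inclusions feed \<open>compact_mod_center_iff\<close>.\<close>

locale open_subgroup =
  fixes H :: "'p::prime_card mat2 set"
  assumes IZ_sub: "IZ \<subseteq> H" and sub_KZ: "H \<subseteq> KZ"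
    and mult: "\<And>g h. g \<in> H \<Longrightarrow> h \<in> H \<Longrightarrow> g ** h \<in> H"
    and inv: "\<And>g. g \<in> H \<Longrightarrow> matrix_inv g \<in> H"
begin

lemma H_GL2: "h \<in> H \<Longrightarrow> h \<in> GL2"
  using sub_KZ KZ_GL2 by blast

lemma one [simp]: "mat 1 \<in> H"
  using IZ_sub I_sub_IZ[OF I_one] by blast

definition coset :: "'p mat2 \<Rightarrow> 'p mat2 set" where
  "coset x = (\<lambda>h. h ** x) ` H"

lemma coset_refl: "x \<in> coset x"
  unfolding coset_def by (rule image_eqI[of _ _ "mat 1"]) simp_all

lemma coset_GL2: "x \<in> GL2 \<Longrightarrow> y \<in> coset x \<Longrightarrow> y \<in> GL2"
  by (auto simp: coset_def H_GL2)

lemma coset_mem_iff: "x \<in> GL2 \<Longrightarrow> y \<in> coset x \<longleftrightarrow> y ** matrix_inv x \<in> H"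
proof
  assume x: "x \<in> GL2" "y ** matrix_inv x \<in> H"
  then have "y = (y ** matrix_inv x) ** x" by simp
  then show "y \<in> coset x" unfolding coset_def using x(2) by blast
qed (auto simp: coset_def)

lemma coset_eq:
  assumes "x \<in> GL2" "y \<in> coset x"
  shows "coset y = coset x"
proof -
  obtain h where h: "h \<in> H" "y = h ** x" using assms(2) by (auto simp: coset_def)
  have y: "y \<in> GL2" using coset_GL2[OF assms] .
  have "z ** matrix_inv y \<in> H \<longleftrightarrow> z ** matrix_inv x \<in> H" for z
  proof -
    have "z ** matrix_inv y = z ** matrix_inv x ** matrix_inv h" "z ** matrix_inv x = z ** matrix_inv y ** h"
      using h assms(1) H_GL2[OF h(1)] by (simp_all add: GL2_inv_mult matrix_mul_assoc)
    then show ?thesis using mult[OF _ h(1)] mult[OF _ inv[OF h(1)]] by metis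
  qed
  then show ?thesis using coset_mem_iff[OF y] coset_mem_iff[OF assms(1)] by blast
qed

lemma cmc_iff: "S \<subseteq> GL2 \<Longrightarrow> compact_mod_center S \<longleftrightarrow> finite (coset ` S)"
  unfolding coset_def[abs_def] by (rule compact_mod_center_iff[OF _ IZ_sub sub_KZ mult inv])

lemma coset_translate: "coset (x ** g) = (\<lambda>z. z ** g) ` coset x"
  by (simp add: coset_def image_image matrix_mul_assoc)

end

interpretation KZ: open_subgroup KZ
  by unfold_locales (auto intro: IZ_sub_KZ KZ_mult KZ_inv)

interpretation IZ: open_subgroup IZ
  by unfold_locales (auto intro: IZ_sub_KZ IZ_mult IZ_inv)

text \<open>Here \<open>\<sigma>\<close> is a representation of \<open>H\<close> only: the weights
  and characters do not in general extend to \<open>GL2\<close>, so \<open>G_rep\<close> would be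
  the wrong requirement.\<close>

locale induced = open_subgroup H + S: Fpbar_module \<sigma>
  for H :: "'p::prime_card mat2 set" and \<sigma> :: "('p, 'v) rep" +
  assumes act_closed: "\<And>h v. h \<in> H \<Longrightarrow> v \<in> carrier \<sigma> \<Longrightarrow> act \<sigma> h v \<in> carrier \<sigma>"
    and act_add: "\<And>h v w. h \<in> H \<Longrightarrow> v \<in> carrier \<sigma> \<Longrightarrow> w \<in> carrier \<sigma> \<Longrightarrow>
      act \<sigma> h (v \<oplus>\<^bsub>\<sigma>\<^esub> w) = act \<sigma> h v \<oplus>\<^bsub>\<sigma>\<^esub> act \<sigma> h w"
    and act_smult: "\<And>h c v. h \<in> H \<Longrightarrow> v \<in> carrier \<sigma> \<Longrightarrow> act \<sigma> h (c \<odot>\<^bsub>\<sigma>\<^esub> v) = c \<odot>\<^bsub>\<sigma>\<^esub> act \<sigma> h v"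
    and act_one: "\<And>v. v \<in> carrier \<sigma> \<Longrightarrow> act \<sigma> (mat 1) v = v"
    and act_mult: "\<And>g h v. g \<in> H \<Longrightarrow> h \<in> H \<Longrightarrow> v \<in> carrier \<sigma> \<Longrightarrow> act \<sigma> (g ** h) v = act \<sigma> g (act \<sigma> h v)"
begin

abbreviation "ind \<equiv> cind H \<sigma>"

text \<open>For an element of the induction the support is a union of cosets \<open>H x\<close> by
  equivariance, so it is recorded as a set of cosets; compactness modulo the center then becomes
  finiteness of this set.\<close>

definition supp :: "('p mat2 \<Rightarrow> 'v) \<Rightarrow> 'p mat2 set set" where
  "supp f = coset ` {x \<in> GL2. f x \<noteq> \<zero>\<^bsub>\<sigma>\<^esub>}"

lemma ind_simps [simp]:
  "\<zero>\<^bsub>ind\<^esub> = (\<lambda>x\<in>GL2. \<zero>\<^bsub>\<sigma>\<^esub>)" "f \<oplus>\<^bsub>ind\<^esub> f' = (\<lambda>x\<in>GL2. f x \<oplus>\<^bsub>\<sigma>\<^esub> f' x)"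
  "c \<odot>\<^bsub>ind\<^esub> f = (\<lambda>x\<in>GL2. c \<odot>\<^bsub>\<sigma>\<^esub> f x)" "act ind g f = (\<lambda>x\<in>GL2. f (x ** g))"
  by (simp_all add: cind_def)

lemma ind_carrier_iff:
  "f \<in> carrier ind \<longleftrightarrow> f \<in> extensional GL2 \<and> (\<forall>x\<in>GL2. f x \<in> carrier \<sigma>) \<and>
    (\<forall>h\<in>H. \<forall>x\<in>GL2. f (h ** x) = act \<sigma> h (f x)) \<and> finite (supp f)"
  by (auto simp: cind_def PiE_iff supp_def cmc_iff[of "{x \<in> GL2. f x \<noteq> \<zero>\<^bsub>\<sigma>\<^esub>}"])

lemma ind_ext: "f \<in> carrier ind \<Longrightarrow> f' \<in> carrier ind \<Longrightarrow> (\<And>x. x \<in> GL2 \<Longrightarrow> f x = f' x) \<Longrightarrow> f = f'"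
  unfolding ind_carrier_iff by (blast intro: extensionalityI)

lemma ind_closed: "f \<in> carrier ind \<Longrightarrow> x \<in> GL2 \<Longrightarrow> f x \<in> carrier \<sigma>"
  by (simp add: ind_carrier_iff)

lemma ind_equi: "f \<in> carrier ind \<Longrightarrow> h \<in> H \<Longrightarrow> x \<in> GL2 \<Longrightarrow> f (h ** x) = act \<sigma> h (f x)"
  by (simp add: ind_carrier_iff)

lemma act_zero: "h \<in> H \<Longrightarrow> act \<sigma> h \<zero>\<^bsub>\<sigma>\<^esub> = \<zero>\<^bsub>\<sigma>\<^esub>"
  using act_smult[of h "\<zero>\<^bsub>\<sigma>\<^esub>" 0] act_closed[of h "\<zero>\<^bsub>\<sigma>\<^esub>"] by simp

lemma supp_smult: "supp (\<lambda>x\<in>GL2. c \<odot>\<^bsub>\<sigma>\<^esub> f x) \<subseteq> supp f"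
  by (auto simp: supp_def)

lemma supp_add: "supp (\<lambda>x\<in>GL2. f x \<oplus>\<^bsub>\<sigma>\<^esub> f' x) \<subseteq> supp f \<union> supp f'"
  unfolding supp_def image_Un[symmetric] by (rule image_mono) auto

lemma supp_act: "g \<in> GL2 \<Longrightarrow> supp (\<lambda>x\<in>GL2. f (x ** g)) = (`) (\<lambda>z. z ** matrix_inv g) ` supp f"
proof -
  assume g: "g \<in> GL2"
  have "{x \<in> GL2. f (x ** g) \<noteq> \<zero>\<^bsub>\<sigma>\<^esub>} = (\<lambda>x. x ** matrix_inv g) ` {x \<in> GL2. f x \<noteq> \<zero>\<^bsub>\<sigma>\<^esub>}"
  proof (intro equalityI subsetI)
    fix x assume "x \<in> {x \<in> GL2. f (x ** g) \<noteq> \<zero>\<^bsub>\<sigma>\<^esub>}"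
    then show "x \<in> (\<lambda>x. x ** matrix_inv g) ` {x \<in> GL2. f x \<noteq> \<zero>\<^bsub>\<sigma>\<^esub>}"
      using g by (intro image_eqI[of _ _ "x ** g"]) auto
  qed (use g in \<open>auto simp: GL2_inv\<close>)
  moreover have "supp (\<lambda>x\<in>GL2. f (x ** g)) = coset ` {x \<in> GL2. f (x ** g) \<noteq> \<zero>\<^bsub>\<sigma>\<^esub>}"
    by (auto simp: supp_def)
  ultimately show ?thesis by (simp add: supp_def image_image coset_translate)
qed

lemma supp_zero: "supp (\<lambda>x\<in>GL2. \<zero>\<^bsub>\<sigma>\<^esub>) = {}"
  by (auto simp: supp_def)

lemma G_rep_ind: "G_rep ind"
proof (rule G_repI)
  show "\<zero>\<^bsub>ind\<^esub> \<in> carrier ind" by (simp add: ind_carrier_iff supp_zero H_GL2 act_zero)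
  show "v \<oplus>\<^bsub>ind\<^esub> w \<in> carrier ind" if "v \<in> carrier ind" "w \<in> carrier ind" for v w
    using that finite_subset[OF supp_add[of v w]] by (simp add: ind_carrier_iff H_GL2 act_add)
  show "c \<odot>\<^bsub>ind\<^esub> v \<in> carrier ind" if "v \<in> carrier ind" for c v
    using that finite_subset[OF supp_smult[of c v]] by (simp add: ind_carrier_iff H_GL2 act_smult)
  show "act ind g v \<in> carrier ind" if "g \<in> GL2" "v \<in> carrier ind" for g v
    using that by (simp add: ind_carrier_iff H_GL2 supp_act) (simp flip: matrix_mul_assoc)
qed (auto simp: ind_carrier_iff fun_eq_iff extensional_def S.a_ac S.smult_add S.smult_add_r S.smult_mult
  matrix_mul_assoc)

sublocale I: G_representation ind
  by unfold_locales (rule G_rep_ind)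

section \<open>The functions \<open>[g, v]\<close>\<close>

definition elem :: "'p mat2 \<Rightarrow> 'v \<Rightarrow> 'p mat2 \<Rightarrow> 'v" where
  "elem = elem_fun H \<sigma>"

lemma elem_apply: "x \<in> GL2 \<Longrightarrow> elem g v x = (if x ** g \<in> H then act \<sigma> (x ** g) v else \<zero>\<^bsub>\<sigma>\<^esub>)"
  by (simp add: elem_def elem_fun_def)

lemma supp_elem: "g \<in> GL2 \<Longrightarrow> supp (elem g v) \<subseteq> {coset (matrix_inv g)}"
proof -
  assume g: "g \<in> GL2"
  have "coset x = coset (matrix_inv g)" if "x \<in> GL2" "x ** g \<in> H" for x
  proof (rule coset_eq)
    show "x \<in> coset (matrix_inv g)"
      unfolding coset_def using that(2) g by (intro image_eqI[of _ _ "x ** g"]) simp_all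
  qed (use g GL2_inv in blast)
  then show ?thesis unfolding supp_def by (auto simp: elem_apply split: if_splits)
qed

lemma elem_closed [simp, intro]:
  assumes "g \<in> GL2" "v \<in> carrier \<sigma>"
  shows "elem g v \<in> carrier ind"
  unfolding ind_carrier_iff
proof (intro conjI ballI)
  show "elem g v \<in> extensional GL2" by (simp add: elem_def elem_fun_def)
  show "elem g v x \<in> carrier \<sigma>" if "x \<in> GL2" for x using that assms by (simp add: elem_apply act_closed)
  show "finite (supp (elem g v))" using finite_subset[OF supp_elem[OF assms(1)]] by simp
  fix h x :: "'p mat2" assume h: "h \<in> H" and x: "x \<in> GL2"
  have "h ** x ** g \<in> H \<longleftrightarrow> x ** g \<in> H"
  proof
    assume "h ** x ** g \<in> H"
    then have "matrix_inv h ** (h ** x ** g) \<in> H" using mult inv h by blast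
    then show "x ** g \<in> H" using H_GL2[OF h] by (simp flip: matrix_mul_assoc)
  qed (simp add: mult h flip: matrix_mul_assoc)
  then show "elem g v (h ** x) = act \<sigma> h (elem g v x)"
    using h x assms by (simp add: elem_apply H_GL2 act_zero) (simp add: act_mult flip: matrix_mul_assoc)
qed

lemma act_elem: "g \<in> GL2 \<Longrightarrow> g' \<in> GL2 \<Longrightarrow> act ind g' (elem g v) = elem (g' ** g) v"
  by (rule extensionalityI[of _ GL2])
    (simp_all add: elem_apply matrix_mul_assoc, simp add: elem_def elem_fun_def)

text \<open>The relation \<open>[g h, v] = [g, h v]\<close>; by it matrices are replaced by standard
  coset representatives in the later computations.\<close>

lemma elem_mult_right:
  assumes "g \<in> GL2" "h \<in> H" "v \<in> carrier \<sigma>"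
  shows "elem (g ** h) v = elem g (act \<sigma> h v)"
proof (rule ind_ext)
  fix x :: "'p mat2" assume x: "x \<in> GL2"
  have "x ** g ** h \<in> H \<longleftrightarrow> x ** g \<in> H"
  proof
    assume "x ** g ** h \<in> H"
    then have "x ** g ** h ** matrix_inv h \<in> H" using mult inv assms by blast
    then show "x ** g \<in> H" using H_GL2[OF assms(2)] by simp
  qed (simp add: mult assms)
  then show "elem (g ** h) v x = elem g (act \<sigma> h v) x"
    using x assms by (simp add: elem_apply matrix_mul_assoc act_mult)
qed (use assms in \<open>auto simp: H_GL2 act_closed\<close>)

lemma elem_smult: "g \<in> GL2 \<Longrightarrow> v \<in> carrier \<sigma> \<Longrightarrow> elem g (c \<odot>\<^bsub>\<sigma>\<^esub> v) = c \<odot>\<^bsub>ind\<^esub> elem g v"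
  by (rule ind_ext) (auto simp del: ind_simps intro!: I.smult_clo, auto simp: elem_apply act_smult)

lemma elem_add: "g \<in> GL2 \<Longrightarrow> v \<in> carrier \<sigma> \<Longrightarrow> w \<in> carrier \<sigma> \<Longrightarrow>
    elem g (v \<oplus>\<^bsub>\<sigma>\<^esub> w) = elem g v \<oplus>\<^bsub>ind\<^esub> elem g w"
  by (rule ind_ext) (auto simp del: ind_simps intro!: I.a_closed, auto simp: elem_apply act_add)

lemma ind_finsum_apply:
  assumes "finite A" "u \<in> A \<rightarrow> carrier ind" "x \<in> GL2"
  shows "(\<Oplus>\<^bsub>ind\<^esub>i\<in>A. u i) x = (\<Oplus>\<^bsub>\<sigma>\<^esub>i\<in>A. u i x)"
  by (rule finsum_additive_image[OF I.abelian_monoid_axioms S.abelian_monoid_axioms, where F = "\<lambda>f. f x"])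
    (use assms in \<open>auto simp: ind_closed\<close>)

definition rp :: "'p mat2 set \<Rightarrow> 'p mat2" where
  "rp C = (SOME x. x \<in> C)"

lemma rp:
  assumes "C \<in> coset ` GL2"
  shows "rp C \<in> C" "rp C \<in> GL2" "coset (rp C) = C"
proof -
  obtain x where x: "x \<in> GL2" "C = coset x" using assms by blast
  show 1: "rp C \<in> C" unfolding rp_def using coset_refl[of x] x(2) by (metis someI)
  show "rp C \<in> GL2" using coset_GL2 x 1 by blast
  show "coset (rp C) = C" using coset_eq x 1 by blast
qed

lemma supp_sub: "supp f \<subseteq> coset ` GL2"
  by (auto simp: supp_def)

lemma not_supp:
  assumes "f \<in> carrier ind" "x \<in> GL2" "coset x \<notin> supp f"
  shows "f x = \<zero>\<^bsub>\<sigma>\<^esub>"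
  using assms by (auto simp: supp_def)

text \<open>The summand for \<open>C\<close> is the restriction of \<open>f\<close> to the coset
  \<open>C\<close>, extended by zero, so at a given point at most one summand survives.\<close>

lemma ind_decomp:
  assumes f: "f \<in> carrier ind"
  shows "f = (\<Oplus>\<^bsub>ind\<^esub>C\<in>supp f. elem (matrix_inv (rp C)) (f (rp C)))"
proof (rule ind_ext)
  have fin: "finite (supp f)" using f by (simp add: ind_carrier_iff)
  note r = rp[OF subsetD[OF supp_sub]]
  have el: "(\<lambda>C. elem (matrix_inv (rp C)) (f (rp C))) \<in> supp f \<rightarrow> carrier ind"
    by (intro funcsetI elem_closed GL2_inv(1) ind_closed[OF f] r(2))
  then show "(\<Oplus>\<^bsub>ind\<^esub>C\<in>supp f. elem (matrix_inv (rp C)) (f (rp C))) \<in> carrier ind"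
    by (rule I.finsum_closed)
  fix x :: "'p mat2" assume x: "x \<in> GL2"
  have "elem (matrix_inv (rp C)) (f (rp C)) x = (if coset x = C then f x else \<zero>\<^bsub>\<sigma>\<^esub>)" if C: "C \<in> supp f" for C
  proof -
    note rC = r[OF C]
    have "x ** matrix_inv (rp C) \<in> H \<longleftrightarrow> coset x = C"
      using coset_mem_iff[OF rC(2), of x] coset_eq[OF rC(2), of x] coset_refl[of x] rC(3) by auto
    moreover have "act \<sigma> (x ** matrix_inv (rp C)) (f (rp C)) = f x" if "x ** matrix_inv (rp C) \<in> H"
      using ind_equi[OF f that rC(2)] rC(2) by simp
    ultimately show ?thesis using x by (simp add: elem_apply)
  qed
  then have "(\<Oplus>\<^bsub>\<sigma>\<^esub>C\<in>supp f. elem (matrix_inv (rp C)) (f (rp C)) x) =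
      (\<Oplus>\<^bsub>\<sigma>\<^esub>C\<in>supp f. if coset x = C then f x else \<zero>\<^bsub>\<sigma>\<^esub>)"
    using ind_closed[OF f x] by (intro S.finsum_cong') auto
  also have "\<dots> = f x"
  proof (cases "coset x \<in> supp f")
    case True
    then show ?thesis using S.finsum_singleton[OF True fin, of "\<lambda>_. f x"] ind_closed[OF f x] by simp
  next
    case False
    then have "(\<Oplus>\<^bsub>\<sigma>\<^esub>C\<in>supp f. if coset x = C then f x else \<zero>\<^bsub>\<sigma>\<^esub>) = (\<Oplus>\<^bsub>\<sigma>\<^esub>C\<in>supp f. \<zero>\<^bsub>\<sigma>\<^esub>)"
      by (intro S.finsum_cong') auto
    then show ?thesis using not_supp[OF f x False] by simp
  qed
  finally show "f x = (\<Oplus>\<^bsub>ind\<^esub>C\<in>supp f. elem (matrix_inv (rp C)) (f (rp C))) x"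
    by (simp add: ind_finsum_apply[OF fin el x])
qed (rule f)

text \<open>The translates of the functions \<open>[id, v]\<close> span the induction, so an
  equivariant map is determined by its values there.\<close>

lemma G_map_unique:
  assumes N: "G_rep N" and F: "G_equivariant ind N F" and F': "G_equivariant ind N F'"
    and eq: "\<And>v. v \<in> carrier \<sigma> \<Longrightarrow> F (elem (mat 1) v) = F' (elem (mat 1) v)" and f: "f \<in> carrier ind"
  shows "F f = F' f"
proof -
  interpret F: G_map ind N F by (intro G_map.intro G_map_axioms.intro G_representation.intro G_rep_ind N F)
  interpret F': G_map ind N F' by (intro G_map.intro G_map_axioms.intro G_representation.intro G_rep_ind N F')
  have fin: "finite (supp f)" using f by (simp add: ind_carrier_iff)
  note r = rp[OF subsetD[OF supp_sub]]
  have el: "(\<lambda>C. elem (matrix_inv (rp C)) (f (rp C))) \<in> supp f \<rightarrow> carrier ind"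
    by (intro funcsetI elem_closed GL2_inv(1) ind_closed[OF f] r(2))
  have e: "F (elem g v) = F' (elem g v)" if "g \<in> GL2" "v \<in> carrier \<sigma>" for g v
  proof -
    have "elem g v = act ind g (elem (mat 1) v)" using act_elem[of "mat 1" g v] that by simp
    then show ?thesis using F.act F'.act eq that by (metis GL2_one elem_closed)
  qed
  have "F f = (\<Oplus>\<^bsub>N\<^esub>C\<in>supp f. F (elem (matrix_inv (rp C)) (f (rp C))))"
    by (subst ind_decomp[OF f]) (rule F.finsum[OF fin el])
  also have "\<dots> = (\<Oplus>\<^bsub>N\<^esub>C\<in>supp f. F' (elem (matrix_inv (rp C)) (f (rp C))))"
    by (intro F.N.finsum_cong' refl e funcsetI F'.closed elem_closed GL2_inv(1) ind_closed[OF f] r(2))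
  also have "\<dots> = F' f"
    by (subst (3) ind_decomp[OF f]) (rule F'.finsum[OF fin el, symmetric])
  finally show ?thesis .
qed

text \<open>The map is the sum of \<open>x^(-1) \<phi>(f x)\<close> over the cosets
  \<open>H x\<close> in the support of \<open>f\<close>; the summand does not depend on the
  representative because \<open>\<phi>\<close> is \<open>H\<close>-equivariant
  (\<open>t_eq\<close>).\<close>

lemma frobenius_reciprocity:
  fixes N :: "('p, 'w) rep"
  assumes N: "G_rep N" and phi: "\<And>v. v \<in> carrier \<sigma> \<Longrightarrow> \<phi> v \<in> carrier N"
    "\<And>v w. v \<in> carrier \<sigma> \<Longrightarrow> w \<in> carrier \<sigma> \<Longrightarrow> \<phi> (v \<oplus>\<^bsub>\<sigma>\<^esub> w) = \<phi> v \<oplus>\<^bsub>N\<^esub> \<phi> w"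
    "\<And>c v. v \<in> carrier \<sigma> \<Longrightarrow> \<phi> (c \<odot>\<^bsub>\<sigma>\<^esub> v) = c \<odot>\<^bsub>N\<^esub> \<phi> v"
    "\<And>h v. h \<in> H \<Longrightarrow> v \<in> carrier \<sigma> \<Longrightarrow> \<phi> (act \<sigma> h v) = act N h (\<phi> v)"
  shows "\<exists>F. G_equivariant ind N F \<and> F \<in> extensional (carrier ind) \<and>
    (\<forall>v\<in>carrier \<sigma>. F (elem (mat 1) v) = \<phi> v)"
proof -
  interpret N: G_representation N by unfold_locales (rule N)
  define t where "t f C = act N (matrix_inv (rp C)) (\<phi> (f (rp C)))" for f C
  have phi0: "\<phi> \<zero>\<^bsub>\<sigma>\<^esub> = \<zero>\<^bsub>N\<^esub>" using phi(3)[of "\<zero>\<^bsub>\<sigma>\<^esub>" 0] phi(1) by simp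
  have t_eq: "t f (coset x) = act N (matrix_inv x) (\<phi> (f x))" if f: "f \<in> carrier ind" and x: "x \<in> GL2" for f x
  proof -
    let ?y = "rp (coset x)"
    have y: "?y \<in> coset x" "?y \<in> GL2" using rp[of "coset x"] x by auto
    then obtain h where h: "h \<in> H" "?y = h ** x" by (auto simp: coset_def)
    have "t f (coset x) = act N (matrix_inv (h ** x)) (act N h (\<phi> (f x)))"
      using ind_equi[OF f h(1) x] phi(4)[OF h(1) ind_closed[OF f x]] by (simp add: t_def h(2))
    also have "\<dots> = act N (matrix_inv (h ** x) ** h) (\<phi> (f x))"
      using h(1) x by (intro N.act_mult[symmetric] phi(1) ind_closed f) (auto simp: H_GL2 GL2_inv)
    also have "matrix_inv (h ** x) ** h = matrix_inv x" using x H_GL2[OF h(1)] by (simp add: GL2_inv_mult)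
    finally show ?thesis .
  qed
  have t_cl: "t f C \<in> carrier N" if f: "f \<in> carrier ind" and C: "C \<in> coset ` GL2" for f C
    using C t_eq[OF f] phi(1) ind_closed[OF f] by (auto intro!: N.act_closed simp: GL2_inv)
  have t_0: "t f C = \<zero>\<^bsub>N\<^esub>" if f: "f \<in> carrier ind" and C: "C \<in> coset ` GL2" "C \<notin> supp f" for f C
    using C t_eq[OF f] not_supp[OF f] phi0 by (auto simp: GL2_inv)
  define F where "F = (\<lambda>f\<in>carrier ind. \<Oplus>\<^bsub>N\<^esub>C\<in>supp f. t f C)"
  have fin: "finite (supp f)" if "f \<in> carrier ind" for f using that by (simp add: ind_carrier_iff)
  \<comment> \<open>The sum may be extended over any larger finite set of cosets. This gives
    functions with different supports a common index set in the proof of additivity.\<close>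
  have F_eq: "F f = (\<Oplus>\<^bsub>N\<^esub>C\<in>A. t f C)" if f: "f \<in> carrier ind" and A: "finite A" "supp f \<subseteq> A" "A \<subseteq> coset ` GL2" for f A
  proof -
    have "(\<Oplus>\<^bsub>N\<^esub>C\<in>supp f. t f C) = (\<Oplus>\<^bsub>N\<^esub>C\<in>A. t f C)"
      using A t_cl[OF f] t_0[OF f] by (intro N.add.finprod_mono_neutral_cong_left) (auto simp: subset_iff)
    then show ?thesis using f by (simp add: F_def)
  qed
  have Fcl: "F f \<in> carrier N" if f: "f \<in> carrier ind" for f
    using f t_cl[OF f] supp_sub[of f] by (auto simp: F_def intro!: N.finsum_closed)
  have "G_equivariant ind N F"
    unfolding G_equivariant_def
  proof (intro conjI ballI allI)
    show "F \<in> carrier ind \<rightarrow> carrier N" using Fcl by blast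
    show "F (v \<oplus>\<^bsub>ind\<^esub> w) = F v \<oplus>\<^bsub>N\<^esub> F w" if v: "v \<in> carrier ind" and w: "w \<in> carrier ind" for v w
    proof -
      let ?A = "supp v \<union> supp w"
      have A: "finite ?A" "?A \<subseteq> coset ` GL2" using fin v w supp_sub by blast+
      have "supp (v \<oplus>\<^bsub>ind\<^esub> w) \<subseteq> ?A" using supp_add by simp
      then have "F (v \<oplus>\<^bsub>ind\<^esub> w) = (\<Oplus>\<^bsub>N\<^esub>C\<in>?A. t (v \<oplus>\<^bsub>ind\<^esub> w) C)"
        using F_eq[OF I.a_closed[OF v w] A(1) _ A(2)] by blast
      also have "\<dots> = (\<Oplus>\<^bsub>N\<^esub>C\<in>?A. t v C \<oplus>\<^bsub>N\<^esub> t w C)"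
      proof (rule N.finsum_cong')
        show "t (v \<oplus>\<^bsub>ind\<^esub> w) C = t v C \<oplus>\<^bsub>N\<^esub> t w C" if "C \<in> ?A" for C
        proof -
          have r: "rp C \<in> GL2" using rp(2) that A(2) by blast
          then show ?thesis
            using ind_closed[OF v r] ind_closed[OF w r] by (simp add: t_def phi GL2_inv N.act_add)
        qed
      qed (use A t_cl v w in auto)
      also have "\<dots> = (\<Oplus>\<^bsub>N\<^esub>C\<in>?A. t v C) \<oplus>\<^bsub>N\<^esub> (\<Oplus>\<^bsub>N\<^esub>C\<in>?A. t w C)"
        using A t_cl v w by (intro N.finsum_addf) blast+
      finally show ?thesis using F_eq[OF v A(1) _ A(2)] F_eq[OF w A(1) _ A(2)] by simp
    qed
    show "F (c \<odot>\<^bsub>ind\<^esub> v) = c \<odot>\<^bsub>N\<^esub> F v" if v: "v \<in> carrier ind" for c v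
    proof -
      have A: "finite (supp v)" "supp v \<subseteq> coset ` GL2" using fin v supp_sub by blast+
      have "supp (c \<odot>\<^bsub>ind\<^esub> v) \<subseteq> supp v" using supp_smult by simp
      then have "F (c \<odot>\<^bsub>ind\<^esub> v) = (\<Oplus>\<^bsub>N\<^esub>C\<in>supp v. t (c \<odot>\<^bsub>ind\<^esub> v) C)"
        using F_eq[OF I.smult_clo[OF v] A(1) _ A(2)] by blast
      also have "\<dots> = (\<Oplus>\<^bsub>N\<^esub>C\<in>supp v. c \<odot>\<^bsub>N\<^esub> t v C)"
      proof (rule N.finsum_cong')
        show "t (c \<odot>\<^bsub>ind\<^esub> v) C = c \<odot>\<^bsub>N\<^esub> t v C" if "C \<in> supp v" for C
        proof -
          have r: "rp C \<in> GL2" using rp(2) that A(2) by blast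
          then show ?thesis
            using ind_closed[OF v r] by (simp add: t_def phi GL2_inv N.act_smult)
        qed
      qed (use A t_cl v in auto)
      also have "\<dots> = c \<odot>\<^bsub>N\<^esub> (\<Oplus>\<^bsub>N\<^esub>C\<in>supp v. t v C)"
        using A t_cl v by (intro N.finsum_smult_ldistr[symmetric]) auto
      finally show ?thesis using F_eq[OF v A(1) _ A(2)] by simp
    qed
    show "F (act ind g v) = act N g (F v)" if g: "g \<in> GL2" and v: "v \<in> carrier ind" for g v
    proof -
      \<comment> \<open>The action of \<open>g\<close> moves the support by right multiplication
        with the inverse of \<open>g\<close>, and the summands correspond under this
        bijection.\<close>
      let ?r = "\<lambda>C. (\<lambda>z. z ** matrix_inv g) ` C"
      have A: "finite (supp v)" "supp v \<subseteq> coset ` GL2" using fin v supp_sub by blast+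
      have gv: "act ind g v \<in> carrier ind" by (rule I.act_closed[OF g v])
      have sp: "supp (act ind g v) = ?r ` supp v" using supp_act[OF g] by simp
      have inj: "inj_on ?r (supp v)"
        by (rule inj_on_inverseI[where g = "\<lambda>C. (\<lambda>z. z ** g) ` C"]) (simp add: image_image g)
      have tg: "t (act ind g v) (?r C) = act N g (t v C)" if C: "C \<in> supp v" for C
      proof -
        obtain x where x: "x \<in> GL2" "C = coset x" using C A(2) by blast
        let ?x = "x ** matrix_inv g"
        have gx: "?x \<in> GL2" "matrix_inv ?x = g ** matrix_inv x"
          using x g by (simp_all add: GL2_inv GL2_inv_mult)
            (metis GL2_inv GL2_inv_unique)
        have "t (act ind g v) (coset ?x) = act N (matrix_inv ?x) (\<phi> (act ind g v ?x))"
          by (rule t_eq[OF gv gx(1)])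
        also have "act ind g v ?x = v x" using gx(1) g by simp
        also have "act N (matrix_inv ?x) (\<phi> (v x)) = act N g (act N (matrix_inv x) (\<phi> (v x)))"
          unfolding gx(2) using g x by (intro N.act_mult phi(1) ind_closed v) (auto simp: GL2_inv)
        finally show ?thesis by (simp only: x(2) coset_translate t_eq[OF v x(1)])
      qed
      have "F (act ind g v) = (\<Oplus>\<^bsub>N\<^esub>C\<in>?r ` supp v. t (act ind g v) C)"
        using gv sp by (simp add: F_def del: ind_simps)
      also have "\<dots> = (\<Oplus>\<^bsub>N\<^esub>C\<in>supp v. t (act ind g v) (?r C))"
      proof (rule N.finsum_reindex[OF funcsetI inj])
        show "t (act ind g v) C \<in> carrier N" if "C \<in> ?r ` supp v" for C
          using that supp_sub[of "act ind g v"] unfolding sp by (intro t_cl[OF gv]) (rule subsetD)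
      qed
      also have "\<dots> = (\<Oplus>\<^bsub>N\<^esub>C\<in>supp v. act N g (t v C))"
        using tg t_cl[OF v] A(2) g by (intro N.finsum_cong') auto
      also have "\<dots> = act N g (\<Oplus>\<^bsub>N\<^esub>C\<in>supp v. t v C)"
        using t_cl[OF v] A by (intro N.act_finsum[symmetric] g) auto
      also have "\<dots> = act N g (F v)" using v by (simp add: F_def)
      finally show ?thesis .
    qed
  qed
  moreover have "F (elem (mat 1) v) = \<phi> v" if v: "v \<in> carrier \<sigma>" for v
  proof -
    have m1: "matrix_inv (mat 1 :: 'p mat2) = mat 1" by (rule GL2_inv_unique) simp_all
    have cl: "elem (mat 1) v \<in> carrier ind" using v by simp
    have "F (elem (mat 1) v) = (\<Oplus>\<^bsub>N\<^esub>C\<in>{coset (mat 1)}. t (elem (mat 1) v) C)"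
      using supp_elem[of "mat 1" v] m1 by (intro F_eq[OF cl]) auto
    also have "\<dots> = t (elem (mat 1) v) (coset (mat 1))"
      using t_cl[OF cl] by (simp add: N.finsum_insert)
    also have "\<dots> = \<phi> v"
      using v by (simp add: t_eq[OF cl] m1 elem_apply act_one phi)
    finally show ?thesis .
  qed
  ultimately show ?thesis by (intro exI[of _ F]) (auto simp: F_def)
qed

end

section \<open>Weights and Hecke operators\<close>

definition pev :: "'a::comm_ring_1 poly poly \<Rightarrow> 'a poly \<Rightarrow> 'a poly poly" where
  "pev u q = poly (map_poly const2 q) u"

lemma const2_hom [simp]: "const2 0 = 0" "const2 1 = 1"
  and const2_add: "const2 (a + b) = const2 a + const2 b"
  and const2_mult: "const2 (a * b) = const2 a * const2 b"
  and const2_minus: "const2 (- a) = - const2 a"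
  by (simp_all add: const2_def one_pCons)

lemma const2_power: "const2 (a ^ n) = const2 a ^ n"
  by (induction n) (simp_all add: const2_mult)

lemma const2_sum: "const2 (sum f A) = (\<Sum>i\<in>A. const2 (f i))"
  by (induction A rule: infinite_finite_induct) (simp_all add: const2_add)

lemma const2_eq_0_iff [simp]: "const2 a = 0 \<longleftrightarrow> a = 0"
  by (simp add: const2_def)

lemma pev_altdef: "pev u q = (\<Sum>i\<le>Polynomial.degree q. const2 (Polynomial.coeff q i) * u ^ i)"
proof -
  have "Polynomial.degree (map_poly const2 q) = Polynomial.degree q"
    by (rule degree_map_poly) simp
  then show ?thesis by (simp add: pev_def poly_altdef coeff_map_poly)
qed

lemma pev_0 [simp]: "pev u 0 = 0"
  by (simp add: pev_def)

lemma pev_pCons: "pev u (pCons a q) = const2 a + u * pev u q"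
proof -
  have "map_poly const2 (pCons a q) = pCons (const2 a) (map_poly const2 q)"
    by (rule poly_eqI) (simp add: coeff_map_poly coeff_pCons split: nat.split)
  then show ?thesis by (simp add: pev_def)
qed

lemma pev_add: "pev u (q + q') = pev u q + pev u q'"
proof -
  have "map_poly const2 (q + q') = map_poly const2 q + map_poly const2 q'"
    by (rule poly_eqI) (simp add: coeff_map_poly const2_add)
  then show ?thesis by (simp add: pev_def)
qed

lemma pev_smult: "pev u (Polynomial.smult a q) = const2 a * pev u q"
proof -
  have "map_poly const2 (Polynomial.smult a q) = Polynomial.smult (const2 a) (map_poly const2 q)"
    by (rule poly_eqI) (simp add: coeff_map_poly const2_mult)
  then show ?thesis by (simp add: pev_def)
qed

lemma pev_mult: "pev u (q * q') = pev u q * pev u q'"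
  by (induction q) (simp_all add: pev_pCons pev_add pev_smult mult_pCons_left algebra_simps)

text \<open>Exhibits the double sum as two nested evaluations, of the coefficients at
  \<open>u\<close> and then of the outer variable at \<open>v\<close>. Compatibility with sums and
  products is read off from this form.\<close>

lemma subst2_altdef: "subst2 P u v = poly (map_poly (pev u) P) v"
proof -
  have "Polynomial.degree (map_poly (pev u) P) \<le> Polynomial.degree P" by (rule degree_map_poly_le)
  then have "poly (map_poly (pev u) P) v =
      (\<Sum>j\<le>Polynomial.degree P. Polynomial.coeff (map_poly (pev u) P) j * v ^ j)"
    unfolding poly_altdef by (intro sum.mono_neutral_left) (auto simp: coeff_eq_0)
  then have "poly (map_poly (pev u) P) v = (\<Sum>j\<le>Polynomial.degree P. pev u (Polynomial.coeff P j) * v ^ j)"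
    by (simp add: coeff_map_poly)
  then show ?thesis
    by (simp add: subst2_def pev_altdef sum_distrib_right)
qed

lemma subst2_0 [simp]: "subst2 0 u v = 0"
  by (simp add: subst2_altdef)

lemma subst2_pCons: "subst2 (pCons q P) u v = pev u q + v * subst2 P u v"
proof -
  have "map_poly (pev u) (pCons q P) = pCons (pev u q) (map_poly (pev u) P)"
    by (rule poly_eqI) (simp add: coeff_map_poly coeff_pCons split: nat.split)
  then show ?thesis by (simp add: subst2_altdef)
qed

lemma subst2_add: "subst2 (P + Q) u v = subst2 P u v + subst2 Q u v"
proof -
  have "map_poly (pev u) (P + Q) = map_poly (pev u) P + map_poly (pev u) Q"
    by (rule poly_eqI) (simp add: coeff_map_poly pev_add)
  then show ?thesis by (simp add: subst2_altdef)
qed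

lemma subst2_smult: "subst2 (Polynomial.smult q P) u v = pev u q * subst2 P u v"
proof -
  have "map_poly (pev u) (Polynomial.smult q P) = Polynomial.smult (pev u q) (map_poly (pev u) P)"
    by (rule poly_eqI) (simp add: coeff_map_poly pev_mult)
  then show ?thesis by (simp add: subst2_altdef)
qed

lemma subst2_mult: "subst2 (P * Q) u v = subst2 P u v * subst2 Q u v"
  by (induction P) (simp_all add: subst2_pCons subst2_add subst2_smult mult_pCons_left algebra_simps)

lemma subst2_const [simp]: "subst2 (const2 c) u v = const2 c"
  by (simp add: const2_def subst2_pCons pev_pCons)

lemma subst2_1 [simp]: "subst2 1 u v = 1"
  using subst2_const[of 1 u v] by simp

lemma subst2_power: "subst2 (P ^ n) u v = subst2 P u v ^ n"
  by (induction n) (simp_all add: subst2_mult)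

lemma subst2_X [simp]: "subst2 varX u v = u"
  by (simp add: varX_def subst2_pCons pev_pCons)

lemma subst2_Y [simp]: "subst2 varY u v = v"
proof -
  have "pev u 1 = 1" using pev_pCons[of u 1 0] by (simp add: one_pCons)
  then show ?thesis by (simp add: varY_def subst2_pCons)
qed

lemma subst2_sum: "subst2 (sum f A) u v = (\<Sum>i\<in>A. subst2 (f i) u v)"
  by (induction A rule: infinite_finite_induct) (simp_all add: subst2_add)

lemma subst2_subst2: "subst2 (subst2 P u' v') u v = subst2 P (subst2 u' u v) (subst2 v' u v)"
  unfolding subst2_def[of P u' v'] subst2_def[of P "subst2 u' u v"]
  by (simp add: subst2_sum subst2_mult subst2_power)

text \<open>Singular matrices are included on purpose: \<open>T\<close> substitutes the reductions
  modulo \<open>p\<close> of matrices of determinant \<open>p\<close>.\<close>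

definition sv :: "'a \<Rightarrow> 'a \<Rightarrow> 'a \<Rightarrow> 'a \<Rightarrow> 'a poly poly \<Rightarrow> 'a::comm_ring_1 poly poly" where
  "sv a b c d P = subst2 P (const2 a * varX + const2 c * varY) (const2 b * varX + const2 d * varY)"

lemma sv_add: "sv a b c d (P + Q) = sv a b c d P + sv a b c d Q"
  and sv_mult: "sv a b c d (P * Q) = sv a b c d P * sv a b c d Q"
  and sv_const [simp]: "sv a b c d (const2 x) = const2 x"
  and sv_0 [simp]: "sv a b c d 0 = 0"
  and sv_power: "sv a b c d (P ^ n) = sv a b c d P ^ n"
  and sv_X: "sv a b c d varX = const2 a * varX + const2 c * varY"
  and sv_Y: "sv a b c d varY = const2 b * varX + const2 d * varY"
  by (simp_all add: sv_def subst2_add subst2_mult subst2_power)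

lemma sv_sv: "sv a b c d (sv a' b' c' d' P) = sv (a*a'+b*c') (a*b'+b*d') (c*a'+d*c') (c*b'+d*d') P"
  by (simp add: sv_def subst2_subst2 subst2_add subst2_mult const2_add const2_mult algebra_simps)

definition mono2 :: "nat \<Rightarrow> nat \<Rightarrow> 'a::comm_ring_1 poly poly" where
  "mono2 i j = varX ^ i * varY ^ j"

lemma coeff_const2_mult: "Polynomial.coeff (Polynomial.coeff (const2 c * P) j) i = c * Polynomial.coeff (Polynomial.coeff P j) i"
  by (simp add: const2_def)

lemma varY_power: "varY ^ n = Polynomial.monom 1 n"
  by (induction n) (simp_all add: varY_def monom_Suc flip: monom_0)

lemma varX_power: "varX ^ n = [:Polynomial.monom 1 n:]"
proof (induction n)
  case 0
  then show ?case by (simp add: monom_0 one_pCons)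
next
  case (Suc n)
  then show ?case by (simp add: varX_def monom_Suc)
qed

lemma mono2_eq: "mono2 i j = Polynomial.monom (Polynomial.monom 1 i) j"
  by (simp add: mono2_def varX_power varY_power smult_monom)

lemma coeff_mono2: "Polynomial.coeff (Polynomial.coeff (mono2 i j) j') i' = (if i = i' \<and> j = j' then 1 else 0)"
  by (simp add: mono2_eq)

lemma homogeneous2_expand:
  assumes "P \<in> homogeneous2 r"
  shows "P = (\<Sum>i\<le>r. const2 (Polynomial.coeff (Polynomial.coeff P (r - i)) i) * mono2 i (r - i))"
proof (rule poly_eqI, rule poly_eqI)
  fix j i
  have "Polynomial.coeff (Polynomial.coeff (\<Sum>k\<le>r. const2 (Polynomial.coeff (Polynomial.coeff P (r - k)) k) * mono2 k (r - k)) j) i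
     = (\<Sum>k\<le>r. if k = i \<and> r - k = j then Polynomial.coeff (Polynomial.coeff P (r - k)) k else 0)"
    by (simp add: coeff_sum coeff_const2_mult coeff_mono2 if_distrib cong: if_cong)
  also have "\<dots> = (\<Sum>k\<le>r. if k = i then (if r - i = j then Polynomial.coeff (Polynomial.coeff P (r - i)) i else 0) else 0)"
    by (intro sum.cong) auto
  also have "\<dots> = Polynomial.coeff (Polynomial.coeff P j) i"
  proof -
    have "Polynomial.coeff (Polynomial.coeff P j) i = 0" if "i + j \<noteq> r"
      using assms that unfolding homogeneous2_def by blast
    then show ?thesis by (auto simp: sum.delta)
  qed
  finally show "Polynomial.coeff (Polynomial.coeff P j) i = Polynomial.coeff (Polynomial.coeff
      (\<Sum>k\<le>r. const2 (Polynomial.coeff (Polynomial.coeff P (r - k)) k) * mono2 k (r - k)) j) i" by simp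
qed

lemma homogeneous2_0 [simp]: "0 \<in> homogeneous2 r"
  by (simp add: homogeneous2_def)

lemma homogeneous2_add: "P \<in> homogeneous2 r \<Longrightarrow> Q \<in> homogeneous2 r \<Longrightarrow> P + Q \<in> homogeneous2 r"
  unfolding homogeneous2_def by (auto simp: add_nonneg_eq_0_iff) (metis add.right_neutral)

lemma homogeneous2_sum: "(\<And>i. i \<in> A \<Longrightarrow> f i \<in> homogeneous2 r) \<Longrightarrow> sum f A \<in> homogeneous2 r"
  by (induction A rule: infinite_finite_induct) (auto intro: homogeneous2_add)

lemma homogeneous2_const: "P \<in> homogeneous2 r \<Longrightarrow> const2 c * P \<in> homogeneous2 r"
  unfolding homogeneous2_def by (auto simp: coeff_const2_mult dest: mult_not_zero)

lemma homogeneous2_mult: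
  assumes "P \<in> homogeneous2 m" "Q \<in> homogeneous2 n"
  shows "P * Q \<in> homogeneous2 (m + n)"
  unfolding homogeneous2_def
proof (intro CollectI allI impI)
  fix i j assume nz: "Polynomial.coeff (Polynomial.coeff (P * Q) j) i \<noteq> 0"
  have "Polynomial.coeff (Polynomial.coeff (P * Q) j) i = (\<Sum>k\<le>j. \<Sum>l\<le>i.
      Polynomial.coeff (Polynomial.coeff P k) l * Polynomial.coeff (Polynomial.coeff Q (j - k)) (i - l))"
    by (simp add: coeff_mult coeff_sum)
  then obtain k where k: "k \<le> j" "(\<Sum>l\<le>i. Polynomial.coeff (Polynomial.coeff P k) l *
      Polynomial.coeff (Polynomial.coeff Q (j - k)) (i - l)) \<noteq> 0"
    using nz by (metis (no_types, lifting) atMost_iff sum.neutral)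
  then obtain l where l: "l \<le> i" "Polynomial.coeff (Polynomial.coeff P k) l *
      Polynomial.coeff (Polynomial.coeff Q (j - k)) (i - l) \<noteq> 0"
    by (metis (no_types, lifting) atMost_iff sum.neutral)
  then have "Polynomial.coeff (Polynomial.coeff P k) l \<noteq> 0" "Polynomial.coeff (Polynomial.coeff Q (j - k)) (i - l) \<noteq> 0"
    by auto
  then have "l + k = m" "(i - l) + (j - k) = n" using assms unfolding homogeneous2_def by blast+
  then show "i + j = m + n" using k(1) l(1) by simp
qed

lemma homogeneous2_const2 [simp]: "const2 c \<in> homogeneous2 0"
  by (auto simp: homogeneous2_def const2_def coeff_pCons split: nat.splits)

lemma homogeneous2_power: "P \<in> homogeneous2 m \<Longrightarrow> P ^ n \<in> homogeneous2 (m * n)"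
proof (induction n)
  case 0
  then show ?case using homogeneous2_const2[of 1] by simp
next
  case (Suc n)
  then show ?case using homogeneous2_mult[of P m "P ^ n" "m * n"] by simp
qed

lemma homogeneous2_mono2 [simp]: "mono2 i j \<in> homogeneous2 (i + j)"
  by (auto simp: homogeneous2_def coeff_mono2 split: if_splits)

lemma homogeneous2_linear: "const2 a * varX + const2 c * varY \<in> homogeneous2 1"
  using homogeneous2_mono2[of 1 0] homogeneous2_mono2[of 0 1]
  by (intro homogeneous2_add homogeneous2_const) (simp_all add: mono2_def)

lemma sv_homogeneous:
  assumes "P \<in> homogeneous2 r"
  shows "sv a b c d P \<in> homogeneous2 r"
proof -
  have "sv a b c d (const2 x * mono2 i (r - i)) \<in> homogeneous2 r" if "i \<le> r" for i x
    using homogeneous2_mult[OF homogeneous2_power[OF homogeneous2_linear, of a c i]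
        homogeneous2_power[OF homogeneous2_linear, of b d "r - i"]] that
    by (auto simp: mono2_def sv_mult sv_power sv_X sv_Y intro!: homogeneous2_const)
  then have "sv a b c d (\<Sum>i\<le>r. const2 (x i) * mono2 i (r - i)) \<in> homogeneous2 r" for x
    unfolding sv_def subst2_sum by (intro homogeneous2_sum) (auto simp: sv_def)
  then show ?thesis using homogeneous2_expand[OF assms] by metis
qed

lemma sv_one: "sv 1 0 0 1 P = P" if "P \<in> homogeneous2 r"
proof -
  have *: "sv 1 0 0 1 (\<Sum>i\<le>r. const2 (x i) * mono2 i (r - i)) = (\<Sum>i\<le>r. const2 (x i) * mono2 i (r - i))"
    for x :: "nat \<Rightarrow> 'a"
    by (simp add: sv_def subst2_sum subst2_mult subst2_power mono2_def)
  show ?thesis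
    using *[of "\<lambda>i. Polynomial.coeff (Polynomial.coeff P (r - i)) i"]
    by (simp only: homogeneous2_expand[OF that, symmetric])
qed

section \<open>The weights \<open>V_r\<close> and the characters \<open>d^r\<close>\<close>

lemma V_rep_simps [simp]:
  "carrier (V_rep r) = homogeneous2 r" "zero (V_rep r) = 0" "add (V_rep r) = (+)"
  "Module.smult (V_rep r) c P = const2 c * P"
  by (simp_all add: V_rep_def)

lemma V_rep_act: "act (V_rep r) g P = sv (red_qp (K_part g $ 1 $ 1)) (red_qp (K_part g $ 1 $ 2))
    (red_qp (K_part g $ 2 $ 1)) (red_qp (K_part g $ 2 $ 2)) P"
  by (simp add: V_rep_def sv_def Let_def)

lemma V_rep_act_zmat:
  "zmat a b c d \<in> GL2_Zp \<Longrightarrow> act (V_rep r) (ppow n ** zmat a b c d) P = sv (red a) (red b) (red c) (red d) P"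
  by (simp add: V_rep_act K_part_eq)

lemma Fpbar_module_V: "Fpbar_module (V_rep r :: ('p::prime_card, 'p fpbar poly poly) rep)"
proof -
  have "abelian_group (V_rep r :: ('p, 'p fpbar poly poly) rep)"
  proof (rule abelian_groupI)
    fix P :: "'p fpbar poly poly" assume P: "P \<in> carrier (V_rep r)"
    have "const2 (-1) * P \<in> carrier (V_rep r)" using P by (simp add: homogeneous2_const)
    moreover have "const2 (-1) * P + P = 0" by (simp add: const2_minus)
    ultimately show "\<exists>y\<in>carrier (V_rep r). y \<oplus>\<^bsub>V_rep r\<^esub> P = \<zero>\<^bsub>V_rep r\<^esub>" by auto
  qed (simp_all add: homogeneous2_add add_ac)
  then have "Module.module Fpbar (V_rep r :: ('p, 'p fpbar poly poly) rep)"
    by (intro moduleI cring_from_type_algebra)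
      (simp_all add: homogeneous2_const const2_add const2_mult distrib_left distrib_right mult.assoc)
  then show ?thesis by (rule Fpbar_module.intro)
qed

lemma K_part_cases:
  assumes "g \<in> KZ"
  obtains a b c d where "K_part g = zmat a b c d" "(a * d - b * c) dvd 1"
  using K_cases[OF K_part_in_K[OF assms]] .

lemma V_act_mult:
  assumes "g \<in> KZ" "h \<in> KZ"
  shows "act (V_rep r) (g ** h) P = act (V_rep r) g (act (V_rep r) h P)"
proof -
  obtain a b c d where g: "K_part g = zmat a b c d" "(a * d - b * c) dvd 1"
    using assms(1) by (rule K_part_cases)
  obtain a' b' c' d' where h: "K_part h = zmat a' b' c' d'" "(a' * d' - b' * c') dvd 1"
    using assms(2) by (rule K_part_cases)
  show ?thesis by (simp add: V_rep_act K_part_mult[OF assms] g h zmat_mult sv_sv)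
qed

interpretation V: induced KZ "V_rep r :: ('p::prime_card, 'p fpbar poly poly) rep" for r
proof (intro induced.intro induced_axioms.intro Fpbar_module_V KZ.open_subgroup_axioms)
  fix h and v :: "'p fpbar poly poly" assume "v \<in> carrier (V_rep r)"
  then show "act (V_rep r) h v \<in> carrier (V_rep r)" by (simp add: V_rep_act sv_homogeneous)
  show "act (V_rep r) (mat 1) v = v"
    using V_rep_act_zmat[of 1 0 0 1 r 0 v] \<open>v \<in> carrier (V_rep r)\<close> by (simp add: zmat_one sv_one)
qed (simp_all add: V_act_mult, simp_all add: V_rep_act sv_add sv_mult)

lemma d_rep_simps [simp]:
  "carrier (d_rep r) = UNIV" "zero (d_rep r) = 0" "add (d_rep r) = (+)" "Module.smult (d_rep r) = (*)"
  by (simp_all add: d_rep_def)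

lemma d_rep_act: "act (d_rep r) g v = red_qp (K_part g $ 2 $ 2) ^ r * v"
  by (simp add: d_rep_def)

lemma d_rep_act_zmat:
  "zmat a b c d \<in> Iwahori \<Longrightarrow> act (d_rep r) (ppow n ** zmat a b c d) v = red d ^ r * v"
  by (simp add: d_rep_act K_part_eq I_sub_K)

lemma Fpbar_module_d: "Fpbar_module (d_rep r :: ('p::prime_card, 'p fpbar) rep)"
proof -
  have "abelian_group (d_rep r :: ('p, 'p fpbar) rep)"
    by (rule abelian_groupI) (auto intro: exI[of _ "- _"] simp: add_ac)
  then have "Module.module Fpbar (d_rep r :: ('p, 'p fpbar) rep)"
    by (intro moduleI cring_from_type_algebra) (simp_all add: algebra_simps)
  then show ?thesis by (rule Fpbar_module.intro)
qed

lemma I_part_cases: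
  assumes "g \<in> IZ"
  obtains a b c d where "K_part g = zmat a b c d" "a dvd 1" "d dvd 1" "red c = 0"
  using I_cases[OF K_part_in_I[OF assms]] .

lemma d_act_mult:
  assumes "g \<in> IZ" "h \<in> IZ"
  shows "act (d_rep r) (g ** h) v = act (d_rep r) g (act (d_rep r) h v)"
proof -
  obtain a b c d where g: "K_part g = zmat a b c d" "a dvd 1" "d dvd 1" "red c = 0"
    using assms(1) by (rule I_part_cases)
  obtain a' b' c' d' where h: "K_part h = zmat a' b' c' d'" "a' dvd 1" "d' dvd 1" "red c' = 0"
    using assms(2) by (rule I_part_cases)
  show ?thesis
    by (simp add: d_rep_act K_part_mult[OF IZ_sub_KZ IZ_sub_KZ, OF assms] g h zmat_mult power_mult_distrib mult_ac)
qed

interpretation D: induced IZ "d_rep r :: ('p::prime_card, 'p fpbar) rep" for r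
proof (intro induced.intro induced_axioms.intro Fpbar_module_d IZ.open_subgroup_axioms)
  fix h and v :: "'p fpbar"
  show "act (d_rep r) (mat 1) v = v"
    using d_rep_act_zmat[of 1 0 0 1 r 0 v] by (simp add: zmat_one zmat_I_iff[of 1 0 0 1, unfolded zmat_one])
qed (simp_all add: d_act_mult, simp_all add: d_rep_act algebra_simps)

lemma elem_fun_V: "elem_fun KZ (V_rep r) = V.elem r"
  by (simp add: V.elem_def)

lemma elem_fun_D: "elem_fun IZ (d_rep r) = D.elem r"
  by (simp add: D.elem_def)

text \<open>Shows that the \<open>THE\<close> in \<open>T_op\<close> denotes, once the prescribed
  values on \<open>[id, P]\<close> depend \<open>KZ\<close>-equivariantly on
  \<open>P\<close>.\<close>

lemma (in induced) ex1_endo: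
  assumes phi: "\<And>v. v \<in> carrier \<sigma> \<Longrightarrow> \<phi> v \<in> carrier ind"
    "\<And>v w. v \<in> carrier \<sigma> \<Longrightarrow> w \<in> carrier \<sigma> \<Longrightarrow> \<phi> (v \<oplus>\<^bsub>\<sigma>\<^esub> w) = \<phi> v \<oplus>\<^bsub>ind\<^esub> \<phi> w"
    "\<And>c v. v \<in> carrier \<sigma> \<Longrightarrow> \<phi> (c \<odot>\<^bsub>\<sigma>\<^esub> v) = c \<odot>\<^bsub>ind\<^esub> \<phi> v"
    "\<And>h v. h \<in> H \<Longrightarrow> v \<in> carrier \<sigma> \<Longrightarrow> \<phi> (act \<sigma> h v) = act ind h (\<phi> v)"
  shows "\<exists>!T. G_endo ind T \<and> (\<forall>v\<in>carrier \<sigma>. T (elem (mat 1) v) = \<phi> v)"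
proof (rule ex_ex1I)
  show "\<exists>T. G_endo ind T \<and> (\<forall>v\<in>carrier \<sigma>. T (elem (mat 1) v) = \<phi> v)"
    using frobenius_reciprocity[OF G_rep_ind phi] unfolding G_endo_def by blast
  fix S T assume S: "G_endo ind S \<and> (\<forall>v\<in>carrier \<sigma>. S (elem (mat 1) v) = \<phi> v)"
    and T: "G_endo ind T \<and> (\<forall>v\<in>carrier \<sigma>. T (elem (mat 1) v) = \<phi> v)"
  then have "S f = T f" if "f \<in> carrier ind" for f
    using G_map_unique[OF G_rep_ind, of S T f] that by (simp add: G_endo_def)
  then show "S = T" using S T unfolding G_endo_def by (intro extensionalityI[of S "carrier ind" T]) auto
qed

section \<open>Equivariant maps out of \<open>ind_IZ d^r\<close>\<close>

lemma D_elem_scalar: "g \<in> GL2 \<Longrightarrow> D.elem r g v = v \<odot>\<^bsub>D.ind r\<^esub> D.elem r g 1"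
  using D.elem_smult[of g 1 r v] by simp

text \<open>For a character, a map out of the induction amounts to a vector \<open>w\<close> on
  which \<open>IZ\<close> acts through \<open>d^r\<close>; elements of \<open>IZ\<close> are written
  \<open>p^n k\<close> with \<open>k \<in> I\<close>.\<close>

lemma D_map_exists:
  fixes N :: "('p::prime_card, 'w) rep"
  assumes N: "G_rep N" and w: "w \<in> carrier N"
    and eq: "\<And>n k. k \<in> Iwahori \<Longrightarrow> act N (ppow n ** k) w = red_qp (k $ 2 $ 2) ^ r \<odot>\<^bsub>N\<^esub> w"
  shows "\<exists>F. G_equivariant (D.ind r) N F \<and> F \<in> extensional (carrier (D.ind r)) \<and> F (D.elem r (mat 1) 1) = w"
proof -
  interpret N: G_representation N by unfold_locales (rule N)
  define \<phi> where "\<phi> v = v \<odot>\<^bsub>N\<^esub> w" for v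
  have "\<exists>F. G_equivariant (D.ind r) N F \<and> F \<in> extensional (carrier (D.ind r)) \<and>
    (\<forall>v\<in>carrier (d_rep r). F (D.elem r (mat 1) v) = \<phi> v)"
  proof (rule D.frobenius_reciprocity[OF N])
    show "\<phi> (act (d_rep r) h v) = act N h (\<phi> v)" if h: "h \<in> IZ" for h v
    proof -
      obtain n k where k: "k \<in> Iwahori" "h = ppow n ** k" using h by (rule IZ_cases)
      have hG: "h \<in> GL2" using h IZ.H_GL2 by blast
      have "act N h (\<phi> v) = v \<odot>\<^bsub>N\<^esub> (red_qp (k $ 2 $ 2) ^ r \<odot>\<^bsub>N\<^esub> w)"
        unfolding \<phi>_def eq[OF k(1), of n, symmetric] k(2)[symmetric] by (rule N.act_smult[OF hG w])
      also have "\<dots> = (v * red_qp (k $ 2 $ 2) ^ r) \<odot>\<^bsub>N\<^esub> w" by (rule N.smult_mult[OF w, symmetric])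
      also have "v * red_qp (k $ 2 $ 2) ^ r = act (d_rep r) h v"
        by (simp add: d_rep_act k K_part_eq I_sub_K mult.commute)
      finally show ?thesis by (simp only: \<phi>_def[of "act (d_rep r) h v"])
    qed
  qed (use w in \<open>simp_all add: \<phi>_def N.smult_add N.smult_mult\<close>)
  then obtain F where F: "G_equivariant (D.ind r) N F" "F \<in> extensional (carrier (D.ind r))"
    "\<forall>v. F (D.elem r (mat 1) v) = \<phi> v" by auto
  have "F (D.elem r (mat 1) 1) = w" using F(3) w by (simp add: \<phi>_def)
  then show ?thesis using F by blast
qed

lemma D_map_unique:
  fixes N :: "('p::prime_card, 'w) rep"
  assumes N: "G_rep N" and F: "G_equivariant (D.ind r) N F" "G_equivariant (D.ind r) N F'"
    and eq: "F (D.elem r (mat 1) 1) = F' (D.elem r (mat 1) 1)" and f: "f \<in> carrier (D.ind r)"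
  shows "F f = F' f"
proof (rule D.G_map_unique[OF N F _ f])
  interpret F: G_map "D.ind r" N F
    by (intro G_map.intro G_map_axioms.intro D.I.G_representation_axioms G_representation.intro N F)
  interpret F': G_map "D.ind r" N F'
    by (intro G_map.intro G_map_axioms.intro D.I.G_representation_axioms G_representation.intro N F)
  fix v :: "'p fpbar"
  have "D.elem r (mat 1) v = v \<odot>\<^bsub>D.ind r\<^esub> D.elem r (mat 1) 1" by (rule D_elem_scalar) simp
  moreover have "F (v \<odot>\<^bsub>D.ind r\<^esub> D.elem r (mat 1) 1) = F' (v \<odot>\<^bsub>D.ind r\<^esub> D.elem r (mat 1) 1)"
    using eq by (simp add: F.smult F'.smult del: D.ind_simps)
  ultimately show "F (D.elem r (mat 1) v) = F' (D.elem r (mat 1) v)" by simp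
qed

text \<open>Common to the three Iwahori operators: once the prescribed image \<open>w\<close> is an
  eigenvector of \<open>IZ\<close> for \<open>d^r\<close>, the \<open>THE\<close> denotes.
  \<open>S\<close> is tied to it by an equation so that each definition can be matched by
  unfolding.\<close>

lemma D_endo_THE:
  fixes w :: "'p::prime_card mat2 \<Rightarrow> 'p fpbar"
  assumes w: "w \<in> carrier (D.ind r)"
    and eq: "\<And>n k. k \<in> Iwahori \<Longrightarrow> act (D.ind r) (ppow n ** k) w = red_qp (k $ 2 $ 2) ^ r \<odot>\<^bsub>D.ind r\<^esub> w"
    and S: "S = (THE T. G_endo (ind_IZ r) T \<and> T (elem_fun IZ (d_rep r) (mat 1) 1) = w)"
  shows "G_endo (D.ind r) S" "S (D.elem r (mat 1) 1) = w"
proof -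
  have "\<exists>!T. G_endo (D.ind r) T \<and> T (D.elem r (mat 1) 1) = w"
  proof (rule ex_ex1I)
    show "\<exists>T. G_endo (D.ind r) T \<and> T (D.elem r (mat 1) 1) = w"
      using D_map_exists[OF D.G_rep_ind w eq] unfolding G_endo_def by blast
    fix T T' assume T: "G_endo (D.ind r) T \<and> T (D.elem r (mat 1) 1) = w"
      "G_endo (D.ind r) T' \<and> T' (D.elem r (mat 1) 1) = w"
    then have "T f = T' f" if "f \<in> carrier (D.ind r)" for f
      using D_map_unique[OF D.G_rep_ind[of r], where r = r and F = T and F' = T' and f = f] that by (simp add: G_endo_def)
    then show "T = T'" using T unfolding G_endo_def by (intro extensionalityI[of T "carrier (D.ind r)" T']) auto
  qed
  from theI'[OF this] show "G_endo (D.ind r) S" "S (D.elem r (mat 1) 1) = w"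
    unfolding S ind_IZ_def elem_fun_D by blast+
qed

lemma teich_cong_exists:
  fixes z :: "'p::prime_card zp"
  obtains t where "t \<in> teich_reps" "red t = red z"
proof -
  obtain x where "red z = to_ac x" using red_in_range[of z] by blast
  then show ?thesis using that[of "teich x"] by (simp add: teich_reps_def)
qed

lemma inj_on_red_teich: "inj_on red teich_reps"
  by (auto simp: inj_on_def teich_reps_def)

lemma (in induced) act_ppow: 
  assumes f: "f \<in> carrier ind" and p: "\<And>v. v \<in> carrier \<sigma> \<Longrightarrow> act \<sigma> (ppow n) v = v"
  shows "act ind (ppow n) f = f"
proof (rule ind_ext)
  fix x :: "'p mat2" assume x: "x \<in> GL2"
  have "ppow n \<in> H" by (rule subsetD[OF IZ_sub center_sub_IZ]) simp
  then have "f (ppow n ** x) = f x" using ind_equi[OF f _ x] p ind_closed[OF f x] by simp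
  then show "act ind (ppow n) f x = f x" using x by (simp add: mat_commute[of _ x, symmetric])
qed (use f in \<open>auto intro!: D.I.act_closed simp del: ind_simps\<close>)

lemma D_act_ppow: "f \<in> carrier (D.ind r) \<Longrightarrow> act (D.ind r) (ppow n) f = f" for f :: "'p::prime_card mat2 \<Rightarrow> 'p fpbar"
proof (erule D.act_ppow)
  show "act (d_rep r) (ppow n) v = v" for v :: "'p fpbar"
    using d_rep_act_zmat[of 1 0 0 1 r n v] by (simp add: zmat_one zmat_I_iff[of 1 0 0 1, unfolded zmat_one])
qed

lemma V_act_ppow: "f \<in> carrier (V.ind r) \<Longrightarrow> act (V.ind r) (ppow n) f = f"
  for f :: "'p::prime_card mat2 \<Rightarrow> 'p fpbar poly poly"
proof (erule V.act_ppow)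
  show "act (V_rep r) (ppow n) v = v" if "v \<in> carrier (V_rep r)" for v :: "'p fpbar poly poly"
    using V_rep_act_zmat[of 1 0 0 1 r n v] that by (simp add: zmat_one sv_one zmat_K_iff[of 1 0 0 1, unfolded zmat_one])
qed

text \<open>An element \<open>k\<close> of \<open>I\<close> permutes the cosets
  \<open>s t I\<close>, and the factor it leaves behind has the same lower right entry as
  \<open>k\<close> modulo \<open>p\<close>; so each summand is turned into another one, times the
  same scalar. \<open>inj\<close> makes the map of indices injective, hence a permutation of the
  finite set of representatives.\<close>

lemma D_sum_equivariant:
  fixes s :: "'p::prime_card zp \<Rightarrow> 'p mat2" and r :: nat
  assumes s: "\<And>t. s t \<in> GL2"
    and perm: "\<And>k t. k \<in> Iwahori \<Longrightarrow> t \<in> teich_reps \<Longrightarrow> \<exists>t' k'. t' \<in> teich_reps \<and> k' \<in> Iwahori \<and>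
      k ** s t = s t' ** k' \<and> red_qp (k' $ 2 $ 2) = red_qp (k $ 2 $ 2)"
    and inj: "\<And>k t1 t2 t' k1 k2. k \<in> Iwahori \<Longrightarrow> k1 \<in> Iwahori \<Longrightarrow> k2 \<in> Iwahori \<Longrightarrow> t1 \<in> teich_reps \<Longrightarrow> t2 \<in> teich_reps \<Longrightarrow>
      k ** s t1 = s t' ** k1 \<Longrightarrow> k ** s t2 = s t' ** k2 \<Longrightarrow> t1 = t2"
  defines "w \<equiv> \<Oplus>\<^bsub>D.ind r\<^esub>t\<in>teich_reps. D.elem r (s t) 1"
  shows "w \<in> carrier (D.ind r)"
    "k \<in> Iwahori \<Longrightarrow> act (D.ind r) (ppow n ** k) w = red_qp (k $ 2 $ 2) ^ r \<odot>\<^bsub>D.ind r\<^esub> w"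
proof -
  note fin = finite_teich_reps[where ?'p = 'p]
  have el: "(\<lambda>t. D.elem r (s t) 1) \<in> teich_reps \<rightarrow> carrier (D.ind r)" using s by simp
  then show w: "w \<in> carrier (D.ind r)" unfolding w_def by (rule D.I.finsum_closed)
  assume k: "k \<in> Iwahori"
  then have kG: "k \<in> GL2" by (intro K_GL2 I_sub_K)
  obtain \<pi> \<kappa> where \<pi>: "\<And>t. t \<in> teich_reps \<Longrightarrow> \<pi> t \<in> teich_reps \<and> \<kappa> t \<in> Iwahori \<and>
      k ** s t = s (\<pi> t) ** \<kappa> t \<and> red_qp (\<kappa> t $ 2 $ 2) = red_qp (k $ 2 $ 2)"
    using perm[OF k] by metis
  have inj\<pi>: "inj_on \<pi> teich_reps"
    using \<pi> inj[OF k] by (intro inj_onI) metis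
  have im: "\<pi> ` teich_reps = teich_reps"
    using \<pi> by (intro endo_inj_surj fin inj\<pi>) auto
  let ?c = "red_qp (k $ 2 $ 2) ^ r"
  have "act (D.ind r) k w = (\<Oplus>\<^bsub>D.ind r\<^esub>t\<in>teich_reps. act (D.ind r) k (D.elem r (s t) 1))"
    unfolding w_def by (rule D.I.act_finsum[OF kG fin el])
  also have "\<dots> = (\<Oplus>\<^bsub>D.ind r\<^esub>t\<in>teich_reps. ?c \<odot>\<^bsub>D.ind r\<^esub> D.elem r (s (\<pi> t)) 1)"
  proof (rule D.I.finsum_cong')
    show "(\<lambda>t. ?c \<odot>\<^bsub>D.ind r\<^esub> D.elem r (s (\<pi> t)) 1) \<in> teich_reps \<rightarrow> carrier (D.ind r)"
      using s by (intro funcsetI D.I.smult_clo D.elem_closed) auto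
    fix t :: "'p zp" assume t: "t \<in> teich_reps"
    have "act (D.ind r) k (D.elem r (s t) 1) = D.elem r (s (\<pi> t) ** \<kappa> t) 1"
      using D.act_elem[OF s kG] \<pi>[OF t] by (simp del: D.ind_simps)
    also have "\<dots> = D.elem r (s (\<pi> t)) (act (d_rep r) (\<kappa> t) 1)"
      using \<pi>[OF t] s by (intro D.elem_mult_right) (auto intro: I_sub_IZ)
    also have "act (d_rep r) (\<kappa> t) 1 = ?c"
      using \<pi>[OF t] by (simp add: d_rep_act K_part_K I_sub_K)
    also have "D.elem r (s (\<pi> t)) ?c = ?c \<odot>\<^bsub>D.ind r\<^esub> D.elem r (s (\<pi> t)) 1" by (rule D_elem_scalar[OF s])
    finally show "act (D.ind r) k (D.elem r (s t) 1) = ?c \<odot>\<^bsub>D.ind r\<^esub> D.elem r (s (\<pi> t)) 1" .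
  qed simp
  also have "\<dots> = ?c \<odot>\<^bsub>D.ind r\<^esub> (\<Oplus>\<^bsub>D.ind r\<^esub>t\<in>teich_reps. D.elem r (s (\<pi> t)) 1)"
    using s by (intro D.I.finsum_smult_ldistr[symmetric] fin) auto
  also have "(\<Oplus>\<^bsub>D.ind r\<^esub>t\<in>teich_reps. D.elem r (s (\<pi> t)) 1) = (\<Oplus>\<^bsub>D.ind r\<^esub>t\<in>\<pi> ` teich_reps. D.elem r (s t) 1)"
    using s by (intro D.I.finsum_reindex[symmetric] inj\<pi>) auto
  finally have *: "act (D.ind r) k w = ?c \<odot>\<^bsub>D.ind r\<^esub> w" by (simp only: im w_def)
  have "act (D.ind r) (ppow n ** k) w = act (D.ind r) (ppow n) (act (D.ind r) k w)"
    by (rule D.I.act_mult[OF _ kG w]) simp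
  also have "\<dots> = act (D.ind r) k w" by (rule D_act_ppow[OF D.I.act_closed[OF kG w]])
  finally show "act (D.ind r) (ppow n ** k) w = ?c \<odot>\<^bsub>D.ind r\<^esub> w" using * by simp
qed

section \<open>The Iwahori operators\<close>

abbreviation (input) pq :: "'p::prime_card qp" where "pq \<equiv> of_nat (CARD('p))"
abbreviation (input) pz :: "'p::prime_card zp" where "pz \<equiv> of_nat (CARD('p))"

definition tmat :: "'p::prime_card zp \<Rightarrow> 'p mat2" where
  "tmat t = mat2 pq (of_zp t) 0 1"

definition smat :: "'p::prime_card zp \<Rightarrow> 'p mat2" where
  "smat t = mat2 1 0 (pq * of_zp t) pq"

lemma tmat_zmat: "tmat t = zmat pz t 0 1" and smat_zmat: "smat t = zmat 1 0 (pz * t) pz"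
  and alpha_zmat: "alpha = zmat 1 0 0 pz" and beta_zmat: "beta = zmat 0 1 pz 0"
  by (simp_all add: tmat_def smat_def alpha_def beta_def zmat_def of_zp_of_nat of_zp_0 of_zp_1 of_zp_mult)

lemma tmat_GL2 [simp]: "tmat t \<in> GL2" and smat_GL2 [simp]: "smat t \<in> GL2"
  and alpha_GL2 [simp]: "alpha \<in> GL2" and beta_GL2 [simp]: "beta \<in> GL2"
  by (simp_all add: tmat_def smat_def alpha_def beta_def mat2_GL2_iff)

lemma red_eqE:
  fixes x y :: "'p::prime_card zp"
  assumes "red x = red y"
  obtains e where "x - y = pz * e"
proof -
  have "red (x - y) = 0" using assms by simp
  then show ?thesis using that unfolding red_eq_0_iff_dvd by (auto elim: dvdE)
qed

lemma Tm10_w: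
  fixes r :: nat
  defines "w \<equiv> \<Oplus>\<^bsub>D.ind r\<^esub>t\<in>(teich_reps :: 'p::prime_card zp set). D.elem r (tmat t) 1"
  shows "w \<in> carrier (D.ind r)"
    "k \<in> Iwahori \<Longrightarrow> act (D.ind r) (ppow n ** k) w = red_qp (k $ 2 $ 2) ^ r \<odot>\<^bsub>D.ind r\<^esub> w"
proof -
  have perm: "\<exists>t' k'. t' \<in> teich_reps \<and> k' \<in> Iwahori \<and> k ** tmat t = tmat t' ** k' \<and> red_qp (k' $ 2 $ 2) = red_qp (k $ 2 $ 2)"
    if "k \<in> Iwahori" for k :: "'p mat2" and t
  proof -
    obtain a b c d where k: "k = zmat a b c d" "a dvd 1" "d dvd 1" "red c = 0" using \<open>k \<in> Iwahori\<close> by (rule I_cases)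
    obtain v where v: "d * v = 1" using k(3) by (metis dvdE)
    \<comment> \<open>\<open>k\<close> acts on the affine line modulo \<open>p\<close> by
      \<open>t \<mapsto> (a t + b) / d\<close>, as \<open>c\<close> vanishes there.\<close>
    obtain t' where t': "t' \<in> teich_reps" "red t' = red ((a * t + b) * v)" by (rule teich_cong_exists)
    have "red d * red v = 1" using v by (metis red_1 red_mult)
    then have "red (a * t + b) = red (t' * (c * t + d))"
      using t'(2) k(4) by (simp add: algebra_simps)
    then obtain e where e: "(a * t + b) - t' * (c * t + d) = pz * e" by (rule red_eqE)
    let ?k = "zmat (a - t' * c) e (pz * c) (c * t + d)"
    have "k ** tmat t = tmat t' ** ?k"
      using e by (simp add: k(1) tmat_zmat zmat_mult algebra_simps)
    moreover have "?k \<in> Iwahori" using k by (simp add: zmat_I_iff zp_unit_iff_red)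
    moreover have "red_qp (?k $ 2 $ 2) = red_qp (k $ 2 $ 2)" using k by simp
    ultimately show ?thesis using t'(1) by blast
  qed
  have inj: "t1 = t2"
    if "k \<in> Iwahori" "k1 \<in> Iwahori" "k2 \<in> Iwahori" "t1 \<in> teich_reps" "t2 \<in> teich_reps"
      "k ** tmat t1 = tmat t' ** k1" "k ** tmat t2 = tmat t' ** k2" for k k1 k2 :: "'p mat2" and t1 t2 t'
  proof -
    from that(1) obtain a b c d where k: "k = zmat a b c d" "a dvd 1" "d dvd 1" "red c = 0" by (rule I_cases)
    from that(2) obtain a1 b1 c1 d1 where k1: "k1 = zmat a1 b1 c1 d1" "a1 dvd 1" "d1 dvd 1" "red c1 = 0" by (rule I_cases)
    from that(3) obtain a2 b2 c2 d2 where k2: "k2 = zmat a2 b2 c2 d2" "a2 dvd 1" "d2 dvd 1" "red c2 = 0" by (rule I_cases)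
    have "a * t1 + b = pz * b1 + t' * (c * t1 + d)" "a * t2 + b = pz * b2 + t' * (c * t2 + d)"
      using that(6,7) by (simp_all add: k(1) k1 k2 tmat_zmat zmat_mult)
    then have "red (a * t1 + b) = red (a * t2 + b)" using k(4) by simp
    then have "red t1 = red t2" using k(2) by (simp add: zp_unit_iff_red)
    then show ?thesis using inj_on_red_teich that(4,5) by (auto simp: inj_on_def)
  qed
  show "w \<in> carrier (D.ind r)"
    unfolding w_def using inj
    by (intro D_sum_equivariant(1)[where s = tmat, OF tmat_GL2]) (blast intro: perm, metis)
  show "act (D.ind r) (ppow n ** k) w = red_qp (k $ 2 $ 2) ^ r \<odot>\<^bsub>D.ind r\<^esub> w" if "k \<in> Iwahori"
    unfolding w_def using inj that
    by (intro D_sum_equivariant(2)[where s = tmat, OF tmat_GL2]) (blast intro: perm, metis)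
qed

lemma T12_w:
  fixes r :: nat
  defines "w \<equiv> \<Oplus>\<^bsub>D.ind r\<^esub>t\<in>(teich_reps :: 'p::prime_card zp set). D.elem r (smat t) 1"
  shows "w \<in> carrier (D.ind r)"
    "k \<in> Iwahori \<Longrightarrow> act (D.ind r) (ppow n ** k) w = red_qp (k $ 2 $ 2) ^ r \<odot>\<^bsub>D.ind r\<^esub> w"
proof -
  have perm: "\<exists>t' k'. t' \<in> teich_reps \<and> k' \<in> Iwahori \<and> k ** smat t = smat t' ** k' \<and> red_qp (k' $ 2 $ 2) = red_qp (k $ 2 $ 2)"
    if "k \<in> Iwahori" for k :: "'p mat2" and t
  proof -
    obtain a b c d where k: "k = zmat a b c d" "a dvd 1" "d dvd 1" "red c = 0" using \<open>k \<in> Iwahori\<close> by (rule I_cases)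
    have "red c = red 0" using k(4) by simp
    then obtain c' where c': "c - 0 = pz * c'" by (rule red_eqE)
    obtain v where v: "a * v = 1" using k(2) by (metis dvdE)
    \<comment> \<open>Here \<open>k\<close> acts on the lower left entry divided by
      \<open>p\<close>: with \<open>c = p c'\<close> the action is
      \<open>t \<mapsto> (c' + d t) / a\<close>.\<close>
    obtain t' where t': "t' \<in> teich_reps" "red t' = red ((c' + d * t) * v)" by (rule teich_cong_exists)
    have "red a * red v = 1" using v by (metis red_1 red_mult)
    have "red t' * red a = red (c' + d * t) * (red a * red v)"
      by (simp only: t'(2) red_mult mult_ac)
    then have "red t' * red a = red (c' + d * t)" by (simp only: \<open>red a * red v = 1\<close> mult_1_right)
    then have "red (c' + d * t) = red (t' * (a + pz * b * t))" by simp
    then obtain e where e: "(c' + d * t) - t' * (a + pz * b * t) = pz * e" by (rule red_eqE)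
    let ?k = "zmat (a + pz * b * t) (pz * b) (pz * e) (d - t' * pz * b)"
    have "k ** smat t = smat t' ** ?k"
      using c' by (simp add: k(1) smat_zmat zmat_mult e[symmetric]) (simp add: algebra_simps)
    moreover have "?k \<in> Iwahori" using k by (simp add: zmat_I_iff zp_unit_iff_red)
    moreover have "red_qp (?k $ 2 $ 2) = red_qp (k $ 2 $ 2)" using k by simp
    ultimately show ?thesis using t'(1) by blast
  qed
  have inj: "t1 = t2"
    if "k \<in> Iwahori" "k1 \<in> Iwahori" "k2 \<in> Iwahori" "t1 \<in> teich_reps" "t2 \<in> teich_reps"
      "k ** smat t1 = smat t' ** k1" "k ** smat t2 = smat t' ** k2" for k k1 k2 :: "'p mat2" and t1 t2 t'
  proof -
    from that(1) obtain a b c d where k: "k = zmat a b c d" "a dvd 1" "d dvd 1" "red c = 0" by (rule I_cases)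
    have cong: "c + d * (pz * t) = pz * (t' * (a + b * (pz * t)) + c1)"
      if "k ** smat t = smat t' ** k1" "k1 = zmat a1 b1 c1 d1" for t k1 a1 b1 c1 d1
      using that by (auto simp add: k(1) smat_zmat zmat_mult algebra_simps)
    from that(2) obtain a1 b1 c1 d1 where k1: "k1 = zmat a1 b1 c1 d1" "a1 dvd 1" "d1 dvd 1" "red c1 = 0" by (rule I_cases)
    from that(3) obtain a2 b2 c2 d2 where k2: "k2 = zmat a2 b2 c2 d2" "a2 dvd 1" "d2 dvd 1" "red c2 = 0" by (rule I_cases)
    have "d * (pz * t1) - d * (pz * t2) = pz * (t' * (a + b * (pz * t1)) + c1) - pz * (t' * (a + b * (pz * t2)) + c2)"
      using cong[OF that(6) k1(1)] cong[OF that(7) k2(1)] by (metis add_diff_cancel_left)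
    then have "pz * (d * t1 - d * t2) = pz * (t' * (a + b * (pz * t1)) + c1 - (t' * (a + b * (pz * t2)) + c2))"
      by (simp add: algebra_simps)
    then have "d * t1 - d * t2 = t' * (a + b * (pz * t1)) + c1 - (t' * (a + b * (pz * t2)) + c2)"
      using zp_p_nonzero mult_left_cancel by blast
    then have "red (d * t1 - d * t2) = 0" using k1(4) k2(4) by simp
    then have "red t1 = red t2" using k(3) by (simp add: zp_unit_iff_red)
    then show ?thesis using inj_on_red_teich that(4,5) by (auto simp: inj_on_def)
  qed
  show "w \<in> carrier (D.ind r)"
    unfolding w_def using inj
    by (intro D_sum_equivariant(1)[where s = smat, OF smat_GL2]) (blast intro: perm, metis)
  show "act (D.ind r) (ppow n ** k) w = red_qp (k $ 2 $ 2) ^ r \<odot>\<^bsub>D.ind r\<^esub> w" if "k \<in> Iwahori"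
    unfolding w_def using inj that
    by (intro D_sum_equivariant(2)[where s = smat, OF smat_GL2]) (blast intro: perm, metis)
qed

lemma beta_conj:
  fixes k :: "'p::prime_card mat2"
  assumes "k = zmat a b (pz * c) d"
  shows "k ** beta = beta ** zmat d c (pz * b) a"
  by (simp add: assms beta_zmat zmat_mult mult.commute)

lemma I_cases':
  fixes k :: "'p::prime_card mat2"
  assumes "k \<in> Iwahori"
  obtains a b c d where "k = zmat a b (pz * c) d" "a dvd 1" "d dvd 1"
proof -
  obtain a b c d where k: "k = zmat a b c d" "a dvd 1" "d dvd 1" "red c = 0" using assms by (rule I_cases)
  have "red c = red 0" using k(4) by simp
  then obtain c' where c': "c - 0 = pz * c'" by (rule red_eqE)
  then show ?thesis using that k by auto
qed

lemma unit_power_p_minus_1: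
  fixes a :: "'p::prime_card zp"
  assumes "a dvd 1" "r = 0 \<or> r = CARD('p) - 1"
  shows "red a ^ r = 1"
proof -
  have "red a * red a ^ (CARD('p) - 1) = red a * 1"
    using red_fermat[of a] prime_gt_0_nat[OF prime_card[where ?'a = 'p]] by (simp flip: power_Suc)
  then have "red a ^ (CARD('p) - 1) = 1" using assms(1) by (simp add: zp_unit_iff_red)
  then show ?thesis using assms(2) by auto
qed

text \<open>Conjugation by \<open>beta\<close> exchanges \<open>a\<close> and \<open>d\<close>, so
  \<open>[[beta, 1]]\<close> is an eigenvector for \<open>a^r\<close>. This agrees with
  \<open>d^r\<close> on all of \<open>I\<close> only if both are trivial, which is where the
  restriction on \<open>r\<close> comes from.\<close>

lemma T10_w:
  fixes k :: "'p::prime_card mat2"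
  assumes r: "r = 0 \<or> r = CARD('p) - 1" and k: "k \<in> Iwahori"
  shows "act (D.ind r) (ppow n ** k) (D.elem r beta 1) = red_qp (k $ 2 $ 2) ^ r \<odot>\<^bsub>D.ind r\<^esub> D.elem r beta 1"
proof -
  obtain a b c d where kz: "k = zmat a b (pz * c) d" "a dvd 1" "d dvd 1" using k by (rule I_cases')
  have kG: "k \<in> GL2" using k by (intro K_GL2 I_sub_K)
  let ?k = "zmat d c (pz * b) a"
  have kI: "?k \<in> Iwahori" using kz by (simp add: zmat_I_iff)
  have "act (D.ind r) k (D.elem r beta 1) = D.elem r (beta ** ?k) 1"
    using D.act_elem[OF beta_GL2 kG] beta_conj[OF kz(1)] by (simp del: D.ind_simps)
  also have "\<dots> = D.elem r beta (act (d_rep r) ?k 1)"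
    using kI by (intro D.elem_mult_right) (auto intro: I_sub_IZ)
  also have "act (d_rep r) ?k 1 = red_qp (k $ 2 $ 2) ^ r"
    using unit_power_p_minus_1[OF kz(2) r] unit_power_p_minus_1[OF kz(3) r] kI kz(1)
    by (simp add: d_rep_act K_part_K I_sub_K)
  also have "D.elem r beta (red_qp (k $ 2 $ 2) ^ r) = red_qp (k $ 2 $ 2) ^ r \<odot>\<^bsub>D.ind r\<^esub> D.elem r beta 1"
    by (rule D_elem_scalar[OF beta_GL2])
  finally have *: "act (D.ind r) k (D.elem r beta 1) = red_qp (k $ 2 $ 2) ^ r \<odot>\<^bsub>D.ind r\<^esub> D.elem r beta 1" .
  have cl: "D.elem r beta 1 \<in> carrier (D.ind r)" by simp
  have "act (D.ind r) (ppow n ** k) (D.elem r beta 1) = act (D.ind r) (ppow n) (act (D.ind r) k (D.elem r beta 1))"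
    by (rule D.I.act_mult[OF _ kG cl]) simp
  also have "\<dots> = act (D.ind r) k (D.elem r beta 1)" by (rule D_act_ppow[OF D.I.act_closed[OF kG cl]])
  finally show ?thesis using * by simp
qed

lemma Tm10_endo: "G_endo (D.ind r) (Tm10 r :: _ \<Rightarrow> 'p::prime_card mat2 \<Rightarrow> _)"
  and Tm10_gen: "Tm10 r (D.elem r (mat 1 :: 'p mat2) 1) = (\<Oplus>\<^bsub>D.ind r\<^esub>t\<in>teich_reps. D.elem r (tmat t) 1)"
proof -
  have "Tm10 r = (THE T. G_endo (ind_IZ r) T \<and> T (elem_fun IZ (d_rep r) (mat 1 :: 'p mat2) 1) =
      (\<Oplus>\<^bsub>D.ind r\<^esub>t\<in>teich_reps. D.elem r (tmat t) 1))"
    by (simp add: Tm10_def tmat_def D.elem_def ind_IZ_def)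
  from D_endo_THE[OF Tm10_w this]
  show "G_endo (D.ind r) (Tm10 r :: _ \<Rightarrow> 'p mat2 \<Rightarrow> _)"
    "Tm10 r (D.elem r (mat 1 :: 'p mat2) 1) = (\<Oplus>\<^bsub>D.ind r\<^esub>t\<in>teich_reps. D.elem r (tmat t) 1)" by blast+
qed

lemma T12_endo: "G_endo (D.ind r) (T12 r :: _ \<Rightarrow> 'p::prime_card mat2 \<Rightarrow> _)"
  and T12_gen: "T12 r (D.elem r (mat 1 :: 'p mat2) 1) = (\<Oplus>\<^bsub>D.ind r\<^esub>t\<in>teich_reps. D.elem r (smat t) 1)"
proof -
  have "T12 r = (THE T. G_endo (ind_IZ r) T \<and> T (elem_fun IZ (d_rep r) (mat 1 :: 'p mat2) 1) =
      (\<Oplus>\<^bsub>D.ind r\<^esub>t\<in>teich_reps. D.elem r (smat t) 1))"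
    by (simp add: T12_def smat_def D.elem_def ind_IZ_def)
  from D_endo_THE[OF T12_w this]
  show "G_endo (D.ind r) (T12 r :: _ \<Rightarrow> 'p mat2 \<Rightarrow> _)"
    "T12 r (D.elem r (mat 1 :: 'p mat2) 1) = (\<Oplus>\<^bsub>D.ind r\<^esub>t\<in>teich_reps. D.elem r (smat t) 1)" by blast+
qed

lemma T10_endo_gen:
  assumes r: "r = 0 \<or> r = CARD('p::prime_card) - 1"
  shows "G_endo (D.ind r) (T10 r :: _ \<Rightarrow> 'p mat2 \<Rightarrow> _)"
    "T10 r (D.elem r (mat 1 :: 'p mat2) 1) = D.elem r beta 1"
proof -
  have "T10 r = (THE T. G_endo (ind_IZ r) T \<and> T (elem_fun IZ (d_rep r) (mat 1 :: 'p mat2) 1) = D.elem r beta 1)"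
    by (simp add: T10_def D.elem_def)
  from D_endo_THE[OF _ T10_w[OF r] this]
  show "G_endo (D.ind r) (T10 r :: _ \<Rightarrow> 'p mat2 \<Rightarrow> _)" "T10 r (D.elem r (mat 1 :: 'p mat2) 1) = D.elem r beta 1"
    by simp_all
qed

section \<open>The operator \<open>T\<close> and the double coset \<open>KZ alpha KZ\<close>\<close>

definition p_primitive :: "'p::prime_card mat2 \<Rightarrow> bool" where
  "p_primitive x \<longleftrightarrow> (\<exists>n a b c d u. x = ppow n ** zmat a b c d \<and> a * d - b * c = pz * u \<and> u dvd 1)"

lemma p_primitive_mult:
  fixes x :: "'p::prime_card mat2"
  assumes "p_primitive x" "h \<in> KZ"
  shows "p_primitive (x ** h)"
proof -
  obtain n a b c d u where x: "x = ppow n ** zmat a b c d" "a * d - b * c = pz * u" "u dvd 1"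
    using assms(1) unfolding p_primitive_def by (elim exE conjE) (rule that)
  obtain m k where h: "k \<in> GL2_Zp" "h = ppow m ** k" using assms(2) by (rule KZ_cases)
  obtain a' b' c' d' where k: "k = zmat a' b' c' d'" "(a' * d' - b' * c') dvd 1" using h(1) by (rule K_cases)
  have "x ** h = ppow (n + m) ** zmat (a*a'+b*c') (a*b'+b*d') (c*a'+d*c') (c*b'+d*d')"
    by (simp only: x(1) h(2) k(1) ppow_mult zmat_mult)
  moreover have "(a*a'+b*c') * (c*b'+d*d') - (a*b'+b*d') * (c*a'+d*c') = pz * (u * (a' * d' - b' * c'))"
  proof -
    have "(a*a'+b*c') * (c*b'+d*d') - (a*b'+b*d') * (c*a'+d*c') = (a * d - b * c) * (a' * d' - b' * c')"
      by (simp add: algebra_simps)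
    then show ?thesis by (simp only: x(2) mult.assoc)
  qed
  ultimately show ?thesis
    unfolding p_primitive_def using x(3) k(2) zp_unit_mult_iff by blast
qed

text \<open>Comparing determinants forces the exponent \<open>n + 1\<close>, so the integral matrix
  is \<open>p\<close> times an element of \<open>K\<close>. This decides which of the products
  \<open>x ** tmat t\<close> and \<open>x ** alpha\<close> can lie in \<open>KZ\<close>.\<close>

lemma KZ_det_p2:
  fixes u :: "'p::prime_card zp"
  assumes "ppow n ** zmat a b c d \<in> KZ" "a * d - b * c = pz * pz * u" "u dvd 1"
  shows "red a = 0 \<and> red b = 0 \<and> red c = 0 \<and> red d = 0"
proof -
  obtain m k where h: "k \<in> GL2_Zp" "ppow n ** zmat a b c d = ppow m ** k" using assms(1) by (rule KZ_cases)
  obtain a' b' c' d' where k: "k = zmat a' b' c' d'" "(a' * d' - b' * c') dvd 1" using h(1) by (rule K_cases)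
  have dm: "det (ppow n :: 'p mat2) = pq powi (n + n)" for n
    by (simp only: mat_mat2 det_mat2 power_int_add[OF disjI1[OF qp_p_nonzero]]) simp
  have "det (ppow n ** zmat a b c d) = det (ppow m ** k)" using h(2) by simp
  then have "pq powi (n + n) * of_zp (pz * pz * u) = pq powi (m + m) * of_zp (a' * d' - b' * c')"
    by (simp only: det_mul dm k(1) det_zmat assms(2))
  moreover have "pq powi (n + n) * of_zp (pz * pz * u) = pq powi (n + n + 2) * of_zp u"
    by (simp add: of_zp_mult of_zp_of_nat power_int_add power2_eq_square)
  ultimately have "n + n + 2 = m + m" using qp_decomp_unique[OF assms(3) k(2)] by simp
  then have m: "m = n + 1" by simp
  have "ppow (- n) ** (ppow n ** zmat a b c d) = ppow (- n) ** (ppow m ** k)" using h(2) by simp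
  then have "zmat a b c d = mat pq ** k"
    by (simp add: matrix_mul_assoc mat_mult_mat m flip: power_int_add)
  also have "mat pq = zmat pz 0 0 pz" by (simp add: mat_mat2 zmat_def of_zp_of_nat of_zp_0)
  finally show ?thesis by (simp add: k(1) zmat_mult)
qed

text \<open>\<open>TP r P\<close> is \<open>T [id, P]\<close>. By \<open>TP_primitive\<close> and \<open>TP_not_primitive\<close> its value at \<open>x\<close> is
  \<open>Sym^r(x mod p) P\<close> if, up to a power of \<open>p\<close>, \<open>x\<close> is integral with determinant of valuation 1, and \<open>0\<close>
  otherwise; in this form the \<open>KZ\<close>-equivariance needed to define \<open>T\<close> is evident.\<close>

definition TP :: "nat \<Rightarrow> 'p::prime_card fpbar poly poly \<Rightarrow> 'p mat2 \<Rightarrow> 'p fpbar poly poly" where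
  "TP r P = (\<Oplus>\<^bsub>V.ind r\<^esub>t\<in>teich_reps. V.elem r (tmat t) (sv 1 (red (- t)) 0 0 P)) \<oplus>\<^bsub>V.ind r\<^esub> V.elem r alpha (sv 0 0 0 1 P)"

lemma TP_closed: "P \<in> homogeneous2 r \<Longrightarrow> TP r P \<in> carrier (V.ind r)"
  unfolding TP_def by (intro V.I.a_closed V.I.finsum_closed funcsetI V.elem_closed) (simp_all add: sv_homogeneous)

lemma TP_apply:
  assumes P: "P \<in> homogeneous2 r" and x: "x \<in> GL2"
  shows "TP r P x = (\<Oplus>\<^bsub>V_rep r\<^esub>t\<in>teich_reps. V.elem r (tmat t) (sv 1 (red (- t)) 0 0 P) x) +
    V.elem r alpha (sv 0 0 0 1 P) x"
proof -
  have "(\<Oplus>\<^bsub>V.ind r\<^esub>t\<in>teich_reps. V.elem r (tmat t) (sv 1 (red (- t)) 0 0 P)) x =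
      (\<Oplus>\<^bsub>V_rep r\<^esub>t\<in>teich_reps. V.elem r (tmat t) (sv 1 (red (- t)) 0 0 P) x)"
    by (rule V.ind_finsum_apply[OF finite_teich_reps _ x]) (simp add: P sv_homogeneous)
  then show ?thesis using x by (simp add: TP_def)
qed

lemma TP_primitive:
  fixes P :: "'p::prime_card fpbar poly poly"
  assumes P: "P \<in> homogeneous2 r" and x: "x = ppow n ** zmat a b c d"
    and u: "a * d - b * c = pz * u" "u dvd 1"
  shows "TP r P x = sv (red a) (red b) (red c) (red d) P"
proof -
  let ?v = "sv (red a) (red b) (red c) (red d) P"
  have vh: "?v \<in> homogeneous2 r" by (rule sv_homogeneous[OF P])
  have u0: "pz * u \<noteq> 0" using u(2) zp_p_nonzero zp_unit_iff_red by (metis mult_eq_0_iff red_0)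
  have "det (zmat a b c d) \<noteq> 0" using u0 by (simp add: det_zmat u(1) of_zp_eq_0_iff del: mult_eq_0_iff)
  then have xG: "x \<in> GL2" by (simp add: x GL2_iff_det[of "zmat a b c d"])
  have t_in: "x ** tmat t = ppow (n + 1) ** zmat a e c f \<and> zmat a e c f \<in> GL2_Zp"
    if "a * t + b = pz * e" "c * t + d = pz * f" for t e f
  proof
    have "zmat a b c d ** tmat t = mat pq ** zmat a e c f"
      using that by (simp add: tmat_zmat zmat_mult mult.commute)
        (simp add: zmat_def mat_mat2 mat2_mult of_zp_mult of_zp_of_nat)
    then have "x ** tmat t = (ppow n ** mat pq) ** zmat a e c f"
      by (simp add: x flip: matrix_mul_assoc)
    then show "x ** tmat t = ppow (n + 1) ** zmat a e c f"
      by (simp add: mat_mult_mat power_int_add)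
    have "pz * (a * f - e * c) = a * (c * t + d) - (a * t + b) * c" by (simp only: that) (simp add: algebra_simps)
    also have "\<dots> = pz * u" using u(1) by (simp add: algebra_simps)
    finally have "a * f - e * c = u" using zp_p_nonzero mult_left_cancel by blast
    then show "zmat a e c f \<in> GL2_Zp" using u(2) by (simp add: zmat_K_iff)
  qed
  have a_in: "x ** alpha = ppow (n + 1) ** zmat e b f d \<and> zmat e b f d \<in> GL2_Zp"
    if "a = pz * e" "c = pz * f" for e f
  proof
    have "zmat a b c d ** alpha = mat pq ** zmat e b f d"
      using that by (simp add: alpha_zmat zmat_mult mult.commute)
        (simp add: zmat_def mat_mat2 mat2_mult of_zp_mult of_zp_of_nat)
    then have "x ** alpha = (ppow n ** mat pq) ** zmat e b f d"
      by (simp add: x flip: matrix_mul_assoc)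
    then show "x ** alpha = ppow (n + 1) ** zmat e b f d"
      by (simp add: mat_mult_mat power_int_add)
    have "pz * (e * d - b * f) = pz * u" unfolding u(1)[symmetric] by (simp add: that algebra_simps)
    then have "e * d - b * f = u" using zp_p_nonzero mult_left_cancel by blast
    then show "zmat e b f d \<in> GL2_Zp" using u(2) by (simp add: zmat_K_iff)
  qed
  have t_red: "red (a * t + b) = 0 \<and> red (c * t + d) = 0" if "x ** tmat t \<in> KZ" for t
  proof -
    have "x ** tmat t = ppow n ** zmat (a * pz) (a * t + b) (c * pz) (c * t + d)"
      by (simp add: x tmat_zmat zmat_mult flip: matrix_mul_assoc)
    moreover have "a * pz * (c * t + d) - (a * t + b) * (c * pz) = pz * (a * d - b * c)"
      by (simp add: algebra_simps)
    ultimately show ?thesis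
      using KZ_det_p2[of n "a * pz" "a * t + b" "c * pz" "c * t + d" u] that u by (simp add: mult.assoc)
  qed
  have a_red: "red a = 0 \<and> red c = 0" if "x ** alpha \<in> KZ"
  proof -
    have "x ** alpha = ppow n ** zmat a (b * pz) c (d * pz)"
      by (simp add: x alpha_zmat zmat_mult flip: matrix_mul_assoc)
    moreover have "a * (d * pz) - b * pz * c = pz * (a * d - b * c)"
      by (simp add: algebra_simps)
    ultimately show ?thesis
      using KZ_det_p2[of n a "b * pz" c "d * pz" u] that u by (simp add: mult.assoc)
  qed
  have t_val: "V.elem r (tmat t) (sv 1 (red (- t)) 0 0 P) x = ?v" if "red (a * t + b) = 0" "red (c * t + d) = 0" for t
  proof -
    have "red (a * t + b) = red 0" "red (c * t + d) = red 0" using that by simp_all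
    then obtain e f where ef: "a * t + b - 0 = pz * e" "c * t + d - 0 = pz * f" by (metis red_eqE)
    have tt: "x ** tmat t = ppow (n + 1) ** zmat a e c f" "zmat a e c f \<in> GL2_Zp"
      using t_in[of t e f] ef by simp_all
    have "V.elem r (tmat t) (sv 1 (red (- t)) 0 0 P) x = sv (red a) (red e) (red c) (red f) (sv 1 (red (- t)) 0 0 P)"
      using tt KZ_iff[of "x ** tmat t"] by (simp add: V.elem_apply[OF xG] V_rep_act_zmat[OF tt(2)]) blast
    \<comment> \<open>Modulo \<open>p\<close> the second column of \<open>x\<close> is
      \<open>- t\<close> times the first, so the product with the singular matrix of the
      substitution gives back all of \<open>x\<close>.\<close>
    also have "\<dots> = ?v"
    proof -
      have "red b = - (red a * red t)" "red d = - (red c * red t)"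
        using that by (simp_all add: eq_neg_iff_add_eq_0 add.commute)
      then show ?thesis by (simp add: sv_sv)
    qed
    finally show ?thesis .
  qed
  have t_zero: "V.elem r (tmat t) (sv 1 (red (- t)) 0 0 P) x = 0" if "\<not> (red (a * t + b) = 0 \<and> red (c * t + d) = 0)" for t
    using that t_red[of t] by (auto simp: V.elem_apply[OF xG])
  show ?thesis
  \<comment> \<open>The reduction of \<open>x\<close> has rank one. If its kernel is spanned by the
    first basis vector, only the \<open>alpha\<close> term contributes; otherwise the kernel
    contains \<open>(t, 1)\<close> for exactly one representative \<open>t\<close>, and only that
    term does.\<close>
  proof (cases "red a = 0 \<and> red c = 0")
    case True
    then have "red a = red 0" "red c = red 0" by simp_all
    then obtain e f where ef: "a - 0 = pz * e" "c - 0 = pz * f" by (metis red_eqE)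
    have aa: "x ** alpha = ppow (n + 1) ** zmat e b f d" "zmat e b f d \<in> GL2_Zp"
      using a_in[of e f] ef by simp_all
    have "V.elem r alpha (sv 0 0 0 1 P) x = sv (red e) (red b) (red f) (red d) (sv 0 0 0 1 P)"
      using aa KZ_iff[of "x ** alpha"] by (simp add: V.elem_apply[OF xG] V_rep_act_zmat[OF aa(2)]) blast
    also have "\<dots> = ?v" using True by (simp add: sv_sv)
    finally have 1: "V.elem r alpha (sv 0 0 0 1 P) x = ?v" .
    have no: "\<not> (red (a * t + b) = 0 \<and> red (c * t + d) = 0)" for t
    proof
      assume "red (a * t + b) = 0 \<and> red (c * t + d) = 0"
      then have "red b = 0" "red d = 0" using True by simp_all
      moreover have "e * d - b * f = u"
      proof -
        have "pz * (e * d - b * f) = pz * u" unfolding u(1)[symmetric] using ef by (simp add: algebra_simps)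
        then show ?thesis using zp_p_nonzero mult_left_cancel by blast
      qed
      ultimately have "red u = 0" by (metis diff_self mult_zero_left mult_zero_right red_diff red_mult)
      then show False using u(2) zp_unit_iff_red by blast
    qed
    have "(\<Oplus>\<^bsub>V_rep r\<^esub>t\<in>teich_reps. V.elem r (tmat t) (sv 1 (red (- t)) 0 0 P) x) = (\<Oplus>\<^bsub>V_rep r\<^esub>t\<in>(teich_reps :: 'p zp set). \<zero>\<^bsub>V_rep r\<^esub>)"
      using t_zero[OF no] by (intro V.S.finsum_cong') auto
    then have "(\<Oplus>\<^bsub>V_rep r\<^esub>t\<in>teich_reps. V.elem r (tmat t) (sv 1 (red (- t)) 0 0 P) x) = 0"
      using V.S.finsum_zero[of r teich_reps] by simp
    then show ?thesis by (simp add: TP_apply[OF P xG] 1)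
  next
    case False
    have det0: "red a * red d = red b * red c"
    proof -
      have "red (a * d - b * c) = 0" by (simp only: u(1) red_mult red_p mult_zero_left)
      then show ?thesis by simp
    qed
    obtain t where t: "t \<in> teich_reps" "red (a * t + b) = 0 \<and> red (c * t + d) = 0"
    proof (cases "red a = 0")
      case True
      then have c0: "red c \<noteq> 0" using False by simp
      then obtain v where v: "c * v = 1" using zp_unit_iff_red by (metis dvdE)
      then have v': "red c * red v = 1" by (metis red_1 red_mult)
      obtain t where t: "t \<in> teich_reps" "red t = red (- d * v)" by (rule teich_cong_exists)
      have "red c * red t = - red d * (red c * red v)" using t(2) by (simp add: mult_ac)
      then have "red (c * t + d) = 0" by (simp add: v')
      moreover have "red b = 0" using det0 True c0 by simp
      ultimately show ?thesis using that t(1) True by simp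
    next
      case a0: False
      then obtain v where v: "a * v = 1" using zp_unit_iff_red by (metis dvdE)
      then have v': "red a * red v = 1" by (metis red_1 red_mult)
      obtain t where t: "t \<in> teich_reps" "red t = red (- b * v)" by (rule teich_cong_exists)
      have "red a * red t = - red b * (red a * red v)" using t(2) by (simp add: mult_ac)
      then have 1: "red a * red t + red b = 0" by (simp add: v')
      have "red a * (red c * red t + red d) = red c * (red a * red t + red b)"
        using det0 by (simp add: algebra_simps)
      then have "red c * red t + red d = 0" using 1 a0 by simp
      then show ?thesis using that t(1) 1 by simp
    qed
    have uniq: "t' = t" if t': "t' \<in> teich_reps" "red (a * t' + b) = 0 \<and> red (c * t' + d) = 0" for t'
    proof -
      have "red a * red t' = red a * red t" "red c * red t' = red c * red t"
        using t(2) t'(2) by (simp_all add: eq_neg_iff_add_eq_0[symmetric])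
      then have "red t' = red t" using False by auto
      then show ?thesis using inj_on_red_teich t(1) t'(1) by (auto simp: inj_on_def)
    qed
    have "(\<Oplus>\<^bsub>V_rep r\<^esub>s\<in>teich_reps. V.elem r (tmat s) (sv 1 (red (- s)) 0 0 P) x) =
        (\<Oplus>\<^bsub>V_rep r\<^esub>s\<in>teich_reps. if t = s then ?v else \<zero>\<^bsub>V_rep r\<^esub>)"
    proof (rule V.S.finsum_cong')
      show "V.elem r (tmat s) (sv 1 (red (- s)) 0 0 P) x = (if t = s then ?v else \<zero>\<^bsub>V_rep r\<^esub>)"
        if "s \<in> teich_reps" for s
        using t_val[of s] t_zero[of s] uniq[OF that] t(2) by auto
    qed (use vh in auto)
    also have "\<dots> = ?v"
      using V.S.finsum_singleton[OF t(1) finite_teich_reps, of "\<lambda>_. ?v"] vh by auto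
    finally have 1: "(\<Oplus>\<^bsub>V_rep r\<^esub>s\<in>teich_reps. V.elem r (tmat s) (sv 1 (red (- s)) 0 0 P) x) = ?v" .
    have "V.elem r alpha (sv 0 0 0 1 P) x = 0"
      using a_red False by (auto simp: V.elem_apply[OF xG])
    then show ?thesis unfolding TP_apply[OF P xG] 1 by simp
  qed
qed

text \<open>The matrix with entries \<open>a\<close>, \<open>b\<close>, \<open>c\<close>,
  \<open>d\<close> is the adjugate of \<open>g\<close>, so \<open>x\<close> is \<open>p^(-1)\<close>
  times the element \<open>x ** g\<close> of \<open>KZ\<close> times an integral matrix of
  determinant \<open>p\<close>.\<close>

lemma p_primitive_of_KZ:
  fixes x g :: "'p::prime_card mat2"
  assumes "x ** g \<in> KZ" "g ** zmat a b c d = mat pq" "a * d - b * c = pz"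
  shows "p_primitive x"
proof -
  obtain m k where h: "k \<in> GL2_Zp" "x ** g = ppow m ** k" using assms(1) by (rule KZ_cases)
  have "p_primitive (ppow (m - 1) ** (k ** zmat a b c d))"
  proof -
    obtain a' b' c' d' where k: "k = zmat a' b' c' d'" "(a' * d' - b' * c') dvd 1" using h(1) by (rule K_cases)
    have "(a'*a+b'*c) * (c'*b+d'*d) - (a'*b+b'*d) * (c'*a+d'*c) = (a * d - b * c) * (a' * d' - b' * c')"
      by (simp add: algebra_simps)
    then show ?thesis
      unfolding p_primitive_def k(1) zmat_mult assms(3) using k(2) by blast
  qed
  moreover have "x = ppow (m - 1) ** (k ** zmat a b c d)"
  proof -
    have "x ** mat pq = ppow m ** (k ** zmat a b c d)"
      by (simp only: assms(2)[symmetric] matrix_mul_assoc h(2))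
    then have "x ** mat pq ** ppow (- 1) = ppow m ** (k ** zmat a b c d) ** ppow (- 1)" by simp
    also have "x ** mat pq ** ppow (- 1) = x"
      by (simp add: mat_mult_mat power_int_minus flip: matrix_mul_assoc)
    also have "ppow m ** (k ** zmat a b c d) ** ppow (- 1) = ppow (- 1) ** (ppow m ** (k ** zmat a b c d))"
      by (rule mat_commute[symmetric])
    also have "\<dots> = ppow (- 1 + m) ** (k ** zmat a b c d)"
      by (simp only: matrix_mul_assoc mat_mult_mat power_int_add[OF disjI1[OF qp_p_nonzero]])
    also have "- 1 + m = m - 1" by simp
    finally show ?thesis .
  qed
  ultimately show ?thesis by simp
qed

lemma TP_not_primitive:
  fixes P :: "'p::prime_card fpbar poly poly"
  assumes P: "P \<in> homogeneous2 r" and x: "x \<in> GL2" "\<not> p_primitive x"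
  shows "TP r P x = 0"
proof -
  have 1: "x ** tmat t \<notin> KZ" for t
  proof
    assume "x ** tmat t \<in> KZ"
    then have "p_primitive x"
      by (rule p_primitive_of_KZ[where a = 1 and b = "- t" and c = 0 and d = pz])
        (simp_all add: tmat_zmat zmat_mult, simp add: zmat_def mat_mat2 of_zp_of_nat of_zp_0)
    then show False using x(2) by simp
  qed
  have 2: "x ** alpha \<notin> KZ"
  proof
    assume "x ** alpha \<in> KZ"
    then have "p_primitive x"
      by (rule p_primitive_of_KZ[where a = pz and b = 0 and c = 0 and d = 1])
        (simp_all add: alpha_zmat zmat_mult, simp add: zmat_def mat_mat2 of_zp_of_nat of_zp_0)
    then show False using x(2) by simp
  qed
  have "(\<Oplus>\<^bsub>V_rep r\<^esub>t\<in>teich_reps. V.elem r (tmat t) (sv 1 (red (- t)) 0 0 P) x) = (\<Oplus>\<^bsub>V_rep r\<^esub>t\<in>(teich_reps :: 'p zp set). \<zero>\<^bsub>V_rep r\<^esub>)"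
    using 1 by (intro V.S.finsum_cong') (auto simp: V.elem_apply[OF x(1)])
  then have "(\<Oplus>\<^bsub>V_rep r\<^esub>t\<in>teich_reps. V.elem r (tmat t) (sv 1 (red (- t)) 0 0 P) x) = 0"
    using V.S.finsum_zero[of r teich_reps] by simp
  then show ?thesis using 2 by (simp add: TP_apply[OF P x(1)] V.elem_apply[OF x(1)])
qed

lemma TP_eqI:
  fixes F F' :: "'p::prime_card mat2 \<Rightarrow> 'p fpbar poly poly"
  assumes "F \<in> carrier (V.ind r)" "F' \<in> carrier (V.ind r)"
    and "\<And>n a b c d u. a * d - b * c = pz * u \<Longrightarrow> u dvd 1 \<Longrightarrow> ppow n ** zmat a b c d \<in> GL2 \<Longrightarrow>
      F (ppow n ** zmat a b c d) = F' (ppow n ** zmat a b c d)"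
    and "\<And>x. x \<in> GL2 \<Longrightarrow> \<not> p_primitive x \<Longrightarrow> F x = F' x"
  shows "F = F'"
proof (rule V.ind_ext[OF assms(1,2)])
  fix x :: "'p mat2" assume "x \<in> GL2"
  then show "F x = F' x" using assms(3,4) by (cases "p_primitive x") (auto simp: p_primitive_def)
qed

lemma TP_add:
  fixes P Q :: "'p::prime_card fpbar poly poly"
  assumes P: "P \<in> homogeneous2 r" and Q: "Q \<in> homogeneous2 r"
  shows "TP r (P + Q) = TP r P \<oplus>\<^bsub>V.ind r\<^esub> TP r Q"
proof (rule TP_eqI[OF TP_closed[OF homogeneous2_add[OF P Q]] V.I.a_closed[OF TP_closed[OF P] TP_closed[OF Q]]])
  fix n a b c d and u :: "'p zp"
  assume u: "a * d - b * c = pz * u" "u dvd 1" and "ppow n ** zmat a b c d \<in> GL2"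
  then show "TP r (P + Q) (ppow n ** zmat a b c d) = (TP r P \<oplus>\<^bsub>V.ind r\<^esub> TP r Q) (ppow n ** zmat a b c d)"
    by (simp add: TP_primitive[OF P refl u] TP_primitive[OF Q refl u]
      TP_primitive[OF homogeneous2_add[OF P Q] refl u] sv_add)
qed (simp add: TP_not_primitive P Q homogeneous2_add)

lemma TP_smult:
  fixes P :: "'p::prime_card fpbar poly poly"
  assumes P: "P \<in> homogeneous2 r"
  shows "TP r (const2 e * P) = e \<odot>\<^bsub>V.ind r\<^esub> TP r P"
proof (rule TP_eqI[OF TP_closed[OF homogeneous2_const[OF P]] V.I.smult_clo[OF TP_closed[OF P]]])
  fix n a b c d and u :: "'p zp"
  assume u: "a * d - b * c = pz * u" "u dvd 1" and "ppow n ** zmat a b c d \<in> GL2"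
  then show "TP r (const2 e * P) (ppow n ** zmat a b c d) = (e \<odot>\<^bsub>V.ind r\<^esub> TP r P) (ppow n ** zmat a b c d)"
    by (simp add: TP_primitive[OF P refl u] TP_primitive[OF homogeneous2_const[OF P] refl u] sv_mult)
qed (simp add: TP_not_primitive P homogeneous2_const)

lemma TP_act:
  fixes P :: "'p::prime_card fpbar poly poly"
  assumes P: "P \<in> homogeneous2 r" and h: "h \<in> KZ"
  shows "TP r (act (V_rep r) h P) = act (V.ind r) h (TP r P)"
proof -
  have hG: "h \<in> GL2" using h by (rule KZ_GL2)
  obtain m k where k: "k \<in> GL2_Zp" "h = ppow m ** k" using h by (rule KZ_cases)
  obtain a' b' c' d' where kz: "k = zmat a' b' c' d'" "(a' * d' - b' * c') dvd 1" using k(1) by (rule K_cases)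
  have hP: "act (V_rep r) h P = sv (red a') (red b') (red c') (red d') P"
    unfolding k(2) kz(1) by (rule V_rep_act_zmat[OF k(1)[unfolded kz(1)]])
  have hPh: "act (V_rep r) h P \<in> homogeneous2 r" unfolding hP by (rule sv_homogeneous[OF P])
  show ?thesis
  proof (rule TP_eqI[OF TP_closed[OF hPh] V.I.act_closed[OF hG TP_closed[OF P]]])
    fix n a b c d and u :: "'p zp"
    assume u: "a * d - b * c = pz * u" "u dvd 1" and x: "ppow n ** zmat a b c d \<in> GL2"
    have "(a*a'+b*c') * (c*b'+d*d') - (a*b'+b*d') * (c*a'+d*c') = (a * d - b * c) * (a' * d' - b' * c')"
      by (simp add: algebra_simps)
    then have det: "(a*a'+b*c') * (c*b'+d*d') - (a*b'+b*d') * (c*a'+d*c') = pz * (u * (a' * d' - b' * c'))"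
      by (simp only: u(1) mult.assoc)
    have un: "u * (a' * d' - b' * c') dvd 1" using u(2) kz(2) zp_unit_mult_iff by blast
    have xh: "ppow n ** zmat a b c d ** h = ppow (n + m) ** zmat (a*a'+b*c') (a*b'+b*d') (c*a'+d*c') (c*b'+d*d')"
      by (simp only: k(2) kz(1) ppow_mult zmat_mult)
    have "act (V.ind r) h (TP r P) (ppow n ** zmat a b c d) = TP r P (ppow n ** zmat a b c d ** h)"
      using x by simp
    also have "\<dots> = sv (red (a*a'+b*c')) (red (a*b'+b*d')) (red (c*a'+d*c')) (red (c*b'+d*d')) P"
      by (rule TP_primitive[OF P xh det un])
    also have "\<dots> = sv (red a) (red b) (red c) (red d) (act (V_rep r) h P)"
      by (simp only: hP sv_sv red_add red_mult)
    also have "\<dots> = TP r (act (V_rep r) h P) (ppow n ** zmat a b c d)"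
      by (rule TP_primitive[OF hPh refl u, symmetric])
    finally show "TP r (act (V_rep r) h P) (ppow n ** zmat a b c d) = act (V.ind r) h (TP r P) (ppow n ** zmat a b c d)" by simp
  next
    fix x :: "'p mat2" assume x: "x \<in> GL2" "\<not> p_primitive x"
    have "x ** h ** matrix_inv h = x" using hG by simp
    then have "\<not> p_primitive (x ** h)"
      using p_primitive_mult[OF _ KZ_inv[OF h], of "x ** h"] x(2) by metis
    then have "TP r P (x ** h) = 0" by (intro TP_not_primitive[OF P]) (simp_all add: x hG)
    then show "TP r (act (V_rep r) h P) x = act (V.ind r) h (TP r P) x"
      using x by (simp add: TP_not_primitive[OF hPh])
  qed
qed

lemma T_op_endo: "G_endo (V.ind r) (T_op r :: _ \<Rightarrow> 'p::prime_card mat2 \<Rightarrow> _)"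
  and T_op_gen: "P \<in> homogeneous2 r \<Longrightarrow> T_op r (V.elem r (mat 1 :: 'p mat2) P) = TP r P"
proof -
  have "\<exists>!T. G_endo (V.ind r) T \<and> (\<forall>P\<in>carrier (V_rep r). T (V.elem r (mat 1 :: 'p mat2) P) = TP r P)"
    by (rule V.ex1_endo) (simp_all add: TP_closed TP_act TP_add TP_smult del: V.ind_simps)
  note th = theI'[OF this]
  have "T_op r = (THE T. G_endo (V.ind r) T \<and> (\<forall>P\<in>carrier (V_rep r). T (V.elem r (mat 1 :: 'p mat2) P) = TP r P))"
    unfolding T_op_def TP_def ind_KZ_def elem_fun_V sv_def tmat_def by simp
  then show "G_endo (V.ind r) (T_op r :: _ \<Rightarrow> 'p mat2 \<Rightarrow> _)"
    "P \<in> homogeneous2 r \<Longrightarrow> T_op r (V.elem r (mat 1 :: 'p mat2) P) = TP r P"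
    using th by simp_all
qed

section \<open>Functions on the prime field\<close>

abbreviation (input) ac :: "'p::prime_card mod_ring \<Rightarrow> 'p fpbar" where "ac \<equiv> to_ac"

lemma CHAR_fpbar [simp]: "CHAR('p::prime_card fpbar) = CARD('p)"
  by simp

text \<open>The binomial coefficient divides \<open>n!\<close>, which is prime to \<open>p\<close>
  for \<open>n < p\<close>.\<close>

lemma of_nat_choose_nonzero:
  assumes "n < CARD('p::prime_card)" "k \<le> n"
  shows "of_nat (n choose k) \<noteq> (0 :: 'p fpbar)"
proof
  assume "of_nat (n choose k) = (0 :: 'p fpbar)"
  then have "CARD('p) dvd n choose k" by (simp only: of_nat_eq_0_iff_char_dvd CHAR_fpbar)
  then have "CARD('p) dvd fact k * fact (n - k) * (n choose k)" by simp
  then have "CARD('p) dvd fact n" using binomial_fact_lemma[OF assms(2)] by simp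
  then show False using assms(1) prime_dvd_fact_iff[OF prime_card[where ?'a = 'p]] by simp
qed

lemma sum_p_eq_0: "(\<Sum>t\<in>(UNIV :: 'p::prime_card mod_ring set). c) = (0 :: 'p fpbar)"
proof -
  have "(of_nat (CARD('p)) :: 'p fpbar) = 0" by (simp only: of_nat_eq_0_iff_char_dvd CHAR_fpbar dvd_refl)
  then show ?thesis by simp
qed

text \<open>The sum is \<open>(t^p - s^p) / (t - s)\<close>, equal to 1 by Fermat for
  \<open>s \<noteq> t\<close>, and it is \<open>p t^(p-1) = 0\<close> on the diagonal. So 1 minus
  the indicator of \<open>s = t\<close> is written as a polynomial in \<open>t\<close>, ready for
  interpolation.\<close>

lemma fermat_sum:
  fixes s t :: "'p::prime_card mod_ring"
  shows "(\<Sum>j<CARD('p). ac s ^ (CARD('p) - Suc j) * ac t ^ j) = (if s = t then 0 else 1)"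
proof (cases "s = t")
  case True
  have "ac t ^ (CARD('p) - Suc j) * ac t ^ j = ac t ^ (CARD('p) - 1)" if "j < CARD('p)" for j
    using that by (simp flip: power_add)
  then have "(\<Sum>j<CARD('p). ac s ^ (CARD('p) - Suc j) * ac t ^ j) = of_nat (CARD('p)) * ac t ^ (CARD('p) - 1)"
    using True by simp
  moreover have "(of_nat (CARD('p)) :: 'p fpbar) = 0" by (simp only: of_nat_eq_0_iff_char_dvd CHAR_fpbar dvd_refl)
  ultimately show ?thesis using True by simp
next
  case False
  let ?S = "\<Sum>j<CARD('p). ac s ^ (CARD('p) - Suc j) * ac t ^ j"
  have "(ac t - ac s) * ?S = ac t - ac s"
    using power_diff_sumr2[of "ac t" "CARD('p)" "ac s"] by (simp add: to_ac_fermat)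
  then have "(ac t - ac s) * (?S - 1) = 0" by (simp add: algebra_simps)
  then have "?S = 1" using False by simp
  then show ?thesis using False by simp
qed

lemma to_ac_diff_power_last:
  fixes s t :: "'p::prime_card mod_ring"
  shows "(ac s - ac t) ^ (CARD('p) - 1) = (if s = t then 0 else 1)"
proof (cases "s = t")
  case True
  then show ?thesis using prime_gt_1_nat[OF prime_card[where ?'a = 'p]] by simp
next
  case False
  have "ac (s - t) * ac (s - t) ^ (CARD('p) - 1) = ac (s - t) * 1"
    using to_ac_fermat[of "s - t"] prime_gt_0_nat[OF prime_card[where ?'a = 'p]] by (simp flip: power_Suc del: to_ac_diff)
  then have "ac (s - t) ^ (CARD('p) - 1) = 1" using False by (simp del: to_ac_diff)
  then show ?thesis using False by simp
qed

text \<open>The exponent is \<open>p - 1 + (j - i)\<close>, and \<open>r > 0\<close> keeps it below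
  \<open>2 (p - 1)\<close>, where the power sum would be nonzero again.\<close>

lemma sum_to_ac_power_shifted:
  fixes i j m r :: nat
  assumes "i \<le> m" "j \<le> m" "m + r = CARD('p) - 1" "r > 0"
  shows "(\<Sum>u\<in>(UNIV :: 'p::prime_card mod_ring set). ac u ^ (r + j) * ac u ^ (m - i)) = (if i = j then -1 else 0)"
proof -
  have "(\<Sum>u\<in>(UNIV :: 'p mod_ring set). ac u ^ (r + j) * ac u ^ (m - i)) = (\<Sum>u\<in>(UNIV :: 'p mod_ring set). ac u ^ (r + j + (m - i)))"
    by (simp add: power_add)
  also have "\<dots> = (if i = j then -1 else 0)"
  proof -
    consider "i = j" | "j < i" | "i < j" by linarith
    then show ?thesis
    proof cases
      case 1
      then have "r + j + (m - i) = CARD('p) - 1" using assms by simp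
      then show ?thesis using 1 sum_to_ac_power_last[where ?'p = 'p] by simp
    next
      case 2
      then show ?thesis using assms by (simp add: sum_to_ac_power_less)
    next
      case 3
      then show ?thesis using assms by (simp add: sum_to_ac_power_between)
    qed
  qed
  finally show ?thesis .
qed

text \<open>By the power sum formulas, \<open>c\<close> is a polynomial function of degree at most \<open>p - 1 - r\<close>, and
  the powers \<open>(t - u)^(p - 1 - r)\<close> span these because the binomial coefficients are units.\<close>

lemma local_kernel:
  fixes c :: "'p::prime_card mod_ring \<Rightarrow> 'p fpbar"
  assumes r: "r \<le> CARD('p) - 1"
    and low: "\<And>i. i < r \<Longrightarrow> (\<Sum>t\<in>UNIV. c t * ac t ^ i) = 0"
    and top: "(\<Sum>t\<in>UNIV. c t * ac t ^ r) + d = 0"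
  shows "\<exists>b. (\<forall>t. c t = (\<Sum>u\<in>UNIV. b u * (ac t - ac u) ^ (CARD('p) - 1 - r))) \<and> d = (\<Sum>u\<in>UNIV. b u)"
proof (cases "r = 0")
  case True
  \<comment> \<open>For \<open>r = 0\<close> the power \<open>(t - u)^(p-1)\<close> is 1 for
    \<open>u \<noteq> t\<close> and 0 for \<open>u = t\<close>, so the required sum is the total of
    \<open>b\<close> minus \<open>b t\<close>. The total is \<open>d\<close> by \<open>top\<close>,
    since the constant \<open>d\<close> sums to 0 over \<open>F_p\<close>.\<close>
  define b where "b u = d - c u" for u
  have "(\<Sum>u\<in>UNIV. b u) = - (\<Sum>u\<in>UNIV. c u)" unfolding b_def sum_subtractf sum_p_eq_0 by simp
  also have "\<dots> = d" using top True by (simp add: eq_neg_iff_add_eq_0 add.commute neg_eq_iff_add_eq_0)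
  finally have bd: "(\<Sum>u\<in>UNIV. b u) = d" .
  have "c t = (\<Sum>u\<in>UNIV. b u * (ac t - ac u) ^ (CARD('p) - 1 - r))" for t
  proof -
    have "(\<Sum>u\<in>UNIV. b u * (ac t - ac u) ^ (CARD('p) - 1 - r)) = (\<Sum>u\<in>UNIV. b u - (if u = t then b u else 0))"
      using True by (intro sum.cong) (auto simp: to_ac_diff_power_last[unfolded One_nat_def])
    also have "\<dots> = d - b t" by (simp add: sum_subtractf bd)
    finally show ?thesis by (simp add: b_def)
  qed
  then show ?thesis using bd by (intro exI[of _ b]) blast
next
  case False
  define m where "m = CARD('p) - 1 - r"
  have mr: "m + r = CARD('p) - 1" "r > 0" using r False by (simp_all add: m_def)
  have mp: "m < CARD('p)" using mr by simp
  define M where "M i = (\<Sum>s\<in>UNIV. c s * ac s ^ i)" for i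
  have M_low: "M i = 0" if "i < r" for i using low[OF that] by (simp add: M_def)
  \<comment> \<open>Interpolation through \<open>fermat_sum\<close> expresses \<open>c\<close> by
    its power moments \<open>M\<close>; those of order below \<open>r\<close> vanish, which bounds
    the degree by \<open>m\<close>.\<close>
  have interp: "c t = - (\<Sum>j\<le>m. M (CARD('p) - Suc j) * ac t ^ j)" for t
  proof -
    have "(\<Sum>j<CARD('p). M (CARD('p) - Suc j) * ac t ^ j) =
        (\<Sum>j<CARD('p). \<Sum>s\<in>UNIV. c s * (ac s ^ (CARD('p) - Suc j) * ac t ^ j))"
      by (simp add: M_def sum_distrib_right mult.assoc)
    also have "\<dots> = (\<Sum>s\<in>UNIV. \<Sum>j<CARD('p). c s * (ac s ^ (CARD('p) - Suc j) * ac t ^ j))"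
      by (rule sum.swap)
    also have "\<dots> = (\<Sum>s\<in>UNIV. c s * (if s = t then 0 else 1))"
      by (simp only: sum_distrib_left[symmetric] fermat_sum)
    also have "\<dots> = (\<Sum>s\<in>UNIV. c s - (if s = t then c s else 0))"
      by (intro sum.cong) auto
    also have "\<dots> = M 0 - c t" by (simp add: sum_subtractf M_def)
    also have "\<dots> = - c t" using M_low[of 0] mr(2) by simp
    finally have "c t = - (\<Sum>j<CARD('p). M (CARD('p) - Suc j) * ac t ^ j)" by simp
    also have "(\<Sum>j<CARD('p). M (CARD('p) - Suc j) * ac t ^ j) = (\<Sum>j\<le>m. M (CARD('p) - Suc j) * ac t ^ j)"
    proof (rule sum.mono_neutral_right)
      show "\<forall>j\<in>{..<CARD('p)} - {..m}. M (CARD('p) - Suc j) * ac t ^ j = 0"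
      proof
        fix j assume "j \<in> {..<CARD('p)} - {..m}"
        then have "CARD('p) - Suc j < r" using mr by auto
        from M_low[OF this] show "M (CARD('p) - Suc j) * ac t ^ j = 0" by simp
      qed
    qed (use mp in auto)
    finally show ?thesis .
  qed
  \<comment> \<open>By \<open>pw\<close>, weighting \<open>(t - u)^m\<close> with
    \<open>u^(r+j)\<close> and summing over \<open>u\<close> isolates the monomial
    \<open>t^j\<close>, up to sign and a binomial coefficient; \<open>q\<close> divides by the
    latter.\<close>
  define q where "q j = M (CARD('p) - Suc j) * (-1) ^ (m - j) / of_nat (m choose j)" for j
  define b where "b u = (\<Sum>j\<le>m. q j * ac u ^ (r + j))" for u
  have pw: "(\<Sum>u\<in>UNIV. ac u ^ (r + j) * (ac t - ac u) ^ m) = - (of_nat (m choose j) * (-1) ^ (m - j)) * ac t ^ j"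
    if j: "j \<le> m" for j and t :: "'p mod_ring"
  proof -
    have "(ac t - ac u) ^ m = (\<Sum>i\<le>m. (of_nat (m choose i) * (-1) ^ (m - i) * ac t ^ i) * ac u ^ (m - i))" for u
      using binomial_ring[of "ac t" "- ac u" m] power_minus[of "ac u"]
      by (simp add: mult_ac cong: sum.cong)
    then have "(\<Sum>u\<in>UNIV. ac u ^ (r + j) * (ac t - ac u) ^ m) =
        (\<Sum>u\<in>UNIV. \<Sum>i\<le>m. (of_nat (m choose i) * (-1) ^ (m - i) * ac t ^ i) * (ac u ^ (r + j) * ac u ^ (m - i)))"
      by (simp add: sum_distrib_left mult_ac)
    also have "\<dots> = (\<Sum>i\<le>m. \<Sum>u\<in>UNIV. (of_nat (m choose i) * (-1) ^ (m - i) * ac t ^ i) * (ac u ^ (r + j) * ac u ^ (m - i)))"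
      by (rule sum.swap)
    also have "\<dots> = (\<Sum>i\<le>m. (of_nat (m choose i) * (-1) ^ (m - i) * ac t ^ i) * (if i = j then -1 else 0))"
      by (intro sum.cong refl) (simp add: sum_distrib_left[symmetric] sum_to_ac_power_shifted[OF _ j mr])
    also have "\<dots> = (\<Sum>i\<le>m. if i = j then - (of_nat (m choose i) * (-1) ^ (m - i)) * ac t ^ i else 0)"
      by (intro sum.cong) auto
    finally show ?thesis using j by simp
  qed
  have qc: "q j * (of_nat (m choose j) * (-1) ^ (m - j)) = M (CARD('p) - Suc j)" if "j \<le> m" for j
    using of_nat_choose_nonzero[OF mp that] by (simp add: q_def flip: power_mult_distrib)
  have "c t = (\<Sum>u\<in>UNIV. b u * (ac t - ac u) ^ m)" for t
  proof -
    have "(\<Sum>u\<in>UNIV. b u * (ac t - ac u) ^ m) = (\<Sum>u\<in>UNIV. \<Sum>j\<le>m. q j * (ac u ^ (r + j) * (ac t - ac u) ^ m))"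
      by (simp add: b_def sum_distrib_right mult.assoc)
    also have "\<dots> = (\<Sum>j\<le>m. q j * (\<Sum>u\<in>UNIV. ac u ^ (r + j) * (ac t - ac u) ^ m))"
      by (subst sum.swap) (simp add: sum_distrib_left)
    also have "\<dots> = (\<Sum>j\<le>m. - (M (CARD('p) - Suc j) * ac t ^ j))"
      by (intro sum.cong refl) (simp add: pw qc[symmetric] mult.assoc)
    finally show ?thesis using interp[of t] by (simp add: sum_negf)
  qed
  \<comment> \<open>Only the exponent \<open>r + m = p - 1\<close> has a nonzero power sum; it
    contributes \<open>- q m\<close>, which is \<open>- M r\<close>.\<close>
  moreover have "d = (\<Sum>u\<in>UNIV. b u)"
  proof -
    have "(\<Sum>u\<in>UNIV. b u) = (\<Sum>j\<le>m. q j * (\<Sum>u\<in>UNIV. ac u ^ (r + j)))"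
      unfolding b_def by (subst sum.swap) (simp add: sum_distrib_left)
    also have "\<dots> = (\<Sum>j\<le>m. if j = m then - q j else 0)"
    proof (intro sum.cong refl)
      fix j assume j: "j \<in> {..m}"
      show "q j * (\<Sum>u\<in>UNIV. ac u ^ (r + j)) = (if j = m then - q j else 0)"
      proof (cases "j = m")
        case True
        then have "r + j = CARD('p) - 1" using mr by simp
        then show ?thesis using True sum_to_ac_power_last[where ?'p = 'p] by simp
      next
        case False
        then have "r + j < CARD('p) - 1" using mr j by simp
        then show ?thesis using False sum_to_ac_power_less[where ?'p = 'p] by simp
      qed
    qed
    also have "\<dots> = - M r" using mr by (simp add: q_def) (simp add: m_def flip: mr(1))
    also have "\<dots> = d" using top by (simp add: M_def eq_neg_iff_add_eq_0 neg_eq_iff_add_eq_0)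
    finally show ?thesis by simp
  qed
  ultimately show ?thesis unfolding m_def by blast
qed

section \<open>Powers of linear forms\<close>

definition lin :: "'p::prime_card mod_ring \<Rightarrow> 'p fpbar poly poly" where
  "lin t = const2 (ac t) * varX + varY"

lemma of_nat_const2: "of_nat n = const2 (of_nat n)"
  by (induction n) (simp_all add: const2_add)

lemma lin_power: "lin t ^ r = (\<Sum>i\<le>r. const2 (of_nat (r choose i) * ac t ^ i) * mono2 i (r - i))"
  unfolding lin_def binomial_ring
  by (simp add: power_mult_distrib const2_mult const2_power mono2_def of_nat_const2 mult_ac)

lemma lin_homogeneous: "lin t ^ r \<in> homogeneous2 r"
  unfolding lin_power by (intro homogeneous2_sum homogeneous2_const) (metis atMost_iff homogeneous2_mono2 le_add_diff_inverse)

lemma varX_power_mono2: "varX ^ r = mono2 r 0"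
  by (simp add: mono2_def)

lemma varX_homogeneous: "varX ^ r \<in> homogeneous2 r"
  using homogeneous2_mono2[of r 0] by (simp add: varX_power_mono2)

text \<open>The coefficient of \<open>X^i Y^(r-i)\<close> is \<open>r choose i\<close> times the
  \<open>i\<close>-th power moment of \<open>c\<close>, plus \<open>d\<close> for
  \<open>i = r\<close>, and these binomial coefficients are invertible.\<close>

lemma lin_relation_coeffs:
  fixes c :: "'p::prime_card mod_ring \<Rightarrow> 'p fpbar"
  assumes r: "r \<le> CARD('p) - 1"
    and 0: "(\<Sum>t\<in>UNIV. const2 (c t) * lin t ^ r) + const2 d * varX ^ r = 0"
  shows "i < r \<Longrightarrow> (\<Sum>t\<in>UNIV. c t * ac t ^ i) = 0" "(\<Sum>t\<in>UNIV. c t * ac t ^ r) + d = 0"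
proof -
  have p: "r < CARD('p)" using r prime_gt_0_nat[OF prime_card[where ?'a = 'p]] by linarith
  have cf: "of_nat (r choose i) * (\<Sum>t\<in>UNIV. c t * ac t ^ i) + (if i = r then d else 0) = 0" if i: "i \<le> r" for i
  proof -
    have "Polynomial.coeff (Polynomial.coeff (lin t ^ r) (r - i)) i = of_nat (r choose i) * ac t ^ i" for t :: "'p mod_ring"
    proof -
      have "Polynomial.coeff (Polynomial.coeff (lin t ^ r) (r - i)) i =
          (\<Sum>k\<le>r. of_nat (r choose k) * ac t ^ k * (if k = i \<and> r - k = r - i then 1 else 0))"
        unfolding lin_power by (simp only: coeff_sum coeff_const2_mult coeff_mono2)
      also have "\<dots> = (\<Sum>k\<le>r. if k = i then of_nat (r choose k) * ac t ^ k else 0)"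
        by (intro sum.cong) auto
      finally show ?thesis using i by simp
    qed
    then have "Polynomial.coeff (Polynomial.coeff ((\<Sum>t\<in>UNIV. const2 (c t) * lin t ^ r) + const2 d * varX ^ r) (r - i)) i =
        (\<Sum>t\<in>UNIV. c t * (of_nat (r choose i) * ac t ^ i)) + (if i = r then d else 0)"
      using i by (auto simp: coeff_sum coeff_const2_mult varX_power_mono2 coeff_mono2)
    then show ?thesis unfolding 0 by (simp add: sum_distrib_left mult_ac)
  qed
  show "(\<Sum>t\<in>UNIV. c t * ac t ^ i) = 0" if "i < r"
    using cf[of i] of_nat_choose_nonzero[OF p, of i] that by simp
  show "(\<Sum>t\<in>UNIV. c t * ac t ^ r) + d = 0" using cf[of r] by simp
qed

text \<open>Orthogonality of power sums: adding up the \<open>(t X + Y)^r\<close> with weights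
  \<open>t^(p-1-i)\<close> isolates the monomial \<open>X^i Y^(r-i)\<close>, up to an invertible
  factor, for \<open>i > 0\<close>.\<close>

lemma lin_powers_span:
  fixes P :: "'p::prime_card fpbar poly poly"
  assumes r: "r \<le> CARD('p) - 1" and P: "P \<in> homogeneous2 r"
  shows "\<exists>c. P = (\<Sum>t\<in>UNIV. const2 (c t) * lin t ^ r)"
proof -
  have p: "r < CARD('p)" using r prime_gt_0_nat[OF prime_card[where ?'a = 'p]] by linarith
  define R where "R = {P :: 'p fpbar poly poly. \<exists>c. P = (\<Sum>t\<in>UNIV. const2 (c t) * lin t ^ r)}"
  have R0: "0 \<in> R" unfolding R_def by (auto intro!: exI[of _ "\<lambda>_. 0"])
  have Radd: "P + Q \<in> R" if "P \<in> R" "Q \<in> R" for P Q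
  proof -
    from that obtain c c' where "P = (\<Sum>t\<in>UNIV. const2 (c t) * lin t ^ r)" "Q = (\<Sum>t\<in>UNIV. const2 (c' t) * lin t ^ r)"
      by (auto simp: R_def)
    then have "P + Q = (\<Sum>t\<in>UNIV. const2 (c t + c' t) * lin t ^ r)"
      by (simp add: const2_add distrib_right sum.distrib)
    then show ?thesis unfolding R_def by (intro CollectI exI)
  qed
  have Rconst: "const2 a * P \<in> R" if "P \<in> R" for a P
  proof -
    from that obtain c where "P = (\<Sum>t\<in>UNIV. const2 (c t) * lin t ^ r)" by (auto simp: R_def)
    then have "const2 a * P = (\<Sum>t\<in>UNIV. const2 (a * c t) * lin t ^ r)"
      by (simp add: const2_mult sum_distrib_left mult.assoc)
    then show ?thesis unfolding R_def by (intro CollectI exI)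
  qed
  have Rsum: "sum f A \<in> R" if "\<And>i. i \<in> A \<Longrightarrow> f i \<in> R" for f and A :: "nat set"
    using that by (induction A rule: infinite_finite_induct) (auto intro: R0 Radd)
  have mono: "mono2 i (r - i) \<in> R" if i: "i \<le> r" for i
  \<comment> \<open>For \<open>i = 0\<close> the weight \<open>t^(p-1)\<close> would also pick up
    \<open>X^r\<close> when \<open>r = p - 1\<close>; but \<open>Y^r\<close> is itself the power
    with \<open>t = 0\<close>.\<close>
  proof (cases "i = 0")
    case True
    have "lin 0 ^ r = (\<Sum>t\<in>UNIV. const2 (if t = 0 then 1 else 0) * lin t ^ r :: 'p fpbar poly poly)"
      by (simp add: if_distrib[of const2] if_distrib[of "\<lambda>x. x * _"] cong: if_cong)
    then have "lin 0 ^ r \<in> R" unfolding R_def by (intro CollectI exI)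
    moreover have "lin 0 ^ r = (mono2 0 r :: 'p fpbar poly poly)" by (simp add: lin_def mono2_def)
    ultimately show ?thesis using True by simp
  next
    case False
    have "(\<Sum>t\<in>(UNIV :: 'p mod_ring set). ac t ^ (CARD('p) - 1 - i) * ac t ^ k) = (if k = i then -1 else 0)" if k: "k \<le> r" for k
    proof -
      have "(\<Sum>t\<in>(UNIV :: 'p mod_ring set). ac t ^ (CARD('p) - 1 - i) * ac t ^ k) = (\<Sum>t\<in>(UNIV :: 'p mod_ring set). ac t ^ (CARD('p) - 1 - i + k))"
        by (simp add: power_add)
      also have "\<dots> = (if k = i then -1 else 0)"
      proof -
        consider "k = i" | "k < i" | "i < k" by linarith
        then show ?thesis
        proof cases
          case 1
          then have "CARD('p) - 1 - i + k = CARD('p) - 1" using r i by simp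
          then show ?thesis using 1 sum_to_ac_power_last[where ?'p = 'p] by simp
        next
          case 2
          then have "CARD('p) - 1 - i + k < CARD('p) - 1" using r i by simp
          then show ?thesis using 2 sum_to_ac_power_less[where ?'p = 'p] by simp
        next
          case 3
          then have "CARD('p) - 1 < CARD('p) - 1 - i + k" "CARD('p) - 1 - i + k < 2 * (CARD('p) - 1)"
            using r i k False by simp_all
          then show ?thesis using 3 sum_to_ac_power_between[where ?'p = 'p] by simp
        qed
      qed
      finally show ?thesis .
    qed
    note ps = this
    have "(\<Sum>t\<in>(UNIV :: 'p mod_ring set). const2 (ac t ^ (CARD('p) - 1 - i)) * lin t ^ r) =
        (\<Sum>t\<in>UNIV. \<Sum>k\<le>r. const2 (of_nat (r choose k)) * mono2 k (r - k) * const2 (ac t ^ (CARD('p) - 1 - i) * ac t ^ k))"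
      unfolding lin_power by (simp add: sum_distrib_left const2_mult mult_ac)
    also have "\<dots> = (\<Sum>k\<le>r. const2 (of_nat (r choose k)) * mono2 k (r - k) * const2 (\<Sum>t\<in>(UNIV :: 'p mod_ring set). ac t ^ (CARD('p) - 1 - i) * ac t ^ k))"
      by (subst sum.swap) (simp add: sum_distrib_left const2_sum)
    also have "\<dots> = (\<Sum>k\<le>r. if k = i then const2 (- of_nat (r choose k)) * mono2 k (r - k) else 0)"
      by (intro sum.cong refl) (simp only: ps atMost_iff, auto simp: const2_minus)
    also have "\<dots> = const2 (- of_nat (r choose i)) * mono2 i (r - i)" using i by simp
    finally have e: "(\<Sum>t\<in>(UNIV :: 'p mod_ring set). const2 (ac t ^ (CARD('p) - 1 - i)) * lin t ^ r) = const2 (- of_nat (r choose i)) * mono2 i (r - i)" .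
    then have "const2 (- of_nat (r choose i)) * mono2 i (r - i) \<in> R"
      unfolding R_def by (intro CollectI exI) (rule sym)
    then have "const2 (inverse (- of_nat (r choose i))) * (const2 (- of_nat (r choose i)) * mono2 i (r - i)) \<in> R"
      by (rule Rconst)
    moreover have "const2 (inverse (- of_nat (r choose i))) * (const2 (- of_nat (r choose i)) * mono2 i (r - i)) = (mono2 i (r - i) :: 'p fpbar poly poly)"
      using of_nat_choose_nonzero[OF p i] by (simp flip: const2_mult mult.assoc)
    ultimately show ?thesis by (simp only:)
  qed
  have "P \<in> R"
    by (subst homogeneous2_expand[OF P]) (intro Rsum Rconst mono, simp)
  then show ?thesis by (simp add: R_def)
qed

section \<open>The comparison map\<close>

lemma (in Fpbar_module) minus_zero_r:
  assumes "v \<in> carrier M"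
  shows "v \<ominus> \<zero> = v"
proof -
  have "\<ominus> \<zero> = \<zero>" using smult_neg1[OF M.zero_closed] smult_zero_r[of "- 1"] by simp
  then show ?thesis using assms by (simp add: minus_eq)
qed

lemma (in G_representation) coset_eq_zero_iff:
  assumes "subrep W M" "v \<in> carrier M"
  shows "W +> v = W +> \<zero> \<longleftrightarrow> v \<in> W"
  using coset_eq_iff[OF assms zero_closed] by (simp only: minus_zero_r[OF assms(2)])

lemma V_elem_add:
  "g \<in> GL2 \<Longrightarrow> P \<in> homogeneous2 r \<Longrightarrow> Q \<in> homogeneous2 r \<Longrightarrow>
    V.elem r g (P + Q) = V.elem r g P \<oplus>\<^bsub>V.ind r\<^esub> V.elem r g Q"
  using V.elem_add[of g P r Q] by (simp del: V.ind_simps)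

lemma V_elem_K:
  fixes k :: "'p::prime_card mat2"
  assumes "k \<in> KZ" "P \<in> homogeneous2 r"
  shows "V.elem r k P = V.elem r (mat 1) (act (V_rep r) k P)"
  using V.elem_mult_right[of "mat 1" k P r] assms by simp

lemma V_elem_ppow_zmat:
  assumes "zmat a b c d \<in> GL2_Zp" "P \<in> homogeneous2 r"
  shows "V.elem r (ppow n ** zmat a b c d) P = V.elem r (mat 1) (sv (red a) (red b) (red c) (red d) P)"
proof -
  have "ppow n ** zmat a b c d \<in> KZ" using assms(1) KZ_iff by blast
  then show ?thesis using V_elem_K[OF _ assms(2)] V_rep_act_zmat[OF assms(1)] by simp
qed

lemma V_elem_one_inject:
  assumes "P \<in> homogeneous2 r" "V.elem r (mat 1 :: 'p::prime_card mat2) P = \<zero>\<^bsub>V.ind r\<^esub>"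
  shows "P = 0"
proof -
  have "P = V.elem r (mat 1) P (mat 1 :: 'p mat2)"
    using V.act_one[of P r] assms(1) by (simp add: V.elem_apply)
  also have "\<dots> = 0" unfolding assms(2) by simp
  finally show ?thesis .
qed

lemma beta_beta: "beta ** beta = (ppow 1 :: 'p::prime_card mat2)"
  by (simp add: beta_def mat2_mult mat_mat2)

definition Phi :: "nat \<Rightarrow> ('p::prime_card mat2 \<Rightarrow> 'p fpbar) \<Rightarrow> 'p mat2 \<Rightarrow> 'p fpbar poly poly" where
  "Phi r = (SOME F. G_equivariant (D.ind r) (V.ind r) F \<and> F (D.elem r (mat 1) 1) = V.elem r beta (varX ^ r))"

lemma Phi: "G_equivariant (D.ind r) (V.ind r) (Phi r :: _ \<Rightarrow> 'p::prime_card mat2 \<Rightarrow> _)"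
    "Phi r (D.elem r (mat 1 :: 'p mat2) 1) = V.elem r beta (varX ^ r)"
proof -
  let ?w = "V.elem r beta (varX ^ r) :: 'p mat2 \<Rightarrow> _"
  have w: "?w \<in> carrier (V.ind r)" by (simp add: varX_homogeneous)
  have "act (V.ind r) (ppow n ** k) ?w = red_qp (k $ 2 $ 2) ^ r \<odot>\<^bsub>V.ind r\<^esub> ?w" if k: "k \<in> Iwahori" for n and k :: "'p mat2"
  proof -
    obtain a b c d where kz: "k = zmat a b (pz * c) d" "a dvd 1" "d dvd 1" using k by (rule I_cases')
    have kG: "k \<in> GL2" using k by (intro K_GL2 I_sub_K)
    let ?k = "zmat d c (pz * b) a"
    have kI: "?k \<in> Iwahori" using kz by (simp add: zmat_I_iff)
    have "act (V.ind r) k ?w = V.elem r (beta ** ?k) (varX ^ r)"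
      using V.act_elem[OF beta_GL2 kG] beta_conj[OF kz(1)] by (simp del: V.ind_simps)
    also have "\<dots> = V.elem r beta (act (V_rep r) ?k (varX ^ r))"
      using kI by (intro V.elem_mult_right) (auto intro: I_sub_IZ IZ_sub_KZ varX_homogeneous)
    \<comment> \<open>\<open>?k\<close> is upper triangular modulo \<open>p\<close> with upper left
      entry \<open>d\<close>, so it multiplies \<open>X\<close> by the reduction of
      \<open>d\<close>.\<close>
    also have "act (V_rep r) ?k (varX ^ r) = const2 (red_qp (k $ 2 $ 2) ^ r) * varX ^ r"
      using V_rep_act_zmat[OF I_sub_K[OF kI], of r 0 "varX ^ r"] kz(1)
      by (simp add: sv_power sv_X power_mult_distrib const2_power)
    also have "V.elem r beta (const2 (red_qp (k $ 2 $ 2) ^ r) * varX ^ r) = red_qp (k $ 2 $ 2) ^ r \<odot>\<^bsub>V.ind r\<^esub> ?w"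
      using V.elem_smult[OF beta_GL2, of "varX ^ r" r] by (simp add: varX_homogeneous del: V.ind_simps)
    finally have *: "act (V.ind r) k ?w = red_qp (k $ 2 $ 2) ^ r \<odot>\<^bsub>V.ind r\<^esub> ?w" .
    have "act (V.ind r) (ppow n ** k) ?w = act (V.ind r) (ppow n) (act (V.ind r) k ?w)"
      by (rule V.I.act_mult[OF _ kG w]) simp
    also have "\<dots> = act (V.ind r) k ?w" by (rule V_act_ppow[OF V.I.act_closed[OF kG w]])
    finally show ?thesis using * by simp
  qed
  from D_map_exists[OF V.G_rep_ind w this]
  have "\<exists>F. G_equivariant (D.ind r) (V.ind r) F \<and> F (D.elem r (mat 1) 1) = ?w" by blast
  from someI_ex[OF this] show "G_equivariant (D.ind r) (V.ind r) (Phi r :: _ \<Rightarrow> 'p mat2 \<Rightarrow> _)"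
    "Phi r (D.elem r (mat 1 :: 'p mat2) 1) = V.elem r beta (varX ^ r)"
    by (simp_all only: Phi_def)
qed

interpretation Phi: G_map "D.ind r" "V.ind r" "Phi r :: _ \<Rightarrow> 'p::prime_card mat2 \<Rightarrow> _" for r
  by (intro G_map.intro G_map_axioms.intro D.I.G_representation_axioms V.I.G_representation_axioms Phi)

lemma Phi_elem:
  fixes g :: "'p::prime_card mat2"
  assumes "g \<in> GL2"
  shows "Phi r (D.elem r g 1) = V.elem r (g ** beta) (varX ^ r)"
proof -
  have "D.elem r g 1 = act (D.ind r) g (D.elem r (mat 1) 1)"
    using D.act_elem[of "mat 1" g r 1] assms by (simp del: D.ind_simps)
  then have "Phi r (D.elem r g 1) = act (V.ind r) g (V.elem r beta (varX ^ r))"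
    using Phi.act[OF assms, of "D.elem r (mat 1) 1" r] Phi(2)[where ?'p = 'p, of r] by (simp del: D.ind_simps V.ind_simps)
  then show ?thesis using V.act_elem[OF beta_GL2 assms] by (simp del: V.ind_simps)
qed

lemma D_elem_closed: "g \<in> GL2 \<Longrightarrow> D.elem r g v \<in> carrier (D.ind r)"
  by simp

text \<open>For \<open>k \<in> K\<close> the elements \<open>k [[beta, 1]]\<close> are, up to scalars, the \<open>et r t\<close>, \<open>t \<in> F_p\<close>, and \<open>einf r\<close>:
  they correspond to the points of the projective line over \<open>F_p\<close>.\<close>

definition et :: "nat \<Rightarrow> 'p::prime_card mod_ring \<Rightarrow> 'p mat2 \<Rightarrow> 'p fpbar" where
  "et r t = D.elem r (tmat (teich t)) 1"

definition einf :: "nat \<Rightarrow> 'p::prime_card mat2 \<Rightarrow> 'p fpbar" where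
  "einf r = D.elem r beta 1"

lemma et_closed [simp]: "et r t \<in> carrier (D.ind r)" and einf_closed [simp]: "einf r \<in> carrier (D.ind r)"
  by (simp_all add: et_def einf_def)

lemma
  fixes t :: "'p::prime_card mod_ring"
  shows Phi_et: "Phi r (et r t) = V.elem r (mat 1) (lin t ^ r)"
    and Phi_einf: "Phi r (einf r :: 'p mat2 \<Rightarrow> _) = V.elem r (mat 1) (varX ^ r)"
proof -
  have one: "zmat 1 0 0 1 \<in> (GL2_Zp :: 'p mat2 set)" by (simp add: zmat_K_iff)
  have k: "zmat (teich t) 1 1 0 \<in> (GL2_Zp :: 'p mat2 set)" by (simp add: zmat_K_iff)
  \<comment> \<open>Up to the scalar \<open>p\<close>, which acts trivially, the product lies in
    \<open>K\<close> and carries \<open>X\<close> to \<open>t X + Y\<close>.\<close>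
  have "tmat (teich t) ** beta = ppow 1 ** zmat (teich t) 1 1 0"
    by (simp add: tmat_def beta_def zmat_def mat_mat2 mat2_mult of_zp_0 of_zp_1 mult.commute)
  then show "Phi r (et r t) = V.elem r (mat 1) (lin t ^ r)"
    using V_elem_ppow_zmat[OF k varX_homogeneous[of r], where n = 1]
    by (simp add: et_def Phi_elem sv_power sv_X lin_def)
  show "Phi r (einf r :: 'p mat2 \<Rightarrow> _) = V.elem r (mat 1) (varX ^ r)"
    using V_elem_ppow_zmat[OF one varX_homogeneous[of r], where n = 1]
    by (simp add: einf_def Phi_elem beta_beta zmat_one sv_power sv_X)
qed

text \<open>Coordinates on the projective line over \<open>F_p\<close>: \<open>c\<close> on the
  affine points, \<open>d\<close> at infinity.\<close>

definition LC :: "nat \<Rightarrow> ('p::prime_card mod_ring \<Rightarrow> 'p fpbar) \<Rightarrow> 'p fpbar \<Rightarrow> 'p mat2 \<Rightarrow> 'p fpbar" where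
  "LC r c d = (\<Oplus>\<^bsub>D.ind r\<^esub>t\<in>UNIV. c t \<odot>\<^bsub>D.ind r\<^esub> et r t) \<oplus>\<^bsub>D.ind r\<^esub> (d \<odot>\<^bsub>D.ind r\<^esub> einf r)"

lemma finsum_d_rep: "finite A \<Longrightarrow> (\<Oplus>\<^bsub>d_rep r\<^esub>i\<in>A. f i) = (\<Sum>i\<in>A. f i)" for f :: "_ \<Rightarrow> 'p::prime_card fpbar"
  by (induction A rule: finite_induct) (simp_all add: D.S.finsum_empty[of r, simplified] D.S.finsum_insert[of _ _ _ r, simplified])

lemma finsum_V_rep:
  fixes f :: "_ \<Rightarrow> 'p::prime_card fpbar poly poly"
  shows "finite A \<Longrightarrow> f \<in> A \<rightarrow> homogeneous2 r \<Longrightarrow> (\<Oplus>\<^bsub>V_rep r\<^esub>i\<in>A. f i) = (\<Sum>i\<in>A. f i)"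
  by (induction A rule: finite_induct) (simp_all add: V.S.finsum_empty[of r, simplified] V.S.finsum_insert[of _ _ _ r, simplified] Pi_iff)

lemma LC_closed [simp]: "LC r c d \<in> carrier (D.ind r)"
  unfolding LC_def by (intro D.I.a_closed D.I.finsum_closed funcsetI D.I.smult_clo et_closed einf_closed)

lemma D_finsum_apply:
  fixes x :: "'p::prime_card mat2"
  assumes "finite A" "u \<in> A \<rightarrow> carrier (D.ind r)" "x \<in> GL2"
  shows "(\<Oplus>\<^bsub>D.ind r\<^esub>i\<in>A. u i) x = (\<Sum>i\<in>A. u i x)"
  using D.ind_finsum_apply[OF assms] finsum_d_rep[OF assms(1)] by simp

lemma LC_apply:
  fixes x :: "'p::prime_card mat2"
  assumes x: "x \<in> GL2"
  shows "LC r c d x = (\<Sum>t\<in>UNIV. c t * et r t x) + d * einf r x"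
proof -
  have "(\<Oplus>\<^bsub>D.ind r\<^esub>t\<in>UNIV. c t \<odot>\<^bsub>D.ind r\<^esub> et r t) x = (\<Sum>t\<in>UNIV. (c t \<odot>\<^bsub>D.ind r\<^esub> et r t) x)"
    by (intro D_finsum_apply x funcsetI D.I.smult_clo et_closed finite)
  then show ?thesis using x by (simp add: LC_def)
qed

lemma LC_map:
  fixes N :: "('p::prime_card, 'w) rep"
  assumes "G_map (D.ind r) N F"
  shows "F (LC r c d) = (\<Oplus>\<^bsub>N\<^esub>t\<in>UNIV. c t \<odot>\<^bsub>N\<^esub> F (et r t)) \<oplus>\<^bsub>N\<^esub> (d \<odot>\<^bsub>N\<^esub> F (einf r))"
proof -
  interpret G_map "D.ind r" N F by (rule assms)
  have cl: "(\<lambda>t. c t \<odot>\<^bsub>D.ind r\<^esub> et r t) \<in> UNIV \<rightarrow> carrier (D.ind r)"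
    by (intro funcsetI D.I.smult_clo et_closed)
  have "F (LC r c d) = F (\<Oplus>\<^bsub>D.ind r\<^esub>t\<in>UNIV. c t \<odot>\<^bsub>D.ind r\<^esub> et r t) \<oplus>\<^bsub>N\<^esub> F (d \<odot>\<^bsub>D.ind r\<^esub> einf r)"
    unfolding LC_def by (rule add[OF D.I.finsum_closed[OF cl] D.I.smult_clo[OF einf_closed]])
  also have "F (\<Oplus>\<^bsub>D.ind r\<^esub>t\<in>UNIV. c t \<odot>\<^bsub>D.ind r\<^esub> et r t) = (\<Oplus>\<^bsub>N\<^esub>t\<in>UNIV. F (c t \<odot>\<^bsub>D.ind r\<^esub> et r t))"
    by (rule finsum[OF finite cl])
  finally show ?thesis by (simp only: smult[OF et_closed] smult[OF einf_closed])
qed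

lemma Phi_LC:
  fixes c :: "'p::prime_card mod_ring \<Rightarrow> 'p fpbar"
  shows "Phi r (LC r c d) = V.elem r (mat 1) ((\<Sum>t\<in>UNIV. const2 (c t) * lin t ^ r) + const2 d * varX ^ r)"
proof -
  have h: "(\<lambda>t. const2 (c t) * lin t ^ r) \<in> UNIV \<rightarrow> carrier (V_rep r)"
    by (simp add: homogeneous2_const lin_homogeneous)
  have el: "V.elem r (mat 1 :: 'p mat2) (const2 a * P) = a \<odot>\<^bsub>V.ind r\<^esub> V.elem r (mat 1) P" if "P \<in> homogeneous2 r" for a P
    using V.elem_smult[of "mat 1" P r a] that by (simp del: V.ind_simps)
  have "V.elem r (mat 1) (\<Sum>t\<in>UNIV. const2 (c t) * lin t ^ r) = V.elem r (mat 1 :: 'p mat2) (\<Oplus>\<^bsub>V_rep r\<^esub>t\<in>UNIV. const2 (c t) * lin t ^ r)"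
    using finsum_V_rep[OF finite, of "\<lambda>t. const2 (c t) * lin t ^ r" UNIV r] h by simp
  also have "\<dots> = (\<Oplus>\<^bsub>V.ind r\<^esub>t\<in>UNIV. V.elem r (mat 1) (const2 (c t) * lin t ^ r))"
  proof (rule finsum_additive_image[OF V.S.abelian_monoid_axioms V.I.abelian_monoid_axioms])
    have "V.elem r (mat 1 :: 'p mat2) (const2 0 * 0) = 0 \<odot>\<^bsub>V.ind r\<^esub> V.elem r (mat 1) 0" by (rule el) simp
    also have "\<dots> = \<zero>\<^bsub>V.ind r\<^esub>" by (rule V.I.smult_0[OF V.elem_closed]) simp_all
    finally show "V.elem r (mat 1 :: 'p mat2) \<zero>\<^bsub>V_rep r\<^esub> = \<zero>\<^bsub>V.ind r\<^esub>" by simp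
  qed (use h in \<open>simp_all add: V_elem_add[OF GL2_one] del: V.ind_simps\<close>)
  finally have 1: "V.elem r (mat 1 :: 'p mat2) (\<Sum>t\<in>UNIV. const2 (c t) * lin t ^ r) =
      (\<Oplus>\<^bsub>V.ind r\<^esub>t\<in>UNIV. c t \<odot>\<^bsub>V.ind r\<^esub> V.elem r (mat 1) (lin t ^ r))"
    by (simp only: el[OF lin_homogeneous])
  have "V.elem r (mat 1 :: 'p mat2) ((\<Sum>t\<in>UNIV. const2 (c t) * lin t ^ r) + const2 d * varX ^ r) =
      V.elem r (mat 1) (\<Sum>t\<in>UNIV. const2 (c t) * lin t ^ r) \<oplus>\<^bsub>V.ind r\<^esub> V.elem r (mat 1) (const2 d * varX ^ r)"
    by (rule V_elem_add) (simp_all add: homogeneous2_const lin_homogeneous homogeneous2_sum varX_homogeneous)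
  then show ?thesis
    unfolding LC_map[OF Phi.G_map_axioms] Phi_et Phi_einf by (simp only: 1 el[OF varX_homogeneous])
qed

lemma LC_add: "LC r c d \<oplus>\<^bsub>D.ind r\<^esub> LC r c' d' = LC r (\<lambda>t. c t + c' t) (d + d')"
  by (rule D.ind_ext[OF D.I.a_closed[OF LC_closed LC_closed] LC_closed])
    (simp add: LC_apply algebra_simps sum.distrib)

lemma LC_smult: "e \<odot>\<^bsub>D.ind r\<^esub> LC r c d = LC r (\<lambda>t. e * c t) (e * d)"
  by (rule D.ind_ext[OF D.I.smult_clo[OF LC_closed] LC_closed])
    (simp add: LC_apply algebra_simps sum_distrib_left)

text \<open>These are the functions in \<open>ind_IZ r\<close> supported on \<open>beta KZ\<close>,
  the smallest \<open>KZ\<close>-stable space containing \<open>einf r\<close>.\<close>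

definition Espan :: "nat \<Rightarrow> ('p::prime_card mat2 \<Rightarrow> 'p fpbar) set" where
  "Espan r = {LC r c d | c d. True}"

lemma LC_et: "LC r (\<lambda>s. if s = t then e else 0) 0 = e \<odot>\<^bsub>D.ind r\<^esub> et r t"
  by (rule D.ind_ext[OF LC_closed D.I.smult_clo[OF et_closed]])
    (simp add: LC_apply if_distrib[of "\<lambda>x. x * _"] cong: if_cong)

lemma LC_einf: "LC r (\<lambda>s. 0) e = e \<odot>\<^bsub>D.ind r\<^esub> einf r"
  by (rule D.ind_ext[OF LC_closed D.I.smult_clo[OF einf_closed]]) (simp add: LC_apply)

text \<open>The point \<open>t = a / c\<close> is the image of infinity under \<open>k\<close>
  acting on the projective line; the Iwahori factor left over beside \<open>tmat (teich t)\<close>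
  has lower right entry \<open>c\<close>.\<close>

lemma elem_K_et:
  fixes k :: "'p::prime_card mat2"
  assumes k: "k \<in> GL2_Zp" "k = zmat a b c d" and c: "red c \<noteq> 0" and t: "red a = ac t * red c"
  shows "D.elem r (k ** beta) 1 = red c ^ r \<odot>\<^bsub>D.ind r\<^esub> et r t"
proof -
  let ?t = "teich t"
  have "red (a - ?t * c) = red 0" using t by simp
  then obtain g where g: "a - ?t * c - 0 = pz * g" by (rule red_eqE)
  have "red (a * d - b * c) \<noteq> 0" using k zmat_K_iff zp_unit_iff_red by blast
  then have "red (b - ?t * d) \<noteq> 0" using t by (auto simp: algebra_simps)
  then have kI: "zmat (b - ?t * d) g (pz * d) c \<in> Iwahori" using c by (simp add: zmat_I_iff zp_unit_iff_red)
  have a: "a = pz * g + ?t * c" using g by (simp add: algebra_simps)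
  have "k ** beta = tmat ?t ** zmat (b - ?t * d) g (pz * d) c"
    by (simp add: k(2) a beta_zmat tmat_zmat zmat_mult algebra_simps)
  then have "D.elem r (k ** beta) 1 = D.elem r (tmat ?t) (act (d_rep r) (zmat (b - ?t * d) g (pz * d) c) 1)"
    using kI by (simp add: D.elem_mult_right[OF tmat_GL2] I_sub_IZ)
  also have "act (d_rep r) (zmat (b - ?t * d) g (pz * d) c) 1 = red c ^ r"
    using d_rep_act_zmat[OF kI, of r 0] by simp
  finally show ?thesis using D_elem_scalar[OF tmat_GL2] by (simp only: et_def)
qed

text \<open>Here \<open>k\<close> lies in \<open>I\<close> and fixes infinity; \<open>beta\<close>
  exchanges its diagonal entries, hence the scalar \<open>a^r\<close>.\<close>

lemma elem_K_einf:
  fixes k :: "'p::prime_card mat2"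
  assumes k: "k \<in> GL2_Zp" "k = zmat a b c d" and c: "red c = 0"
  shows "D.elem r (k ** beta) 1 = red a ^ r \<odot>\<^bsub>D.ind r\<^esub> einf r"
proof -
  have "red c = red 0" using c by simp
  then obtain c' where c': "c - 0 = pz * c'" by (rule red_eqE)
  have "red (a * d - b * c) \<noteq> 0" using k zmat_K_iff zp_unit_iff_red by blast
  then have "red a \<noteq> 0" "red d \<noteq> 0" using c by auto
  then have kI: "zmat d c' (pz * b) a \<in> Iwahori" by (simp add: zmat_I_iff zp_unit_iff_red)
  have "k ** beta = beta ** zmat d c' (pz * b) a"
    using c' by (intro beta_conj) (simp add: k(2))
  then have "D.elem r (k ** beta) 1 = D.elem r beta (act (d_rep r) (zmat d c' (pz * b) a) 1)"
    using kI by (simp add: D.elem_mult_right[OF beta_GL2] I_sub_IZ)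
  also have "act (d_rep r) (zmat d c' (pz * b) a) 1 = red a ^ r"
    using d_rep_act_zmat[OF kI, of r 0] by simp
  finally show ?thesis using D_elem_scalar[OF beta_GL2] by (simp only: einf_def)
qed

lemma elem_K_Espan:
  fixes k :: "'p::prime_card mat2"
  assumes k: "k \<in> GL2_Zp"
  shows "D.elem r (k ** beta) 1 \<in> Espan r"
proof -
  obtain a b c d where kz: "k = zmat a b c d" using k by (rule K_cases) blast
  show ?thesis
  proof (cases "red c = 0")
    case True
    have "D.elem r (k ** beta) 1 = LC r (\<lambda>s. 0) (red a ^ r)"
      by (simp only: LC_einf elem_K_einf[OF k kz True])
    then show ?thesis unfolding Espan_def by blast
  next
    case False
    then obtain v where "c * v = 1" using zp_unit_iff_red by (metis dvdE)
    then have v: "red v * red c = 1" by (metis red_1 red_mult mult.commute)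
    obtain t where t: "red (a * v) = ac t" using red_in_range[of "a * v"] by blast
    have "ac t * red c = red a * (red v * red c)" by (simp add: t[symmetric] mult.assoc)
    then have "red a = ac t * red c" by (simp add: v)
    then have "D.elem r (k ** beta) 1 = LC r (\<lambda>s. if s = t then red c ^ r else 0) 0"
      by (simp only: LC_et elem_K_et[OF k kz False])
    then show ?thesis unfolding Espan_def by blast
  qed
qed

lemma Espan_act:
  fixes h :: "'p::prime_card mat2"
  assumes u: "u \<in> Espan r" and h: "h \<in> KZ"
  shows "act (D.ind r) h u \<in> Espan r"
proof -
  obtain c d where u: "u = LC r c d" using u by (auto simp: Espan_def)
  obtain n k where k: "k \<in> GL2_Zp" "h = ppow n ** k" using h by (rule KZ_cases)
  have kG: "k \<in> GL2" using k(1) by (rule K_GL2)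
  have "act (D.ind r) k (et r t) \<in> Espan r" for t
  proof -
    let ?m = "zmat (teich t) 1 1 0"
    have "tmat (teich t) = ?m ** beta" by (simp add: tmat_zmat beta_zmat zmat_mult)
    then have "act (D.ind r) k (et r t) = D.elem r ((k ** ?m) ** beta) 1"
      using D.act_elem[OF tmat_GL2 kG, of r "teich t" 1] by (simp add: et_def matrix_mul_assoc del: D.ind_simps)
    moreover have "k ** ?m \<in> GL2_Zp" using k(1) by (intro K_mult) (simp_all add: zmat_K_iff)
    ultimately show ?thesis using elem_K_Espan by simp
  qed
  then have "\<exists>C e. act (D.ind r) k (et r t) = LC r C e" for t by (auto simp: Espan_def)
  then obtain C e where C: "\<And>t. act (D.ind r) k (et r t) = LC r (C t) (e t)" by metis
  have "act (D.ind r) k (einf r) \<in> Espan r"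
    using D.act_elem[OF beta_GL2 kG, of r 1] elem_K_Espan[OF k(1)] by (simp add: einf_def del: D.ind_simps)
  then obtain C' e' where C': "act (D.ind r) k (einf r) = LC r C' e'" by (auto simp: Espan_def)
  have "act (D.ind r) h u = act (D.ind r) (ppow n) (act (D.ind r) k u)"
    unfolding k(2) u by (rule D.I.act_mult[OF _ kG LC_closed]) simp
  also have "\<dots> = act (D.ind r) k u" unfolding u by (rule D_act_ppow[OF D.I.act_closed[OF kG LC_closed]])
  \<comment> \<open>Each basis element goes to a combination of basis elements, so the new
    coordinates arise from the old ones by a matrix with columns \<open>C t\<close>,
    \<open>e t\<close> and a last one \<open>C'\<close>, \<open>e'\<close>.\<close>
  also have "\<dots> = LC r (\<lambda>s. (\<Sum>t\<in>UNIV. c t * C t s) + d * C' s) ((\<Sum>t\<in>UNIV. c t * e t) + d * e')"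
  proof (rule D.ind_ext)
    show "act (D.ind r) k u \<in> carrier (D.ind r)" unfolding u by (rule D.I.act_closed[OF kG LC_closed])
    fix x :: "'p mat2" assume x: "x \<in> GL2"
    have ek: "et r t (x ** k) = (\<Sum>s\<in>UNIV. C t s * et r s x) + e t * einf r x" for t
      using fun_cong[OF C[of t], of x] x by (simp add: LC_apply)
    have ei: "einf r (x ** k) = (\<Sum>s\<in>UNIV. C' s * et r s x) + e' * einf r x"
      using fun_cong[OF C', of x] x by (simp add: LC_apply)
    have "act (D.ind r) k u x = (\<Sum>t\<in>UNIV. c t * et r t (x ** k)) + d * einf r (x ** k)"
      using x kG by (simp add: u LC_apply)
    also have "(\<Sum>t\<in>UNIV. c t * et r t (x ** k)) =
        (\<Sum>s\<in>UNIV. (\<Sum>t\<in>UNIV. c t * C t s) * et r s x) + (\<Sum>t\<in>UNIV. c t * e t) * einf r x"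
      unfolding ek distrib_left sum.distrib sum_distrib_left sum_distrib_right
      by (subst sum.swap) (simp add: mult.assoc)
    finally show "act (D.ind r) k u x = LC r (\<lambda>s. (\<Sum>t\<in>UNIV. c t * C t s) + d * C' s) ((\<Sum>t\<in>UNIV. c t * e t) + d * e') x"
      using x by (simp add: LC_apply ei algebra_simps sum.distrib sum_distrib_left)
  qed simp
  finally show ?thesis by (auto simp: Espan_def)
qed

section \<open>The operators \<open>A_op\<close> and \<open>B_op\<close>\<close>

definition A_op :: "nat \<Rightarrow> ('p::prime_card mat2 \<Rightarrow> 'p fpbar) \<Rightarrow> 'p mat2 \<Rightarrow> 'p fpbar" where
  "A_op r = endo_add (D.ind r) (Tm10 r) (delta_T10 r (CARD('p) - 1))"

definition B_op :: "nat \<Rightarrow> ('p::prime_card mat2 \<Rightarrow> 'p fpbar) \<Rightarrow> 'p mat2 \<Rightarrow> 'p fpbar" where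
  "B_op r = endo_add (D.ind r) (T12 r) (delta_T10 r 0)"

lemma delta_T10:
  assumes "s = 0 \<or> s = CARD('p::prime_card) - 1"
  shows "G_equivariant (D.ind r) (D.ind r) (delta_T10 r s :: _ \<Rightarrow> 'p mat2 \<Rightarrow> _)"
    "delta_T10 r s (D.elem r (mat 1 :: 'p mat2) 1) = (if r = s then 1 else 0) \<odot>\<^bsub>D.ind r\<^esub> einf r"
proof -
  have e: "D.elem r (mat 1 :: 'p mat2) 1 \<in> carrier (D.ind r)" by simp
  show "G_equivariant (D.ind r) (D.ind r) (delta_T10 r s :: _ \<Rightarrow> 'p mat2 \<Rightarrow> _)"
    using T10_endo_gen(1)[where ?'p = 'p, of r] assms D.I.endo_scalar_equivariant[of r 0]
    by (auto simp: delta_T10_def G_endo_def ind_IZ_def)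
  show "delta_T10 r s (D.elem r (mat 1 :: 'p mat2) 1) = (if r = s then 1 else 0) \<odot>\<^bsub>D.ind r\<^esub> einf r"
    using T10_endo_gen(2)[where ?'p = 'p, of r] assms D.I.smult_1[OF einf_closed] D.I.smult_0[OF einf_closed] D.I.smult_0[OF e] e
    by (auto simp: delta_T10_def ind_IZ_def endo_scalar_def einf_def simp del: D.ind_simps)
qed

lemma A_op_equivariant: "G_equivariant (D.ind r) (D.ind r) (A_op r :: _ \<Rightarrow> 'p::prime_card mat2 \<Rightarrow> _)"
  unfolding A_op_def using Tm10_endo delta_T10(1)[where ?'p = 'p] by (intro D.I.endo_add_equivariant) (auto simp: G_endo_def)

lemma B_op_equivariant: "G_equivariant (D.ind r) (D.ind r) (B_op r :: _ \<Rightarrow> 'p::prime_card mat2 \<Rightarrow> _)"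
  unfolding B_op_def using T12_endo delta_T10(1)[where ?'p = 'p] by (intro D.I.endo_add_equivariant) (auto simp: G_endo_def)

interpretation A: G_map "D.ind r" "D.ind r" "A_op r :: _ \<Rightarrow> 'p::prime_card mat2 \<Rightarrow> _" for r
  by (intro G_map.intro G_map_axioms.intro D.I.G_representation_axioms A_op_equivariant)

lemma finsum_teich:
  fixes u :: "'p::prime_card zp \<Rightarrow> 'p mat2 \<Rightarrow> 'p fpbar"
  assumes "\<And>t. u t \<in> carrier (D.ind r)"
  shows "(\<Oplus>\<^bsub>D.ind r\<^esub>t\<in>teich_reps. u t) = (\<Oplus>\<^bsub>D.ind r\<^esub>t\<in>UNIV. u (teich t))"
  unfolding teich_reps_def by (rule D.I.finsum_reindex[OF _ inj_teich]) (use assms in auto)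

lemma A_op_gen: "A_op r (D.elem r (mat 1 :: 'p::prime_card mat2) 1) = LC r (\<lambda>_. 1) (if r = CARD('p) - 1 then 1 else 0)"
proof -
  have "(\<Oplus>\<^bsub>D.ind r\<^esub>t\<in>(teich_reps :: 'p zp set). D.elem r (tmat t) 1) = (\<Oplus>\<^bsub>D.ind r\<^esub>t\<in>UNIV. 1 \<odot>\<^bsub>D.ind r\<^esub> et r t)"
    by (subst finsum_teich) (simp_all only: D_elem_closed[OF tmat_GL2] D.I.smult_1[OF et_closed], simp only: et_def)
  then show ?thesis
    using delta_T10(2)[where ?'p = 'p, of "CARD('p) - 1" r]
    by (simp add: A_op_def endo_add_def Tm10_gen LC_def del: D.ind_simps)
qed

text \<open>The matrix sends infinity to \<open>m\<close>, 0 to infinity and any other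
  \<open>s\<close> to \<open>t = m + 1/s\<close>, with scalar
  \<open>s^r = (t - m)^(-r) = (t - m)^(p-1-r)\<close>. At \<open>t = m\<close> the power is 0 except
  for \<open>r = p - 1\<close>, when it is \<open>0^0 = 1\<close>; that term is supplied by
  \<open>T_{1,0}\<close>.\<close>

lemma A_op_kappa:
  fixes m :: "'p::prime_card mod_ring"
  assumes r: "r \<le> CARD('p) - 1"
  shows "act (D.ind r) (zmat (teich m) 1 1 0) (A_op r (D.elem r (mat 1) 1)) =
    LC r (\<lambda>t. (ac t - ac m) ^ (CARD('p) - 1 - r)) 1"
proof -
  let ?k = "zmat (teich m) 1 1 0 :: 'p mat2"
  let ?q = "CARD('p) - 1"
  have kK: "?k \<in> GL2_Zp" by (simp add: zmat_K_iff)
  have kG: "?k \<in> GL2" by (rule K_GL2[OF kK])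
  have ei: "act (D.ind r) ?k (einf r) = et r m"
  proof -
    have "act (D.ind r) ?k (einf r) = D.elem r (?k ** beta) 1"
      using D.act_elem[OF beta_GL2 kG, of r 1] by (simp add: einf_def del: D.ind_simps)
    also have "?k ** beta = tmat (teich m)" by (simp add: tmat_zmat beta_zmat zmat_mult)
    finally show ?thesis by (simp only: et_def)
  qed
  have et: "act (D.ind r) ?k (et r s) = (if s = 0 then einf r else ac s ^ r \<odot>\<^bsub>D.ind r\<^esub> et r (m + inverse s))" for s
  proof -
    let ?kk = "zmat (teich m * teich s + 1) (teich m) (teich s) 1"
    have "act (D.ind r) ?k (et r s) = D.elem r (?k ** tmat (teich s)) 1"
      using D.act_elem[OF tmat_GL2 kG, of r "teich s" 1] by (simp add: et_def del: D.ind_simps)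
    also have "?k ** tmat (teich s) = ?kk ** beta"
      by (simp add: tmat_zmat beta_zmat zmat_mult algebra_simps)
    finally have e: "act (D.ind r) ?k (et r s) = D.elem r (?kk ** beta) 1" .
    have kkK: "?kk \<in> GL2_Zp" by (simp add: zmat_K_iff algebra_simps)
    show ?thesis
    proof (cases "s = 0")
      case True
      then show ?thesis using e elem_K_einf[OF kkK refl, of r] D.I.smult_1[OF einf_closed] by (simp del: D.ind_simps)
    next
      case False
      have "red (teich m * teich s + 1) = ac (m + inverse s) * red (teich s)"
        using False by (simp add: distrib_right)
      then show ?thesis using e elem_K_et[OF kkK refl, of "m + inverse s" r] False by (simp del: D.ind_simps)
    qed
  qed
  show ?thesis
  proof (rule D.ind_ext)
    show "act (D.ind r) ?k (A_op r (D.elem r (mat 1) 1)) \<in> carrier (D.ind r)"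
      unfolding A_op_gen by (rule D.I.act_closed[OF kG LC_closed])
    fix x :: "'p mat2" assume x: "x \<in> GL2"
    let ?\<delta> = "if r = ?q then 1 else (0 :: 'p fpbar)"
    have xk: "x ** ?k \<in> GL2" using x kG by simp
    have et': "et r s (x ** ?k) = (if s = 0 then einf r x else ac s ^ r * et r (m + inverse s) x)" for s
      using fun_cong[OF et[of s], of x] x by (cases "s = 0") simp_all
    have ei': "einf r (x ** ?k) = et r m x" using fun_cong[OF ei, of x] x by simp
    have "act (D.ind r) ?k (A_op r (D.elem r (mat 1) 1)) x = (\<Sum>s\<in>UNIV. et r s (x ** ?k)) + ?\<delta> * einf r (x ** ?k)"
      using x LC_apply[OF xk, of r "\<lambda>_. 1" ?\<delta>] by (simp add: A_op_gen)
    also have "(\<Sum>s\<in>UNIV. et r s (x ** ?k)) = einf r x + (\<Sum>s\<in>UNIV - {0}. ac s ^ r * et r (m + inverse s) x)"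
      by (subst sum.remove[of UNIV 0]) (auto simp: et' intro!: sum.cong)
    also have "(\<Sum>s\<in>UNIV - {0}. ac s ^ r * et r (m + inverse s) x) = (\<Sum>t\<in>UNIV - {m}. (ac t - ac m) ^ (?q - r) * et r t x)"
    proof (rule sum.reindex_bij_witness[where i = "\<lambda>t. inverse (t - m)" and j = "\<lambda>s. m + inverse s"])
      fix s :: "'p mod_ring" assume "s \<in> UNIV - {0}"
      then have s: "s \<noteq> 0" by simp
      have "ac s ^ ?q = 1" using to_ac_diff_power_last[of s 0] s by simp
      moreover have "ac s ^ r * ac s ^ (?q - r) = ac s ^ ?q"
        using r by (simp only: power_add[symmetric] le_add_diff_inverse)
      ultimately have "ac s ^ r * ac s ^ (?q - r) = 1" by simp
      then have "inverse (ac s) ^ (?q - r) = ac s ^ r"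
        using s by (simp add: field_simps power_inverse)
      then show "(ac (m + inverse s) - ac m) ^ (?q - r) * et r (m + inverse s) x = ac s ^ r * et r (m + inverse s) x"
        by simp
    qed auto
    also have "einf r x + \<dots> + ?\<delta> * einf r (x ** ?k) = (\<Sum>t\<in>UNIV. (ac t - ac m) ^ (?q - r) * et r t x) + 1 * einf r x"
    proof -
      have "(\<Sum>t\<in>UNIV. (ac t - ac m) ^ (?q - r) * et r t x) =
          (ac m - ac m) ^ (?q - r) * et r m x + (\<Sum>t\<in>UNIV - {m}. (ac t - ac m) ^ (?q - r) * et r t x)"
        by (rule sum.remove) simp_all
      then show ?thesis using r ei' by (cases "r = ?q") (auto simp: power_0_left)
    qed
    also have "\<dots> = LC r (\<lambda>t. (ac t - ac m) ^ (?q - r)) 1 x" by (rule LC_apply[OF x, symmetric])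
    finally show "act (D.ind r) ?k (A_op r (D.elem r (mat 1) 1)) x = LC r (\<lambda>t. (ac t - ac m) ^ (?q - r)) 1 x" .
  qed simp
qed

text \<open>A vanishing image is a linear relation between the \<open>(t X + Y)^r\<close> and
  \<open>X^r\<close>. \<open>local_kernel\<close> solves it by powers of \<open>t - u\<close>, which
  \<open>A_op_kappa\<close> recognizes as translates of the image of
  \<open>[[id, 1]]\<close>.\<close>

lemma local_image:
  fixes c :: "'p::prime_card mod_ring \<Rightarrow> 'p fpbar"
  assumes r: "r \<le> CARD('p) - 1" and 0: "Phi r (LC r c d) = \<zero>\<^bsub>V.ind r\<^esub>"
  shows "LC r c d \<in> endo_image (D.ind r) (A_op r)"
proof -
  let ?P = "(\<Sum>t\<in>UNIV. const2 (c t) * lin t ^ r) + const2 d * varX ^ r"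
  have Ph: "?P \<in> homogeneous2 r"
    by (intro homogeneous2_add homogeneous2_sum homogeneous2_const lin_homogeneous varX_homogeneous)
  have P0: "?P = 0" using V_elem_one_inject[OF Ph] 0 unfolding Phi_LC .
  obtain b where b: "\<And>t. c t = (\<Sum>u\<in>UNIV. b u * (ac t - ac u) ^ (CARD('p) - 1 - r))" "d = (\<Sum>u\<in>UNIV. b u)"
    using local_kernel[OF r lin_relation_coeffs(1)[OF r P0] lin_relation_coeffs(2)[OF r P0]] by blast
  let ?k = "\<lambda>m. zmat (teich m) 1 1 0 :: 'p mat2"
  have kG: "?k m \<in> GL2" for m by (intro K_GL2) (simp add: zmat_K_iff)
  define v where "v = (\<Oplus>\<^bsub>D.ind r\<^esub>m\<in>UNIV. b m \<odot>\<^bsub>D.ind r\<^esub> D.elem r (?k m) 1)"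
  have cl: "(\<lambda>m. b m \<odot>\<^bsub>D.ind r\<^esub> D.elem r (?k m) 1) \<in> UNIV \<rightarrow> carrier (D.ind r)"
    by (intro funcsetI D.I.smult_clo D.elem_closed kG) simp
  have vc: "v \<in> carrier (D.ind r)" unfolding v_def by (rule D.I.finsum_closed[OF cl])
  have Ak: "A_op r (b m \<odot>\<^bsub>D.ind r\<^esub> D.elem r (?k m) 1) = LC r (\<lambda>t. b m * (ac t - ac m) ^ (CARD('p) - 1 - r)) (b m * 1)" for m
  proof -
    have e1: "D.elem r (mat 1 :: 'p mat2) 1 \<in> carrier (D.ind r)" by simp
    have "D.elem r (?k m) 1 = act (D.ind r) (?k m) (D.elem r (mat 1) 1)"
      using D.act_elem[OF GL2_one kG[of m], of r 1] by (simp del: D.ind_simps)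
    then have "A_op r (D.elem r (?k m) 1) = LC r (\<lambda>t. (ac t - ac m) ^ (CARD('p) - 1 - r)) 1"
      using A.act[OF kG e1, of m] A_op_kappa[OF r, of m] by (simp del: D.ind_simps)
    moreover have "A_op r (b m \<odot>\<^bsub>D.ind r\<^esub> D.elem r (?k m) 1) = b m \<odot>\<^bsub>D.ind r\<^esub> A_op r (D.elem r (?k m) 1)"
      by (rule A.smult) (simp add: kG)
    ultimately show ?thesis by (simp only: LC_smult)
  qed
  have "A_op r v = (\<Oplus>\<^bsub>D.ind r\<^esub>m\<in>UNIV. LC r (\<lambda>t. b m * (ac t - ac m) ^ (CARD('p) - 1 - r)) (b m * 1))"
    unfolding v_def A.finsum[OF finite cl] Ak ..
  also have "\<dots> = LC r c d"
  proof (rule D.ind_ext)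
    show "(\<Oplus>\<^bsub>D.ind r\<^esub>m\<in>UNIV. LC r (\<lambda>t. b m * (ac t - ac m) ^ (CARD('p) - 1 - r)) (b m * 1)) \<in> carrier (D.ind r)"
      by (intro D.I.finsum_closed funcsetI LC_closed)
    fix x :: "'p mat2" assume x: "x \<in> GL2"
    have "(\<Oplus>\<^bsub>D.ind r\<^esub>m\<in>UNIV. LC r (\<lambda>t. b m * (ac t - ac m) ^ (CARD('p) - 1 - r)) (b m * 1)) x =
        (\<Sum>m\<in>UNIV. LC r (\<lambda>t. b m * (ac t - ac m) ^ (CARD('p) - 1 - r)) (b m * 1) x)"
      by (intro D_finsum_apply finite funcsetI LC_closed x)
    also have "\<dots> = (\<Sum>m\<in>UNIV. \<Sum>t\<in>UNIV. b m * (ac t - ac m) ^ (CARD('p) - 1 - r) * et r t x) + (\<Sum>m\<in>UNIV. b m * einf r x)"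
      by (simp add: LC_apply[OF x] sum.distrib)
    also have "\<dots> = (\<Sum>t\<in>UNIV. c t * et r t x) + d * einf r x"
      by (subst sum.swap) (simp only: b sum_distrib_right)
    also have "\<dots> = LC r c d x" by (rule LC_apply[OF x, symmetric])
    finally show "(\<Oplus>\<^bsub>D.ind r\<^esub>m\<in>UNIV. LC r (\<lambda>t. b m * (ac t - ac m) ^ (CARD('p) - 1 - r)) (b m * 1)) x = LC r c d x" .
  qed simp
  finally show ?thesis unfolding endo_image_def using vc by (metis imageI)
qed

lemma Espan_Phi_ex:
  fixes P :: "'p::prime_card fpbar poly poly"
  assumes r: "r \<le> CARD('p) - 1" and P: "P \<in> homogeneous2 r"
  shows "\<exists>u. u \<in> Espan r \<and> Phi r u = V.elem r (mat 1 :: 'p mat2) P"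
proof -
  obtain c where c: "P = (\<Sum>t\<in>UNIV. const2 (c t) * lin t ^ r)" using lin_powers_span[OF r P] by blast
  have "Phi r (LC r c 0) = V.elem r (mat 1) P" unfolding Phi_LC c by simp
  then show ?thesis unfolding Espan_def by blast
qed

lemma Espan_closed: "u \<in> Espan r \<Longrightarrow> u \<in> carrier (D.ind r)"
  by (auto simp: Espan_def simp del: D.ind_simps)

text \<open>An inverse of the map induced by \<open>Phi\<close> modulo the image of \<open>A_op\<close> is obtained by lifting a
  weight vector to the span of the \<open>et\<close> and \<open>einf\<close>: by \<open>local_image\<close> the lift is unique modulo this image.\<close>

lemma Phi_kernel:
  fixes f :: "'p::prime_card mat2 \<Rightarrow> 'p fpbar"
  assumes r: "r \<le> CARD('p) - 1" and f: "f \<in> carrier (D.ind r)" and f0: "Phi r f = \<zero>\<^bsub>V.ind r\<^esub>"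
  shows "f \<in> endo_image (D.ind r) (A_op r)"
proof -
  let ?M = "D.ind r :: ('p, 'p mat2 \<Rightarrow> 'p fpbar) rep"
  define W where "W = endo_image ?M (A_op r)"
  have W: "subrep W ?M" unfolding W_def by (rule D.I.subrep_endo_image[OF A_op_equivariant])
  let ?Q = "rep_quot ?M W"
  have Q: "G_rep ?Q" by (rule D.I.G_rep_quot[OF W])
  interpret Q: G_representation ?Q by unfold_locales (rule Q)
  have Qcl: "W +>\<^bsub>?M\<^esub> v \<in> carrier ?Q" if "v \<in> carrier ?M" for v using that by (simp add: D.I.quot_carrier)
  \<comment> \<open>The difference of two lifts lies in the span again and is killed by
    \<open>Phi\<close>, so \<open>local_image\<close> applies to it.\<close>
  have wd: "W +>\<^bsub>?M\<^esub> u = W +>\<^bsub>?M\<^esub> u'" if u: "u \<in> Espan r" "u' \<in> Espan r" "Phi r u = Phi r u'" for u u'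
  proof -
    obtain c d where c: "u = LC r c d" using u(1) by (auto simp: Espan_def)
    obtain c' d' where c': "u' = LC r c' d'" using u(2) by (auto simp: Espan_def)
    note cl = Espan_closed[OF u(1)] Espan_closed[OF u(2)]
    have "u \<ominus>\<^bsub>?M\<^esub> u' = u \<oplus>\<^bsub>?M\<^esub> ((- 1) \<odot>\<^bsub>?M\<^esub> u')"
      using cl by (simp add: D.I.minus_eq D.I.smult_neg1 del: D.ind_simps)
    then have m: "u \<ominus>\<^bsub>?M\<^esub> u' = LC r (\<lambda>t. c t + - 1 * c' t) (d + - 1 * d')"
      by (simp only: c c' LC_smult LC_add)
    have "Phi r (u \<ominus>\<^bsub>?M\<^esub> u') = Phi r u \<ominus>\<^bsub>V.ind r\<^esub> Phi r u'" by (rule Phi.minus[OF cl])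
    also have "\<dots> = \<zero>\<^bsub>V.ind r\<^esub>" unfolding u(3) using Phi.closed[OF cl(2)] by (simp add: V.I.minus_eq V.I.r_neg del: V.ind_simps)
    finally have "u \<ominus>\<^bsub>?M\<^esub> u' \<in> W" unfolding m W_def by (rule local_image[OF r])
    then show ?thesis using D.I.coset_eq_iff[OF W cl] by simp
  qed
  define \<psi> where "\<psi> P = W +>\<^bsub>?M\<^esub> (SOME u. u \<in> Espan r \<and> Phi r u = V.elem r (mat 1) P)" for P
  have \<psi>: "\<psi> P = W +>\<^bsub>?M\<^esub> u" if u: "u \<in> Espan r" "Phi r u = V.elem r (mat 1) P" for P u
  proof -
    have "\<exists>u. u \<in> Espan r \<and> Phi r u = V.elem r (mat 1) P" using u by blast
    note s = someI_ex[OF this]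
    show ?thesis unfolding \<psi>_def by (rule wd) (use s u in auto)
  qed
  have ex: "\<exists>u. u \<in> Espan r \<and> Phi r u = V.elem r (mat 1 :: 'p mat2) P" if "P \<in> homogeneous2 r" for P
    by (rule Espan_Phi_ex[OF r that])
  have "\<exists>F. G_equivariant (V.ind r) ?Q F \<and> F \<in> extensional (carrier (V.ind r)) \<and>
    (\<forall>v\<in>carrier (V_rep r). F (V.elem r (mat 1) v) = \<psi> v)"
  proof (rule V.frobenius_reciprocity[OF Q])
    fix P assume "P \<in> carrier (V_rep r :: ('p, 'p fpbar poly poly) rep)"
    then have P: "P \<in> homogeneous2 r" by simp
    then obtain u where u: "u \<in> Espan r" "Phi r u = V.elem r (mat 1 :: 'p mat2) P" using ex by blast
    note ucl = Espan_closed[OF u(1)]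
    show "\<psi> P \<in> carrier ?Q" unfolding \<psi>[OF u] by (rule Qcl[OF ucl])
    show "\<psi> (P \<oplus>\<^bsub>V_rep r\<^esub> P') = \<psi> P \<oplus>\<^bsub>?Q\<^esub> \<psi> P'" if "P' \<in> carrier (V_rep r :: ('p, 'p fpbar poly poly) rep)" for P'
    proof -
      have P': "P' \<in> homogeneous2 r" using that by simp
      obtain u' where u': "u' \<in> Espan r" "Phi r u' = V.elem r (mat 1 :: 'p mat2) P'" using ex[OF P'] by blast
      note ucl' = Espan_closed[OF u'(1)]
      have "u \<oplus>\<^bsub>?M\<^esub> u' \<in> Espan r" using u(1) u'(1) LC_add unfolding Espan_def by blast
      moreover have "Phi r (u \<oplus>\<^bsub>?M\<^esub> u') = V.elem r (mat 1) (P + P')"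
        unfolding Phi.add[OF ucl ucl'] u(2) u'(2) by (rule V_elem_add[OF GL2_one P P', symmetric])
      ultimately have "\<psi> (P + P') = W +>\<^bsub>?M\<^esub> (u \<oplus>\<^bsub>?M\<^esub> u')" by (rule \<psi>)
      then show ?thesis unfolding \<psi>[OF u] \<psi>[OF u'] D.I.quot_add[OF W ucl ucl'] by simp
    qed
    show "\<psi> (c \<odot>\<^bsub>V_rep r\<^esub> P) = c \<odot>\<^bsub>?Q\<^esub> \<psi> P" for c
    proof -
      have "c \<odot>\<^bsub>?M\<^esub> u \<in> Espan r" using u(1) LC_smult unfolding Espan_def by blast
      moreover have "Phi r (c \<odot>\<^bsub>?M\<^esub> u) = V.elem r (mat 1) (const2 c * P)"
        unfolding Phi.smult[OF ucl] u(2) using V.elem_smult[OF GL2_one, of P r c] P by (simp del: V.ind_simps)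
      ultimately have "\<psi> (const2 c * P) = W +>\<^bsub>?M\<^esub> (c \<odot>\<^bsub>?M\<^esub> u)" by (rule \<psi>)
      then show ?thesis unfolding \<psi>[OF u] D.I.quot_smult[OF W ucl] by simp
    qed
    show "\<psi> (act (V_rep r) h P) = act ?Q h (\<psi> P)" if h: "h \<in> KZ" for h
    proof -
      have hG: "h \<in> GL2" using h by (rule KZ_GL2)
      have "Phi r (act ?M h u) = V.elem r (mat 1) (act (V_rep r) h P)"
        unfolding Phi.act[OF hG ucl] u(2) using V.act_elem[OF GL2_one hG, of r P] V_elem_K[OF h P] by (simp del: V.ind_simps)
      with Espan_act[OF u(1) h] have "\<psi> (act (V_rep r) h P) = W +>\<^bsub>?M\<^esub> (act ?M h u)" by (rule \<psi>)
      then show ?thesis unfolding \<psi>[OF u] D.I.quot_act[OF W ucl hG] .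
    qed
  qed
  then obtain \<Psi> where \<Psi>: "G_equivariant (V.ind r) ?Q \<Psi>" "\<And>P. P \<in> homogeneous2 r \<Longrightarrow> \<Psi> (V.elem r (mat 1) P) = \<psi> P" by auto
  interpret \<Psi>: G_map "V.ind r" ?Q \<Psi>
    by (intro G_map.intro G_map_axioms.intro V.I.G_representation_axioms Q.G_representation_axioms \<Psi>(1))
  have e1: "D.elem r (mat 1 :: 'p mat2) 1 \<in> carrier ?M" by simp
  \<comment> \<open>\<open>\<Psi>\<close> after \<open>Phi\<close> is the projection modulo
    \<open>W\<close>: both maps are equivariant, so their values at \<open>[[id, 1]]\<close>
    decide.\<close>
  have "\<Psi> (Phi r f) = W +>\<^bsub>?M\<^esub> f"
  proof (rule D_map_unique[OF Q G_equivariant_comp[OF Phi(1) \<Psi>(1)] _ _ f])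
    show "G_equivariant ?M ?Q (\<lambda>v. W +>\<^bsub>?M\<^esub> v)"
      unfolding G_equivariant_def using Qcl by (auto simp: D.I.quot_add[OF W] D.I.quot_smult[OF W] D.I.quot_act[OF W] simp del: D.ind_simps)
    have vx: "V.elem r (mat 1 :: 'p mat2) (varX ^ r) \<in> carrier (V.ind r)" by (simp add: varX_homogeneous)
    have "V.elem r beta (varX ^ r) = act (V.ind r) beta (V.elem r (mat 1 :: 'p mat2) (varX ^ r))"
      by (simp only: V.act_elem[OF GL2_one beta_GL2] matrix_mul_rid)
    then have "\<Psi> (Phi r (D.elem r (mat 1) 1)) = act ?Q beta (\<Psi> (V.elem r (mat 1) (varX ^ r)))"
      unfolding Phi(2) using \<Psi>.act[OF beta_GL2 vx] by (simp del: V.ind_simps)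
    also have "\<Psi> (V.elem r (mat 1) (varX ^ r)) = W +>\<^bsub>?M\<^esub> einf r"
    proof -
      have "einf r = LC r (\<lambda>_. 0) (1 :: 'p fpbar)" unfolding LC_einf by (rule D.I.smult_1[OF einf_closed, symmetric])
      then have "einf r \<in> (Espan r :: ('p mat2 \<Rightarrow> 'p fpbar) set)" unfolding Espan_def by blast
      from \<psi>[OF this Phi_einf] show ?thesis using \<Psi>(2)[OF varX_homogeneous] by simp
    qed
    also have "act ?Q beta (W +>\<^bsub>?M\<^esub> einf r) = W +>\<^bsub>?M\<^esub> (act ?M beta (einf r))"
      by (rule D.I.quot_act[OF W einf_closed beta_GL2])
    \<comment> \<open>The square of \<open>beta\<close> is the scalar \<open>p\<close>, which acts
      trivially, so \<open>beta\<close> takes \<open>einf r\<close> back to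
      \<open>[[id, 1]]\<close>.\<close>
    also have "act ?M beta (einf r) = act ?M (ppow 1) (D.elem r (mat 1) 1)"
      using D.act_elem[OF beta_GL2 beta_GL2, where ?'p = 'p, of r 1] D.act_elem[OF GL2_one, where ?'p = 'p, of "ppow 1" r 1]
      by (simp add: einf_def beta_beta del: D.ind_simps)
    also have "\<dots> = D.elem r (mat 1) 1" by (rule D_act_ppow[OF e1])
    finally show "\<Psi> (Phi r (D.elem r (mat 1) 1)) = W +>\<^bsub>?M\<^esub> (D.elem r (mat 1) 1)" .
  qed
  then have "W +>\<^bsub>?M\<^esub> f = W +>\<^bsub>?M\<^esub> \<zero>\<^bsub>?M\<^esub>"
    unfolding f0 \<Psi>.zero using D.I.quot_zero[OF W] by simp
  then show ?thesis using D.I.coset_eq_zero_iff[OF W f] unfolding W_def by blast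
qed

text \<open>The projection to the cokernel of \<open>Phi\<close> and the zero map are both
  equivariant and agree on the functions \<open>[id, P]\<close>, which are images of elements of
  \<open>Espan r\<close>.\<close>

lemma Phi_onto:
  assumes r: "r \<le> CARD('p::prime_card) - 1"
  shows "Phi r ` carrier (D.ind r) = carrier (V.ind r :: ('p, 'p mat2 \<Rightarrow> 'p fpbar poly poly) rep)"
proof (intro equalityI subsetI)
  let ?N = "V.ind r :: ('p, 'p mat2 \<Rightarrow> 'p fpbar poly poly) rep"
  define W where "W = Phi r ` carrier (D.ind r :: ('p, 'p mat2 \<Rightarrow> 'p fpbar) rep)"
  have W: "subrep W ?N" unfolding W_def by (rule Phi.subrep_image[OF D.I.subrep_carrier])
  let ?Q = "rep_quot ?N W"
  fix f assume f: "f \<in> carrier ?N"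
  have "W +>\<^bsub>?N\<^esub> f = W +>\<^bsub>?N\<^esub> \<zero>\<^bsub>?N\<^esub>"
  proof (rule V.G_map_unique[OF V.I.G_rep_quot[OF W], where F = "\<lambda>v. W +>\<^bsub>?N\<^esub> v" and F' = "\<lambda>v. W +>\<^bsub>?N\<^esub> \<zero>\<^bsub>?N\<^esub>", OF _ _ _ f])
    note q = V.I.quot_add[OF W] V.I.quot_smult[OF W] V.I.quot_act[OF W]
    show "G_equivariant ?N ?Q (\<lambda>v. W +>\<^bsub>?N\<^esub> v)"
      unfolding G_equivariant_def V.I.quot_carrier by (auto simp: q simp del: V.ind_simps)
    show "G_equivariant ?N ?Q (\<lambda>v. W +>\<^bsub>?N\<^esub> \<zero>\<^bsub>?N\<^esub>)"
      unfolding G_equivariant_def V.I.quot_carrier by (auto simp: q simp del: V.ind_simps)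
    fix P assume "P \<in> carrier (V_rep r :: ('p, 'p fpbar poly poly) rep)"
    then have P: "P \<in> homogeneous2 r" by simp
    then obtain u where u: "u \<in> Espan r" "Phi r u = V.elem r (mat 1 :: 'p mat2) P" using Espan_Phi_ex[OF r] by blast
    have "V.elem r (mat 1 :: 'p mat2) P \<in> W" unfolding W_def u(2)[symmetric] using Espan_closed[OF u(1)] by (rule imageI)
    moreover have "V.elem r (mat 1 :: 'p mat2) P \<in> carrier ?N" using P by simp
    ultimately show "W +>\<^bsub>?N\<^esub> V.elem r (mat 1) P = W +>\<^bsub>?N\<^esub> \<zero>\<^bsub>?N\<^esub>"
      using V.I.coset_eq_zero_iff[OF W] by blast
  qed
  then show "f \<in> Phi r ` carrier (D.ind r)" using V.I.coset_eq_zero_iff[OF W f] unfolding W_def by blast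
qed (use Phi.closed in blast)

text \<open>Comparison at \<open>[[id, 1]]\<close>: since
  \<open>beta ** tmat t = smat t ** beta\<close>, the first \<open>p\<close> terms of
  \<open>T [beta, X^r]\<close> match those of \<open>T_{1,2}\<close>. The remaining one substitutes
  0 for \<open>X\<close> in \<open>X^r\<close>, hence survives only for \<open>r = 0\<close>; there
  \<open>beta ** alpha\<close> lies in \<open>KZ\<close>, and the term becomes the image of
  \<open>[[beta, 1]]\<close>.\<close>

lemma Phi_B:
  fixes f :: "'p::prime_card mat2 \<Rightarrow> 'p fpbar"
  assumes f: "f \<in> carrier (D.ind r)"
  shows "Phi r (B_op r f) = T_op r (Phi r f)"
proof (rule D_map_unique[OF V.G_rep_ind G_equivariant_comp[OF B_op_equivariant Phi(1)] G_equivariant_comp[OF Phi(1)] _ f])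
  show T: "G_equivariant (V.ind r) (V.ind r) (T_op r :: _ \<Rightarrow> 'p mat2 \<Rightarrow> _)"
    using T_op_endo[where ?'p = 'p, of r] by (simp only: G_endo_def)
  interpret T: G_map "V.ind r" "V.ind r" "T_op r :: _ \<Rightarrow> 'p mat2 \<Rightarrow> _"
    by (intro G_map.intro G_map_axioms.intro V.I.G_representation_axioms T)
  let ?N = "V.ind r :: ('p, 'p mat2 \<Rightarrow> 'p fpbar poly poly) rep"
  let ?w = "\<Oplus>\<^bsub>?N\<^esub>t\<in>teich_reps. V.elem r (smat t ** beta) (varX ^ r)"
  let ?e = "(if r = 0 then 1 else 0) \<odot>\<^bsub>?N\<^esub> V.elem r (mat 1) (varX ^ r)"
  have cs: "(\<lambda>t. D.elem r (smat t :: 'p mat2) 1) \<in> teich_reps \<rightarrow> carrier (D.ind r)" by simp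
  have "B_op r (D.elem r (mat 1 :: 'p mat2) 1) =
      (\<Oplus>\<^bsub>D.ind r\<^esub>t\<in>teich_reps. D.elem r (smat t) 1) \<oplus>\<^bsub>D.ind r\<^esub> ((if r = 0 then 1 else 0) \<odot>\<^bsub>D.ind r\<^esub> einf r)"
    using delta_T10(2)[where ?'p = 'p, of 0 r] by (simp add: B_op_def endo_add_def T12_gen del: D.ind_simps)
  then have "Phi r (B_op r (D.elem r (mat 1 :: 'p mat2) 1)) =
      Phi r (\<Oplus>\<^bsub>D.ind r\<^esub>t\<in>teich_reps. D.elem r (smat t :: 'p mat2) 1) \<oplus>\<^bsub>?N\<^esub> Phi r ((if r = 0 then 1 else 0) \<odot>\<^bsub>D.ind r\<^esub> einf r)"
    by (simp only: Phi.add[OF D.I.finsum_closed[OF cs] D.I.smult_clo[OF einf_closed]])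
  also have "\<dots> = ?w \<oplus>\<^bsub>?N\<^esub> ?e"
    by (simp only: Phi.finsum[OF finite_teich_reps cs] Phi.smult[OF einf_closed] Phi_einf Phi_elem[OF smat_GL2])
  finally have L: "Phi r (B_op r (D.elem r (mat 1 :: 'p mat2) 1)) = ?w \<oplus>\<^bsub>?N\<^esub> ?e" .
  have vx: "V.elem r (mat 1 :: 'p mat2) (varX ^ r) \<in> carrier ?N" by (simp add: varX_homogeneous)
  have s1: "sv 1 (red (- t)) 0 0 (varX ^ r) = varX ^ r" for t :: "'p zp" by (simp add: sv_power sv_X)
  have s2: "sv 0 0 0 1 (varX ^ r) = const2 (if r = 0 then 1 else (0 :: 'p fpbar))" by (simp add: sv_power sv_X power_0_left)
  have s2h: "const2 (if r = 0 then 1 else (0 :: 'p fpbar)) \<in> homogeneous2 r"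
    unfolding s2[symmetric] by (rule sv_homogeneous[OF varX_homogeneous])
  have ct: "(\<lambda>t. V.elem r (tmat t :: 'p mat2) (varX ^ r)) \<in> teich_reps \<rightarrow> carrier ?N" by (simp add: varX_homogeneous)
  have ca: "V.elem r (alpha :: 'p mat2) (const2 (if r = 0 then 1 else 0)) \<in> carrier ?N"
    using s2h by (intro V.elem_closed) simp_all
  have "V.elem r beta (varX ^ r) = act ?N beta (V.elem r (mat 1) (varX ^ r))"
    by (simp only: V.act_elem[OF GL2_one beta_GL2] matrix_mul_rid)
  then have "T_op r (Phi r (D.elem r (mat 1 :: 'p mat2) 1)) = act ?N beta (TP r (varX ^ r))"
    unfolding Phi(2) by (simp only: T.act[OF beta_GL2 vx] T_op_gen[OF varX_homogeneous])
  also have "\<dots> = act ?N beta (\<Oplus>\<^bsub>?N\<^esub>t\<in>teich_reps. V.elem r (tmat t) (varX ^ r)) \<oplus>\<^bsub>?N\<^esub>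
      act ?N beta (V.elem r alpha (const2 (if r = 0 then 1 else 0)))"
    unfolding TP_def s1 s2 by (rule V.I.act_add[OF beta_GL2 V.I.finsum_closed[OF ct] ca])
  also have "act ?N beta (\<Oplus>\<^bsub>?N\<^esub>t\<in>teich_reps. V.elem r (tmat t) (varX ^ r)) = ?w"
  proof -
    have "beta ** tmat t = smat t ** beta" for t :: "'p zp"
      by (simp add: beta_zmat tmat_zmat smat_zmat zmat_mult algebra_simps)
    then show ?thesis
      by (simp only: V.I.act_finsum[OF beta_GL2 finite_teich_reps ct] V.act_elem[OF tmat_GL2 beta_GL2])
  qed
  also have "act ?N beta (V.elem r alpha (const2 (if r = 0 then 1 else 0))) = ?e"
  proof -
    have w: "zmat 0 1 1 0 \<in> (GL2_Zp :: 'p mat2 set)" by (simp add: zmat_K_iff)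
    have "beta ** alpha = (ppow 1 ** zmat 0 1 1 0 :: 'p mat2)"
      by (simp add: beta_def alpha_def zmat_def mat_mat2 mat2_mult of_zp_0 of_zp_1)
    then have "act ?N beta (V.elem r alpha (const2 (if r = 0 then 1 else 0))) =
        V.elem r (mat 1) (const2 (if r = 0 then 1 else 0))"
      by (simp only: V.act_elem[OF alpha_GL2 beta_GL2] V_elem_ppow_zmat[OF w s2h] sv_const)
    also have "\<dots> = ?e"
    proof (cases "r = 0")
      case True
      then show ?thesis using V.I.smult_1[OF vx] by (simp del: V.ind_simps)
    next
      case False
      then have "V.elem r (mat 1 :: 'p mat2) (const2 (if r = 0 then 1 else 0)) = V.elem r (mat 1) (const2 0 * varX ^ r)" by simp
      also have "\<dots> = 0 \<odot>\<^bsub>?N\<^esub> V.elem r (mat 1) (varX ^ r)"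
        using V.elem_smult[OF GL2_one, where ?'p = 'p, of "varX ^ r" r 0] by (simp add: varX_homogeneous del: V.ind_simps)
      finally show ?thesis using False by simp
    qed
    finally show ?thesis .
  qed
  finally show "Phi r (B_op r (D.elem r (mat 1 :: 'p mat2) 1)) = T_op r (Phi r (D.elem r (mat 1 :: 'p mat2) 1))"
    unfolding L by (rule sym)
qed

text \<open>On \<open>[[id, 1]]\<close> the image is \<open>[id, P]\<close>, with \<open>P\<close>
  the sum of all \<open>(t X + Y)^r\<close>, plus \<open>X^r\<close> for \<open>r = p - 1\<close>.
  Power sums kill every coefficient of the former except that of \<open>X^(p-1)\<close>, where they
  give \<open>-1\<close>.\<close>

lemma Phi_A:
  fixes f :: "'p::prime_card mat2 \<Rightarrow> 'p fpbar"
  assumes r: "r \<le> CARD('p) - 1" and f: "f \<in> carrier (D.ind r)"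
  shows "Phi r (A_op r f) = \<zero>\<^bsub>V.ind r\<^esub>"
proof (rule D_map_unique[OF V.G_rep_ind G_equivariant_comp[OF A_op_equivariant Phi(1)], where F' = "\<lambda>_. \<zero>\<^bsub>V.ind r\<^esub>", OF _ _ f])
  let ?N = "V.ind r :: ('p, 'p mat2 \<Rightarrow> 'p fpbar poly poly) rep"
  show "G_equivariant (D.ind r) ?N (\<lambda>_. \<zero>\<^bsub>?N\<^esub>)"
    unfolding G_equivariant_def by (auto simp del: V.ind_simps)
  have P0: "(\<Sum>t\<in>UNIV. const2 1 * lin t ^ r) + const2 (if r = CARD('p) - 1 then 1 else 0) * varX ^ r = (0 :: 'p fpbar poly poly)"
  proof -
    have "(\<Sum>t\<in>UNIV. const2 1 * lin t ^ r :: 'p fpbar poly poly) = (\<Sum>t\<in>UNIV. \<Sum>i\<le>r. const2 (of_nat (r choose i)) * mono2 i (r - i) * const2 (ac t ^ i))"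
      unfolding lin_power by (simp add: const2_mult mult_ac)
    also have "\<dots> = (\<Sum>i\<le>r. const2 (of_nat (r choose i)) * mono2 i (r - i) * const2 (\<Sum>t\<in>(UNIV :: 'p mod_ring set). ac t ^ i))"
      by (subst sum.swap) (simp add: sum_distrib_left const2_sum)
    also have "\<dots> = (\<Sum>i\<le>r. if i = r then - const2 (if r = CARD('p) - 1 then 1 else 0) * varX ^ r else 0)"
    proof (intro sum.cong refl)
      fix i assume i: "i \<in> {..r}"
      consider "i = CARD('p) - 1" | "i < CARD('p) - 1" using i r by (metis atMost_iff le_antisym le_trans nat_less_le)
      then show "const2 (of_nat (r choose i)) * mono2 i (r - i) * const2 (\<Sum>t\<in>(UNIV :: 'p mod_ring set). ac t ^ i) =
          (if i = r then - const2 (if r = CARD('p) - 1 then 1 else 0) * varX ^ r else 0)"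
      proof cases
        case 1
        then have "r = CARD('p) - 1" "i = r" using i r by simp_all
        then show ?thesis using sum_to_ac_power_last[where ?'p = 'p] by (simp add: mono2_def const2_minus)
      next
        case 2
        then show ?thesis using sum_to_ac_power_less[OF 2] by auto
      qed
    qed
    finally show ?thesis by simp
  qed
  have "Phi r (A_op r (D.elem r (mat 1 :: 'p mat2) 1)) = V.elem r (mat 1) (const2 0 * 0)"
    unfolding A_op_gen Phi_LC P0 by simp
  also have "\<dots> = 0 \<odot>\<^bsub>?N\<^esub> V.elem r (mat 1) 0"
    using V.elem_smult[OF GL2_one, where ?'p = 'p, of 0 r 0] by (simp del: V.ind_simps)
  also have "\<dots> = \<zero>\<^bsub>?N\<^esub>" by (rule V.I.smult_0[OF V.elem_closed]) simp_all
  finally show "Phi r (A_op r (D.elem r (mat 1 :: 'p mat2) 1)) = \<zero>\<^bsub>?N\<^esub>" .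
qed

section \<open>Isomorphism of the quotients\<close>

lemma Iwahori_quot_iso:
  fixes S :: "('p::prime_card mat2 \<Rightarrow> 'p fpbar) \<Rightarrow> 'p mat2 \<Rightarrow> 'p fpbar"
  assumes r: "r \<le> CARD('p) - 1" and S: "G_equivariant (D.ind r) (D.ind r) S"
    and PS: "\<And>f. f \<in> carrier (D.ind r) \<Longrightarrow> Phi r (S f) = endo_minus (V.ind r) (T_op r) (endo_scalar (V.ind r) l) (Phi r f)"
  shows "Iwahori_quot r S \<cong>\<^sub>G rep_quot (ind_KZ r)
    (endo_image (ind_KZ r) (endo_minus (ind_KZ r) (T_op r) (endo_scalar (ind_KZ r) l)))"
proof -
  let ?M = "D.ind r :: ('p, 'p mat2 \<Rightarrow> 'p fpbar) rep"
  let ?N = "V.ind r :: ('p, 'p mat2 \<Rightarrow> 'p fpbar poly poly) rep"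
  let ?T = "endo_minus ?N (T_op r) (endo_scalar ?N l)"
  interpret S: G_map ?M ?M S by (intro G_map.intro G_map_axioms.intro D.I.G_representation_axioms S)
  have T: "G_equivariant ?N ?N ?T"
    using T_op_endo V.I.endo_scalar_equivariant by (intro V.I.endo_minus_equivariant) (auto simp: G_endo_def)
  \<comment> \<open>The sum of the two images is the full preimage of the image of
    \<open>T - l\<close>: if \<open>Phi v = (T - l) w\<close> and \<open>w = Phi b\<close>, then
    \<open>v\<close> minus \<open>S b\<close> lies in the kernel of \<open>Phi\<close>, which is the
    first image.\<close>
  have W: "endo_image ?M (A_op r) <+>\<^bsub>?M\<^esub> endo_image ?M S = {v \<in> carrier ?M. Phi r v \<in> endo_image ?N ?T}"
  proof (intro equalityI subsetI)
    fix v assume "v \<in> endo_image ?M (A_op r) <+>\<^bsub>?M\<^esub> endo_image ?M S"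
    then obtain a b where ab: "a \<in> carrier ?M" "b \<in> carrier ?M" "v = A_op r a \<oplus>\<^bsub>?M\<^esub> S b"
      unfolding D.I.set_add_mem endo_image_def by blast
    note cl = A.closed[OF ab(1)] S.closed[OF ab(2)]
    have "Phi r v = \<zero>\<^bsub>?N\<^esub> \<oplus>\<^bsub>?N\<^esub> ?T (Phi r b)"
      unfolding ab(3) Phi.add[OF cl] Phi_A[OF r ab(1)] PS[OF ab(2)] ..
    also have "\<dots> = ?T (Phi r b)"
      unfolding PS[OF ab(2), symmetric] by (rule V.I.l_zero[OF Phi.closed[OF cl(2)]])
    finally show "v \<in> {v \<in> carrier ?M. Phi r v \<in> endo_image ?N ?T}"
      using D.I.a_closed[OF cl] Phi.closed[OF ab(2)] unfolding ab(3) endo_image_def by blast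
  next
    fix v assume "v \<in> {v \<in> carrier ?M. Phi r v \<in> endo_image ?N ?T}"
    then obtain w where v: "v \<in> carrier ?M" and w: "w \<in> carrier ?N" "Phi r v = ?T w" unfolding endo_image_def by blast
    have "w \<in> Phi r ` carrier ?M" using w(1) unfolding Phi_onto[OF r] .
    then obtain b where b: "b \<in> carrier ?M" "w = Phi r b" by blast
    note Sb = S.closed[OF b(1)]
    have "Phi r (v \<ominus>\<^bsub>?M\<^esub> S b) = Phi r v \<ominus>\<^bsub>?N\<^esub> Phi r v"
      unfolding Phi.minus[OF v Sb] PS[OF b(1)] w(2) b(2) ..
    also have "\<dots> = \<zero>\<^bsub>?N\<^esub>" using V.I.r_neg[OF Phi.closed[OF v]] by (simp only: V.I.minus_eq)
    finally have "v \<ominus>\<^bsub>?M\<^esub> S b \<in> endo_image ?M (A_op r)" by (rule Phi_kernel[OF r D.I.minus_closed[OF v Sb]])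
    moreover have "v = (v \<ominus>\<^bsub>?M\<^esub> S b) \<oplus>\<^bsub>?M\<^esub> S b"
      using v Sb by (simp add: D.I.minus_eq D.I.a_assoc D.I.l_neg del: D.ind_simps)
    moreover have "S b \<in> endo_image ?M S" unfolding endo_image_def using b(1) by blast
    ultimately show "v \<in> endo_image ?M (A_op r) <+>\<^bsub>?M\<^esub> endo_image ?M S" unfolding D.I.set_add_mem by blast
  qed
  show ?thesis
    unfolding Iwahori_quot_def ind_IZ_def ind_KZ_def A_op_def[symmetric]
    by (rule rep_quot_iso[OF D.G_rep_ind V.G_rep_ind Phi(1) Phi_onto[OF r] V.I.subrep_endo_image[OF T] W])
qed

text \<open>Two forms, because for \<open>l = 0\<close> the Iwahori quotient of the theorem is
  written without subtracting the zero scalar, while \<open>pi_rep\<close> always subtracts.\<close>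

lemma Iwahori_quot_twist_iso:
  fixes l :: "'p::prime_card fpbar"
  assumes r: "r \<le> CARD('p) - 1" and \<eta>: "\<And>x y. x \<noteq> 0 \<Longrightarrow> y \<noteq> 0 \<Longrightarrow> \<eta> (x * y) = \<eta> x * \<eta> y" "\<eta> 1 = 1"
  shows "Iwahori_quot r (endo_minus (ind_IZ r) (endo_add (ind_IZ r) (T12 r) (delta_T10 r 0)) (endo_scalar (ind_IZ r) l)) \<otimes>\<^sub>G \<eta>
      \<cong>\<^sub>G pi_rep r l \<eta>"
    "l = 0 \<Longrightarrow> Iwahori_quot r (endo_add (ind_IZ r) (T12 r) (delta_T10 r 0)) \<otimes>\<^sub>G \<eta> \<cong>\<^sub>G pi_rep r l \<eta>"
proof -
  let ?M = "D.ind r :: ('p, 'p mat2 \<Rightarrow> 'p fpbar) rep"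
  let ?N = "V.ind r :: ('p, 'p mat2 \<Rightarrow> 'p fpbar poly poly) rep"
  interpret B: G_map ?M ?M "B_op r" by (intro G_map.intro G_map_axioms.intro D.I.G_representation_axioms B_op_equivariant)
  have 1: "Phi r (endo_minus ?M (B_op r) (endo_scalar ?M l) f) = endo_minus ?N (T_op r) (endo_scalar ?N l) (Phi r f)"
    if f: "f \<in> carrier ?M" for f
    using f Phi.closed[OF f] Phi.minus[OF B.closed[OF f] D.I.smult_clo[OF f]] Phi_B[OF f] Phi.smult[OF f]
    by (simp add: endo_minus_def endo_scalar_def del: D.ind_simps V.ind_simps)
  have 2: "Phi r (B_op r f) = endo_minus ?N (T_op r) (endo_scalar ?N 0) (Phi r f)" if f: "f \<in> carrier ?M" for f
  proof -
    have "endo_minus ?N (T_op r) (endo_scalar ?N 0) (Phi r f) = Phi r (B_op r f) \<ominus>\<^bsub>?N\<^esub> \<zero>\<^bsub>?N\<^esub>"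
      using Phi.closed[OF f] V.I.smult_0[OF Phi.closed[OF f]] Phi_B[OF f]
      by (simp add: endo_minus_def endo_scalar_def del: V.ind_simps)
    also have "\<dots> = Phi r (B_op r f)"
      by (rule V.I.minus_zero_r[OF Phi.closed[OF B.closed[OF f]]])
    finally show ?thesis by simp
  qed
  show "Iwahori_quot r (endo_minus (ind_IZ r) (endo_add (ind_IZ r) (T12 r) (delta_T10 r 0)) (endo_scalar (ind_IZ r) l)) \<otimes>\<^sub>G \<eta>
      \<cong>\<^sub>G pi_rep r l \<eta>"
    unfolding pi_rep_def
    by (rule rep_iso_twist[OF Iwahori_quot_iso[OF r] \<eta>])
      (simp_all only: ind_IZ_def B_op_def[symmetric] 1 D.I.endo_minus_equivariant[OF B_op_equivariant D.I.endo_scalar_equivariant]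
        not_False_eq_True)
  show "Iwahori_quot r (endo_add (ind_IZ r) (T12 r) (delta_T10 r 0)) \<otimes>\<^sub>G \<eta> \<cong>\<^sub>G pi_rep r l \<eta>" if "l = 0"
    unfolding pi_rep_def that
    by (rule rep_iso_twist[OF Iwahori_quot_iso[OF r] \<eta>])
      (simp_all only: ind_IZ_def B_op_def[symmetric] 2 B_op_equivariant not_False_eq_True)
qed

section \<open>Characters and the correspondence\<close>

lemma gal_iso_refl: "\<rho> \<cong>\<^sub>G\<^sub>a\<^sub>l \<rho>"
proof -
  have "\<exists>A'. (mat 1 :: 'a fpbar^2^2) ** A' = mat 1 \<and> A' ** mat 1 = mat 1" by auto
  then have "mat 1 ** matrix_inv (mat 1 :: 'a fpbar^2^2) = mat 1 \<and> matrix_inv (mat 1 :: 'a fpbar^2^2) ** mat 1 = mat 1"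
    unfolding matrix_inv_def by (rule someI_ex)
  then have "matrix_inv (mat 1 :: 'a fpbar^2^2) = mat 1" by simp
  moreover have "invertible (mat 1 :: 'a fpbar^2^2)" unfolding invertible_def by auto
  ultimately show ?thesis unfolding gal_iso_def by (intro exI[of _ "mat 1"]) simp
qed

lemma smooth_char_mult: "smooth_char \<eta> \<Longrightarrow> x \<noteq> 0 \<Longrightarrow> y \<noteq> 0 \<Longrightarrow> \<eta> (x * y) = \<eta> x * \<eta> y"
  by (simp add: smooth_char_def)

lemma smooth_char_1: "smooth_char \<eta> \<Longrightarrow> \<eta> 1 = 1"
proof -
  assume "smooth_char \<eta>"
  then have "\<eta> 1 \<noteq> 0" "\<eta> (1 * 1) = \<eta> 1 * \<eta> 1" unfolding smooth_char_def using one_neq_zero by blast+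
  then show ?thesis by simp
qed

lemma omega_Qp_mult: "x \<noteq> 0 \<Longrightarrow> y \<noteq> 0 \<Longrightarrow> omega_Qp (x * y) = omega_Qp x * omega_Qp y"
  by (simp add: omega_Qp_def unit_part_mult)

lemma omega_Qp_1: "omega_Qp (1 :: 'p::prime_card qp) = 1"
  using unit_part_eq[of "1 :: 'p zp" 0] by (simp add: omega_Qp_def of_zp_1)

lemma residue_class_le: "residue_class TYPE('p::prime_card) a \<le> CARD('p) - 1"
proof -
  have p: "1 < CARD('p)" using prime_gt_1_nat[OF prime_card] .
  then have "a mod (int (CARD('p)) - 1) < int (CARD('p)) - 1" by (intro pos_mod_bound) simp
  moreover have "int (CARD('p) - 1) = int (CARD('p)) - 1" using p by simp
  ultimately show ?thesis unfolding residue_class_def nat_le_iff by linarith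
qed

theorem theorem2p2:
  fixes r :: nat
    and l :: "'p::prime_card fpbar"
    and \<eta> :: "'p qp \<Rightarrow> 'p fpbar"
    and N1 :: "('p, 'v) rep"
    and N2 :: "('p, 'w) rep"
  assumes "r \<le> CARD('p) - 1"
    and "smooth_char \<eta>"
  shows "(l = 0 \<longrightarrow>
      breuil_LL (gal_twist (ind_omega2 (r + 1)) (gal_char \<eta>))
        (Iwahori_quot r (endo_add (ind_IZ r) (T12 r) (delta_T10 r 0)) \<otimes>\<^sub>G \<eta>)) \<and>
    (l \<noteq> 0 \<longrightarrow> (let s = residue_class TYPE('p) (int (CARD('p)) - 3 - int r) in
      semisimplification
        (Iwahori_quot r (endo_minus (ind_IZ r)
            (endo_add (ind_IZ r) (T12 r) (delta_T10 r 0)) (endo_scalar (ind_IZ r) l))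
          \<otimes>\<^sub>G \<eta>) N1 \<longrightarrow>
      semisimplification
        (Iwahori_quot s (endo_minus (ind_IZ s)
            (endo_add (ind_IZ s) (T12 s) (delta_T10 s 0)) (endo_scalar (ind_IZ s) (inverse l)))
          \<otimes>\<^sub>G (\<lambda>x. \<eta> x * omega_Qp x ^ (r + 1))) N2 \<longrightarrow>
      breuil_LL
        (gal_twist (gal_sum (\<lambda>\<sigma>. unram l \<sigma> * cyclotomic \<sigma> ^ (r + 1)) (unram (inverse l)))
          (gal_char \<eta>))
        (N1 \<oplus>\<^sub>G N2)))"
proof (intro conjI impI)
  note \<eta> = smooth_char_mult[OF assms(2)] smooth_char_1[OF assms(2)]
  show "breuil_LL (gal_twist (ind_omega2 (r + 1)) (gal_char \<eta>))
      (Iwahori_quot r (endo_add (ind_IZ r) (T12 r) (delta_T10 r 0)) \<otimes>\<^sub>G \<eta>)" if "l = 0"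
    unfolding breuil_LL_def using assms gal_iso_refl Iwahori_quot_twist_iso(2)[OF assms(1) \<eta> refl] by blast
  assume l: "l \<noteq> 0"
  show "let s = residue_class TYPE('p) (int (CARD('p)) - 3 - int r) in
      semisimplification
        (Iwahori_quot r (endo_minus (ind_IZ r)
            (endo_add (ind_IZ r) (T12 r) (delta_T10 r 0)) (endo_scalar (ind_IZ r) l))
          \<otimes>\<^sub>G \<eta>) N1 \<longrightarrow>
      semisimplification
        (Iwahori_quot s (endo_minus (ind_IZ s)
            (endo_add (ind_IZ s) (T12 s) (delta_T10 s 0)) (endo_scalar (ind_IZ s) (inverse l)))
          \<otimes>\<^sub>G (\<lambda>x. \<eta> x * omega_Qp x ^ (r + 1))) N2 \<longrightarrow>
      breuil_LL
        (gal_twist (gal_sum (\<lambda>\<sigma>. unram l \<sigma> * cyclotomic \<sigma> ^ (r + 1)) (unram (inverse l)))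
          (gal_char \<eta>))
        (N1 \<oplus>\<^sub>G N2)"
    unfolding Let_def
  proof (intro impI)
    let ?s = "residue_class TYPE('p) (int (CARD('p)) - 3 - int r)"
    let ?\<eta> = "\<lambda>x. \<eta> x * omega_Qp x ^ (r + 1)"
    have \<eta>': "?\<eta> (x * y) = ?\<eta> x * ?\<eta> y" if "x \<noteq> 0" "y \<noteq> 0" for x y
      using that by (simp add: \<eta>(1) omega_Qp_mult power_mult_distrib mult_ac)
    have \<eta>1: "?\<eta> 1 = 1" by (simp add: \<eta>(2) omega_Qp_1)
    assume 1: "semisimplification (Iwahori_quot r (endo_minus (ind_IZ r)
            (endo_add (ind_IZ r) (T12 r) (delta_T10 r 0)) (endo_scalar (ind_IZ r) l)) \<otimes>\<^sub>G \<eta>) N1"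
      and 2: "semisimplification (Iwahori_quot ?s (endo_minus (ind_IZ ?s)
            (endo_add (ind_IZ ?s) (T12 ?s) (delta_T10 ?s 0)) (endo_scalar (ind_IZ ?s) (inverse l))) \<otimes>\<^sub>G ?\<eta>) N2"
    obtain N1' :: "('p, nat \<Rightarrow> ('p mat2 \<Rightarrow> 'p fpbar poly poly) set set) rep"
      where N1: "semisimplification (pi_rep r l \<eta>) N1'" "N1 \<cong>\<^sub>G N1'"
      using semisimplification_iso[OF Iwahori_quot_twist_iso(1)[OF assms(1) \<eta>] 1] by blast
    obtain N2' :: "('p, nat \<Rightarrow> ('p mat2 \<Rightarrow> 'p fpbar poly poly) set set) rep"
      where N2: "semisimplification (pi_rep ?s (inverse l) ?\<eta>) N2'" "N2 \<cong>\<^sub>G N2'"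
      using semisimplification_iso[OF Iwahori_quot_twist_iso(1)[OF residue_class_le \<eta>' \<eta>1] 2] by blast
    show "breuil_LL (gal_twist (gal_sum (\<lambda>\<sigma>. unram l \<sigma> * cyclotomic \<sigma> ^ (r + 1)) (unram (inverse l)))
          (gal_char \<eta>)) (N1 \<oplus>\<^sub>G N2)"
      \<comment> \<open>With the given \<open>r\<close>, \<open>l\<close> and \<open>\<eta>\<close>
        as witnesses the Galois side holds by reflexivity, and only the automorphic side has to be
        transported.\<close>
      unfolding breuil_LL_def
      by (rule disjI2, rule exI[of _ r], rule exI[of _ l], rule exI[of _ \<eta>], rule exI[of _ N1'], rule exI[of _ N2'])
        (use assms l gal_iso_refl N1 N2 rep_iso_prod[OF N1(2) N2(2)] in blast)
  qed
qed

end
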